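(* Let $K$ be a valued field with valuation ring $\mathcal{O}$, maximal ideal $\mathfrak{m}$ and residue field $k=\mathcal{O}/\mathfrak{m}$. For any semistable multi-filtered vector space $(V,\mathrm{Fil}^{\bullet}_i)$ over $K$, there exists an integral model $(\mathrm{M},\mathrm{Fil}^{\bullet}_i)$ of $(V,\mathrm{Fil}^{\bullet}_i)$ such that its reduction $\overline{\mathrm{M}}=\mathrm{M}\otimes_{\mathcal{O}}k$, with its induced filtrations $\overline{\mathrm{Fil}^{\bullet}_i}$, is a semistable multi-filtered vector space over $k$.
   Context: The valuation ring $\mathcal{O}$ is arbitrary (not assumed discrete or Noetherian), with $K=\mathrm{Frac}(\mathcal{O})$. All $\mathcal{O}$-modules are finitely presented. A multi-filtered vector space $(V,\mathrm{Fil}^{\bullet}_i)$ over a field $F$ is a finite-dimensional $F$-vector space $V$ together with finitely many filtrations $\mathrm{Fil}^{\bullet}_i$, $1\le i\le n$, each of which is decreasing, indexed by natural numbers, exhaustive and separated: $V=\mathrm{Fil}^0_i\supseteq \mathrm{Fil}^1_i\supseteq\cdots\supseteq \mathrm{Fil}^{l_i}_i=0$. A subspace $W\subseteq V$ carries the induced filtrations $\mathrm{Fil}^j_i\cap W$; a quotient of $V$ carries the image filtrations. The weight is $w(V,\mathrm{Fil}^{\bullet}_i)=\sum_i\sum_j j\cdot\dim(\mathrm{Fil}^j_i/\mathrm{Fil}^{j+1}_i)$ and the slope is $\mu(V,\mathrm{Fil}^{\bullet}_i)=w(V,\mathrm{Fil}^{\bullet}_i)/\dim(V)$. The multi-filtered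 vector space $(V,\mathrm{Fil}^{\bullet}_i)$ is semistable if $\mu(W)\le\mu(V)$ for every nonzero subspace $W\subseteq V$ (with the induced filtrations). An integral model of a multi-filtered $K$-vector space $(V,\mathrm{Fil}^{\bullet}_i)$ is an $\mathcal{O}$-lattice $\mathrm{M}\subseteq V$ (a finitely presented, hence finite free, $\mathcal{O}$-submodule with $\mathrm{M}\otimes_{\mathcal{O}}K=V$) endowed with the filtrations $\mathrm{Fil}^{\bullet}_i\cap \mathrm{M}$, still denoted $\mathrm{Fil}^{\bullet}_i$. The induced filtration $\overline{\mathrm{Fil}^{\bullet}_i}$ on $\overline{\mathrm{M}}=\mathrm{M}\otimes_{\mathcal{O}}k$ consists of the images of $\mathrm{Fil}^{j}_i\cap \mathrm{M}$ in $\overline{\mathrm{M}}$. *)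

theory Defs
  imports Complex_Main "HOL-Algebra.QuotRing" "HOL-Algebra.Subrings" "Jordan_Normal_Form.Missing_VectorSpace"
begin

section \<open>Valued fields\<close>

text \<open>The valuation is written additively, with values in an arbitrary totally ordered abelian group
  (so it may be trivial, non-discrete, or of any rank). The value at \<open>0\<close>, usually \<open>\<infinity>\<close>, is not used.\<close>

locale valued_field = field K for K (structure) +
  fixes v :: "'a \<Rightarrow> 'g::linordered_ab_group_add"
  assumes val_mult: "\<lbrakk>x \<in> carrier K; y \<in> carrier K; x \<noteq> \<zero>; y \<noteq> \<zero>\<rbrakk> \<Longrightarrow> v (x \<otimes> y) = v x + v y"
    and val_add: "\<lbrakk>x \<in> carrier K; y \<in> carrier K; x \<noteq> \<zero>; y \<noteq> \<zero>; x \<oplus> y \<noteq> \<zero>\<rbrakk>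
      \<Longrightarrow> min (v x) (v y) \<le> v (x \<oplus> y)"

definition valuation_ring ::
    "('a, 'm) ring_scheme \<Rightarrow> ('a \<Rightarrow> 'g::linordered_ab_group_add) \<Rightarrow> ('a, 'm) ring_scheme" where
  "valuation_ring K v = K\<lparr>carrier := {x \<in> carrier K. x = \<zero>\<^bsub>K\<^esub> \<or> 0 \<le> v x}\<rparr>"

definition valuation_ideal ::
    "('a, 'm) ring_scheme \<Rightarrow> ('a \<Rightarrow> 'g::linordered_ab_group_add) \<Rightarrow> 'a set" where
  "valuation_ideal K v = {x \<in> carrier K. x = \<zero>\<^bsub>K\<^esub> \<or> 0 < v x}"

definition residue_field ::
    "('a, 'm) ring_scheme \<Rightarrow> ('a \<Rightarrow> 'g::linordered_ab_group_add) \<Rightarrow> 'a set ring" where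
  "residue_field K v = valuation_ring K v Quot valuation_ideal K v"

context valued_field
begin

lemma val_one: "v \<one> = 0"
  using val_mult[of \<one> \<one>] by simp

lemma val_uminus:
  assumes "x \<in> carrier K" "x \<noteq> \<zero>"
  shows "v (\<ominus> x) = v x"
proof -
  have m: "\<ominus> \<one> \<in> carrier K" "\<ominus> \<one> \<noteq> \<zero>"
    using one_not_zero by auto
  have "v (\<ominus> \<one>) + v (\<ominus> \<one>) = 0"
    using val_mult[OF m(1) m(1) m(2) m(2)] val_one by (simp add: l_minus)
  then have "v (\<ominus> \<one>) = 0" by simp
  then show ?thesis
    using val_mult[OF m(1) assms(1) m(2) assms(2)] assms by (simp add: l_minus)
qed

lemma valuation_ring_subring: "subring (carrier (valuation_ring K v)) K"
proof (rule subringI)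
  fix x y assume "x \<in> carrier (valuation_ring K v)" "y \<in> carrier (valuation_ring K v)"
  then show "x \<otimes> y \<in> carrier (valuation_ring K v)"
    by (cases "x = \<zero> \<or> y = \<zero>") (auto simp: valuation_ring_def val_mult)
next
  fix x y assume "x \<in> carrier (valuation_ring K v)" "y \<in> carrier (valuation_ring K v)"
  then show "x \<oplus> y \<in> carrier (valuation_ring K v)"
    using val_add[of x y]
    by (cases "x = \<zero> \<or> y = \<zero> \<or> x \<oplus> y = \<zero>")
      (auto simp: valuation_ring_def min_def split: if_splits)
next
  fix x assume "x \<in> carrier (valuation_ring K v)"
  then show "\<ominus> x \<in> carrier (valuation_ring K v)"
    by (cases "x = \<zero>") (auto simp: valuation_ring_def val_uminus)
qed (auto simp: valuation_ring_def val_one)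

lemma cring_valuation_ring: "cring (valuation_ring K v)"
proof -
  have "valuation_ring K v = K\<lparr>carrier := carrier (valuation_ring K v)\<rparr>"
    by (simp add: valuation_ring_def)
  moreover have "cring (K\<lparr>carrier := carrier (valuation_ring K v)\<rparr>)"
  proof (rule cring.intro[OF subring_is_ring[OF valuation_ring_subring] comm_monoid.intro])
    show "Group.monoid (K\<lparr>carrier := carrier (valuation_ring K v)\<rparr>)"
      using subring_is_ring[OF valuation_ring_subring] by (rule ring.is_monoid)
    show "comm_monoid_axioms (K\<lparr>carrier := carrier (valuation_ring K v)\<rparr>)"
      by unfold_locales (auto simp: valuation_ring_def m_comm)
  qed
  ultimately show ?thesis by simp
qed

lemma maximalideal_valuation_ideal: "maximalideal (valuation_ideal K v) (valuation_ring K v)"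
proof -
  interpret R: cring "valuation_ring K v" by (rule cring_valuation_ring)
  have neg: "\<ominus>\<^bsub>valuation_ring K v\<^esub> x = \<ominus> x" if "x \<in> carrier (valuation_ring K v)" for x
  proof (rule R.minus_equality)
    show "\<ominus> x \<oplus>\<^bsub>valuation_ring K v\<^esub> x = \<zero>\<^bsub>valuation_ring K v\<^esub>"
      using that by (simp add: valuation_ring_def l_neg)
    show "\<ominus> x \<in> carrier (valuation_ring K v)"
      using subringE(5)[OF valuation_ring_subring that] .
  qed (fact that)
  have idl: "ideal (valuation_ideal K v) (valuation_ring K v)"
  proof (rule idealI)
    show "ring (valuation_ring K v)" by (rule R.ring_axioms)
    show "subgroup (valuation_ideal K v) (add_monoid (valuation_ring K v))"
    proof (rule R.add.subgroupI)
      show "valuation_ideal K v \<subseteq> carrier (valuation_ring K v)"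
        by (auto simp: valuation_ideal_def valuation_ring_def)
      show "valuation_ideal K v \<noteq> {}" by (auto simp: valuation_ideal_def)
      fix x y assume xy: "x \<in> valuation_ideal K v" "y \<in> valuation_ideal K v"
      have "x \<in> carrier (valuation_ring K v)"
        using xy by (auto simp: valuation_ideal_def valuation_ring_def)
      with xy show "\<ominus>\<^bsub>valuation_ring K v\<^esub> x \<in> valuation_ideal K v"
        by (cases "x = \<zero>") (auto simp: neg valuation_ideal_def val_uminus)
      show "x \<oplus>\<^bsub>valuation_ring K v\<^esub> y \<in> valuation_ideal K v"
        using xy val_add[of x y] 
        by (cases "x = \<zero> \<or> y = \<zero> \<or> x \<oplus> y = \<zero>")
          (auto simp: valuation_ring_def valuation_ideal_def min_def split: if_splits)
    qed
  next
    fix a x assume "a \<in> valuation_ideal K v" "x \<in> carrier (valuation_ring K v)"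
    then show "x \<otimes>\<^bsub>valuation_ring K v\<^esub> a \<in> valuation_ideal K v"
      and "a \<otimes>\<^bsub>valuation_ring K v\<^esub> x \<in> valuation_ideal K v"
      by (cases "a = \<zero> \<or> x = \<zero>";
          auto simp: valuation_ring_def valuation_ideal_def val_mult add_pos_nonneg add_nonneg_pos)+
  qed
  show ?thesis
  proof (rule maximalideal.intro[OF idl], rule maximalideal_axioms.intro)
    show "carrier (valuation_ring K v) \<noteq> valuation_ideal K v"
    proof
      assume "carrier (valuation_ring K v) = valuation_ideal K v"
      then have "\<one> \<in> valuation_ideal K v"
        by (metis subringE(3) valuation_ring_subring)
      then show False using val_one one_not_zero by (simp add: valuation_ideal_def)
    qed
    fix J assume J: "ideal J (valuation_ring K v)" "valuation_ideal K v \<subseteq> J"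
      "J \<subseteq> carrier (valuation_ring K v)"
    interpret J: ideal J "valuation_ring K v" by fact
    show "J = valuation_ideal K v \<or> J = carrier (valuation_ring K v)"
    proof (cases "J \<subseteq> valuation_ideal K v")
      case False
      then obtain x where x: "x \<in> J" "x \<notin> valuation_ideal K v" by auto
      then have xK: "x \<in> carrier K" "x \<noteq> \<zero>" "v x = 0"
        using J(3) by (auto simp: valuation_ideal_def valuation_ring_def)
      have i: "inv x \<in> carrier K" "inv x \<noteq> \<zero>" "inv x \<otimes> x = \<one>"
        using xK field_Units by auto
      have "v (inv x) = 0" using val_mult[OF i(1) xK(1) i(2) xK(2)] i xK val_one by simp
      then have "inv x \<in> carrier (valuation_ring K v)"
        using i by (simp add: valuation_ring_def)
      from J.I_l_closed[OF x(1) this] have "\<one>\<^bsub>valuation_ring K v\<^esub> \<in> J"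
        using i(3) by (simp add: valuation_ring_def)
      then show ?thesis by (simp add: J.one_imp_carrier)
    qed (use J in auto)
  qed
qed

lemma field_residue_field: "field (residue_field K v)"
  unfolding residue_field_def
  by (rule maximalideal.quotient_is_field[OF maximalideal_valuation_ideal cring_valuation_ring])

end


section \<open>Quotients and reductions of modules\<close>

text \<open>Module records extend ring records; the multiplicative fields of a module carry no meaning.\<close>

definition quotient_module :: "('r, 'b, 'm) module_scheme \<Rightarrow> 'b set \<Rightarrow> ('r, 'b set) module" where
  "quotient_module M N =
    \<lparr>carrier = a_rcosets\<^bsub>M\<^esub> N, mult = undefined, one = undefined,
     zero = N, add = set_add M,
     smult = (\<lambda>r X. \<Union>x\<in>X. N +>\<^bsub>M\<^esub> (r \<odot>\<^bsub>M\<^esub> x))\<rparr>"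

definition ideal_smult ::
    "('r, 'k) ring_scheme \<Rightarrow> 'r set \<Rightarrow> ('r, 'b, 'm) module_scheme \<Rightarrow> 'b set" where
  "ideal_smult R I M = module.span R M {a \<odot>\<^bsub>M\<^esub> x | a x. a \<in> I \<and> x \<in> carrier M}"

text \<open>The base change \<open>M \<otimes>\<^sub>R R/I\<close>, as a module over \<open>R Quot I\<close>, realised on \<open>M/IM\<close>, where
  \<open>x \<otimes> A\<close> is \<open>A \<odot> reduction_map R I M x\<close>. Its universal property for \<open>R\<close>-bilinear maps
  \<open>M \<times> R/I \<rightarrow> L\<close> is \<open>reduction_universal\<close> below.\<close>

definition reduction ::
    "('r, 'k) ring_scheme \<Rightarrow> 'r set \<Rightarrow> ('r, 'b, 'm) module_scheme \<Rightarrow> ('r set, 'b set) module" where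
  "reduction R I M =
    \<lparr>carrier = a_rcosets\<^bsub>M\<^esub> (ideal_smult R I M), mult = undefined, one = undefined,
     zero = ideal_smult R I M, add = set_add M,
     smult = (\<lambda>A X. \<Union>a\<in>A. \<Union>x\<in>X. ideal_smult R I M +>\<^bsub>M\<^esub> (a \<odot>\<^bsub>M\<^esub> x))\<rparr>"

definition reduction_map ::
    "('r, 'k) ring_scheme \<Rightarrow> 'r set \<Rightarrow> ('r, 'b, 'm) module_scheme \<Rightarrow> 'b \<Rightarrow> 'b set" where
  "reduction_map R I M x = ideal_smult R I M +>\<^bsub>M\<^esub> x"

context module
begin

lemma ideal_smult_submodule:
  assumes "ideal I R"
  shows "submodule R (ideal_smult R I M) M"
proof -
  interpret I: ideal I R by fact
  show ?thesis unfolding ideal_smult_def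
    by (rule span_is_submodule) (auto intro: smult_closed I.a_Hcarr)
qed

lemma smult_in_ideal_smult:
  assumes "ideal I R" "a \<in> I" "x \<in> carrier M"
  shows "a \<odot>\<^bsub>M\<^esub> x \<in> ideal_smult R I M"
proof -
  interpret I: ideal I R by fact
  have "{a \<odot>\<^bsub>M\<^esub> x | a x. a \<in> I \<and> x \<in> carrier M} \<subseteq> carrier M"
    by (auto intro: smult_closed I.a_Hcarr)
  from in_own_span[OF this] assms show ?thesis unfolding ideal_smult_def by blast
qed

lemma submodule_abelian_subgroup:
  assumes "submodule R N M"
  shows "abelian_subgroup N M"
proof -
  interpret N: submodule R N M by fact
  have "subgroup N (add_monoid M)"
  proof (rule M.add.subgroupI)
    fix x assume "x \<in> N"
    then have "\<ominus>\<^bsub>M\<^esub> x = (\<ominus> \<one>) \<odot>\<^bsub>M\<^esub> x" using N.subset by (auto simp: smult_l_minus)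
    then show "\<ominus>\<^bsub>M\<^esub> x \<in> N" using \<open>x \<in> N\<close> by simp
  next
    show "N \<noteq> {}" using N.zero_closed by blast
  qed (use N.subset in auto)
  then show ?thesis
    by (intro abelian_subgroupI3 additive_subgroupI M.abelian_group_axioms)
qed

lemma reduction_smult:
  assumes "ideal I R" "a \<in> carrier R" "x \<in> carrier M"
  shows "(I +> a) \<odot>\<^bsub>reduction R I M\<^esub> reduction_map R I M x = reduction_map R I M (a \<odot>\<^bsub>M\<^esub> x)"
proof -
  interpret I: ideal I R by fact
  let ?N = "ideal_smult R I M"
  interpret N: submodule R ?N M by (rule ideal_smult_submodule) fact
  interpret A: abelian_subgroup ?N M by (rule submodule_abelian_subgroup) unfold_locales
  have eq: "?N +>\<^bsub>M\<^esub> (b \<odot>\<^bsub>M\<^esub> y) = ?N +>\<^bsub>M\<^esub> (a \<odot>\<^bsub>M\<^esub> x)" if b: "b \<in> I +> a" and y: "y \<in> ?N +>\<^bsub>M\<^esub> x" for b y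
  proof -
    obtain i where i: "i \<in> I" "b = i \<oplus> a" using b by (auto simp: a_r_coset_def')
    obtain z where z: "z \<in> ?N" "y = z \<oplus>\<^bsub>M\<^esub> x" using y by (auto simp: a_r_coset_def')
    have c: "i \<in> carrier R" "z \<in> carrier M" "b \<in> carrier R" "y \<in> carrier M"
      using i z assms N.subset I.a_Hcarr by auto
    have "b \<odot>\<^bsub>M\<^esub> y = (b \<odot>\<^bsub>M\<^esub> z \<oplus>\<^bsub>M\<^esub> i \<odot>\<^bsub>M\<^esub> x) \<oplus>\<^bsub>M\<^esub> a \<odot>\<^bsub>M\<^esub> x"
      using c assms i z by (simp add: smult_r_distr smult_l_distr M.a_ac)
    moreover have "b \<odot>\<^bsub>M\<^esub> z \<oplus>\<^bsub>M\<^esub> i \<odot>\<^bsub>M\<^esub> x \<in> ?N"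
      using c z smult_in_ideal_smult[OF assms(1) i(1) assms(3)] by auto
    ultimately have "b \<odot>\<^bsub>M\<^esub> y \<in> ?N +>\<^bsub>M\<^esub> (a \<odot>\<^bsub>M\<^esub> x)" by (auto simp: a_r_coset_def')
    then show ?thesis by (rule A.a_repr_independence'[symmetric]) (use assms in auto)
  qed
  have "a \<in> I +> a" "x \<in> ?N +>\<^bsub>M\<^esub> x" using I.a_rcos_self A.a_rcos_self assms by auto
  moreover have "(\<Union>b\<in>I +> a. \<Union>y\<in>?N +>\<^bsub>M\<^esub> x. ?N +>\<^bsub>M\<^esub> (b \<odot>\<^bsub>M\<^esub> y))
      = (\<Union>b\<in>I +> a. \<Union>y\<in>?N +>\<^bsub>M\<^esub> x. ?N +>\<^bsub>M\<^esub> (a \<odot>\<^bsub>M\<^esub> x))"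
    by (intro SUP_cong refl eq)
  ultimately show ?thesis unfolding reduction_def reduction_map_def by auto
qed

lemma reduction_carrier: "carrier (reduction R I M) = reduction_map R I M ` carrier M"
  by (auto simp: reduction_def reduction_map_def A_RCOSETS_def' a_r_coset_def')

lemma reduction_add:
  assumes "ideal I R" "x \<in> carrier M" "y \<in> carrier M"
  shows "reduction_map R I M x \<oplus>\<^bsub>reduction R I M\<^esub> reduction_map R I M y = reduction_map R I M (x \<oplus>\<^bsub>M\<^esub> y)"
proof -
  interpret A: abelian_subgroup "ideal_smult R I M" M
    by (rule submodule_abelian_subgroup ideal_smult_submodule)+ fact
  show ?thesis using assms by (simp add: reduction_def reduction_map_def A.a_rcos_sum)
qed

lemma reduction_zero:
  assumes "ideal I R"
  shows "\<zero>\<^bsub>reduction R I M\<^esub> = reduction_map R I M \<zero>\<^bsub>M\<^esub>"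
proof -
  interpret A: abelian_subgroup "ideal_smult R I M" M
    by (rule submodule_abelian_subgroup ideal_smult_submodule)+ fact
  show ?thesis by (simp add: reduction_def reduction_map_def A.a_subset)
qed

lemma reduction_map_eq_iff:
  assumes "ideal I R" "x \<in> carrier M" "y \<in> carrier M"
  shows "reduction_map R I M x = reduction_map R I M y \<longleftrightarrow> x \<ominus>\<^bsub>M\<^esub> y \<in> ideal_smult R I M"
proof -
  interpret A: abelian_subgroup "ideal_smult R I M" M
    by (rule submodule_abelian_subgroup ideal_smult_submodule)+ fact
  have "reduction_map R I M x = reduction_map R I M y \<longleftrightarrow> x \<in> ideal_smult R I M +>\<^bsub>M\<^esub> y"
    unfolding reduction_map_def using assms A.a_repr_independence' A.a_rcos_self by metis
  then show ?thesis using A.a_rcos_module[OF assms(3,2)] by (simp add: M.minus_eq)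
qed

lemma reduction_module:
  assumes "ideal I R"
  shows "module (R Quot I) (reduction R I M)"
proof -
  interpret I: ideal I R by fact
  interpret Q: cring "R Quot I" by (rule I.quotient_is_cring[OF R.cring_axioms])
  have cQ: "carrier (R Quot I) = (+>) I ` carrier R"
    by (auto simp: FactRing_def A_RCOSETS_def' a_r_coset_def')
  have hom: "(+>) I \<in> ring_hom R (R Quot I)" by (rule I.rcos_ring_hom)
  have cT: "carrier (reduction R I M) = reduction_map R I M ` carrier M"
    by (rule reduction_carrier)
  let ?T = "reduction R I M" and ?p = "reduction_map R I M"
  have Tcases: "\<And>X. X \<in> carrier ?T \<Longrightarrow> \<exists>x. x \<in> carrier M \<and> X = ?p x"
    and Qcases: "\<And>A. A \<in> carrier (R Quot I) \<Longrightarrow> \<exists>a. a \<in> carrier R \<and> A = I +> a"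
    by (auto simp: cT cQ)
  have pT: "\<And>x. x \<in> carrier M \<Longrightarrow> ?p x \<in> carrier ?T" by (simp add: cT)
  note simps = reduction_add[OF assms] reduction_smult[OF assms] reduction_zero[OF assms] pT
    ring_hom_mult[OF hom, symmetric] ring_hom_add[OF hom, symmetric] ring_hom_one[OF hom, symmetric]
  show ?thesis
  proof (rule moduleI[OF Q.cring_axioms abelian_groupI])
    fix X Y assume "X \<in> carrier ?T" "Y \<in> carrier ?T"
    then show "X \<oplus>\<^bsub>?T\<^esub> Y \<in> carrier ?T" "X \<oplus>\<^bsub>?T\<^esub> Y = Y \<oplus>\<^bsub>?T\<^esub> X"
      by (auto dest!: Tcases simp: simps M.a_comm)
  next
    fix X Y Z assume "X \<in> carrier ?T" "Y \<in> carrier ?T" "Z \<in> carrier ?T"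
    then show "X \<oplus>\<^bsub>?T\<^esub> Y \<oplus>\<^bsub>?T\<^esub> Z = X \<oplus>\<^bsub>?T\<^esub> (Y \<oplus>\<^bsub>?T\<^esub> Z)"
      by (auto dest!: Tcases simp: simps M.a_assoc)
  next
    fix X assume "X \<in> carrier ?T"
    then obtain x where x: "x \<in> carrier M" "X = ?p x" by (auto dest: Tcases)
    then show "\<zero>\<^bsub>?T\<^esub> \<oplus>\<^bsub>?T\<^esub> X = X" "\<one>\<^bsub>R Quot I\<^esub> \<odot>\<^bsub>?T\<^esub> X = X"
      by (simp_all add: simps)
    show "\<exists>Y\<in>carrier ?T. Y \<oplus>\<^bsub>?T\<^esub> X = \<zero>\<^bsub>?T\<^esub>"
      using x by (intro bexI[of _ "?p (\<ominus>\<^bsub>M\<^esub> x)"]) (simp_all add: simps M.l_neg)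
  next
    show "\<zero>\<^bsub>?T\<^esub> \<in> carrier ?T" by (simp add: simps)
  next
    fix A X assume "A \<in> carrier (R Quot I)" "X \<in> carrier ?T"
    then show "A \<odot>\<^bsub>?T\<^esub> X \<in> carrier ?T" by (auto dest!: Tcases Qcases simp: simps)
  next
    fix A B X assume "A \<in> carrier (R Quot I)" "B \<in> carrier (R Quot I)" "X \<in> carrier ?T"
    then obtain a b x where *: "a \<in> carrier R" "b \<in> carrier R" "x \<in> carrier M"
      "A = I +> a" "B = I +> b" "X = ?p x"
      by (auto dest!: Tcases Qcases)
    show "(A \<oplus>\<^bsub>R Quot I\<^esub> B) \<odot>\<^bsub>?T\<^esub> X = A \<odot>\<^bsub>?T\<^esub> X \<oplus>\<^bsub>?T\<^esub> B \<odot>\<^bsub>?T\<^esub> X"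
      unfolding * using *(1-3) by (simp add: simps smult_l_distr)
    show "(A \<otimes>\<^bsub>R Quot I\<^esub> B) \<odot>\<^bsub>?T\<^esub> X = A \<odot>\<^bsub>?T\<^esub> (B \<odot>\<^bsub>?T\<^esub> X)"
      unfolding * using *(1-3) by (simp add: simps smult_assoc1)
  next
    fix A X Y assume "A \<in> carrier (R Quot I)" "X \<in> carrier ?T" "Y \<in> carrier ?T"
    then obtain a x y where *: "a \<in> carrier R" "x \<in> carrier M" "y \<in> carrier M"
      "A = I +> a" "X = ?p x" "Y = ?p y"
      by (auto dest!: Tcases Qcases)
    show "A \<odot>\<^bsub>?T\<^esub> (X \<oplus>\<^bsub>?T\<^esub> Y) = A \<odot>\<^bsub>?T\<^esub> X \<oplus>\<^bsub>?T\<^esub> A \<odot>\<^bsub>?T\<^esub> Y"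
      unfolding * using *(1-3) by (simp add: simps smult_r_distr)
  qed
qed

theorem reduction_universal:
  assumes I: "ideal I R" and L: "module R L"
    and \<beta>_closed: "\<And>x A. \<lbrakk>x \<in> carrier M; A \<in> carrier (R Quot I)\<rbrakk> \<Longrightarrow> \<beta> x A \<in> carrier L"
    and \<beta>_add_l: "\<And>x y A. \<lbrakk>x \<in> carrier M; y \<in> carrier M; A \<in> carrier (R Quot I)\<rbrakk>
      \<Longrightarrow> \<beta> (x \<oplus>\<^bsub>M\<^esub> y) A = \<beta> x A \<oplus>\<^bsub>L\<^esub> \<beta> y A"
    and \<beta>_add_r: "\<And>x A B. \<lbrakk>x \<in> carrier M; A \<in> carrier (R Quot I); B \<in> carrier (R Quot I)\<rbrakk>
      \<Longrightarrow> \<beta> x (A \<oplus>\<^bsub>R Quot I\<^esub> B) = \<beta> x A \<oplus>\<^bsub>L\<^esub> \<beta> x B"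
    and \<beta>_smult_l: "\<And>r x A. \<lbrakk>r \<in> carrier R; x \<in> carrier M; A \<in> carrier (R Quot I)\<rbrakk>
      \<Longrightarrow> \<beta> (r \<odot>\<^bsub>M\<^esub> x) A = r \<odot>\<^bsub>L\<^esub> \<beta> x A"
    and \<beta>_smult_r: "\<And>r x A. \<lbrakk>r \<in> carrier R; x \<in> carrier M; A \<in> carrier (R Quot I)\<rbrakk>
      \<Longrightarrow> \<beta> x ((I +> r) \<otimes>\<^bsub>R Quot I\<^esub> A) = r \<odot>\<^bsub>L\<^esub> \<beta> x A"
  shows "\<exists>!g. g \<in> carrier (reduction R I M) \<rightarrow>\<^sub>E carrier L
    \<and> (\<forall>X\<in>carrier (reduction R I M). \<forall>Y\<in>carrier (reduction R I M).
         g (X \<oplus>\<^bsub>reduction R I M\<^esub> Y) = g X \<oplus>\<^bsub>L\<^esub> g Y)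
    \<and> (\<forall>r\<in>carrier R. \<forall>X\<in>carrier (reduction R I M).
         g ((I +> r) \<odot>\<^bsub>reduction R I M\<^esub> X) = r \<odot>\<^bsub>L\<^esub> g X)
    \<and> (\<forall>x\<in>carrier M. \<forall>A\<in>carrier (R Quot I).
         g (A \<odot>\<^bsub>reduction R I M\<^esub> reduction_map R I M x) = \<beta> x A)"
    (is "\<exists>!g. ?P g")
proof -
  interpret I: ideal I R by fact
  interpret L: module R L by fact
  interpret Q: cring "R Quot I" by (rule I.quotient_is_cring[OF R.cring_axioms])
  let ?T = "reduction R I M" and ?p = "reduction_map R I M" and ?N = "ideal_smult R I M"
  interpret T: module "R Quot I" ?T by (rule reduction_module[OF I])
  have cQ: "carrier (R Quot I) = (+>) I ` carrier R"
    by (auto simp: FactRing_def A_RCOSETS_def' a_r_coset_def')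
  have one: "\<one>\<^bsub>R Quot I\<^esub> = I +> \<one>" and zero: "\<zero>\<^bsub>R Quot I\<^esub> = I" by (auto simp: FactRing_def)
  define h where "h x = \<beta> x (I +> \<one>)" for x
  have one_c: "I +> \<one> \<in> carrier (R Quot I)" using cQ by auto
  have h: "mod_hom R M L h"
    unfolding mod_hom_def mod_hom_axioms_def module_hom_def
    using module_axioms L \<beta>_closed \<beta>_add_l \<beta>_smult_l one_c by (auto simp: h_def)
  interpret h: mod_hom R M L h by (rule h)
  have \<beta>: "\<beta> x (I +> a) = h (a \<odot>\<^bsub>M\<^esub> x)" if "x \<in> carrier M" "a \<in> carrier R" for x a
  proof -
    have "\<beta> x (I +> a) = \<beta> x ((I +> a) \<otimes>\<^bsub>R Quot I\<^esub> \<one>\<^bsub>R Quot I\<^esub>)"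
      using that cQ by auto
    also have "\<dots> = a \<odot>\<^bsub>L\<^esub> h x" using that one_c \<beta>_smult_r by (simp add: one h_def)
    finally show ?thesis using that by simp
  qed
  have "?N \<subseteq> h.ker"
    unfolding ideal_smult_def
  proof (rule span_is_subset[OF _ h.ker_is_submodule], clarify)
    fix a x assume a: "a \<in> I" and x: "x \<in> carrier M"
    have aR: "a \<in> carrier R" using a by (rule I.a_Hcarr)
    have "I +> a = I +> \<zero>" using I.a_rcos_const[OF a] by (simp add: I.a_subset)
    then have "h (a \<odot>\<^bsub>M\<^esub> x) = h (\<zero> \<odot>\<^bsub>M\<^esub> x)" using \<beta>[OF x aR] \<beta>[OF x R.zero_closed] by simp
    then show "a \<odot>\<^bsub>M\<^esub> x \<in> h.ker" using x aR by (simp add: h.ker_def smult_l_null)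
  qed
  then have ker: "h z = \<zero>\<^bsub>L\<^esub>" if "z \<in> ?N" for z using that by (auto simp: h.ker_def)
  have eq: "h x = h y" if "x \<in> carrier M" "y \<in> carrier M" "?p x = ?p y" for x y
  proof -
    have "h (x \<ominus>\<^bsub>M\<^esub> y) = \<zero>\<^bsub>L\<^esub>"
      using ker reduction_map_eq_iff[OF I that(1,2)] that by simp
    then have "h x \<ominus>\<^bsub>L\<^esub> h y = \<zero>\<^bsub>L\<^esub>" using that by simp
    moreover have "h x \<in> carrier L" "h y \<in> carrier L" using that by auto
    moreover from this have "(h x \<ominus>\<^bsub>L\<^esub> h y) \<oplus>\<^bsub>L\<^esub> h y = h x"
      by (simp add: L.M.minus_eq L.M.a_assoc L.M.l_neg)
    ultimately show ?thesis by simp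
  qed
  define g where "g = (\<lambda>X\<in>carrier ?T. h (SOME x. x \<in> carrier M \<and> ?p x = X))"
  have g: "g (?p x) = h x" if x: "x \<in> carrier M" for x
  proof -
    have "\<exists>y. y \<in> carrier M \<and> ?p y = ?p x" using x by auto
    from someI_ex[OF this] show ?thesis
      using eq[of "SOME y. y \<in> carrier M \<and> ?p y = ?p x" x] x by (auto simp: g_def reduction_carrier)
  qed
  have "?P g"
  proof (intro conjI ballI)
    show "g \<in> carrier ?T \<rightarrow>\<^sub>E carrier L"
    proof (rule PiE_I)
      fix X assume "X \<in> carrier ?T"
      then obtain x where "x \<in> carrier M" "X = ?p x" by (auto simp: reduction_carrier)
      then show "g X \<in> carrier L" using g by simp
    qed (simp add: g_def)
  next
    fix X Y assume "X \<in> carrier ?T" "Y \<in> carrier ?T"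
    then obtain x y where "x \<in> carrier M" "X = ?p x" "y \<in> carrier M" "Y = ?p y"
      by (auto simp: reduction_carrier)
    then show "g (X \<oplus>\<^bsub>?T\<^esub> Y) = g X \<oplus>\<^bsub>L\<^esub> g Y" by (simp add: reduction_add[OF I] g)
  next
    fix r X assume "r \<in> carrier R" "X \<in> carrier ?T"
    moreover from this obtain x where "x \<in> carrier M" "X = ?p x" by (auto simp: reduction_carrier)
    ultimately show "g ((I +> r) \<odot>\<^bsub>?T\<^esub> X) = r \<odot>\<^bsub>L\<^esub> g X" by (simp add: reduction_smult[OF I] g)
  next
    fix x A assume "x \<in> carrier M" "A \<in> carrier (R Quot I)"
    moreover from this obtain a where "a \<in> carrier R" "A = I +> a" using cQ by auto
    ultimately show "g (A \<odot>\<^bsub>?T\<^esub> ?p x) = \<beta> x A" by (simp add: reduction_smult[OF I] g \<beta>)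
  qed
  moreover have "g' = g" if "?P g'" for g'
  proof
    fix X
    show "g' X = g X"
    proof (cases "X \<in> carrier ?T")
      case True
      then obtain x where x: "x \<in> carrier M" "X = ?p x" by (auto simp: reduction_carrier)
      have "X = (I +> \<one>) \<odot>\<^bsub>?T\<^esub> ?p x" using x by (simp add: reduction_smult[OF I])
      moreover have "g' ((I +> \<one>) \<odot>\<^bsub>?T\<^esub> ?p x) = \<beta> x (I +> \<one>)" using that x one_c by blast
      ultimately have "g' X = h x" by (simp add: h_def)
      then show ?thesis using x g by simp
    next
      case False
      have "g' \<in> carrier ?T \<rightarrow>\<^sub>E carrier L" using that by blast
      with False show ?thesis by (auto simp: g_def PiE_def extensional_def)
    qed
  qed
  ultimately show ?thesis by (rule ex1I)
qed

end


section \<open>Finitely presented modules\<close>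

definition finitely_presented :: "('r, 'k) ring_scheme \<Rightarrow> ('r, 'b, 'm) module_scheme \<Rightarrow> bool" where
  "finitely_presented R M \<longleftrightarrow>
    (\<exists>(r::nat) f S. mod_hom R (ring.func_space R {1..r}) M f
       \<and> f ` carrier (ring.func_space R {1..r}) = carrier M
       \<and> finite S \<and> S \<subseteq> carrier (ring.func_space R {1..r})
       \<and> module.span R (ring.func_space R {1..r}) S
           = {c \<in> carrier (ring.func_space R {1..r}). f c = \<zero>\<^bsub>M\<^esub>})"


section \<open>Multi-filtered vector spaces and semistability\<close>

text \<open>\<open>Fil i j\<close> is the \<open>j\<close>-th step of the \<open>i\<close>-th filtration, \<open>1 \<le> i \<le> n\<close>.\<close>

locale multi_filtered_space = vectorspace F V for F and V +
  fixes n :: nat and Fil :: "nat \<Rightarrow> nat \<Rightarrow> 'c set"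
  assumes fin_dim: "fin_dim"
    and Fil_subspace: "i \<in> {1..n} \<Longrightarrow> subspace F (Fil i j) V"
    and Fil_decreasing: "i \<in> {1..n} \<Longrightarrow> Fil i (Suc j) \<subseteq> Fil i j"
    and Fil_exhaustive: "i \<in> {1..n} \<Longrightarrow> Fil i 0 = carrier V"
    and Fil_separated: "i \<in> {1..n} \<Longrightarrow> \<exists>l. Fil i l = {\<zero>\<^bsub>V\<^esub>}"

text \<open>The sum over \<open>j\<close> is restricted to the finitely many nonzero steps; the graded pieces vanish
  outside this range.\<close>

definition filtration_weight ::
    "('a, 'm) ring_scheme \<Rightarrow> ('a, 'b, 'k) module_scheme \<Rightarrow> nat \<Rightarrow> (nat \<Rightarrow> nat \<Rightarrow> 'b set) \<Rightarrow> nat" where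
  "filtration_weight F V n Fil =
    (\<Sum>i\<in>{1..n}. \<Sum>j\<in>{j. Fil i j \<noteq> {\<zero>\<^bsub>V\<^esub>}}.
       j * vectorspace.dim F (quotient_module (V\<lparr>carrier := Fil i j\<rparr>) (Fil i (Suc j))))"

definition slope ::
    "('a, 'm) ring_scheme \<Rightarrow> ('a, 'b, 'k) module_scheme \<Rightarrow> nat \<Rightarrow> (nat \<Rightarrow> nat \<Rightarrow> 'b set) \<Rightarrow> rat" where
  "slope F V n Fil = of_nat (filtration_weight F V n Fil) / of_nat (vectorspace.dim F V)"

definition semistable ::
    "('a, 'm) ring_scheme \<Rightarrow> ('a, 'b, 'k) module_scheme \<Rightarrow> nat \<Rightarrow> (nat \<Rightarrow> nat \<Rightarrow> 'b set) \<Rightarrow> bool" where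
  "semistable F V n Fil \<longleftrightarrow>
    (\<forall>W. subspace F W V \<and> W \<noteq> {\<zero>\<^bsub>V\<^esub>} \<longrightarrow>
       slope F (V\<lparr>carrier := W\<rparr>) n (\<lambda>i j. Fil i j \<inter> W) \<le> slope F V n Fil)"


section \<open>Integral models\<close>

text \<open>For a submodule \<open>M\<close> of \<open>V\<close> over the valuation ring, the map \<open>M \<otimes> K \<rightarrow> V\<close> is always injective
  (\<open>K\<close> is a localisation), so \<open>M \<otimes> K = V\<close> says that \<open>M\<close> spans \<open>V\<close> over \<open>K\<close>.\<close>

definition is_lattice ::
    "('a, 'm) ring_scheme \<Rightarrow> ('a \<Rightarrow> 'g::linordered_ab_group_add) \<Rightarrow> ('a, 'b, 'k) module_scheme \<Rightarrow>
     'b set \<Rightarrow> bool" where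
  "is_lattice K v V M \<longleftrightarrow>
    submodule (valuation_ring K v) M V
    \<and> finitely_presented (valuation_ring K v) (V\<lparr>carrier := M\<rparr>)
    \<and> module.span K V M = carrier V"

definition integral_model ::
    "('a, 'm) ring_scheme \<Rightarrow> ('a \<Rightarrow> 'g::linordered_ab_group_add) \<Rightarrow> ('a, 'b, 'k) module_scheme \<Rightarrow>
     (nat \<Rightarrow> nat \<Rightarrow> 'b set) \<Rightarrow> 'b set \<Rightarrow> (nat \<Rightarrow> nat \<Rightarrow> 'b set) \<Rightarrow> bool" where
  "integral_model K v V Fil M FilM \<longleftrightarrow> is_lattice K v V M \<and> FilM = (\<lambda>i j. Fil i j \<inter> M)"

definition model_reduction ::
    "('a, 'm) ring_scheme \<Rightarrow> ('a \<Rightarrow> 'g::linordered_ab_group_add) \<Rightarrow> ('a, 'b, 'k) module_scheme \<Rightarrow>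
     'b set \<Rightarrow> ('a set, 'b set) module" where
  "model_reduction K v V M = reduction (valuation_ring K v) (valuation_ideal K v) (V\<lparr>carrier := M\<rparr>)"

definition reduced_filtration ::
    "('a, 'm) ring_scheme \<Rightarrow> ('a \<Rightarrow> 'g::linordered_ab_group_add) \<Rightarrow> ('a, 'b, 'k) module_scheme \<Rightarrow>
     'b set \<Rightarrow> (nat \<Rightarrow> nat \<Rightarrow> 'b set) \<Rightarrow> nat \<Rightarrow> nat \<Rightarrow> 'b set set" where
  "reduced_filtration K v V M FilM i j =
    reduction_map (valuation_ring K v) (valuation_ideal K v) (V\<lparr>carrier := M\<rparr>) ` FilM i j"

end

theory Submission
 imports Defs
begin

text \<open>All dimensions over \<open>K\<close>, \<open>k\<close> and other residue fields are lengths of quotients of submodules of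
 \<open>V\<close>. Semistability of \<open>V\<close> says that an integer degree is nonpositive on all subspaces. Choose a
 lattice \<open>M\<close> whose reduction has the least possible maximal degree \<open>D\<close>, and suppose \<open>D > 0\<close>. The
 submodule \<open>W\<close> of the reduction of degree \<open>D\<close> is unique. Langton's elementary modification, combined with
 the closedness of finitely generated submodules of \<open>M\<^sup>n\<close>, shows that the \<open>a\<close> modulo which \<open>W\<close> lifts, with
 its filtrations, are closed under multiplication; they form the complement \<open>S\<close> of a prime ideal \<open>P\<close>,
 where \<open>\<zero> \<notin> S\<close> because \<open>V\<close> is semistable. The lifts modulo the \<open>a \<in> S\<close> define a subspace of degree
 \<open>D\<close> over an extension of the residue field of the localisation at \<open>P\<close>. Such a subspace exists over that
 residue field already, by comparing dimensions in an algebra generated by finitely many coefficients,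
 which has polynomial growth. It lifts to \<open>V\<close>, and this lift is a lift of \<open>W\<close> modulo an element of
 \<open>P\<close>, a contradiction.\<close>

section \<open>Length of quotients over a local ring\<close>

text \<open>For a complete discrete valuation, Langton's modification is iterated and the lifts of W
  converge. Here a sequence of moduli need not reach every element, lifts modulo different elements
  are unrelated, and no limit is available. Two devices replace it. Minimality of D permits
  Langton's step at every modulus reached so far, but a step gains an uncontrolled factor;
  comparison with a best possible correction of the lift squares the modulus instead, and in a
  valuation ring closure under squares and divisors already yields the complement of a prime. In
  place of a limit, one arbitrary lift is chosen for each modulus in S, and families are read modulo
  those eventually divisible by all of S. The lifts become exact there, at the price of coefficients
  in a huge ring over the residue field at P; the descent works because finitely many families
  involve only finitely many coefficients. The degree is the slope inequality perturbed by the
  dimension, so that equal degrees force equal dimensions: this makes W unique and turns equalities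
  of degrees into equalities of nested submodules.\<close>

locale local_module = module R M for R (structure) and M +
 fixes I
 assumes I_carrier: "I \<subseteq> carrier R"
  and unit_outside: "\<lbrakk>r \<in> carrier R; r \<notin> I\<rbrakk> \<Longrightarrow> \<exists>s\<in>carrier R. s \<otimes> r = \<one>"

section \<open>Sums, intersections and cyclic submodules\<close>

context module
begin

abbreviation sub where "sub N \<equiv> submodule R N M"

lemma subI:
 assumes "N \<subseteq> carrier M" "\<zero>\<^bsub>M\<^esub> \<in> N"
  and "\<And>x y. \<lbrakk>x \<in> N; y \<in> N\<rbrakk> \<Longrightarrow> x \<oplus>\<^bsub>M\<^esub> y \<in> N"
  and "\<And>r x. \<lbrakk>r \<in> carrier R; x \<in> N\<rbrakk> \<Longrightarrow> r \<odot>\<^bsub>M\<^esub> x \<in> N"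
 shows "sub N"
 using assms module_axioms by (auto intro!: submodule.intro)

lemma sub_carrier: "\<lbrakk>sub N; x \<in> N\<rbrakk> \<Longrightarrow> x \<in> carrier M"
 using submodule.subset by blast

lemma sub_subset: "sub N \<Longrightarrow> N \<subseteq> carrier M"
 by (rule submodule.subset)

lemma sub_zero: "sub N \<Longrightarrow> \<zero>\<^bsub>M\<^esub> \<in> N"
 by (rule submodule.zero_closed)

lemma sub_add: "\<lbrakk>sub N; x \<in> N; y \<in> N\<rbrakk> \<Longrightarrow> x \<oplus>\<^bsub>M\<^esub> y \<in> N"
 by (rule submodule.m_closed)

lemma sub_smult: "\<lbrakk>sub N; r \<in> carrier R; x \<in> N\<rbrakk> \<Longrightarrow> r \<odot>\<^bsub>M\<^esub> x \<in> N"
 by (rule submodule.smult_closed)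

lemma sub_neg:
 assumes "sub N" "x \<in> N"
 shows "\<ominus>\<^bsub>M\<^esub> x \<in> N"
proof -
 have "\<ominus>\<^bsub>M\<^esub> x = (\<ominus> \<one>) \<odot>\<^bsub>M\<^esub> x"
  using smult_minus_1[OF sub_carrier[OF assms]] by simp
 then show ?thesis using sub_smult[OF assms(1) _ assms(2), of "\<ominus> \<one>"] by simp
qed

lemma sub_minus: "\<lbrakk>sub N; x \<in> N; y \<in> N\<rbrakk> \<Longrightarrow> x \<ominus>\<^bsub>M\<^esub> y \<in> N"
 using sub_add sub_neg M.minus_eq by simp

lemma sub_cancel:
 assumes "sub N" "x \<oplus>\<^bsub>M\<^esub> y \<in> N" "x \<in> N" "y \<in> carrier M"
 shows "y \<in> N"
proof -
 have "y = \<ominus>\<^bsub>M\<^esub> x \<oplus>\<^bsub>M\<^esub> (x \<oplus>\<^bsub>M\<^esub> y)"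
  using assms sub_carrier[OF assms(1)] by (simp add: M.a_assoc[symmetric] M.l_neg)
 then show ?thesis using sub_add[OF assms(1) sub_neg[OF assms(1,3)] assms(2)] by simp
qed

lemma sub_cancel':
 assumes "sub N" "x \<oplus>\<^bsub>M\<^esub> y \<in> N" "y \<in> N" "x \<in> carrier M"
 shows "x \<in> N"
 using sub_cancel[of N y x] assms sub_carrier[OF assms(1)] by (simp add: M.a_comm)

lemma sub_diffD:
 assumes "sub N" "x \<ominus>\<^bsub>M\<^esub> y \<in> N" "y \<in> N" "x \<in> carrier M"
 shows "x \<in> N"
 using sub_cancel'[of N x "\<ominus>\<^bsub>M\<^esub> y"] assms sub_neg by (simp add: M.minus_eq)

lemma minus_add_cancel:
 "\<lbrakk>x \<in> carrier M; y \<in> carrier M\<rbrakk> \<Longrightarrow> (x \<ominus>\<^bsub>M\<^esub> y) \<oplus>\<^bsub>M\<^esub> y = x"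
 "\<lbrakk>x \<in> carrier M; y \<in> carrier M\<rbrakk> \<Longrightarrow> y \<oplus>\<^bsub>M\<^esub> (x \<ominus>\<^bsub>M\<^esub> y) = x"
 "\<lbrakk>x \<in> carrier M; y \<in> carrier M\<rbrakk> \<Longrightarrow> (x \<oplus>\<^bsub>M\<^esub> y) \<ominus>\<^bsub>M\<^esub> y = x"
proof -
 assume *: "x \<in> carrier M" "y \<in> carrier M"
 show 1: "(x \<ominus>\<^bsub>M\<^esub> y) \<oplus>\<^bsub>M\<^esub> y = x" using * by (simp add: M.minus_eq M.a_assoc M.l_neg)
 show "y \<oplus>\<^bsub>M\<^esub> (x \<ominus>\<^bsub>M\<^esub> y) = x" using * 1 M.a_comm[of y "x \<ominus>\<^bsub>M\<^esub> y"] by simp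
 show "(x \<oplus>\<^bsub>M\<^esub> y) \<ominus>\<^bsub>M\<^esub> y = x" using * by (simp add: M.minus_eq M.a_assoc M.r_neg)
qed

lemma sub_Int: "\<lbrakk>sub A; sub B\<rbrakk> \<Longrightarrow> sub (A \<inter> B)"
 by (rule subI) (auto dest: sub_carrier intro: sub_zero sub_add sub_smult)

lemma sub_zero_set: "sub {\<zero>\<^bsub>M\<^esub>}"
 by (rule subI) auto

lemma sub_carrier_set: "sub (carrier M)"
 by (rule subI) auto

lemma mem_sum: "x \<in> A <+>\<^bsub>M\<^esub> B \<longleftrightarrow> (\<exists>a\<in>A. \<exists>b\<in>B. x = a \<oplus>\<^bsub>M\<^esub> b)"
 by (auto simp: set_add_def')

lemma sumI: "\<lbrakk>a \<in> A; b \<in> B\<rbrakk> \<Longrightarrow> a \<oplus>\<^bsub>M\<^esub> b \<in> A <+>\<^bsub>M\<^esub> B"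
 by (auto simp: mem_sum)

lemma sub_sum:
 assumes "sub A" "sub B"
 shows "sub (A <+>\<^bsub>M\<^esub> B)"
proof (rule subI)
 show "A <+>\<^bsub>M\<^esub> B \<subseteq> carrier M"
  using sub_subset[OF assms(1)] sub_subset[OF assms(2)] by (auto simp: mem_sum subset_iff)
 show "\<zero>\<^bsub>M\<^esub> \<in> A <+>\<^bsub>M\<^esub> B" using sumI[OF sub_zero[OF assms(1)] sub_zero[OF assms(2)]] by simp
next
 fix x y assume "x \<in> A <+>\<^bsub>M\<^esub> B" "y \<in> A <+>\<^bsub>M\<^esub> B"
 then obtain a b c d where *: "a \<in> A" "b \<in> B" "c \<in> A" "d \<in> B" "x = a \<oplus>\<^bsub>M\<^esub> b" "y = c \<oplus>\<^bsub>M\<^esub> d"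
  by (auto simp: mem_sum)
 have "x \<oplus>\<^bsub>M\<^esub> y = (a \<oplus>\<^bsub>M\<^esub> c) \<oplus>\<^bsub>M\<^esub> (b \<oplus>\<^bsub>M\<^esub> d)"
  using * assms by (simp add: sub_carrier M.a_ac)
 then show "x \<oplus>\<^bsub>M\<^esub> y \<in> A <+>\<^bsub>M\<^esub> B" using * assms by (auto intro!: sumI sub_add)
next
 fix r x assume r: "r \<in> carrier R" and "x \<in> A <+>\<^bsub>M\<^esub> B"
 then obtain a b where *: "a \<in> A" "b \<in> B" "x = a \<oplus>\<^bsub>M\<^esub> b" by (auto simp: mem_sum)
 have "r \<odot>\<^bsub>M\<^esub> x = r \<odot>\<^bsub>M\<^esub> a \<oplus>\<^bsub>M\<^esub> r \<odot>\<^bsub>M\<^esub> b"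
  using * r assms by (simp add: sub_carrier smult_r_distr)
 then show "r \<odot>\<^bsub>M\<^esub> x \<in> A <+>\<^bsub>M\<^esub> B" using * r assms by (auto intro!: sumI sub_smult)
qed

lemma sum_upper1: "\<lbrakk>sub A; sub B\<rbrakk> \<Longrightarrow> A \<subseteq> A <+>\<^bsub>M\<^esub> B"
proof
 fix x assume *: "sub A" "sub B" "x \<in> A"
 then show "x \<in> A <+>\<^bsub>M\<^esub> B"
  using sumI[of x A "\<zero>\<^bsub>M\<^esub>" B] sub_zero[of B] sub_carrier[of A x] by simp
qed

lemma sum_upper2: "\<lbrakk>sub A; sub B\<rbrakk> \<Longrightarrow> B \<subseteq> A <+>\<^bsub>M\<^esub> B"
proof
 fix x assume *: "sub A" "sub B" "x \<in> B"
 then show "x \<in> A <+>\<^bsub>M\<^esub> B"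
  using sumI[of "\<zero>\<^bsub>M\<^esub>" A x B] sub_zero[of A] sub_carrier[of B x] by simp
qed

lemma sum_least: "\<lbrakk>sub C; A \<subseteq> C; B \<subseteq> C\<rbrakk> \<Longrightarrow> A <+>\<^bsub>M\<^esub> B \<subseteq> C"
 by (auto simp: mem_sum intro!: sub_add)

lemma sum_mono: "\<lbrakk>A \<subseteq> A'; B \<subseteq> B'\<rbrakk> \<Longrightarrow> A <+>\<^bsub>M\<^esub> B \<subseteq> A' <+>\<^bsub>M\<^esub> B'"
 unfolding set_add_def' by blast

lemma sum_absorb1: "\<lbrakk>sub A; sub B; B \<subseteq> A\<rbrakk> \<Longrightarrow> A <+>\<^bsub>M\<^esub> B = A"
 by (intro equalityI sum_least sum_upper1) auto

lemma sum_absorb2: "\<lbrakk>sub A; sub B; A \<subseteq> B\<rbrakk> \<Longrightarrow> A <+>\<^bsub>M\<^esub> B = B"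
 by (intro equalityI sum_least sum_upper2) auto

lemma sum_comm: "\<lbrakk>sub A; sub B\<rbrakk> \<Longrightarrow> A <+>\<^bsub>M\<^esub> B = B <+>\<^bsub>M\<^esub> A"
 by (intro equalityI sum_least sum_upper1 sum_upper2 sub_sum)

lemma sum_assoc:
 assumes "sub A" "sub B" "sub C"
 shows "(A <+>\<^bsub>M\<^esub> B) <+>\<^bsub>M\<^esub> C = A <+>\<^bsub>M\<^esub> (B <+>\<^bsub>M\<^esub> C)"
proof (intro equalityI)
 note s = sub_sum[OF assms(1,2)] sub_sum[OF assms(2,3)]
 show "(A <+>\<^bsub>M\<^esub> B) <+>\<^bsub>M\<^esub> C \<subseteq> A <+>\<^bsub>M\<^esub> (B <+>\<^bsub>M\<^esub> C)"
  using sum_upper1[OF assms(1) s(2)] sum_upper2[OF assms(1) s(2)]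
   sum_upper1[OF assms(2,3)] sum_upper2[OF assms(2,3)]
  by (intro sum_least sub_sum assms) auto
 show "A <+>\<^bsub>M\<^esub> (B <+>\<^bsub>M\<^esub> C) \<subseteq> (A <+>\<^bsub>M\<^esub> B) <+>\<^bsub>M\<^esub> C"
  using sum_upper1[OF s(1) assms(3)] sum_upper2[OF s(1) assms(3)]
   sum_upper1[OF assms(1,2)] sum_upper2[OF assms(1,2)]
  by (intro sum_least sub_sum assms) auto
qed

lemma modular_law:
 assumes "sub A" "sub B" "sub C" "A \<subseteq> C"
 shows "(A <+>\<^bsub>M\<^esub> B) \<inter> C = A <+>\<^bsub>M\<^esub> (B \<inter> C)"
proof (intro equalityI subsetI)
 fix x assume x: "x \<in> (A <+>\<^bsub>M\<^esub> B) \<inter> C"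
 then obtain a b where ab: "a \<in> A" "b \<in> B" "x = a \<oplus>\<^bsub>M\<^esub> b" by (auto simp: mem_sum)
 have "b \<in> C" using sub_cancel[of C a b] ab x assms sub_carrier by blast
 then show "x \<in> A <+>\<^bsub>M\<^esub> (B \<inter> C)" using ab by (auto intro!: sumI)
next
 fix x assume "x \<in> A <+>\<^bsub>M\<^esub> (B \<inter> C)"
 then show "x \<in> (A <+>\<^bsub>M\<^esub> B) \<inter> C" using assms sub_add[of C] by (auto simp: mem_sum)
qed

definition line where "line x = {r \<odot>\<^bsub>M\<^esub> x | r. r \<in> carrier R}"

lemma line_self: "x \<in> carrier M \<Longrightarrow> x \<in> line x"
 unfolding line_def by (force intro: exI[of _ "\<one>"])

lemma sub_line: "x \<in> carrier M \<Longrightarrow> sub (line x)"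
proof (rule subI)
 assume x: "x \<in> carrier M"
 show "line x \<subseteq> carrier M" using x by (auto simp: line_def)
 show "\<zero>\<^bsub>M\<^esub> \<in> line x" using x unfolding line_def by (force intro: exI[of _ "\<zero>"])
 show "y \<oplus>\<^bsub>M\<^esub> z \<in> line x" if "y \<in> line x" "z \<in> line x" for y z
  using that x unfolding line_def by clarify (metis smult_l_distr R.a_closed)
 show "r \<odot>\<^bsub>M\<^esub> y \<in> line x" if "r \<in> carrier R" "y \<in> line x" for r y
  using that x unfolding line_def by clarify (metis smult_assoc1 R.m_closed)
qed

lemma line_least: "\<lbrakk>sub N; x \<in> N\<rbrakk> \<Longrightarrow> line x \<subseteq> N"
 by (auto simp: line_def intro: sub_smult)

lemma mem_sum_line: "y \<in> A <+>\<^bsub>M\<^esub> line x \<longleftrightarrow> (\<exists>a\<in>A. \<exists>r\<in>carrier R. y = a \<oplus>\<^bsub>M\<^esub> r \<odot>\<^bsub>M\<^esub> x)"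
 by (auto simp: mem_sum line_def)

lemma sub_adjoin: "\<lbrakk>sub A; x \<in> carrier M\<rbrakk> \<Longrightarrow> sub (A <+>\<^bsub>M\<^esub> line x)"
 by (intro sub_sum sub_line)

lemma adjoin_upper: "\<lbrakk>sub A; x \<in> carrier M\<rbrakk> \<Longrightarrow> A \<subseteq> A <+>\<^bsub>M\<^esub> line x"
 by (intro sum_upper1 sub_line)

lemma adjoin_self: "\<lbrakk>sub A; x \<in> carrier M\<rbrakk> \<Longrightarrow> x \<in> A <+>\<^bsub>M\<^esub> line x"
 using sum_upper2[OF _ sub_line] line_self by blast

lemma adjoin_least: "\<lbrakk>sub C; A \<subseteq> C; x \<in> C\<rbrakk> \<Longrightarrow> A <+>\<^bsub>M\<^esub> line x \<subseteq> C"
 by (intro sum_least line_least)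

lemma adjoin_absorb: "\<lbrakk>sub A; x \<in> A\<rbrakk> \<Longrightarrow> A <+>\<^bsub>M\<^esub> line x = A"
 by (intro equalityI adjoin_least adjoin_upper) (auto dest: sub_carrier)

lemma sum_adjoin: "\<lbrakk>sub A; sub N; x \<in> carrier M\<rbrakk> \<Longrightarrow>
  (A <+>\<^bsub>M\<^esub> line x) <+>\<^bsub>M\<^esub> N = (A <+>\<^bsub>M\<^esub> N) <+>\<^bsub>M\<^esub> line x"
 by (metis sub_line sum_assoc sum_comm)

lemma sub_smult_cancel:
 assumes "sub A" "r \<odot>\<^bsub>M\<^esub> x \<in> A" "s \<in> carrier R" "r \<in> carrier R" "s \<otimes> r = \<one>" "x \<in> carrier M"
 shows "x \<in> A"
 using sub_smult[OF assms(1,3,2)] assms by (simp add: smult_assoc1[symmetric])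

end

section \<open>Length of a quotient, by chains of simple steps\<close>

context local_module
begin

text \<open>\<open>dm B n A\<close> encodes that A/B has length n without forming the quotient: A
  arises from B by n steps, each adjoining a vector outside the current submodule that
  \<open>I\<close> multiplies into it. Since everything outside \<open>I\<close> is a unit, each
  step is one-dimensional over the residue field. Over a field with \<open>I\<close> the zero set,
  the length is the dimension.\<close>

inductive dm :: "'c set \<Rightarrow> nat \<Rightarrow> 'c set \<Rightarrow> bool" for B where
 dm_refl: "sub B \<Longrightarrow> dm B 0 B"
| dm_step: "\<lbrakk>dm B n A; x \<in> carrier M; x \<notin> A; \<And>r. r \<in> I \<Longrightarrow> r \<odot>\<^bsub>M\<^esub> x \<in> A\<rbrakk>
  \<Longrightarrow> dm B (Suc n) (A <+>\<^bsub>M\<^esub> line x)"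

lemma dm_subs: "dm B n A \<Longrightarrow> sub B \<and> sub A \<and> B \<subseteq> A"
 by (induction rule: dm.induct) (use sub_adjoin adjoin_upper in blast)+

lemma dm_zero: "dm B 0 A \<longleftrightarrow> sub B \<and> A = B"
 by (auto intro: dm.intros elim: dm.cases)

lemma dm_Suc: "dm B (Suc n) A \<longleftrightarrow> (\<exists>C x. dm B n C \<and> x \<in> carrier M \<and> x \<notin> C
  \<and> (\<forall>r\<in>I. r \<odot>\<^bsub>M\<^esub> x \<in> C) \<and> A = C <+>\<^bsub>M\<^esub> line x)"
proof
 assume "dm B (Suc n) A"
 then show "\<exists>C x. dm B n C \<and> x \<in> carrier M \<and> x \<notin> C
  \<and> (\<forall>r\<in>I. r \<odot>\<^bsub>M\<^esub> x \<in> C) \<and> A = C <+>\<^bsub>M\<^esub> line x"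
  by cases blast
qed (auto intro: dm_step)

lemma dm_neq: "dm B (Suc n) A \<Longrightarrow> A \<noteq> B"
proof
 assume "dm B (Suc n) A" "A = B"
 then obtain C x where C: "dm B n C" "x \<in> carrier M" "x \<notin> C" "B = C <+>\<^bsub>M\<^esub> line x"
  unfolding dm_Suc by blast
 then show False using dm_subs[OF C(1)] adjoin_self[of C x] by blast
qed

lemma dm_one: "\<lbrakk>sub A; x \<in> carrier M; x \<notin> A; \<And>r. r \<in> I \<Longrightarrow> r \<odot>\<^bsub>M\<^esub> x \<in> A\<rbrakk>
  \<Longrightarrow> dm A 1 (A <+>\<^bsub>M\<^esub> line x)"
 using dm_step[OF dm_refl] by simp

lemma dm_trans: "dm C k A \<Longrightarrow> dm B n C \<Longrightarrow> dm B (n + k) A"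
 by (induction rule: dm.induct) (auto intro: dm_step)

text \<open>A vector of C outside A has the form a + r x with r outside \<open>I\<close>, because
  \<open>I\<close> sends x into A; then r is a unit and C contains x.\<close>

lemma simple_interval:
 assumes "sub A" "sub C" "x \<in> carrier M" "\<And>r. r \<in> I \<Longrightarrow> r \<odot>\<^bsub>M\<^esub> x \<in> A"
  "A \<subseteq> C" "C \<subseteq> A <+>\<^bsub>M\<^esub> line x"
 shows "C = A \<or> C = A <+>\<^bsub>M\<^esub> line x"
proof (cases "C = A")
 case False
 then obtain z where z: "z \<in> C" "z \<notin> A" using assms(5) by blast
 then have "z \<in> A <+>\<^bsub>M\<^esub> line x" using assms(6) by blast
 then obtain a r where ar: "a \<in> A" "r \<in> carrier R" "z = a \<oplus>\<^bsub>M\<^esub> r \<odot>\<^bsub>M\<^esub> x"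
  by (auto simp: mem_sum_line)
 have "r \<notin> I" using z ar assms sub_add by blast
 then obtain s where s: "s \<in> carrier R" "s \<otimes> r = \<one>" using unit_outside ar by blast
 have "r \<odot>\<^bsub>M\<^esub> x \<in> C" using sub_cancel[OF assms(2), of a] z ar assms by auto
 then have "x \<in> C" using sub_smult_cancel assms s ar by blast
 then show ?thesis using adjoin_least[OF assms(2,5)] assms(6) by blast
qed simp

text \<open>Each step of the chain goes to exactly one side. If x lies in A + N, its component y in
  N generates the same extension of A, and the step shows up in the intersection with N. Otherwise x
  stays new modulo N, and the step shows up in the sum.\<close>

lemma dm_split:
 assumes "dm B n A" "sub N"
 shows "\<exists>k l. k + l = n \<and> dm (B \<inter> N) k (A \<inter> N) \<and> dm (B <+>\<^bsub>M\<^esub> N) l (A <+>\<^bsub>M\<^esub> N)"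
 using assms(1)
proof (induction rule: dm.induct)
 case dm_refl
 then show ?case using assms(2) by (auto simp: dm_zero sub_Int sub_sum)
next
 case (dm_step n A x)
 then obtain k l where kl: "k + l = n" "dm (B \<inter> N) k (A \<inter> N)" "dm (B <+>\<^bsub>M\<^esub> N) l (A <+>\<^bsub>M\<^esub> N)"
  by auto
 have A: "sub A" using dm_subs dm_step(1) by blast
 note N = assms(2)
 have AN: "sub (A <+>\<^bsub>M\<^esub> N)" using A N by (rule sub_sum)
 show ?case
 proof (cases "x \<in> A <+>\<^bsub>M\<^esub> N")
  case True
  then obtain a y where ay: "a \<in> A" "y \<in> N" "x = a \<oplus>\<^bsub>M\<^esub> y" by (auto simp: mem_sum)
  have yc: "y \<in> carrier M" "a \<in> carrier M" using ay N A sub_carrier by auto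
  have y: "y \<notin> A" using dm_step(3) ay A sub_add by blast
  have Iy: "r \<odot>\<^bsub>M\<^esub> y \<in> A" if "r \<in> I" for r
  proof (rule sub_cancel[OF A])
   have "r \<in> carrier R" using that I_carrier by blast
   then show "r \<odot>\<^bsub>M\<^esub> a \<oplus>\<^bsub>M\<^esub> r \<odot>\<^bsub>M\<^esub> y \<in> A" "r \<odot>\<^bsub>M\<^esub> a \<in> A" "r \<odot>\<^bsub>M\<^esub> y \<in> carrier M"
    using dm_step(4)[OF that] ay yc A sub_smult by (auto simp: smult_r_distr)
  qed
  have eq: "(A <+>\<^bsub>M\<^esub> line x) \<inter> N = (A \<inter> N) <+>\<^bsub>M\<^esub> line y"
  proof -
   have "A <+>\<^bsub>M\<^esub> line x = A <+>\<^bsub>M\<^esub> line y"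
   proof (intro equalityI adjoin_least)
    show "x \<in> A <+>\<^bsub>M\<^esub> line y"
     unfolding ay(3) by (intro sumI ay line_self yc)
    have "y = \<ominus>\<^bsub>M\<^esub> a \<oplus>\<^bsub>M\<^esub> x" using ay yc by (simp add: M.a_assoc[symmetric] M.l_neg)
    then show "y \<in> A <+>\<^bsub>M\<^esub> line x"
     using sumI[OF sub_neg[OF A ay(1)] line_self[OF dm_step(2)]] by simp
   qed (use A yc dm_step(2) sub_adjoin adjoin_upper in auto)
   also have "\<dots> \<inter> N = (line y <+>\<^bsub>M\<^esub> A) \<inter> N" using sum_comm[OF A sub_line[OF yc(1)]] by simp
   also have "\<dots> = line y <+>\<^bsub>M\<^esub> (A \<inter> N)"
    using modular_law[OF sub_line[OF yc(1)] A N line_least[OF N ay(2)]] .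
   also have "\<dots> = (A \<inter> N) <+>\<^bsub>M\<^esub> line y"
    using sum_comm[OF sub_Int[OF A N] sub_line[OF yc(1)]] by simp
   finally show ?thesis .
  qed
  have "dm (B \<inter> N) (Suc k) ((A <+>\<^bsub>M\<^esub> line x) \<inter> N)"
   unfolding eq
  proof (rule dm.dm_step[OF kl(2) yc(1)])
   show "y \<notin> A \<inter> N" using y by simp
   show "r \<odot>\<^bsub>M\<^esub> y \<in> A \<inter> N" if "r \<in> I" for r
    using Iy that I_carrier sub_smult[OF N _ ay(2)] by blast
  qed
  moreover have "(A <+>\<^bsub>M\<^esub> line x) <+>\<^bsub>M\<^esub> N = A <+>\<^bsub>M\<^esub> N"
   using sum_adjoin[OF A N dm_step(2)] adjoin_absorb[OF AN True] by simp
  ultimately show ?thesis using kl by (intro exI[of _ "Suc k"] exI[of _ l]) auto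
 next
  case False
  have "dm (B <+>\<^bsub>M\<^esub> N) (Suc l) ((A <+>\<^bsub>M\<^esub> line x) <+>\<^bsub>M\<^esub> N)"
   unfolding sum_adjoin[OF A N dm_step(2)]
   by (rule dm.dm_step[OF kl(3) dm_step(2) False]) (use dm_step(4) sum_upper1[OF A N] in blast)
  moreover have "(A <+>\<^bsub>M\<^esub> line x) \<inter> N = A \<inter> N"
  proof (intro equalityI subsetI)
   fix z assume z: "z \<in> (A <+>\<^bsub>M\<^esub> line x) \<inter> N"
   then obtain a r where ar: "a \<in> A" "r \<in> carrier R" "z = a \<oplus>\<^bsub>M\<^esub> r \<odot>\<^bsub>M\<^esub> x"
    by (auto simp: mem_sum_line)
   show "z \<in> A \<inter> N"
   proof (cases "r \<in> I")
    case True
    then show ?thesis using ar z dm_step(4) sub_add[OF A] by auto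
   next
    case False
    then obtain s where s: "s \<in> carrier R" "s \<otimes> r = \<one>" using unit_outside ar by blast
    \<comment> \<open>A unit coefficient would put x itself into A + N.\<close>
    have "r \<odot>\<^bsub>M\<^esub> x \<in> A <+>\<^bsub>M\<^esub> N"
     by (rule sub_cancel[OF AN, of a])
      (use z ar sum_upper1[OF A N] sum_upper2[OF A N] dm_step(2) in auto)
    then have "x \<in> A <+>\<^bsub>M\<^esub> N" using sub_smult_cancel[OF AN _ s(1) ar(2) s(2) dm_step(2)] by simp
    then show ?thesis using \<open>x \<notin> A <+>\<^bsub>M\<^esub> N\<close> by simp
   qed
  qed (use adjoin_upper[OF A dm_step(2)] in auto)
  ultimately show ?thesis using kl by (intro exI[of _ k] exI[of _ "Suc l"]) auto
 qed
qed

lemma dm_between: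
 assumes "dm B n A" "sub C" "B \<subseteq> C" "C \<subseteq> A"
 shows "\<exists>k l. k + l = n \<and> dm B k C \<and> dm C l A"
proof -
 have B: "sub B" "sub A" using dm_subs assms(1) by auto
 have "B \<inter> C = B" "A \<inter> C = C" "B <+>\<^bsub>M\<^esub> C = C" "A <+>\<^bsub>M\<^esub> C = A"
  using assms B sum_absorb1 sum_absorb2 by auto
 then show ?thesis using dm_split[OF assms(1,2)] by auto
qed

text \<open>Jordan-Hoelder. The last term but one, C, of the first chain cuts the second chain in
  two; the lower piece is settled by induction, and the upper piece has length one because nothing
  lies strictly between C and A.\<close>

lemma dm_unique: "dm B n A \<Longrightarrow> dm B n' A \<Longrightarrow> n = n'"
proof (induction n arbitrary: n' A)
 case 0
 then show ?case using dm_neq by (cases n') (auto simp: dm_zero)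
next
 case (Suc n)
 then obtain C x where C: "dm B n C" "x \<in> carrier M" "x \<notin> C" "\<forall>r\<in>I. r \<odot>\<^bsub>M\<^esub> x \<in> C"
  "A = C <+>\<^bsub>M\<^esub> line x" by (auto simp: dm_Suc)
 have sC: "sub C" "B \<subseteq> C" using dm_subs C by auto
 have CA: "C \<subseteq> A" using C adjoin_upper sC by blast
 obtain k l where kl: "k + l = n'" "dm B k C" "dm C l A"
  using dm_between[OF Suc.prems(2) sC CA] by auto
 have "k = n" using Suc.IH[OF C(1) kl(2)] by simp
 moreover have "l = 1"
 proof (cases l)
  case 0
  then have "A = C" using kl dm_zero by simp
  then show ?thesis using C adjoin_self sC by blast
 next
  case (Suc j)
  then obtain E y where E: "dm C j E" "y \<in> carrier M" "y \<notin> E" "A = E <+>\<^bsub>M\<^esub> line y"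
   using kl by (auto simp: dm_Suc)
  have sE: "sub E" "C \<subseteq> E" using dm_subs E by auto
  have "E \<subseteq> A" using E adjoin_upper sE by blast
  then have "E = C \<or> E = A" using simple_interval[of C E x] sC sE C by auto
  moreover have "E \<noteq> A" using E adjoin_self sE by blast
  ultimately have "dm C j C" using E by simp
  then have "j = 0" using dm_neq by (cases j) auto
  then show ?thesis using Suc by simp
 qed
 ultimately show ?case using kl by simp
qed

definition fin where "fin B A \<longleftrightarrow> (\<exists>n. dm B n A)"

text \<open>Specified only when a finite chain exists, so the facts about it carry
  \<open>fin\<close> or \<open>dm\<close> as a premise.\<close>

definition rk where "rk B A = (THE n. dm B n A)"

lemma rk_eq: "dm B n A \<Longrightarrow> rk B A = n"
 unfolding rk_def using dm_unique by blast

lemma dm_rk: "fin B A \<Longrightarrow> dm B (rk B A) A"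
 unfolding fin_def using rk_eq by blast

lemma dm_fin: "dm B n A \<Longrightarrow> fin B A"
 unfolding fin_def by blast

lemma dm_iff: "dm B n A \<longleftrightarrow> fin B A \<and> rk B A = n"
 using dm_fin dm_rk rk_eq by blast

lemma fin_subs: "fin B A \<Longrightarrow> sub B \<and> sub A \<and> B \<subseteq> A"
 unfolding fin_def using dm_subs by blast

lemma rk_split:
 assumes "fin B A" "sub N"
 shows "fin (B \<inter> N) (A \<inter> N)" "fin (B <+>\<^bsub>M\<^esub> N) (A <+>\<^bsub>M\<^esub> N)"
  "rk B A = rk (B \<inter> N) (A \<inter> N) + rk (B <+>\<^bsub>M\<^esub> N) (A <+>\<^bsub>M\<^esub> N)"
 using dm_split[OF dm_rk[OF assms(1)] assms(2)] by (auto simp: dm_iff)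

lemma rk_between:
 assumes "fin B A" "sub C" "B \<subseteq> C" "C \<subseteq> A"
 shows "fin B C" "fin C A" "rk B A = rk B C + rk C A"
 using dm_between[OF dm_rk[OF assms(1)] assms(2-)] by (auto simp: dm_iff)

lemma rk_trans:
 assumes "fin B C" "fin C A"
 shows "fin B A" "rk B A = rk B C + rk C A"
 using dm_trans[OF dm_rk[OF assms(2)] dm_rk[OF assms(1)]] by (auto simp: dm_iff)

lemma rk_self: "sub B \<Longrightarrow> fin B B" "sub B \<Longrightarrow> rk B B = 0"
 using dm_refl dm_iff by auto

lemma rk_zero_iff: "fin B A \<Longrightarrow> rk B A = 0 \<longleftrightarrow> A = B"
 using dm_rk[of B A] dm_zero rk_self fin_subs by metis

lemma rk_mono: "\<lbrakk>fin B A; sub C; B \<subseteq> C; C \<subseteq> A\<rbrakk> \<Longrightarrow> rk B C \<le> rk B A"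
 using rk_between(3) by simp

lemma rk_eq_imp_eq: "\<lbrakk>fin B A; sub C; B \<subseteq> C; C \<subseteq> A; rk B A \<le> rk B C\<rbrakk> \<Longrightarrow> C = A"
 using rk_between[of B A C] rk_zero_iff[of C A] by auto

lemma second_iso:
 assumes "sub A" "sub N" "fin (A \<inter> N) A \<or> fin N (A <+>\<^bsub>M\<^esub> N)"
 shows "fin (A \<inter> N) A" "fin N (A <+>\<^bsub>M\<^esub> N)" "rk (A \<inter> N) A = rk N (A <+>\<^bsub>M\<^esub> N)"
proof -
 have AN: "sub (A \<inter> N)" "sub (A <+>\<^bsub>M\<^esub> N)" using assms sub_Int sub_sum by auto
 have e: "(A \<inter> N) <+>\<^bsub>M\<^esub> N = N" using sum_absorb2[OF AN(1) assms(2)] by simp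
 have e1: "N <+>\<^bsub>M\<^esub> A = A <+>\<^bsub>M\<^esub> N" "(A <+>\<^bsub>M\<^esub> N) <+>\<^bsub>M\<^esub> A = A <+>\<^bsub>M\<^esub> N" "(A <+>\<^bsub>M\<^esub> N) \<inter> A = A"
  using sum_comm[OF assms(2,1)] sum_absorb1[OF AN(2) assms(1)] sum_upper1[OF assms(1,2)] by auto
 have *: "fin N (A <+>\<^bsub>M\<^esub> N) \<and> rk (A \<inter> N) A = rk N (A <+>\<^bsub>M\<^esub> N)" if "fin (A \<inter> N) A"
  using rk_split[OF that assms(2)] rk_self(2)[OF AN(1)] by (simp add: e)
 have "fin (A \<inter> N) A" if "fin N (A <+>\<^bsub>M\<^esub> N)"
  using rk_split(1)[OF that assms(1)] e1 by (simp add: Int_commute[of N A])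
 with * assms(3) show "fin (A \<inter> N) A" "fin N (A <+>\<^bsub>M\<^esub> N)" "rk (A \<inter> N) A = rk N (A <+>\<^bsub>M\<^esub> N)"
  by auto
qed

section \<open>Generating lists and independence modulo a submodule\<close>

primrec ext :: "'c set \<Rightarrow> 'c list \<Rightarrow> 'c set" where
 "ext B [] = B"
| "ext B (x # xs) = ext B xs <+>\<^bsub>M\<^esub> line x"

text \<open>The head of the list is the vector adjoined last, so it is compared with the extension
  by the tail.\<close>

primrec indep :: "'c set \<Rightarrow> 'c list \<Rightarrow> bool" where
 "indep B [] \<longleftrightarrow> True"
| "indep B (x # xs) \<longleftrightarrow> indep B xs \<and> x \<notin> ext B xs"

lemma ext_sub: "\<lbrakk>sub B; set xs \<subseteq> carrier M\<rbrakk> \<Longrightarrow> sub (ext B xs)"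
 by (induction xs) (auto intro: sub_adjoin)

lemma ext_upper: "\<lbrakk>sub B; set xs \<subseteq> carrier M\<rbrakk> \<Longrightarrow> B \<subseteq> ext B xs"
proof (induction xs)
 case (Cons x xs)
 then show ?case using adjoin_upper[OF ext_sub, of B xs x] by auto
qed simp

lemma ext_mem: "\<lbrakk>sub B; set xs \<subseteq> carrier M\<rbrakk> \<Longrightarrow> set xs \<subseteq> ext B xs"
proof (induction xs)
 case (Cons x xs)
 then show ?case using ext_sub[of B xs] adjoin_upper[of "ext B xs" x] adjoin_self[of "ext B xs" x] by auto
qed simp

lemma ext_least: "\<lbrakk>sub C; B \<subseteq> C; set xs \<subseteq> C\<rbrakk> \<Longrightarrow> ext B xs \<subseteq> C"
proof (induction xs)
 case (Cons x xs)
 then show ?case using adjoin_least[of C "ext B xs" x] by simp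
qed simp

lemma ext_mono: "B \<subseteq> C \<Longrightarrow> ext B xs \<subseteq> ext C xs"
 by (induction xs) (simp_all add: sum_mono)

lemma ext_sum: "\<lbrakk>sub B; sub N; set xs \<subseteq> carrier M\<rbrakk> \<Longrightarrow> ext B xs <+>\<^bsub>M\<^esub> N = ext (B <+>\<^bsub>M\<^esub> N) xs"
 by (induction xs) (auto simp: sum_adjoin ext_sub)

lemma dm_list: "dm B n A \<Longrightarrow> \<exists>xs. length xs = n \<and> set xs \<subseteq> A \<and> indep B xs \<and> ext B xs = A"
proof (induction rule: dm.induct)
 case dm_refl
 then show ?case by (intro exI[of _ "[]"]) auto
next
 case (dm_step n A x)
 then obtain xs where xs: "length xs = n" "set xs \<subseteq> A" "indep B xs" "ext B xs = A" by auto
 have "sub A" using dm_subs dm_step by blast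
 with xs dm_step adjoin_upper[of A x] adjoin_self[of A x] show ?case
  by (intro exI[of _ "x # xs"]) auto
qed

lemma indep_dm:
 assumes "sub B" "set xs \<subseteq> carrier M" "indep B xs" "\<And>x r. x \<in> set xs \<Longrightarrow> r \<in> I \<Longrightarrow> r \<odot>\<^bsub>M\<^esub> x \<in> B"
 shows "dm B (length xs) (ext B xs)"
 using assms(2-)
proof (induction xs)
 case (Cons x xs)
 then show ?case using ext_upper[OF assms(1), of xs] by (auto intro!: dm_step)
qed (use assms(1) in \<open>auto intro: dm_refl\<close>)

lemma ext_dm:
 assumes "sub B" "set xs \<subseteq> carrier M" "\<And>x r. x \<in> set xs \<Longrightarrow> r \<in> I \<Longrightarrow> r \<odot>\<^bsub>M\<^esub> x \<in> B"
 shows "fin B (ext B xs) \<and> rk B (ext B xs) \<le> length xs"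
 using assms(2-)
proof (induction xs)
 case Nil
 then show ?case using rk_self[OF assms(1)] by simp
next
 case (Cons x xs)
 have s: "sub (ext B xs)" "B \<subseteq> ext B xs" using ext_sub ext_upper assms(1) Cons by auto
 show ?case
 proof (cases "x \<in> ext B xs")
  case True
  then show ?thesis using Cons adjoin_absorb[OF s(1)] by auto
 next
  case False
  have "dm B (Suc (rk B (ext B xs))) (ext B (x # xs))"
   using dm_step[OF dm_rk, of B "ext B xs" x] Cons False s by auto
  then show ?thesis using Cons dm_iff by auto
 qed
qed

text \<open>N maps onto A/B, so A/B is N/(N \<inter> B). Generators are chosen for the latter, and
  the modular law keeps them independent over B. In this way generators of a reduction can be taken
  from a prescribed submodule of a lattice.\<close>

lemma dm_gens_in:
 assumes "dm B n A" "sub N" "N \<subseteq> A" "A \<subseteq> B <+>\<^bsub>M\<^esub> N"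
 shows "\<exists>xs. length xs = n \<and> set xs \<subseteq> N \<and> indep B xs \<and> ext B xs = A"
proof -
 have B: "sub B" "sub A" "B \<subseteq> A" using dm_subs assms(1) by auto
 have A: "A = N <+>\<^bsub>M\<^esub> B"
  using sum_comm[OF assms(2) B(1)] sum_least[OF B(2) B(3) assms(3)] assms(4) by auto
 have "fin B (N <+>\<^bsub>M\<^esub> B)" using dm_fin assms(1) A by simp
 then have "fin (N \<inter> B) N" "rk (N \<inter> B) N = n"
  using second_iso[OF assms(2) B(1)] rk_eq[OF assms(1)] A by auto
 then have "dm (N \<inter> B) n N" by (simp add: dm_iff)
 from dm_list[OF this] obtain xs where xs: "length xs = n" "set xs \<subseteq> N" "indep (N \<inter> B) xs"
  "ext (N \<inter> B) xs = N" by auto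
 have xc: "set xs \<subseteq> carrier M" using xs assms(2) sub_carrier by blast
 have "indep B xs"
  using xs(2,3)
 proof (induction xs)
  case (Cons x xs)
  have xsc: "set xs \<subseteq> carrier M" using Cons.prems assms(2) sub_carrier by auto
  have "ext B xs = ext (N \<inter> B) xs <+>\<^bsub>M\<^esub> B"
   using ext_sum[OF sub_Int[OF assms(2) B(1)] B(1) xsc] sum_absorb2[OF sub_Int[OF assms(2) B(1)] B(1)]
   by simp
  moreover have "(ext (N \<inter> B) xs <+>\<^bsub>M\<^esub> B) \<inter> N = ext (N \<inter> B) xs"
   using modular_law[of "ext (N \<inter> B) xs" B N] ext_sub[OF sub_Int[OF assms(2) B(1)] xsc] B
    ext_least[OF assms(2), of "N \<inter> B" xs] Cons.prems assms(2)
    sum_absorb1[of "ext (N \<inter> B) xs" "B \<inter> N"] ext_upper[OF sub_Int[OF assms(2) B(1)] xsc] sub_Int[of B N]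
   by (auto simp: Int_commute)
  ultimately show ?case using Cons by auto
 qed simp
 moreover have "ext B xs = A"
  using ext_sum[OF sub_Int[OF assms(2) B(1)] B(1) xc] sum_absorb2[OF sub_Int[OF assms(2) B(1)] B(1)] xs A
  by simp
 ultimately show ?thesis using xs by blast
qed

lemma indep_Int:
 assumes "sub B" "sub N" "set xs \<subseteq> N" "indep (B \<inter> N) xs"
 shows "indep B xs"
 using assms(3,4)
proof (induction xs)
 case (Cons x xs)
 have xsc: "set xs \<subseteq> carrier M" using Cons.prems assms(2) sub_carrier by auto
 have BN: "sub (B \<inter> N)" using sub_Int assms by auto
 have e: "sub (ext (B \<inter> N) xs)" "B \<inter> N \<subseteq> ext (B \<inter> N) xs" "ext (B \<inter> N) xs \<subseteq> N"
  using ext_sub ext_upper BN xsc ext_least[OF assms(2)] Cons.prems by auto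
 have "ext B xs = ext (B \<inter> N) xs <+>\<^bsub>M\<^esub> B"
  using ext_sum[OF BN assms(1) xsc] sum_absorb2[OF BN assms(1)] by simp
 then have "ext B xs \<inter> N = ext (B \<inter> N) xs"
  using modular_law[OF e(1) assms(1,2) e(3)] sum_absorb1[OF e(1) BN e(2)] by simp
 then show ?case using Cons by auto
qed simp

end

text \<open>The single principle by which lengths are transported. A map h that is additive on X and
  semilinear along \<open>\<kappa>\<close>, with \<open>Z\<close> as the preimage of
  \<open>D\<close>, carries a chain from \<open>Z\<close> to \<open>X\<close> step by step to one
  from \<open>D\<close> to \<open>D\<close> + h(\<open>X\<close>). It serves for scaling by a, for
  passing from \<O> to its residue field, for multiplying families by a vector or a coefficient, and
  for quotient spaces.\<close>

lemma rk_map: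
 assumes "local_module R M I" "local_module R' M' I'"
  and \<kappa>: "\<kappa> ` carrier R = carrier R'" "\<kappa> ` I = I'"
  and h: "\<And>x. x \<in> X \<Longrightarrow> h x \<in> carrier M'"
   "\<And>x y. \<lbrakk>x \<in> X; y \<in> X\<rbrakk> \<Longrightarrow> h (x \<oplus>\<^bsub>M\<^esub> y) = h x \<oplus>\<^bsub>M'\<^esub> h y"
   "\<And>r x. \<lbrakk>r \<in> carrier R; x \<in> X\<rbrakk> \<Longrightarrow> h (r \<odot>\<^bsub>M\<^esub> x) = \<kappa> r \<odot>\<^bsub>M'\<^esub> h x"
  and D: "submodule R' D M'"
  and Z: "\<And>x. x \<in> X \<Longrightarrow> h x \<in> D \<longleftrightarrow> x \<in> Z"
  and dm: "local_module.dm R M I Z n X"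
 shows "local_module.dm R' M' I' D n (D <+>\<^bsub>M'\<^esub> h ` X)"
proof -
 interpret A: local_module R M I by fact
 interpret B: local_module R' M' I' by fact
 have X: "A.sub X" using A.dm_subs dm by blast
 have im: "B.sub (h ` Y)" if Y: "A.sub Y" "Y \<subseteq> X" for Y
 proof (rule B.subI)
  show "h ` Y \<subseteq> carrier M'" using Y h(1) by blast
  have z: "\<zero>\<^bsub>M\<^esub> \<in> Y" using A.sub_zero Y by blast
  obtain r where "r \<in> carrier R" "\<kappa> r = \<zero>\<^bsub>R'\<^esub>" using \<kappa>(1) B.R.zero_closed by (metis imageE)
  then have "h (r \<odot>\<^bsub>M\<^esub> \<zero>\<^bsub>M\<^esub>) = \<zero>\<^bsub>M'\<^esub>" using h(1,3) z Y by (metis B.lmult_0 subsetD)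
  then show "\<zero>\<^bsub>M'\<^esub> \<in> h ` Y" using z \<open>r \<in> carrier R\<close> by force
  show "x \<oplus>\<^bsub>M'\<^esub> y \<in> h ` Y" if "x \<in> h ` Y" "y \<in> h ` Y" for x y
   using that Y h(2) A.sub_add[OF Y(1)] by (force simp: image_iff)
  show "r \<odot>\<^bsub>M'\<^esub> y \<in> h ` Y" if asm: "r \<in> carrier R'" "y \<in> h ` Y" for r y
  proof -
   have "r \<in> \<kappa> ` carrier R" using asm(1) \<kappa>(1) by simp
   then obtain s where s: "s \<in> carrier R" "r = \<kappa> s" by blast
   obtain y' where y': "y' \<in> Y" "y = h y'" using asm(2) by blast
   have "y' \<in> X" using y'(1) Y(2) by blast
   then have "r \<odot>\<^bsub>M'\<^esub> y = h (s \<odot>\<^bsub>M\<^esub> y')" using h(3)[OF s(1)] s(2) y'(2) by simp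
   then show ?thesis using A.sub_smult[OF Y(1) s(1) y'(1)] by simp
  qed
 qed
 have minus: "h x = h (x \<ominus>\<^bsub>M\<^esub> y) \<oplus>\<^bsub>M'\<^esub> h y" if "x \<in> X" "y \<in> X" for x y
  using h(2)[of "x \<ominus>\<^bsub>M\<^esub> y" y] that A.sub_minus[OF X] A.minus_add_cancel(1) A.sub_carrier[OF X] by metis
 have "B.dm D n (D <+>\<^bsub>M'\<^esub> h ` Y)" if "A.dm Z n Y" "Y \<subseteq> X" for n Y
  using that
 proof (induction rule: A.dm.induct)
  case dm_refl
  have "h ` Z \<subseteq> D" using dm_refl Z by auto
  then have "D <+>\<^bsub>M'\<^esub> h ` Z = D" using B.sum_absorb1[OF D im] dm_refl by simp
  then show ?case using B.dm_refl[OF D] by simp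
 next
  case (dm_step n Y x)
  have Y: "A.sub Y" "Z \<subseteq> Y" using A.dm_subs dm_step by auto
  have xX: "x \<in> X" "Y \<subseteq> X"
   using A.adjoin_self[OF Y(1) dm_step(2)] A.adjoin_upper[OF Y(1) dm_step(2)] dm_step.prems by auto
  have C: "B.sub (D <+>\<^bsub>M'\<^esub> h ` Y)" using B.sub_sum[OF D im[OF Y(1) xX(2)]] .
  have "h ` (Y <+>\<^bsub>M\<^esub> A.line x) = h ` Y <+>\<^bsub>M'\<^esub> B.line (h x)"
  proof (intro equalityI subsetI)
   fix z assume "z \<in> h ` (Y <+>\<^bsub>M\<^esub> A.line x)"
   then obtain y r where "y \<in> Y" "r \<in> carrier R" "z = h (y \<oplus>\<^bsub>M\<^esub> r \<odot>\<^bsub>M\<^esub> x)"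
    by (auto simp: A.mem_sum_line)
   then show "z \<in> h ` Y <+>\<^bsub>M'\<^esub> B.line (h x)"
    using h xX A.sub_smult[OF X] \<kappa>(1)[symmetric] by (auto simp: B.mem_sum_line subset_iff)
  next
   fix z assume "z \<in> h ` Y <+>\<^bsub>M'\<^esub> B.line (h x)"
   then obtain y r where yr: "y \<in> Y" "r \<in> carrier R" "z = h y \<oplus>\<^bsub>M'\<^esub> \<kappa> r \<odot>\<^bsub>M'\<^esub> h x"
    unfolding B.mem_sum_line \<kappa>(1)[symmetric] by blast
   then have "z = h (y \<oplus>\<^bsub>M\<^esub> r \<odot>\<^bsub>M\<^esub> x)" using h xX A.sub_smult[OF X] by (auto simp: subset_iff)
   moreover have "y \<oplus>\<^bsub>M\<^esub> r \<odot>\<^bsub>M\<^esub> x \<in> Y <+>\<^bsub>M\<^esub> A.line x"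
    using yr unfolding A.mem_sum_line by blast
   ultimately show "z \<in> h ` (Y <+>\<^bsub>M\<^esub> A.line x)" by blast
  qed
  then have "D <+>\<^bsub>M'\<^esub> h ` (Y <+>\<^bsub>M\<^esub> A.line x) = (D <+>\<^bsub>M'\<^esub> h ` Y) <+>\<^bsub>M'\<^esub> B.line (h x)"
   using B.sum_assoc[OF D im[OF Y(1) xX(2)] B.sub_line[OF h(1)[OF xX(1)]]] by simp
  moreover have "B.dm D (Suc n) \<dots>"
  proof (rule B.dm_step)
   show "B.dm D n (D <+>\<^bsub>M'\<^esub> h ` Y)" using dm_step xX by simp
   show "h x \<in> carrier M'" using h xX by simp
   \<comment> \<open>From h x = d + h y follows h(x - y) = d, so x - y lies in \<open>Z\<close>,
     hence in \<open>Y\<close>, and so would x.\<close>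
   show "h x \<notin> D <+>\<^bsub>M'\<^esub> h ` Y"
   proof
    assume "h x \<in> D <+>\<^bsub>M'\<^esub> h ` Y"
    then obtain d y where dy: "d \<in> D" "y \<in> Y" "h x = d \<oplus>\<^bsub>M'\<^esub> h y" by (auto simp: B.mem_sum)
    have y: "y \<in> X" "x \<ominus>\<^bsub>M\<^esub> y \<in> X" using dy xX A.sub_minus[OF X] by auto
    have "h (x \<ominus>\<^bsub>M\<^esub> y) \<oplus>\<^bsub>M'\<^esub> h y = d \<oplus>\<^bsub>M'\<^esub> h y"
     using minus[OF xX(1) y(1)] dy(3) by simp
    then have "h (x \<ominus>\<^bsub>M\<^esub> y) = d"
     using h(1)[OF y(1)] h(1)[OF y(2)] B.sub_carrier[OF D dy(1)] by simp
    then have "x \<ominus>\<^bsub>M\<^esub> y \<in> Y" using Z[OF y(2)] dy Y by auto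
    then show False using A.sub_diffD[OF Y(1) _ dy(2) dm_step(2)] dm_step(3) by simp
   qed
   show "r' \<odot>\<^bsub>M'\<^esub> h x \<in> D <+>\<^bsub>M'\<^esub> h ` Y" if asm: "r' \<in> I'" for r'
   proof -
    obtain r where r: "r \<in> I" "r' = \<kappa> r" using asm \<kappa>(2) by blast
    then have "r' \<odot>\<^bsub>M'\<^esub> h x = h (r \<odot>\<^bsub>M\<^esub> x)" using h(3) xX A.I_carrier by auto
    also have "\<dots> \<in> h ` Y" using dm_step(4) r by blast
    finally show ?thesis using B.sum_upper2[OF D im[OF Y(1) xX(2)]] by blast
   qed
  qed
  ultimately show ?case by simp
 qed
 from this[OF dm] show ?thesis by simp
qed

section \<open>Lattices over a valuation ring\<close>

locale vector_notation =
 fixes V :: "('a, 'c, 'k) module_scheme"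
begin

abbreviation vzero ("0\<^sub>V") where "0\<^sub>V \<equiv> \<zero>\<^bsub>V\<^esub>"
abbreviation vadd (infixl "\<boxplus>" 65) where "x \<boxplus> y \<equiv> x \<oplus>\<^bsub>V\<^esub> y"
abbreviation vsmult (infixl "\<cdot>" 70) where "r \<cdot> x \<equiv> r \<odot>\<^bsub>V\<^esub> x"
abbreviation vsum (infixl "\<uplus>" 60) where "A \<uplus> B \<equiv> A <+>\<^bsub>V\<^esub> B"

end

text \<open>Only the ring of the valuation is kept. The same K and V can then be used with a
  localisation of \<O> in place of \<O>.\<close>

locale valued_space = vectorspace K V + vector_notation V for K (structure) and V +
 fixes \<O>
 assumes O_subring: "subring \<O> K"
  and O_total: "\<lbrakk>x \<in> carrier K; x \<noteq> \<zero>; x \<notin> \<O>\<rbrakk> \<Longrightarrow> inv x \<in> \<O>"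
begin

abbreviation R where "R \<equiv> K\<lparr>carrier := \<O>\<rparr>"

section \<open>Divisibility in a valuation ring\<close>

definition m where "m = {x \<in> \<O>. x = \<zero> \<or> inv x \<notin> \<O>}"

lemma O_carrier: "x \<in> \<O> \<Longrightarrow> x \<in> carrier K"
 using subringE(1)[OF O_subring] by blast

lemma O_closed:
 "\<zero> \<in> \<O>" "\<one> \<in> \<O>" "\<lbrakk>x \<in> \<O>; y \<in> \<O>\<rbrakk> \<Longrightarrow> x \<oplus> y \<in> \<O>" "\<lbrakk>x \<in> \<O>; y \<in> \<O>\<rbrakk> \<Longrightarrow> x \<otimes> y \<in> \<O>" "x \<in> \<O> \<Longrightarrow> \<ominus> x \<in> \<O>"
 using subringE[OF O_subring] by auto

lemma inv_K: 
 assumes "x \<in> carrier K" "x \<noteq> \<zero>"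
 shows "inv x \<in> carrier K" "inv x \<noteq> \<zero>" "inv x \<otimes> x = \<one>" "x \<otimes> inv x = \<one>" "inv (inv x) = x"
proof -
 have u: "x \<in> Units K" using assms by (simp add: field_Units)
 then show i: "inv x \<in> carrier K" "inv x \<otimes> x = \<one>" "x \<otimes> inv x = \<one>" "inv (inv x) = x" by auto
 show "inv x \<noteq> \<zero>" using i(2) assms by auto
qed

lemma cring_R: "cring R"
proof (rule cring.intro[OF subring_is_ring[OF O_subring] comm_monoid.intro])
 show "Group.monoid R" using subring_is_ring[OF O_subring] by (rule ring.is_monoid)
 show "comm_monoid_axioms R" by unfold_locales (auto simp: R.m_comm O_carrier)
qed

lemma module_R: "module R V"
 by (rule moduleI[OF cring_R M.abelian_group_axioms])
  (auto simp: O_carrier smult_l_distr smult_r_distr smult_assoc1)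

lemma m_O: "x \<in> m \<Longrightarrow> x \<in> \<O>"
 by (simp add: m_def)

lemma m_carrier: "x \<in> m \<Longrightarrow> x \<in> carrier K"
 using m_O O_carrier by blast

lemma zero_m: "\<zero> \<in> m"
 by (simp add: m_def O_closed)

lemma one_nm: "\<one> \<notin> m"
 using O_closed(2) by (simp add: m_def)

lemma O_unit: "\<lbrakk>x \<in> \<O>; x \<notin> m\<rbrakk> \<Longrightarrow> x \<noteq> \<zero> \<and> inv x \<in> \<O>"
 by (auto simp: m_def O_closed)

lemma nO_inv: "\<lbrakk>x \<in> carrier K; x \<notin> \<O>\<rbrakk> \<Longrightarrow> x \<noteq> \<zero> \<and> inv x \<in> m"
 by (metis (no_types, lifting) O_total inv_K(5) O_closed(1) m_def mem_Collect_eq)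

lemma m_mult:
 assumes "r \<in> \<O>" "x \<in> m"
 shows "r \<otimes> x \<in> m"
proof (cases "r \<otimes> x = \<zero>")
 case False
 have c: "r \<in> carrier K" "x \<in> carrier K" using assms O_carrier m_carrier by auto
 have nz: "r \<noteq> \<zero>" "x \<noteq> \<zero>" using False c by auto
 have "inv x = r \<otimes> inv (r \<otimes> x)"
 proof -
  have "inv x = inv x \<otimes> ((r \<otimes> x) \<otimes> inv (r \<otimes> x))" using inv_K[of "r \<otimes> x"] inv_K[of x] c nz False by simp
  also have "\<dots> = (inv x \<otimes> x) \<otimes> (r \<otimes> inv (r \<otimes> x))"
   using inv_K(1)[of "r \<otimes> x"] inv_K(1)[of x] c nz False by (simp add: R.m_ac)
  finally show ?thesis using inv_K[of x] inv_K(1)[of "r \<otimes> x"] c nz False by simp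
 qed
 then have "inv (r \<otimes> x) \<notin> \<O>" using assms nz O_closed(4) by (auto simp: m_def)
 then show ?thesis using assms O_closed by (auto simp: m_def)
qed (simp add: zero_m)

lemma divide_total:
 assumes "x \<in> carrier K" "y \<in> carrier K"
 shows "\<exists>r\<in>\<O>. x = r \<otimes> y \<or> y = r \<otimes> x"
proof (cases "y = \<zero>")
 case True
 then show ?thesis using assms O_closed(1) by (intro bexI[of _ "\<zero>"]) auto
next
 case False
 note y = inv_K[OF assms(2) False]
 have x: "x = (x \<otimes> inv y) \<otimes> y" using y assms by (simp add: R.m_assoc)
 show ?thesis
 proof (cases "x \<otimes> inv y \<in> \<O>")
  case True
  then show ?thesis using x by blast
 next
  case nO: False
  let ?q = "x \<otimes> inv y"
  have q: "?q \<in> carrier K" "?q \<noteq> \<zero>" "inv ?q \<in> \<O>" using nO nO_inv[of ?q] y assms m_O by auto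
  have "inv ?q \<otimes> x = inv ?q \<otimes> (?q \<otimes> y)" using x by simp
  also have "\<dots> = y" using inv_K[OF q(1,2)] q(1) assms(2) by (simp add: R.m_assoc[symmetric])
  finally show ?thesis using q by metis
 qed
qed

lemma m_add:
 assumes "x \<in> m" "y \<in> m"
 shows "x \<oplus> y \<in> m"
proof -
 have *: "a \<oplus> r \<otimes> a \<in> m" if "a \<in> m" "r \<in> \<O>" for a r
 proof -
  have "a \<oplus> r \<otimes> a = (\<one> \<oplus> r) \<otimes> a" using that m_carrier O_carrier by (simp add: R.l_distr)
  then show ?thesis using m_mult that O_closed by simp
 qed
 obtain r where "r \<in> \<O>" "x = r \<otimes> y \<or> y = r \<otimes> x"
  using divide_total m_carrier assms by meson
 then show ?thesis using * assms m_carrier R.a_comm by metis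
qed

lemma one_minus_unit:
 assumes "c \<in> m"
 shows "\<one> \<ominus> c \<in> \<O>" "\<one> \<ominus> c \<noteq> \<zero>" "inv (\<one> \<ominus> c) \<in> \<O>"
proof -
 have c: "c \<in> carrier K" using assms m_carrier by simp
 have "\<one> \<ominus> c \<notin> m"
 proof
  assume "\<one> \<ominus> c \<in> m"
  then have "(\<one> \<ominus> c) \<oplus> c \<in> m" using m_add assms by simp
  then show False using one_nm c by (simp add: R.minus_eq R.a_assoc R.l_neg)
 qed
 moreover show "\<one> \<ominus> c \<in> \<O>" using O_closed m_O[OF assms] by (simp add: R.minus_eq)
 ultimately show "\<one> \<ominus> c \<noteq> \<zero>" "inv (\<one> \<ominus> c) \<in> \<O>" using O_unit by auto
qed

text \<open>The divisor is itself a member of the set, an element of least value; finitely many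
  moduli are thus replaced by one of them.\<close>

lemma common_divisor:
 assumes "finite T" "T \<noteq> {}" "T \<subseteq> carrier K"
 shows "\<exists>c\<in>T. \<forall>x\<in>T. \<exists>r\<in>\<O>. x = r \<otimes> c"
 using assms
proof (induction rule: finite_ne_induct)
 case (singleton x)
 then show ?case using O_closed(2) by (auto intro!: bexI[of _ "\<one>"])
next
 case (insert x F)
 then obtain c where c: "c \<in> F" "\<forall>x\<in>F. \<exists>r\<in>\<O>. x = r \<otimes> c" by auto
 have K: "x \<in> carrier K" "c \<in> carrier K" using insert c by auto
 obtain r where r: "r \<in> \<O>" "x = r \<otimes> c \<or> c = r \<otimes> x" using divide_total[OF K] by auto
 then show ?case
 proof (elim disjE)
  assume "x = r \<otimes> c"
  then show ?thesis using c r by (intro bexI[of _ c]) auto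
 next
  assume cx: "c = r \<otimes> x"
  have "\<exists>s\<in>\<O>. y = s \<otimes> x" if "y \<in> insert x F" for y
  proof (cases "y = x")
   case True
   then show ?thesis using O_closed(2) K by (intro bexI[of _ "\<one>"]) auto
  next
   case False
   then obtain s where s: "s \<in> \<O>" "y = s \<otimes> c" using \<open>y \<in> insert x F\<close> c by auto
   then have "y = (s \<otimes> r) \<otimes> x" using cx r O_carrier K by (simp add: R.m_assoc)
   then show ?thesis using O_closed(4) r s by blast
  qed
  then show ?thesis by blast
 qed
qed

end

sublocale valued_space \<subseteq> VK: local_module K V "{\<zero>}"
proof unfold_locales
 fix r assume "r \<in> carrier K" "r \<notin> {\<zero>}"
 then show "\<exists>s\<in>carrier K. s \<otimes> r = \<one>" using inv_K[of r] by auto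
qed auto

sublocale valued_space \<subseteq> VO: local_module "K\<lparr>carrier := \<O>\<rparr>" V m
proof (intro local_module.intro[OF module_R] local_module_axioms.intro)
 show "m \<subseteq> carrier (K\<lparr>carrier := \<O>\<rparr>)" using m_O by auto
 fix r assume "r \<in> carrier (K\<lparr>carrier := \<O>\<rparr>)" "r \<notin> m"
 then show "\<exists>s\<in>carrier (K\<lparr>carrier := \<O>\<rparr>). s \<otimes>\<^bsub>K\<lparr>carrier := \<O>\<rparr>\<^esub> r = \<one>\<^bsub>K\<lparr>carrier := \<O>\<rparr>\<^esub>"
  using O_unit[of r] inv_K[of r] O_carrier by auto
qed

section \<open>Submodules over the valuation ring, and their multiples by m and by scalars\<close>

context valued_space
begin

abbreviation Osub where "Osub N \<equiv> submodule (K\<lparr>carrier := \<O>\<rparr>) N V"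

lemma OsubI:
 assumes "N \<subseteq> carrier V" "0\<^sub>V \<in> N"
  and "\<And>x y. \<lbrakk>x \<in> N; y \<in> N\<rbrakk> \<Longrightarrow> x \<boxplus> y \<in> N"
  and "\<And>r x. \<lbrakk>r \<in> \<O>; x \<in> N\<rbrakk> \<Longrightarrow> r \<cdot> x \<in> N"
 shows "Osub N"
 using assms by (intro VO.subI) auto

lemma Osub_smult: "\<lbrakk>Osub N; r \<in> \<O>; x \<in> N\<rbrakk> \<Longrightarrow> r \<cdot> x \<in> N"
 using VO.sub_smult[of N r x] by simp

lemma sub_Osub: "sub Y \<Longrightarrow> Osub Y"
 by (intro OsubI) (auto simp: sub_zero sub_add sub_smult O_carrier dest: sub_carrier)

lemma smult_inv:
 assumes "c \<in> carrier K" "c \<noteq> \<zero>" "x \<in> carrier V"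
 shows "inv c \<cdot> (c \<cdot> x) = x" "c \<cdot> (inv c \<cdot> x) = x"
 using inv_K[OF assms(1,2)] assms by (simp_all add: smult_assoc1[symmetric])

lemma sub_cancel_smult: "\<lbrakk>sub Y; c \<cdot> x \<in> Y; c \<in> carrier K; c \<noteq> \<zero>; x \<in> carrier V\<rbrakk> \<Longrightarrow> x \<in> Y"
 using sub_smult[of Y "inv c" "c \<cdot> x"] smult_inv(1)[of c x] inv_K(1) by auto

lemma smult_cancel:
 assumes "c \<cdot> x = d \<cdot> x" "c \<in> carrier K" "d \<in> carrier K" "x \<in> carrier V" "x \<noteq> 0\<^sub>V"
 shows "c = d"
proof (rule ccontr)
 assume "c \<noteq> d"
 then have nz: "c \<ominus> d \<noteq> \<zero>" using assms by simp
 have "(c \<ominus> d) \<cdot> x = c \<cdot> x \<ominus>\<^bsub>V\<^esub> d \<cdot> x"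
  using assms by (simp add: R.minus_eq M.minus_eq smult_l_distr smult_l_minus)
 then have "(c \<ominus> d) \<cdot> x = 0\<^sub>V" using assms by simp
 then have "x \<in> {0\<^sub>V}" using sub_cancel_smult[OF sub_zero_set _ _ nz] assms by simp
 then show False using assms by simp
qed

text \<open>For a submodule A this set of products is already the submodule mA: of two scalars one
  divides the other, and moving the quotient into the vector (\<open>common_factor\<close>) turns a
  sum of two products into one product.\<close>

definition mm where "mm A = {c \<cdot> x | c x. c \<in> m \<and> x \<in> A}"

definition scale where "scale a A = (\<lambda>x. a \<cdot> x) ` A"

lemma mmI: "\<lbrakk>c \<in> m; x \<in> A\<rbrakk> \<Longrightarrow> c \<cdot> x \<in> mm A"
 by (auto simp: mm_def)

lemma common_factor:
 assumes "Osub A" "Osub B" "x \<in> A" "y \<in> B" "c \<in> carrier K" "d \<in> carrier K"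
 shows "\<exists>u\<in>A. \<exists>w\<in>B. \<exists>e\<in>{c, d}. c \<cdot> x = e \<cdot> u \<and> d \<cdot> y = e \<cdot> w"
proof -
 have xy: "x \<in> carrier V" "y \<in> carrier V" using assms VO.sub_carrier by auto
 obtain r where r: "r \<in> \<O>" "c = r \<otimes> d \<or> d = r \<otimes> c" using divide_total assms(5,6) by blast
 from r(2) show ?thesis
 proof
  assume e: "c = r \<otimes> d"
  then have "c \<cdot> x = d \<cdot> (r \<cdot> x)"
   using r(1) xy assms O_carrier by (simp add: smult_assoc1[symmetric] R.m_comm)
  then show ?thesis using Osub_smult[OF assms(1) r(1) assms(3)] assms(4) by blast
 next
  assume e: "d = r \<otimes> c"
  then have "d \<cdot> y = c \<cdot> (r \<cdot> y)"
   using r(1) xy assms O_carrier by (simp add: smult_assoc1[symmetric] R.m_comm)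
  then show ?thesis using Osub_smult[OF assms(2) r(1) assms(4)] assms(3) by blast
 qed
qed

lemma mm_sub:
 assumes "Osub A"
 shows "Osub (mm A)" "mm A \<subseteq> A"
proof -
 show 1: "mm A \<subseteq> A" using Osub_smult[OF assms] m_O by (auto simp: mm_def)
 show "Osub (mm A)"
 proof (rule OsubI)
  show "mm A \<subseteq> carrier V" using 1 VO.sub_subset[OF assms] by blast
  show "0\<^sub>V \<in> mm A" using mmI[OF zero_m VO.sub_zero[OF assms]] m_carrier[OF zero_m] by simp
  fix u w assume "u \<in> mm A" "w \<in> mm A"
  then obtain c x d y where *: "c \<in> m" "x \<in> A" "u = c \<cdot> x" "d \<in> m" "y \<in> A" "w = d \<cdot> y"
   by (auto simp: mm_def)
  obtain x' y' e where e: "x' \<in> A" "y' \<in> A" "e \<in> {c, d}" "u = e \<cdot> x'" "w = e \<cdot> y'"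
   using common_factor[OF assms assms *(2,5) m_carrier[OF *(1)] m_carrier[OF *(4)]] * by metis
  have "e \<in> m" using e * by auto
  moreover have "u \<boxplus> w = e \<cdot> (x' \<boxplus> y')"
   using e m_carrier[OF \<open>e \<in> m\<close>] VO.sub_carrier[OF assms] by (simp add: smult_r_distr)
  ultimately show "u \<boxplus> w \<in> mm A" using mmI VO.sub_add[OF assms e(1,2)] by simp
 next
  fix r u assume r: "r \<in> \<O>" and "u \<in> mm A"
  then obtain c x where *: "c \<in> m" "x \<in> A" "u = c \<cdot> x" by (auto simp: mm_def)
  have "r \<cdot> u = (r \<otimes> c) \<cdot> x"
   using * r O_carrier m_carrier VO.sub_carrier[OF assms] by (simp add: smult_assoc1)
  then show "r \<cdot> u \<in> mm A" using mmI[OF m_mult[OF r *(1)] *(2)] by simp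
 qed
qed

lemma mm_mono: "A \<subseteq> B \<Longrightarrow> mm A \<subseteq> mm B"
 by (auto simp: mm_def)

lemma mm_Int:
 assumes "sub Y" "Osub A"
 shows "mm (A \<inter> Y) = mm A \<inter> Y"
proof (intro equalityI subsetI)
 fix z assume "z \<in> mm (A \<inter> Y)"
 then show "z \<in> mm A \<inter> Y" using sub_smult[OF assms(1)] m_carrier by (auto simp: mm_def)
next
 fix z assume "z \<in> mm A \<inter> Y"
 then obtain c x where *: "c \<in> m" "x \<in> A" "z = c \<cdot> x" "z \<in> Y" by (auto simp: mm_def)
 show "z \<in> mm (A \<inter> Y)"
 proof (cases "c = \<zero>")
  case True
  then have "z = \<zero> \<cdot> 0\<^sub>V" using * VO.sub_carrier[OF assms(2)] by simp
  then show ?thesis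
   using mmI[OF zero_m, of "0\<^sub>V" "A \<inter> Y"] VO.sub_zero[OF assms(2)] sub_zero[OF assms(1)] by simp
 next
  case False
  then have "x \<in> Y" using sub_cancel_smult[OF assms(1)] * m_carrier VO.sub_carrier[OF assms(2)] by blast
  then show ?thesis using * mmI by blast
 qed
qed

lemma mm_sum:
 assumes "Osub A" "Osub B"
 shows "mm (A \<uplus> B) = mm A \<uplus> mm B"
proof (intro equalityI subsetI)
 fix z assume "z \<in> mm (A \<uplus> B)"
 then obtain c a b where *: "c \<in> m" "a \<in> A" "b \<in> B" "z = c \<cdot> (a \<boxplus> b)"
  by (auto simp: mm_def mem_sum)
 then have "z = c \<cdot> a \<boxplus> c \<cdot> b"
  using m_carrier VO.sub_carrier assms by (metis smult_r_distr)
 then show "z \<in> mm A \<uplus> mm B" using sumI mmI * by metis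
next
 fix z assume "z \<in> mm A \<uplus> mm B"
 then obtain c x d y where *: "c \<in> m" "x \<in> A" "d \<in> m" "y \<in> B" "z = c \<cdot> x \<boxplus> d \<cdot> y"
  by (auto simp: mm_def mem_sum)
 obtain x' y' e where e: "x' \<in> A" "y' \<in> B" "e \<in> {c, d}" "c \<cdot> x = e \<cdot> x'" "d \<cdot> y = e \<cdot> y'"
  using common_factor[OF assms *(2,4) m_carrier[OF *(1)] m_carrier[OF *(3)]] by metis
 have em: "e \<in> m" using e * by auto
 have "z = e \<cdot> (x' \<boxplus> y')"
  using e *(5) m_carrier[OF em] VO.sub_carrier assms by (metis smult_r_distr)
 then show "z \<in> mm (A \<uplus> B)" using mmI[OF em sumI[OF e(1,2)]] by simp
qed

lemma scaleI: "x \<in> A \<Longrightarrow> a \<cdot> x \<in> scale a A"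
 by (auto simp: scale_def)

lemma scale_sub:
 assumes "Osub A" "a \<in> carrier K"
 shows "Osub (scale a A)"
proof (rule OsubI)
 note A = VO.sub_carrier[OF assms(1)]
 show "scale a A \<subseteq> carrier V" using A assms by (auto simp: scale_def)
 show "0\<^sub>V \<in> scale a A" using scaleI[OF VO.sub_zero[OF assms(1)], of a] assms by simp
 show "x \<boxplus> y \<in> scale a A" if xy: "x \<in> scale a A" "y \<in> scale a A" for x y
 proof -
  obtain u w where "u \<in> A" "w \<in> A" "x = a \<cdot> u" "y = a \<cdot> w" using xy by (auto simp: scale_def)
  then show ?thesis using scaleI[OF VO.sub_add[OF assms(1)], of u w a] A assms by (simp add: smult_r_distr)
 qed
 show "r \<cdot> x \<in> scale a A" if rx: "r \<in> \<O>" "x \<in> scale a A" for r x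
 proof -
  obtain u where "u \<in> A" "x = a \<cdot> u" using rx by (auto simp: scale_def)
  then show ?thesis using scaleI[OF Osub_smult[OF assms(1) rx(1)], of u a] A assms O_carrier[OF rx(1)]
   by (simp add: smult_assoc1[symmetric] R.m_comm)
 qed
qed

lemma scale_subset: "\<lbrakk>Osub A; a \<in> \<O>\<rbrakk> \<Longrightarrow> scale a A \<subseteq> A"
 using Osub_smult by (auto simp: scale_def)

lemma scale_mono: "A \<subseteq> B \<Longrightarrow> scale a A \<subseteq> scale a B"
 by (auto simp: scale_def)

lemma scale_mult:
 "\<lbrakk>Osub A; a \<in> carrier K; b \<in> carrier K\<rbrakk> \<Longrightarrow> scale (a \<otimes> b) A = scale a (scale b A)"
 using VO.sub_carrier[of A] by (force simp: scale_def image_image smult_assoc1)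

lemma scale_dvd: "\<lbrakk>Osub A; a \<in> carrier K; r \<in> \<O>\<rbrakk> \<Longrightarrow> scale (r \<otimes> a) A \<subseteq> scale a A"
 using scale_mult[of A a r] scale_mono[OF scale_subset[of A r], of a] O_carrier by (simp add: R.m_comm)

lemma scale_m: "c \<in> m \<Longrightarrow> scale c A \<subseteq> mm A"
 by (auto simp: scale_def mm_def)

lemma mm_scale:
 assumes "Osub A" "a \<in> carrier K"
 shows "mm (scale a A) = scale a (mm A)"
proof -
 have "c \<cdot> (a \<cdot> x) = a \<cdot> (c \<cdot> x)" if "c \<in> m" "x \<in> A" for c x
  using that m_carrier VO.sub_carrier[OF assms(1)] assms(2) by (simp add: smult_assoc1[symmetric] R.m_comm)
 then show ?thesis unfolding mm_def scale_def by (auto simp: image_iff) metis+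
qed

lemma scale_Int:
 assumes "Osub A" "sub Y" "a \<in> carrier K" "a \<noteq> \<zero>"
 shows "scale a (A \<inter> Y) = scale a A \<inter> Y"
proof (intro equalityI subsetI)
 fix z assume "z \<in> scale a (A \<inter> Y)"
 then show "z \<in> scale a A \<inter> Y" using sub_smult[OF assms(2,3)] unfolding scale_def by blast
next
 fix z assume z: "z \<in> scale a A \<inter> Y"
 then obtain x where x: "x \<in> A" "z = a \<cdot> x" unfolding scale_def by blast
 then have "x \<in> Y" using sub_cancel_smult[OF assms(2) _ assms(3,4)] VO.sub_carrier[OF assms(1)] z by blast
 then show "z \<in> scale a (A \<inter> Y)" unfolding scale_def using x by blast
qed

lemma scale_mem_iff:
 assumes "a \<in> carrier K" "a \<noteq> \<zero>" "x \<in> carrier V" "A \<subseteq> carrier V"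
 shows "a \<cdot> x \<in> scale a A \<longleftrightarrow> x \<in> A"
proof
 assume "a \<cdot> x \<in> scale a A"
 then obtain y where y: "y \<in> A" "a \<cdot> x = a \<cdot> y" unfolding scale_def by blast
 then have "x = y" using smult_inv(1)[OF assms(1,2)] assms(3,4) by (metis subsetD)
 then show "x \<in> A" using y by simp
qed (rule scaleI)

lemma scale_Int2:
 assumes "a \<in> carrier K" "a \<noteq> \<zero>" "A \<subseteq> carrier V" "B \<subseteq> carrier V"
 shows "scale a (A \<inter> B) = scale a A \<inter> scale a B"
proof (intro equalityI subsetI)
 fix z assume z: "z \<in> scale a A \<inter> scale a B"
 then obtain x where "x \<in> A" "z = a \<cdot> x" by (auto simp: scale_def)
 then show "z \<in> scale a (A \<inter> B)" using z scale_mem_iff[OF assms(1,2) _ assms(4), of x] assms(3) scaleI by auto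
qed (auto simp: scale_def)

lemma rk_scale:
 assumes "a \<in> carrier K" "a \<noteq> \<zero>" "VO.fin B A"
 shows "VO.fin (scale a B) (scale a A)" "VO.rk (scale a B) (scale a A) = VO.rk B A"
proof -
 have s: "Osub B" "Osub A" "B \<subseteq> A" using VO.fin_subs[OF assms(3)] by auto
 have c: "A \<subseteq> carrier V" "B \<subseteq> carrier V" using s VO.sub_subset by auto
 have "VO.dm (scale a B) (VO.rk B A) (scale a B \<uplus> (\<lambda>x. a \<cdot> x) ` A)"
 proof (rule rk_map[where \<kappa> = id and X = A and Z = B, OF VO.local_module_axioms VO.local_module_axioms])
  show "a \<cdot> (r \<cdot> x) = id r \<cdot> (a \<cdot> x)" if "r \<in> carrier R" "x \<in> A" for r x
   using that assms O_carrier c by (simp add: smult_assoc1[symmetric] R.m_comm subset_iff)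
  show "(a \<cdot> x \<in> scale a B) = (x \<in> B)" if "x \<in> A" for x
   using scale_mem_iff[OF assms(1,2) _ c(2)] that c by blast
  show "VO.dm B (VO.rk B A) A" using VO.dm_rk assms by simp
  show "Osub (scale a B)" using scale_sub s assms by simp
 qed (use assms c in \<open>auto simp: smult_r_distr subset_iff\<close>)
 moreover have "scale a B \<uplus> (\<lambda>x. a \<cdot> x) ` A = scale a A"
  using VO.sum_absorb2[OF scale_sub[OF s(1) assms(1)] scale_sub[OF s(2) assms(1)] scale_mono[OF s(3)]]
  by (simp add: scale_def)
 ultimately show "VO.fin (scale a B) (scale a A)" "VO.rk (scale a B) (scale a A) = VO.rk B A"
  by (auto simp: VO.dm_iff)
qed

end

section \<open>Lattices, their reductions and adapted bases\<close>

locale fd_valued_space = valued_space +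
 assumes fd: "VK.fin {0\<^sub>V} (carrier V)"
begin

abbreviation dimK where "dimK Y \<equiv> VK.rk {0\<^sub>V} Y"

lemma sub_zero_subset: "sub Y \<Longrightarrow> {0\<^sub>V} \<subseteq> Y"
 using sub_zero by simp

lemma finK: "sub Y \<Longrightarrow> VK.fin {0\<^sub>V} Y"
 using VK.rk_between(1)[OF fd _ sub_zero_subset] sub_subset by blast

lemma finK': "\<lbrakk>sub Y; sub Z; Y \<subseteq> Z\<rbrakk> \<Longrightarrow> VK.fin Y Z"
 using VK.rk_between(2)[OF finK _ sub_zero_subset] by blast

lemma dimK_between: "\<lbrakk>sub Y; sub Z; Y \<subseteq> Z\<rbrakk> \<Longrightarrow> dimK Z = dimK Y + VK.rk Y Z"
 using VK.rk_between(3)[OF finK _ sub_zero_subset] by blast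

lemma dimK_eq: "\<lbrakk>sub Y; sub Z; Y \<subseteq> Z; dimK Z \<le> dimK Y\<rbrakk> \<Longrightarrow> Y = Z"
 using VK.rk_eq_imp_eq[OF finK _ sub_zero_subset] by blast

lemma dimK_adjoin: "\<lbrakk>sub Y; x \<in> carrier V; x \<notin> Y\<rbrakk> \<Longrightarrow> dimK (Y \<uplus> line x) = Suc (dimK Y)"
 using VK.dm_step[OF VK.dm_rk[OF finK]] sub_zero VK.rk_eq by simp

text \<open>The condition is that M/mM has dimension dim V. Over a valuation ring this already makes
  M free of that rank (\<open>lattice_basis\<close>), and it can be verified for a modified lattice
  by adding lengths, with no basis at hand.\<close>

definition lattice where "lattice M \<longleftrightarrow> VO.dm (mm M) (dimK (carrier V)) M"

lemma lattice_sub: "lattice M \<Longrightarrow> Osub M"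
 using VO.dm_subs lattice_def by blast

lemma lattice_fin: "lattice M \<Longrightarrow> VO.fin (mm M) M"
 using VO.dm_fin lattice_def by blast

lemma lattice_finI: "lattice M \<Longrightarrow> sub Y \<Longrightarrow> VO.fin (mm M \<inter> Y) (M \<inter> Y)"
 using VO.rk_split(1)[OF lattice_fin] sub_Osub by blast

text \<open>In one step of a flag of subspaces, the reduction of \<open>M\<close> grows by at most one dimension,
 because an \<open>\<O>\<close>-submodule of \<open>K\<close> needs at most one generator modulo \<open>m\<close>.\<close>

lemma reduction_step:
 assumes M: "Osub M" and Y: "sub Y" and x: "x \<in> carrier V"
  and fin: "VO.fin (mm M \<inter> (Y \<uplus> line x)) (M \<inter> (Y \<uplus> line x))" (is "VO.fin (_ \<inter> ?Y) _")
 shows "VO.rk (mm M \<inter> ?Y) (M \<inter> ?Y) \<le> Suc (VO.rk (mm M \<inter> Y) (M \<inter> Y))"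
  and "VO.rk (mm M \<inter> ?Y) (M \<inter> ?Y) = Suc (VO.rk (mm M \<inter> Y) (M \<inter> Y)) \<Longrightarrow>
   \<exists>g\<in>M \<inter> ?Y. g \<notin> Y \<and> M \<inter> ?Y = (M \<inter> Y) \<uplus> VO.line g"
proof -
 have Y': "sub ?Y" "Y \<subseteq> ?Y" using sub_adjoin adjoin_upper Y x by auto
 have OY: "Osub Y" "Osub ?Y" using sub_Osub Y Y' by auto
 have sM: "Osub (M \<inter> ?Y)" "Osub (mm M \<inter> ?Y)" using VO.sub_Int M mm_sub OY by auto
 \<comment> \<open>A/B is what the reduction gains in passing from Y to Y + Kx.\<close>
 define B where "B = (mm M \<inter> ?Y) \<uplus> Y"
 define A where "A = (M \<inter> ?Y) \<uplus> Y"
 have sB: "Osub B" "Osub A" using VO.sub_sum sM OY unfolding A_def B_def by auto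
 have "mm M \<inter> ?Y \<inter> Y = mm M \<inter> Y" "M \<inter> ?Y \<inter> Y = M \<inter> Y" using Y' by auto
 then have rk: "VO.fin B A" "VO.rk (mm M \<inter> ?Y) (M \<inter> ?Y) = VO.rk (mm M \<inter> Y) (M \<inter> Y) + VO.rk B A"
  using VO.rk_split[OF fin OY(1)] unfolding A_def B_def by auto
 have YB: "Y \<subseteq> B" "mm M \<inter> ?Y \<subseteq> B" "M \<inter> ?Y \<subseteq> A" "Y \<subseteq> A"
  using VO.sum_upper1[OF sM(2) OY(1)] VO.sum_upper2[OF sM(2) OY(1)]
   VO.sum_upper1[OF sM(1) OY(1)] VO.sum_upper2[OF sM(1) OY(1)] unfolding A_def B_def by auto
 \<comment> \<open>Modulo Y, both g and h are multiples of x, so one is an \<O>-multiple of the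
   other. If g were r h with r in m, it would lie in \<open>B\<close>; hence r is a unit, and in all
   cases h is a multiple of g.\<close>
 have key: "\<exists>r\<in>\<O>. h \<ominus>\<^bsub>V\<^esub> r \<cdot> g \<in> Y" if g: "g \<in> M \<inter> ?Y" "g \<notin> B" and h: "h \<in> M \<inter> ?Y" for g h
 proof -
  obtain y c where yc: "y \<in> Y" "c \<in> carrier K" "g = y \<boxplus> c \<cdot> x"
   using g by (auto simp: mem_sum_line)
  obtain z d where zd: "z \<in> Y" "d \<in> carrier K" "h = z \<boxplus> d \<cdot> x"
   using h by (auto simp: mem_sum_line)
  note car = sub_carrier[OF Y yc(1)] sub_carrier[OF Y zd(1)]
  have *: "(z' \<boxplus> (r \<otimes> c') \<cdot> x) \<ominus>\<^bsub>V\<^esub> r \<cdot> (y' \<boxplus> c' \<cdot> x) \<in> Y"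
   if "z' \<in> Y" "y' \<in> Y" "r \<in> \<O>" "c' \<in> carrier K" for z' y' r c'
  proof -
   have "(z' \<boxplus> (r \<otimes> c') \<cdot> x) \<ominus>\<^bsub>V\<^esub> r \<cdot> (y' \<boxplus> c' \<cdot> x)
     = (z' \<ominus>\<^bsub>V\<^esub> r \<cdot> y') \<boxplus> ((r \<otimes> c') \<cdot> x \<ominus>\<^bsub>V\<^esub> (r \<otimes> c') \<cdot> x)"
    using that x sub_carrier[OF Y] O_carrier
    by (simp add: M.minus_eq smult_r_distr smult_assoc1 M.minus_add M.a_ac)
   also have "\<dots> = z' \<ominus>\<^bsub>V\<^esub> r \<cdot> y'"
    using that x sub_carrier[OF Y] O_carrier by simp
   finally show ?thesis using that sub_minus[OF Y] sub_smult[OF Y] O_carrier by simp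
  qed
  obtain r where r: "r \<in> \<O>" "d = r \<otimes> c \<or> c = r \<otimes> d" using divide_total zd yc by blast
  from r(2) show ?thesis
  proof
   assume "d = r \<otimes> c"
   then show ?thesis using *[OF zd(1) yc(1) r(1) yc(2)] r(1) zd yc by blast
  next
   assume e: "c = r \<otimes> d"
   have *: "g \<ominus>\<^bsub>V\<^esub> r \<cdot> h \<in> Y" using *[OF yc(1) zd(1) r(1) zd(2)] zd(3) yc(3) e by simp
   have hc: "h \<in> carrier V" "g \<in> carrier V" using h g VO.sub_carrier[OF M] by auto
   have "r \<notin> m"
   proof
    assume "r \<in> m"
    then have "r \<cdot> h \<in> mm M \<inter> ?Y" using h mmI sub_smult[OF Y'(1)] m_carrier by auto
    then have "(g \<ominus>\<^bsub>V\<^esub> r \<cdot> h) \<boxplus> r \<cdot> h \<in> B"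
     using * YB VO.sub_add[OF sB(1)] by blast
    then show False using g minus_add_cancel(1)[of g "r \<cdot> h"] hc r O_carrier by simp
   qed
   then have u: "r \<noteq> \<zero>" "inv r \<in> \<O>" using O_unit r by auto
   have "d = inv r \<otimes> c" using e inv_K[of r] u r O_carrier zd by (simp add: R.m_assoc[symmetric])
   then show ?thesis using *[OF] u
     \<open>\<And>z' y' r c'. \<lbrakk>z' \<in> Y; y' \<in> Y; r \<in> \<O>; c' \<in> carrier K\<rbrakk> \<Longrightarrow> (z' \<boxplus> (r \<otimes> c') \<cdot> x) \<ominus>\<^bsub>V\<^esub> r \<cdot> (y' \<boxplus> c' \<cdot> x) \<in> Y\<close>[OF zd(1) yc(1) u(2) yc(2)]
     zd yc by blast
  qed
 qed
 have main: "VO.rk B A = 1 \<and> M \<inter> ?Y = (M \<inter> Y) \<uplus> VO.line g \<and> g \<notin> Y" if g: "g \<in> M \<inter> ?Y" "g \<notin> B" for g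
 proof -
  have gc: "g \<in> carrier V" using g VO.sub_carrier[OF M] by auto
  have eq: "M \<inter> ?Y = (M \<inter> Y) \<uplus> VO.line g"
  proof (intro equalityI subsetI)
   fix h assume h: "h \<in> M \<inter> ?Y"
   then obtain r where r: "r \<in> \<O>" "h \<ominus>\<^bsub>V\<^esub> r \<cdot> g \<in> Y" using key[OF g] by blast
   have "h \<ominus>\<^bsub>V\<^esub> r \<cdot> g \<in> M"
    using VO.sub_minus[OF M] h Osub_smult[OF M r(1)] g by auto
   moreover have "h = (h \<ominus>\<^bsub>V\<^esub> r \<cdot> g) \<boxplus> r \<cdot> g"
    using minus_add_cancel(1)[of h "r \<cdot> g"] h VO.sub_carrier[OF M] r O_carrier gc by simp
   ultimately show "h \<in> (M \<inter> Y) \<uplus> VO.line g"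
    using r unfolding VO.mem_sum_line by (intro bexI[of _ "h \<ominus>\<^bsub>V\<^esub> r \<cdot> g"] bexI[of _ r]) auto
  next
   fix h assume "h \<in> (M \<inter> Y) \<uplus> VO.line g"
   moreover have "(M \<inter> Y) \<uplus> VO.line g \<subseteq> M \<inter> ?Y"
    by (rule VO.adjoin_least[OF sM(1)]) (use Y' g in auto)
   ultimately show "h \<in> M \<inter> ?Y" by blast
  qed
  have "A = B \<uplus> VO.line g"
  proof (intro equalityI)
   have "M \<inter> ?Y \<subseteq> B \<uplus> VO.line g"
    unfolding eq by (rule VO.sum_mono) (use YB in auto)
   moreover have "Y \<subseteq> B \<uplus> VO.line g"
    using YB(1) VO.adjoin_upper[OF sB(1) gc] by (rule subset_trans)
   ultimately show "A \<subseteq> B \<uplus> VO.line g"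
    unfolding A_def by (rule VO.sum_least[OF VO.sub_adjoin[OF sB(1) gc]])
   show "B \<uplus> VO.line g \<subseteq> A"
   proof (rule VO.adjoin_least[OF sB(2)])
    show "B \<subseteq> A" using VO.fin_subs[OF rk(1)] by simp
    show "g \<in> A" using subsetD[OF YB(3) g(1)] .
   qed
  qed
  moreover have "VO.dm B 1 (B \<uplus> VO.line g)"
  proof (rule VO.dm_one[OF sB(1) gc g(2)])
   fix r assume "r \<in> m"
   then have "r \<cdot> g \<in> mm M \<inter> ?Y" using mmI g sub_smult[OF Y'(1)] m_carrier by auto
   then show "r \<cdot> g \<in> B" using YB by auto
  qed
  ultimately show ?thesis using eq VO.rk_eq g YB by auto
 qed
 have AB: "VO.rk B A = 0" if "M \<inter> ?Y \<subseteq> B"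
 proof -
  have "A = B" using VO.sum_least[OF sB(1) that YB(1)] VO.fin_subs[OF rk(1)] unfolding A_def by simp
  then show ?thesis using VO.rk_zero_iff[OF rk(1)] by simp
 qed
 show "VO.rk (mm M \<inter> ?Y) (M \<inter> ?Y) \<le> Suc (VO.rk (mm M \<inter> Y) (M \<inter> Y))"
 proof (cases "M \<inter> ?Y \<subseteq> B")
  case True
  then show ?thesis using rk(2) AB by simp
 next
  case False
  then obtain g where "g \<in> M \<inter> ?Y" "g \<notin> B" by blast
  then show ?thesis using rk(2) main by simp
 qed
 assume "VO.rk (mm M \<inter> ?Y) (M \<inter> ?Y) = Suc (VO.rk (mm M \<inter> Y) (M \<inter> Y))"
 then have "\<not> M \<inter> ?Y \<subseteq> B" using rk(2) AB by auto
 then obtain g where g: "g \<in> M \<inter> ?Y" "g \<notin> B" by blast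
 then show "\<exists>g\<in>M \<inter> ?Y. g \<notin> Y \<and> M \<inter> ?Y = (M \<inter> Y) \<uplus> VO.line g" using main by blast
qed

lemma reduction_rank_mono:
 assumes "lattice M"
 shows "VK.dm Z n Y \<Longrightarrow> VO.rk (mm M \<inter> Y) (M \<inter> Y) \<le> VO.rk (mm M \<inter> Z) (M \<inter> Z) + n"
proof (induction rule: VK.dm.induct)
 case (dm_step n A x)
 have A: "sub A" using VK.dm_subs dm_step by blast
 have "VO.rk (mm M \<inter> (A \<uplus> line x)) (M \<inter> (A \<uplus> line x)) \<le> Suc (VO.rk (mm M \<inter> A) (M \<inter> A))"
  using reduction_step(1)[OF lattice_sub[OF assms] A dm_step(2)]
   lattice_finI[OF assms sub_adjoin[OF A dm_step(2)]] by blast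
 then show ?case using dm_step by simp
qed simp

text \<open>Along a flag from 0 through Y to V the rank of the reduction grows by at most one per
  step. It must reach dim V at the end, so no step may fail to contribute.\<close>

theorem lattice_rank:
 assumes M: "lattice M" and Y: "sub Y"
 shows "VO.rk (mm M \<inter> Y) (M \<inter> Y) = dimK Y"
proof -
 let ?r = "\<lambda>Y. VO.rk (mm M \<inter> Y) (M \<inter> Y)"
 have sM: "Osub M" using lattice_sub M by simp
 have z: "M \<inter> {0\<^sub>V} = mm M \<inter> {0\<^sub>V}" using VO.sub_zero sM mm_sub by auto
 have "?r {0\<^sub>V} = 0"
  unfolding z using VO.rk_self(2)[of "mm M \<inter> {0\<^sub>V}"] VO.sub_Int mm_sub(1)[OF sM] VO.sub_zero_set by blast
 then have 1: "?r Y \<le> dimK Y" using reduction_rank_mono[OF M VK.dm_rk[OF finK[OF Y]]] by simp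
 have c: "M \<inter> carrier V = M" "mm M \<inter> carrier V = mm M" using VO.sub_subset mm_sub(1) sM by auto
 have "?r (carrier V) = dimK (carrier V)"
  unfolding c using VO.rk_eq M lattice_def by blast
 moreover have "?r (carrier V) \<le> ?r Y + VK.rk Y (carrier V)"
  using reduction_rank_mono[OF M VK.dm_rk[OF finK'[OF Y sub_carrier_set sub_subset[OF Y]]]] .
 ultimately show ?thesis using 1 dimK_between[OF Y sub_carrier_set sub_subset[OF Y]] by simp
qed

abbreviation Ospan where "Ospan es \<equiv> VO.ext {0\<^sub>V} es"
abbreviation Kspan where "Kspan es \<equiv> VK.ext {0\<^sub>V} es"

lemma Ospan_sub: "set es \<subseteq> carrier V \<Longrightarrow> Osub (Ospan es)"
 using VO.ext_sub[OF VO.sub_zero_set] .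

lemma Kspan_sub: "set es \<subseteq> carrier V \<Longrightarrow> sub (Kspan es)"
 using VK.ext_sub[OF sub_zero_set] .

lemma Ospan_Kspan: "set es \<subseteq> carrier V \<Longrightarrow> Ospan es \<subseteq> Kspan es"
 using VO.ext_least[OF sub_Osub[OF Kspan_sub] sub_zero_subset[OF Kspan_sub]] VK.ext_mem[OF sub_zero_set] by blast

text \<open>A basis of M \<inter> Y over \<O> that is also one of Y over K. By
  \<open>lattice_rank\<close> every step of a flag of Y gains a dimension in the reduction, and
  \<open>reduction_step\<close> then supplies the single new generator.\<close>

lemma lattice_basis:
 assumes M: "lattice M"
 shows "sub Y \<Longrightarrow> \<exists>es. length es = dimK Y \<and> set es \<subseteq> M \<inter> Y \<and> M \<inter> Y = Ospan es \<and> Y = Kspan es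
  \<and> VK.indep {0\<^sub>V} es"
proof -
 assume "sub Y"
 have sM: "Osub M" using lattice_sub M by simp
 have "VK.dm {0\<^sub>V} n Y \<Longrightarrow> \<exists>es. length es = n \<and> set es \<subseteq> M \<inter> Y \<and> M \<inter> Y = Ospan es \<and> Y = Kspan es
  \<and> VK.indep {0\<^sub>V} es" for n Y
 proof (induction rule: VK.dm.induct)
  case dm_refl
  then show ?case using VO.sub_zero[OF sM] by (intro exI[of _ "[]"]) auto
 next
  case (dm_step n A x)
  then obtain es where es: "length es = n" "set es \<subseteq> M \<inter> A" "M \<inter> A = Ospan es" "A = Kspan es"
   "VK.indep {0\<^sub>V} es" by blast
  have A: "sub A" using VK.dm_subs dm_step by blast
  let ?Y = "A \<uplus> line x"
  have Y': "sub ?Y" using sub_adjoin[OF A dm_step(2)] .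
  have "VO.rk (mm M \<inter> ?Y) (M \<inter> ?Y) = Suc (VO.rk (mm M \<inter> A) (M \<inter> A))"
   using lattice_rank[OF M Y'] lattice_rank[OF M A] dimK_adjoin[OF A dm_step(2,3)] by simp
  then obtain g where g: "g \<in> M \<inter> ?Y" "g \<notin> A" "M \<inter> ?Y = (M \<inter> A) \<uplus> VO.line g"
   using reduction_step(2)[OF sM A dm_step(2) lattice_finI[OF M Y']] by blast
  have gc: "g \<in> carrier V" using g VO.sub_carrier[OF sM] by blast
  have "A \<uplus> line g = ?Y"
   using VK.simple_interval[OF A sub_adjoin[OF A gc] dm_step(2,4) adjoin_upper[OF A gc]]
    adjoin_least[OF Y' adjoin_upper[OF A dm_step(2)], of g] g adjoin_self[OF A gc] by blast
  moreover have "M \<inter> A \<subseteq> M \<inter> ?Y" using adjoin_upper[OF A dm_step(2)] by blast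
  ultimately show ?case
   using es(1,5) g es(2) es(3,4)[symmetric] by (intro exI[of _ "g # es"]) auto
 qed
 from this[OF VK.dm_rk[OF finK[OF \<open>sub Y\<close>]]] show ?thesis .
qed

lemma lattice_basis_carrier:
 assumes M: "lattice M"
 shows "\<exists>es. length es = dimK (carrier V) \<and> set es \<subseteq> M \<and> M = Ospan es \<and> carrier V = Kspan es
  \<and> VK.indep {0\<^sub>V} es"
proof -
 have "M \<inter> carrier V = M" using VO.sub_subset lattice_sub[OF M] by auto
 then show ?thesis using lattice_basis[OF M sub_carrier_set] by simp
qed

text \<open>With M spanned by the tail and x the head, the chain is built over N = mM + mx. It first
  climbs to M + N, which repeats the chain of the tail because M meets N in mM, and then adds x in
  one step.\<close>

lemma Ospan_dm:
 assumes "VK.indep {0\<^sub>V} es" "set es \<subseteq> carrier V"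
 shows "VO.dm (mm (Ospan es)) (length es) (Ospan es)"
 using assms
proof (induction es)
 case Nil
 have "mm {0\<^sub>V} = {0\<^sub>V}"
  using mm_sub[OF VO.sub_zero_set] VO.sub_zero by blast
 then show ?case using VO.dm_refl[OF VO.sub_zero_set] by simp
next
 case (Cons x es)
 let ?M = "Ospan es" and ?Y = "Kspan es" and ?L = "VO.line x"
 have x: "x \<in> carrier V" "x \<notin> ?Y" and es: "set es \<subseteq> carrier V" using Cons by auto
 note s = Ospan_sub[OF es] Kspan_sub[OF es] Ospan_Kspan[OF es] VO.sub_line[OF x(1)]
 note ms = mm_sub(1)[OF s(1)] mm_sub(1)[OF s(4)]
 have IH: "VO.dm (mm ?M) (length es) ?M" using Cons by simp
 have mx: "z \<in> mm ?L \<longleftrightarrow> (\<exists>c\<in>m. z = c \<cdot> x)" for z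
 proof
  assume "z \<in> mm ?L"
  then obtain c r where "c \<in> m" "r \<in> \<O>" "z = c \<cdot> (r \<cdot> x)" by (auto simp: mm_def VO.line_def)
  then show "\<exists>c\<in>m. z = c \<cdot> x"
   using m_mult[of r c] x m_carrier O_carrier by (intro bexI[of _ "r \<otimes> c"]) (auto simp: smult_assoc1[symmetric] R.m_comm)
 qed (use mmI VO.line_self[OF x(1)] in blast)
 define N where "N = mm ?M \<uplus> mm ?L"
 have sN: "Osub N" "mm ?L \<subseteq> N" "mm ?M \<subseteq> N"
  using VO.sub_sum[OF ms] VO.sum_upper2[OF ms] VO.sum_upper1[OF ms] unfolding N_def by auto
 have MN: "?M \<inter> N = mm ?M"
 proof (intro equalityI subsetI)
  fix z assume "z \<in> ?M \<inter> N"
  then obtain u c where u: "z \<in> ?M" "u \<in> mm ?M" "c \<in> m" "z = u \<boxplus> c \<cdot> x"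
   unfolding N_def by (auto simp: mem_sum mx)
  have cx: "c \<cdot> x \<in> ?M"
   using VO.sub_cancel[OF s(1), of u "c \<cdot> x"] u mm_sub(2)[OF s(1)] x m_carrier by auto
  have "c = \<zero>"
   using sub_cancel_smult[OF s(2), of c x] cx s(3) x u m_carrier by blast
  then have "z = u" using u x VO.sub_carrier[OF ms(1)] by simp
  then show "z \<in> mm ?M" using u by simp
 qed (use mm_sub(2)[OF s(1)] sN in auto)
 have "VO.dm N (length es) (?M \<uplus> N)"
  using VO.second_iso[OF s(1) sN(1)] IH unfolding MN VO.dm_iff by auto
 moreover have MN2: "?M \<uplus> N = ?M \<uplus> mm ?L"
  unfolding N_def using VO.sum_assoc[OF s(1) ms] VO.sum_absorb1[OF s(1) ms(1) mm_sub(2)[OF s(1)]] by simp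
 moreover have "VO.dm (?M \<uplus> mm ?L) 1 ((?M \<uplus> mm ?L) \<uplus> ?L)"
 proof (rule VO.dm_one[OF VO.sub_sum[OF s(1) ms(2)] x(1)])
  show "x \<notin> ?M \<uplus> mm ?L"
  proof
   assume "x \<in> ?M \<uplus> mm ?L"
   then obtain u w where uw: "u \<in> ?M" "w \<in> mm ?L" "x = u \<boxplus> w" unfolding mem_sum by blast
   then obtain c where c: "c \<in> m" "w = c \<cdot> x" using mx by blast
   have u: "u \<in> ?M" "c \<in> m" "x = u \<boxplus> c \<cdot> x" using uw(1,3) c(1) unfolding c(2) by auto
   have uc: "u \<in> carrier V" using u VO.sub_carrier[OF s(1)] by blast
   \<comment> \<open>x = u + c x with c in m puts (1 - c) x, and hence x, into the span of the tail,
     because 1 - c is a unit.\<close>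
   have "(\<one> \<ominus> c) \<cdot> x = x \<ominus>\<^bsub>V\<^esub> c \<cdot> x"
    using x m_carrier[OF u(2)] by (simp add: R.minus_eq smult_l_distr smult_l_minus M.minus_eq)
   also have "\<dots> = u" using minus_add_cancel(3)[OF uc, of "c \<cdot> x"] u(3) x m_carrier[OF u(2)] by simp
   finally show False
    using sub_cancel_smult[OF s(2), of "\<one> \<ominus> c" x] u(1) s(3) x one_minus_unit[OF u(2)] O_carrier by auto
  qed
  show "r \<cdot> x \<in> ?M \<uplus> mm ?L" if "r \<in> m" for r
   using VO.sum_upper2[OF s(1) ms(2)] that mx by blast
 qed
 moreover have "(?M \<uplus> mm ?L) \<uplus> ?L = ?M \<uplus> ?L"
  using VO.sum_assoc[OF s(1) ms(2) s(4)] VO.sum_absorb2[OF ms(2) s(4) mm_sub(2)[OF s(4)]] by simp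
 ultimately have "VO.dm N (length es + 1) (?M \<uplus> ?L)"
  using VO.dm_trans by metis
 then show ?case unfolding N_def using mm_sum[OF s(1,4)] by simp
qed

lemma lattice_Ospan:
 assumes "VK.indep {0\<^sub>V} es" "set es \<subseteq> carrier V" "Kspan es = carrier V"
 shows "lattice (Ospan es)"
proof -
 have "VK.dm {0\<^sub>V} (length es) (carrier V)"
  using VK.indep_dm[OF sub_zero_set assms(2,1)] assms(2,3) by (simp add: subset_iff)
 then show ?thesis using Ospan_dm[OF assms(1,2)] VK.rk_eq by (simp add: lattice_def)
qed

lemma lattice_exists: "\<exists>M. lattice M"
 using VK.dm_list[OF VK.dm_rk[OF fd]] lattice_Ospan by metis

section \<open>Nakayama's lemma and lifting of subspaces\<close>

lemma nakayama_span:
 assumes "set es \<subseteq> carrier V"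
 shows "Osub N \<Longrightarrow> Ospan es \<subseteq> N \<uplus> mm (Ospan es) \<Longrightarrow> Ospan es \<subseteq> N"
 using assms
proof (induction es)
 case Nil
 then show ?case using VO.sub_zero by simp
next
 case (Cons x es)
 let ?M = "Ospan es" and ?L = "VO.line x"
 have x: "x \<in> carrier V" and es: "set es \<subseteq> carrier V" using Cons by auto
 note N = Cons.prems(1)
 note s = Ospan_sub[OF es] VO.sub_line[OF x]
 note ms = mm_sub(1)[OF s(1)] mm_sub(1)[OF s(2)]
 define T where "T = N \<uplus> mm ?M"
 have T: "Osub T" "N \<subseteq> T" "mm ?M \<subseteq> T"
  using VO.sub_sum[OF N ms(1)] VO.sum_upper1[OF N ms(1)] VO.sum_upper2[OF N ms(1)] unfolding T_def by auto
 have sub: "?M \<uplus> ?L \<subseteq> T \<uplus> mm ?L"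
  using Cons.prems(2) mm_sum[OF s] VO.sum_assoc[OF N ms] unfolding T_def by simp
 have "x \<in> T \<uplus> mm ?L" using sub VO.adjoin_self[OF s(1) x] by blast
 \<comment> \<open>The error coming from the tail is absorbed in \<open>T\<close>, so the head
   satisfies x = t + d x with d in m. Inverting 1 - d removes x from the error term, and the
   induction hypothesis treats the tail.\<close>
 then obtain t c r where t: "t \<in> T" "c \<in> m" "r \<in> \<O>" "x = t \<boxplus> c \<cdot> (r \<cdot> x)"
  by (auto simp: mem_sum mm_def VO.line_def)
 define d where "d = r \<otimes> c"
 have d: "d \<in> m" "d \<in> carrier K" "c \<cdot> (r \<cdot> x) = d \<cdot> x"
  using m_mult[OF t(3,2)] m_carrier[OF t(2)] O_carrier[OF t(3)] x unfolding d_def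
  by (auto simp: smult_assoc1[symmetric] R.m_comm)
 have tc: "t \<in> carrier V" using t VO.sub_carrier[OF T(1)] by blast
 have "(\<one> \<ominus> d) \<cdot> x = x \<ominus>\<^bsub>V\<^esub> d \<cdot> x"
  using x d by (simp add: R.minus_eq smult_l_distr smult_l_minus M.minus_eq)
 also have "\<dots> = t" using minus_add_cancel(3)[OF tc, of "d \<cdot> x"] t(4) x d by simp
 finally have "(\<one> \<ominus> d) \<cdot> x \<in> T" using t by simp
 then have "inv (\<one> \<ominus> d) \<cdot> ((\<one> \<ominus> d) \<cdot> x) \<in> T"
  using Osub_smult[OF T(1)] one_minus_unit[OF d(1)] by blast
 then have xT: "x \<in> T" using smult_inv(1)[of "\<one> \<ominus> d" x] one_minus_unit[OF d(1)] O_carrier x by simp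
 have "mm ?L \<subseteq> T" using mm_sub(2)[OF s(2)] VO.line_least[OF T(1) xT] by blast
 then have "?M \<subseteq> T" using sub VO.sum_absorb1[OF T(1) ms(2)] VO.sum_upper1[OF s] by auto
 then have "?M \<subseteq> N" using Cons.IH[OF N _ es] unfolding T_def by blast
 moreover have "x \<in> N"
  using xT VO.sum_absorb1[OF N ms(1)] mm_sub(2)[OF s(1)] \<open>?M \<subseteq> N\<close> unfolding T_def by blast
 ultimately show ?case using VO.adjoin_least[OF N] by simp
qed

text \<open>The congruence is assumed modulo mM only. As N lies in Y, the modular law improves it to
  one modulo m(M \<inter> Y), and M \<inter> Y is finitely generated.\<close>

lemma nakayama:
 assumes M: "lattice M" and Y: "sub Y" and N: "Osub N" "N \<subseteq> M \<inter> Y" and le: "M \<inter> Y \<subseteq> N \<uplus> mm M"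
 shows "N = M \<inter> Y"
proof -
 have sM: "Osub M" using lattice_sub M by simp
 obtain es where es: "set es \<subseteq> M \<inter> Y" "M \<inter> Y = Ospan es" using lattice_basis[OF M Y] by blast
 have "M \<inter> Y \<subseteq> (N \<uplus> mm M) \<inter> Y" using le by blast
 also have "\<dots> = N \<uplus> mm (M \<inter> Y)"
  using VO.modular_law[OF N(1) mm_sub(1)[OF sM] sub_Osub[OF Y]] N(2) mm_Int[OF Y sM] by auto
 finally have "Ospan es \<subseteq> N \<uplus> mm (Ospan es)" using es by simp
 moreover have "set es \<subseteq> carrier V" using es VO.sub_carrier[OF sM] by blast
 ultimately show ?thesis using nakayama_span[OF _ N(1)] es N(2) by blast
qed

lemma nakayama_carrier:
 assumes M: "lattice M" and N: "Osub N" "N \<subseteq> M" and le: "M \<subseteq> N \<uplus> mm M"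
 shows "N = M"
proof -
 have "M \<inter> carrier V = M" using VO.sub_subset lattice_sub[OF M] by auto
 then show ?thesis using nakayama[OF M sub_carrier_set N(1)] assms by simp
qed

lemma rank_reduction:
 assumes M: "lattice M" and Y: "sub Y" and F: "sub F" and YF: "Y \<subseteq> F"
 shows "VO.fin (mm M \<inter> F) ((M \<inter> Y) \<uplus> (mm M \<inter> F))"
  and "VO.rk (mm M \<inter> F) ((M \<inter> Y) \<uplus> (mm M \<inter> F)) = dimK Y"
proof -
 have sM: "Osub M" using lattice_sub M by simp
 have s: "Osub (M \<inter> Y)" "Osub (mm M \<inter> F)" using VO.sub_Int sM mm_sub sub_Osub Y F by auto
 have "M \<inter> Y \<inter> (mm M \<inter> F) = mm M \<inter> Y" using YF mm_sub(2)[OF sM] by auto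
 then show "VO.fin (mm M \<inter> F) ((M \<inter> Y) \<uplus> (mm M \<inter> F))"
  "VO.rk (mm M \<inter> F) ((M \<inter> Y) \<uplus> (mm M \<inter> F)) = dimK Y"
  using VO.second_iso[OF s] lattice_finI[OF M Y] lattice_rank[OF M Y] by auto
qed

text \<open>Generators of X modulo the reduction of Z are adjoined to Z over K. The resulting Y has
  a reduction containing X, while dim Y is at most the rank of X; so the two agree. Z is 0 in most
  uses, and a given subspace when a functional has to vanish on it.\<close>

lemma lift_subspace:
 assumes M: "lattice M" and F: "sub F" and Z: "sub Z" "Z \<subseteq> F"
  and X: "Osub X" "M \<inter> Z \<subseteq> X" "mm M \<inter> F \<subseteq> X" "X \<subseteq> M \<inter> F"
 shows "\<exists>Y. sub Y \<and> Z \<subseteq> Y \<and> Y \<subseteq> F \<and> (M \<inter> Y) \<uplus> (mm M \<inter> F) = X \<and> dimK Y = VO.rk (mm M \<inter> F) X"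
proof -
 have sM: "Osub M" using lattice_sub M by simp
 let ?B = "mm M \<inter> F" and ?C = "(M \<inter> Z) \<uplus> (mm M \<inter> F)"
 have finF: "VO.fin ?B (M \<inter> F)" using lattice_finI[OF M F] .
 have s: "Osub (M \<inter> Z)" "Osub ?B" using VO.sub_Int sM mm_sub sub_Osub Z F by auto
 have finX: "VO.fin ?B X" using VO.rk_between(1)[OF finF X(1,3,4)] .
 have B0: "Osub ?C" "?B \<subseteq> ?C" "?C \<subseteq> X"
  using VO.sub_sum[OF s] VO.sum_upper2[OF s] VO.sum_least[OF X(1-3)] by auto
 note rX = VO.rk_between[OF finX B0]
 obtain xs where xs: "length xs = VO.rk ?C X" "set xs \<subseteq> X" "VO.ext ?C xs = X"
  using VO.dm_list[OF VO.dm_rk[OF rX(2)]] by blast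
 define Y where "Y = VK.ext Z xs"
 have xc: "set xs \<subseteq> carrier V" "set xs \<subseteq> F" "set xs \<subseteq> M" using xs X VO.sub_carrier[OF sM] by auto
 have Y: "sub Y" "Z \<subseteq> Y" "set xs \<subseteq> Y" "Y \<subseteq> F"
  using VK.ext_sub[OF Z(1) xc(1)] VK.ext_upper[OF Z(1) xc(1)] VK.ext_mem[OF Z(1) xc(1)]
   VK.ext_least[OF F Z(2) xc(2)] unfolding Y_def by auto
 let ?X1 = "(M \<inter> Y) \<uplus> ?B"
 have sY: "Osub (M \<inter> Y)" using VO.sub_Int sM sub_Osub Y by auto
 have X1: "Osub ?X1" "M \<inter> Y \<subseteq> ?X1" "?B \<subseteq> ?X1"
  using VO.sub_sum[OF sY s(2)] VO.sum_upper1[OF sY s(2)] VO.sum_upper2[OF sY s(2)] by auto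
 have "?C \<subseteq> ?X1" using VO.sum_least[OF X1(1) _ X1(3), of "M \<inter> Z"] X1(2) Y(2) by blast
 moreover have "set xs \<subseteq> ?X1" using xc(3) Y(3) X1(2) by blast
 ultimately have XX1: "X \<subseteq> ?X1" using VO.ext_least[OF X1(1), of ?C xs] xs(3) by simp
 note r1 = rank_reduction[OF M Y(1) F Y(4)]
 have "dimK Y \<le> dimK Z + length xs"
 proof -
  have "VK.rk Z Y \<le> length xs"
   unfolding Y_def using VK.ext_dm[OF Z(1) xc(1)] xc(1) sub_zero[OF Z(1)] by (auto simp: subset_iff)
  then show ?thesis using dimK_between[OF Z(1) Y(1,2)] by simp
 qed
 also have "\<dots> = VO.rk ?B X" using rX(3) rank_reduction(2)[OF M Z(1) F Z(2)] xs by simp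
 finally have le: "VO.rk ?B ?X1 \<le> VO.rk ?B X" using r1 by simp
 have "X = ?X1" using VO.rk_eq_imp_eq[OF r1(1) X(1,3) XX1 le] .
 then show ?thesis using Y r1(2) by metis
qed

lemma lift_subspace_carrier:
 assumes M: "lattice M" and Z: "sub Z"
  and X: "Osub X" "M \<inter> Z \<subseteq> X" "mm M \<subseteq> X" "X \<subseteq> M"
 shows "\<exists>Y. sub Y \<and> Z \<subseteq> Y \<and> (M \<inter> Y) \<uplus> mm M = X \<and> dimK Y = VO.rk (mm M) X"
proof -
 have sM: "Osub M" using lattice_sub M by simp
 have "M \<inter> carrier V = M" "mm M \<inter> carrier V = mm M" using VO.sub_subset mm_sub(1) sM by auto
 then show ?thesis using lift_subspace[OF M sub_carrier_set Z sub_subset[OF Z], of X] X by auto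
qed

end

subsection \<open>Complements and functionals\<close>

context fd_valued_space
begin

lemma lattice_decomposition:
 assumes M: "lattice M" and Y: "sub Y" and Q: "sub Q"
  and dim: "dimK Y + dimK Q \<le> dimK (carrier V)"
  and le: "M \<subseteq> ((M \<inter> Y) \<uplus> (M \<inter> Q)) \<uplus> mm M"
 shows "(M \<inter> Y) \<uplus> (M \<inter> Q) = M" "Y \<inter> Q = {0\<^sub>V}" "Y \<uplus> Q = carrier V"
proof -
 have sM: "Osub M" using lattice_sub M by simp
 have s: "Osub (M \<inter> Y)" "Osub (M \<inter> Q)" using VO.sub_Int sM sub_Osub Y Q by auto
 show eq: "(M \<inter> Y) \<uplus> (M \<inter> Q) = M"
  using nakayama_carrier[OF M VO.sub_sum[OF s] VO.sum_least[OF sM] le] by simp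
 obtain es where es: "set es \<subseteq> M" "carrier V = Kspan es" using lattice_basis_carrier[OF M] by blast
 note YQ = sub_sum[OF Y Q]
 have "(M \<inter> Y) \<uplus> (M \<inter> Q) \<subseteq> Y \<uplus> Q" by (rule sum_mono) auto
 then have "M \<subseteq> Y \<uplus> Q" using eq by simp
 then have "Kspan es \<subseteq> Y \<uplus> Q"
  using VK.ext_least[OF YQ sub_zero_subset[OF YQ]] es by blast
 then show c: "Y \<uplus> Q = carrier V" using es sub_subset[OF YQ] by blast
 have QY: "sub (Q \<inter> Y)" using sub_Int Q Y by auto
 have "VK.rk (Q \<inter> Y) Q = VK.rk Y (Q \<uplus> Y)"
  using VK.second_iso(3)[OF Q Y] finK'[OF QY Q] by auto
 moreover have "dimK Q = dimK (Q \<inter> Y) + VK.rk (Q \<inter> Y) Q" using dimK_between[OF QY Q] by auto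
 moreover have "dimK (carrier V) = dimK Y + VK.rk Y (Q \<uplus> Y)"
  using dimK_between[OF Y sub_carrier_set sub_subset[OF Y]] c sum_comm[OF Y Q] by simp
 ultimately have "dimK (Q \<inter> Y) = 0" using dim by simp
 then show "Y \<inter> Q = {0\<^sub>V}" using VK.rk_zero_iff[OF finK[OF QY]] by auto
qed

text \<open>Q lifts vectors that complete the reduction of Y to all of M/mM.\<close>

lemma lattice_complement:
 assumes M: "lattice M" and Y: "sub Y"
 shows "\<exists>Q. sub Q \<and> dimK Y + dimK Q \<le> dimK (carrier V) \<and>
  M \<subseteq> ((M \<inter> Y) \<uplus> (M \<inter> Q)) \<uplus> mm M"
proof -
 have sM: "Osub M" using lattice_sub M by simp
 note smM = mm_sub[OF sM]
 have sY: "Osub (M \<inter> Y)" using VO.sub_Int sM sub_Osub Y by auto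
 have cV: "mm M \<inter> carrier V = mm M" using VO.sub_subset smM(1) by auto
 let ?X = "(M \<inter> Y) \<uplus> mm M"
 have X: "Osub ?X" "mm M \<subseteq> ?X" "?X \<subseteq> M"
  using VO.sub_sum[OF sY smM(1)] VO.sum_upper2[OF sY smM(1)] VO.sum_least[OF sM _ smM(2)] by auto
 note rX = VO.rk_between[OF lattice_fin[OF M] X]
 obtain xs where xs: "length xs = VO.rk ?X M" "set xs \<subseteq> M" "VO.ext ?X xs = M"
  using VO.dm_list[OF VO.dm_rk[OF rX(2)]] by blast
 have xc: "set xs \<subseteq> carrier V" using xs VO.sub_carrier[OF sM] by blast
 let ?E = "VO.ext (mm M) xs"
 have E: "Osub ?E" "mm M \<subseteq> ?E" "?E \<subseteq> M"
  using VO.ext_sub[OF smM(1) xc] VO.ext_upper[OF smM(1) xc] VO.ext_least[OF sM smM(2) xs(2)] by auto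
 have rE: "VO.rk (mm M) ?E \<le> length xs"
  using VO.ext_dm[OF smM(1) xc] xs(2) mmI by blast
 have "M \<inter> {0\<^sub>V} \<subseteq> ?E" using VO.sub_zero[OF E(1)] by auto
 then obtain Q where Q: "sub Q" "(M \<inter> Q) \<uplus> mm M = ?E" "dimK Q = VO.rk (mm M) ?E"
  using lift_subspace_carrier[OF M sub_zero_set E(1) _ E(2,3)] by blast
 have "VO.rk (mm M) M = dimK (carrier V)" using VO.rk_eq M lattice_def by blast
 moreover have "VO.rk (mm M) ?X = dimK Y"
  using rank_reduction(2)[OF M Y sub_carrier_set sub_subset[OF Y]] cV by simp
 ultimately have "dimK Y + dimK Q \<le> dimK (carrier V)" using Q(3) rE xs(1) rX(3) by simp
 moreover have "M \<subseteq> ((M \<inter> Y) \<uplus> (M \<inter> Q)) \<uplus> mm M"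
 proof -
  have sQ: "Osub (M \<inter> Q)" using VO.sub_Int sM sub_Osub Q by auto
  have "M = VO.ext ((M \<inter> Y) \<uplus> mm M) xs" using xs by simp
  also have "(M \<inter> Y) \<uplus> mm M = mm M \<uplus> (M \<inter> Y)" using VO.sum_comm[OF sY smM(1)] .
  also have "VO.ext \<dots> xs = ?E \<uplus> (M \<inter> Y)" using VO.ext_sum[OF smM(1) sY xc] by simp
  also have "\<dots> = (M \<inter> Y) \<uplus> ((M \<inter> Q) \<uplus> mm M)" using VO.sum_comm[OF E(1) sY] Q(2) by simp
  finally show ?thesis using VO.sum_assoc[OF sY sQ smM(1)] by simp
 qed
 ultimately show ?thesis using Q(1) by blast
qed

section \<open>Linear maps, projections and integral functionals\<close>

definition linfun where
 "linfun \<theta> \<longleftrightarrow> (\<forall>x\<in>carrier V. \<theta> x \<in> carrier K)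
  \<and> (\<forall>x\<in>carrier V. \<forall>y\<in>carrier V. \<theta> (x \<boxplus> y) = \<theta> x \<oplus> \<theta> y)
  \<and> (\<forall>c\<in>carrier K. \<forall>x\<in>carrier V. \<theta> (c \<cdot> x) = c \<otimes> \<theta> x)"

definition linmap where
 "linmap \<phi> \<longleftrightarrow> (\<forall>x\<in>carrier V. \<phi> x \<in> carrier V)
  \<and> (\<forall>x\<in>carrier V. \<forall>y\<in>carrier V. \<phi> (x \<boxplus> y) = \<phi> x \<boxplus> \<phi> y)
  \<and> (\<forall>c\<in>carrier K. \<forall>x\<in>carrier V. \<phi> (c \<cdot> x) = c \<cdot> \<phi> x)"

lemma linfunD:
 assumes "linfun \<theta>"
 shows "x \<in> carrier V \<Longrightarrow> \<theta> x \<in> carrier K"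
  "\<lbrakk>x \<in> carrier V; y \<in> carrier V\<rbrakk> \<Longrightarrow> \<theta> (x \<boxplus> y) = \<theta> x \<oplus> \<theta> y"
  "\<lbrakk>c \<in> carrier K; x \<in> carrier V\<rbrakk> \<Longrightarrow> \<theta> (c \<cdot> x) = c \<otimes> \<theta> x"
 using assms by (auto simp: linfun_def)

lemma linmapD:
 assumes "linmap \<phi>"
 shows "x \<in> carrier V \<Longrightarrow> \<phi> x \<in> carrier V"
  "\<lbrakk>x \<in> carrier V; y \<in> carrier V\<rbrakk> \<Longrightarrow> \<phi> (x \<boxplus> y) = \<phi> x \<boxplus> \<phi> y"
  "\<lbrakk>c \<in> carrier K; x \<in> carrier V\<rbrakk> \<Longrightarrow> \<phi> (c \<cdot> x) = c \<cdot> \<phi> x"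
 using assms by (auto simp: linmap_def)

lemma decomposition_unique:
 assumes Y: "sub Y" and Q: "sub Q" and YQ: "Y \<inter> Q = {0\<^sub>V}"
  and e: "y \<boxplus> q = y' \<boxplus> q'" and i: "y \<in> Y" "y' \<in> Y" "q \<in> Q" "q' \<in> Q"
 shows "y = y'"
proof -
 note c = sub_carrier[OF Y i(1)] sub_carrier[OF Y i(2)] sub_carrier[OF Q i(3)] sub_carrier[OF Q i(4)]
 define z where "z = y \<ominus>\<^bsub>V\<^esub> y'"
 have z: "z \<in> Y" "y = z \<boxplus> y'" "z \<in> carrier V"
  using sub_minus[OF Y i(1,2)] minus_add_cancel(1)[OF c(1,2)] c by (auto simp: z_def)
 have "(z \<boxplus> q) \<boxplus> y' = q' \<boxplus> y'" using e z c by (simp add: M.a_ac)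
 then have "z \<boxplus> q \<in> Q" using c z i by simp
 then have "z \<in> Q" using sub_cancel'[OF Q] i z by blast
 then have "z = 0\<^sub>V" using z YQ by blast
 then show ?thesis using z c by simp
qed

lemma projection:
 assumes Y: "sub Y" and Q: "sub Q" and YQ: "Y \<inter> Q = {0\<^sub>V}" "Y \<uplus> Q = carrier V"
 shows "\<exists>\<pi>. linmap \<pi> \<and> (\<forall>y\<in>Y. \<forall>q\<in>Q. \<pi> (y \<boxplus> q) = y)"
proof -
 define \<pi> where "\<pi> x = (THE y. y \<in> Y \<and> (\<exists>q\<in>Q. x = y \<boxplus> q))" for x
 have \<pi>: "\<pi> (y \<boxplus> q) = y" if "y \<in> Y" "q \<in> Q" for y q
  unfolding \<pi>_def by (rule the_equality) (use that decomposition_unique[OF Y Q YQ(1)] in blast)+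
 have dec: "\<exists>y\<in>Y. \<exists>q\<in>Q. x = y \<boxplus> q" if "x \<in> carrier V" for x
  using that YQ(2) mem_sum by auto
 note c = sub_carrier[OF Y] sub_carrier[OF Q]
 have "linmap \<pi>"
  unfolding linmap_def
 proof (intro conjI ballI)
  fix x assume x: "x \<in> carrier V"
  then obtain y q where 1: "y \<in> Y" "q \<in> Q" "x = y \<boxplus> q" using dec by blast
  show "\<pi> x \<in> carrier V" using 1 \<pi> c by simp
  {
   fix x' assume "x' \<in> carrier V"
   then obtain y' q' where 2: "y' \<in> Y" "q' \<in> Q" "x' = y' \<boxplus> q'" using dec by blast
   have "x \<boxplus> x' = (y \<boxplus> y') \<boxplus> (q \<boxplus> q')" using 1 2 c by (simp add: M.a_ac)
   then show "\<pi> (x \<boxplus> x') = \<pi> x \<boxplus> \<pi> x'"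
    using \<pi>[OF sub_add[OF Y 1(1) 2(1)] sub_add[OF Q 1(2) 2(2)]] \<pi> 1 2 by simp
  }
 next
  fix r x assume r: "r \<in> carrier K" and x: "x \<in> carrier V"
  then obtain y q where 1: "y \<in> Y" "q \<in> Q" "x = y \<boxplus> q" using dec by blast
  have "r \<cdot> x = r \<cdot> y \<boxplus> r \<cdot> q" using 1 c r by (simp add: smult_r_distr)
  then show "\<pi> (r \<cdot> x) = r \<cdot> \<pi> x"
   using \<pi>[OF sub_smult[OF Y r 1(1)] sub_smult[OF Q r 1(2)]] \<pi> 1 by simp
 qed
 then show ?thesis using \<pi> by blast
qed

lemma functional:
 assumes Y: "sub Y" and x: "x \<in> carrier V" "x \<notin> Y" and e: "Y \<uplus> line x = carrier V"
 shows "\<exists>\<theta>. linfun \<theta> \<and> (\<forall>y\<in>Y. \<forall>c\<in>carrier K. \<theta> (y \<boxplus> c \<cdot> x) = c)"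
proof -
 have YL: "Y \<inter> line x = {0\<^sub>V}"
 proof (intro equalityI subsetI)
  fix z assume "z \<in> Y \<inter> line x"
  then obtain c where c: "c \<in> carrier K" "z = c \<cdot> x" "z \<in> Y" unfolding line_def by blast
  then have "c = \<zero>" using sub_cancel_smult[OF Y, of c x] x by blast
  then show "z \<in> {0\<^sub>V}" using c x by simp
 qed (use sub_zero[OF Y] sub_zero[OF sub_line[OF x(1)]] in auto)
 have nz: "x \<noteq> 0\<^sub>V" using x sub_zero[OF Y] by auto
 have "line x \<uplus> Y = carrier V" "line x \<inter> Y = {0\<^sub>V}"
  using e YL sum_comm[OF Y sub_line[OF x(1)]] by auto
 then obtain \<pi> where \<pi>: "linmap \<pi>" "\<forall>y\<in>line x. \<forall>q\<in>Y. \<pi> (y \<boxplus> q) = y"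
  using projection[OF sub_line[OF x(1)] Y] by blast
 define \<theta> where "\<theta> z = (THE c. c \<in> carrier K \<and> \<pi> z = c \<cdot> x)" for z
 have uniq: "\<theta> z = c" if "c \<in> carrier K" "\<pi> z = c \<cdot> x" for z c
  unfolding \<theta>_def by (rule the_equality) (use that smult_cancel[OF _ _ _ x(1) nz] in auto)
 have \<pi>': "\<pi> (y \<boxplus> c \<cdot> x) = c \<cdot> x" if "y \<in> Y" "c \<in> carrier K" for y c
 proof -
  have "c \<cdot> x \<in> line x" using that unfolding line_def by blast
  then have "\<pi> (c \<cdot> x \<boxplus> y) = c \<cdot> x" using \<pi>(2) that by blast
  then show ?thesis using M.a_comm[of y "c \<cdot> x"] that x sub_carrier[OF Y] by simp
 qed
 have dec: "\<exists>c\<in>carrier K. \<pi> z = c \<cdot> x" if "z \<in> carrier V" for z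
 proof -
  have "z \<in> Y \<uplus> line x" using that e by simp
  then show ?thesis unfolding mem_sum_line using \<pi>' by blast
 qed
 have "linfun \<theta>"
  unfolding linfun_def
 proof (intro conjI ballI)
  fix z assume z: "z \<in> carrier V"
  then obtain c where c: "c \<in> carrier K" "\<pi> z = c \<cdot> x" using dec by blast
  show "\<theta> z \<in> carrier K" using uniq c by simp
  {
   fix z' assume z': "z' \<in> carrier V"
   then obtain c' where c': "c' \<in> carrier K" "\<pi> z' = c' \<cdot> x" using dec by blast
   have "\<pi> (z \<boxplus> z') = (c \<oplus> c') \<cdot> x"
    using linmapD(2)[OF \<pi>(1) z z'] c c' x by (simp add: smult_l_distr)
   then show "\<theta> (z \<boxplus> z') = \<theta> z \<oplus> \<theta> z'" using uniq c c' by simp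
  }
  fix r assume r: "r \<in> carrier K"
  have "\<pi> (r \<cdot> z) = (r \<otimes> c) \<cdot> x"
   using linmapD(3)[OF \<pi>(1) r z] c x r by (simp add: smult_assoc1)
  then show "\<theta> (r \<cdot> z) = r \<otimes> \<theta> z" using uniq c r by simp
 qed
 then show ?thesis using uniq \<pi>' by blast
qed

text \<open>The reduction of x lies outside that of Z. A hyperplane of M/mM that contains the
  reduction of Z but not x lifts to a hyperplane Y of V containing Z; \<theta> is the coordinate
  along x in V = Y + Kx.\<close>

lemma lattice_functional:
 assumes M: "lattice M" and Z: "sub Z" and x: "x \<in> M" "x \<notin> (M \<inter> Z) \<uplus> mm M"
 shows "\<exists>\<theta>. linfun \<theta> \<and> (\<forall>z\<in>Z. \<theta> z = \<zero>) \<and> \<theta> x = \<one> \<and> (\<forall>z\<in>M. \<theta> z \<in> \<O>)"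
proof -
 have sM: "Osub M" using lattice_sub M by simp
 note smM = mm_sub[OF sM]
 have xc: "x \<in> carrier V" using x VO.sub_carrier[OF sM] by blast
 have sZ: "Osub (M \<inter> Z)" using VO.sub_Int sM sub_Osub Z by auto
 have cV: "mm M \<inter> carrier V = mm M" using VO.sub_subset smM(1) by auto
 let ?X = "(M \<inter> Z) \<uplus> mm M"
 have X: "Osub ?X" "mm M \<subseteq> ?X" "?X \<subseteq> M" "M \<inter> Z \<subseteq> ?X"
  using VO.sub_sum[OF sZ smM(1)] VO.sum_upper2[OF sZ smM(1)] VO.sum_least[OF sM _ smM(2)]
   VO.sum_upper1[OF sZ smM(1)] by auto
 let ?X' = "?X \<uplus> VO.line x"
 have X': "Osub ?X'" "?X \<subseteq> ?X'" "?X' \<subseteq> M"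
  using VO.sub_adjoin[OF X(1) xc] VO.adjoin_upper[OF X(1) xc] VO.adjoin_least[OF sM X(3) x(1)] by auto
 note rX = VO.rk_between[OF lattice_fin[OF M] X(1-3)]
 note rX' = VO.rk_between[OF rX(2) X']
 have one: "VO.rk ?X ?X' = 1"
  by (rule VO.rk_eq, rule VO.dm_one[OF X(1) xc x(2)]) (use mmI x(1) X(2) in blast)
 obtain xs where xs: "length xs = VO.rk ?X' M" "set xs \<subseteq> M" "VO.ext ?X' xs = M"
  using VO.dm_list[OF VO.dm_rk[OF rX'(2)]] by blast
 have xsc: "set xs \<subseteq> carrier V" using xs VO.sub_carrier[OF sM] by blast
 let ?E = "VO.ext ?X xs"
 have E: "Osub ?E" "?X \<subseteq> ?E" "?E \<subseteq> M"
  using VO.ext_sub[OF X(1) xsc] VO.ext_upper[OF X(1) xsc] VO.ext_least[OF sM X(3) xs(2)] by auto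
 have Ex: "?E \<uplus> VO.line x = M"
  using VO.ext_sum[OF X(1) VO.sub_line[OF xc] xsc] xs(3) by simp
 have rE: "VO.rk ?X ?E \<le> length xs"
  using VO.ext_dm[OF X(1) xsc] xs(2) mmI X(2) by blast
 have finE: "VO.fin ?X ?E" using VO.rk_between(1)[OF rX(2) E] .
 \<comment> \<open>M has length one more over \<open>?X\<close> than the list \<open>xs\<close> can
   account for.\<close>
 have nE: "?E \<noteq> M" using rE xs(1) rX'(3) one by auto
 have xE: "x \<notin> ?E" using nE Ex VO.adjoin_absorb[OF E(1)] by auto
 have mE: "mm M \<subseteq> ?E" "M \<inter> Z \<subseteq> ?E" using E(2) X by auto
 obtain Y where Y: "sub Y" "Z \<subseteq> Y" "(M \<inter> Y) \<uplus> mm M = ?E" "dimK Y = VO.rk (mm M) ?E"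
  using lift_subspace_carrier[OF M Z E(1) mE(2,1) E(3)] by blast
 have sY: "Osub (M \<inter> Y)" using VO.sub_Int sM sub_Osub Y by auto
 have xY: "x \<notin> Y" using xE x(1) Y(3) VO.sum_upper1[OF sY smM(1)] by blast
 have rd: "VO.rk (mm M) M = dimK (carrier V)" using VO.rk_eq M lattice_def by blast
 have "VO.rk ?E (?E \<uplus> VO.line x) = 1"
  by (rule VO.rk_eq, rule VO.dm_one[OF E(1) xc xE]) (use mmI x(1) mE in blast)
 then have "VO.rk ?E M = 1" by (subst (asm) Ex)
 then have "dimK (carrier V) = Suc (dimK Y)"
  using VO.rk_between(3)[OF lattice_fin[OF M] E(1) mE(1) E(3)] rd Y(4) by simp
 then have "Y \<uplus> line x = carrier V"
  using dimK_eq[OF sub_adjoin[OF Y(1) xc] sub_carrier_set sub_subset[OF sub_adjoin[OF Y(1) xc]]]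
   dimK_adjoin[OF Y(1) xc xY] by simp
 then obtain \<theta> where \<theta>: "linfun \<theta>" "\<forall>y\<in>Y. \<forall>c\<in>carrier K. \<theta> (y \<boxplus> c \<cdot> x) = c"
  using functional[OF Y(1) xc xY] by blast
 \<comment> \<open>This splitting over \<O>, not only over K, is what makes \<theta> integral on
   M.\<close>
 have MY: "(M \<inter> Y) \<uplus> VO.line x = M"
 proof (rule nakayama_carrier[OF M VO.sub_adjoin[OF sY xc]])
  show "(M \<inter> Y) \<uplus> VO.line x \<subseteq> M" using VO.adjoin_least[OF sM _ x(1)] by blast
  have "((M \<inter> Y) \<uplus> VO.line x) \<uplus> mm M = M"
   using VO.sum_adjoin[OF sY smM(1) xc] Y(3) Ex by simp
  then show "M \<subseteq> ((M \<inter> Y) \<uplus> VO.line x) \<uplus> mm M" by simp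
 qed
 have "\<theta> z = \<zero>" if "z \<in> Z" for z
 proof -
  have z: "z \<in> Y" "z \<in> carrier V" using that Y sub_carrier[OF Z] by auto
  then have "\<theta> (z \<boxplus> \<zero> \<cdot> x) = \<zero>" using \<theta>(2) by blast
  then show ?thesis using z xc by simp
 qed
 moreover have "\<theta> x = \<one>"
 proof -
  have "\<theta> (0\<^sub>V \<boxplus> \<one> \<cdot> x) = \<one>" using \<theta>(2) sub_zero[OF Y(1)] by blast
  then show ?thesis using xc by simp
 qed
 moreover have "\<theta> z \<in> \<O>" if "z \<in> M" for z
 proof -
  have "z \<in> (M \<inter> Y) \<uplus> VO.line x" using that MY by simp
  then obtain y r where "y \<in> Y" "r \<in> \<O>" "z = y \<boxplus> r \<cdot> x" unfolding VO.mem_sum_line by auto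
  then show ?thesis using \<theta>(2) O_carrier by simp
 qed
 ultimately show ?thesis using \<theta>(1) by blast
qed

text \<open>A basis of M adapted to the line Kx consists of one vector g. It lies outside mM because
  the reduction of M \<inter> Kx has dimension one; c is the content of x.\<close>

lemma primitive_part:
 assumes M: "lattice M" and x: "x \<in> carrier V" "x \<noteq> 0\<^sub>V"
 shows "\<exists>c\<in>carrier K. \<exists>g\<in>M. c \<noteq> \<zero> \<and> g \<notin> mm M \<and> x = c \<cdot> g \<and> (x \<in> M \<longrightarrow> c \<in> \<O>) \<and> (x \<in> mm M \<longrightarrow> c \<in> m)"
proof -
 have sM: "Osub M" using lattice_sub M by simp
 note L = sub_line[OF x(1)]
 have L0: "{0\<^sub>V} \<uplus> line z = line z" if "z \<in> carrier V" for z
  using sum_absorb2[OF sub_zero_set sub_line[OF that] sub_zero_subset[OF sub_line[OF that]]] .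
 have "dimK {0\<^sub>V} = 0" using VK.rk_self(2)[OF sub_zero_set] .
 then have d: "dimK (line x) = 1"
  using dimK_adjoin[OF sub_zero_set x(1)] x L0[OF x(1)] by simp
 obtain es where es: "length es = 1" "set es \<subseteq> M \<inter> line x" "M \<inter> line x = Ospan es" "line x = Kspan es"
  using lattice_basis[OF M L] d by auto
 then obtain g where g: "es = [g]" by (metis One_nat_def length_0_conv length_Suc_conv)
 have gM: "g \<in> M" "g \<in> line x" "g \<in> carrier V" using es g VO.sub_carrier[OF sM] by auto
 have eqM: "M \<inter> line x = VO.line g"
  using es(3) g VO.sum_absorb2[OF VO.sub_zero_set VO.sub_line[OF gM(3)]] VO.sub_zero[OF VO.sub_line[OF gM(3)]] by simp
 have eqK: "line x = line g" using es(4) g L0[OF gM(3)] by simp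
 have "x \<in> line g" using eqK line_self[OF x(1)] by simp
 then obtain c where c: "c \<in> carrier K" "x = c \<cdot> g" unfolding line_def by blast
 have cz: "c \<noteq> \<zero>" using c x gM by auto
 have gz: "g \<noteq> 0\<^sub>V" using c x by auto
 have "g \<notin> mm M"
 proof
  assume "g \<in> mm M"
  then have "M \<inter> line x \<subseteq> mm M \<inter> line x" using eqM VO.line_least[OF mm_sub(1)[OF sM]] by blast
  then have "M \<inter> line x = mm M \<inter> line x" using mm_sub(2)[OF sM] by blast
  then have "VO.rk (mm M \<inter> line x) (M \<inter> line x) = 0"
   using VO.rk_zero_iff[OF lattice_finI[OF M L]] by simp
  then show False using lattice_rank[OF M L] d by simp
 qed
 moreover have "c \<in> \<O>" if "x \<in> M"
 proof -
  have "x \<in> VO.line g" using that eqM line_self[OF x(1)] by blast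
  then obtain r where r: "r \<in> \<O>" "x = r \<cdot> g" unfolding VO.line_def by auto
  then show ?thesis using smult_cancel[of c g r] c gM gz O_carrier by auto
 qed
 moreover have "c \<in> m" if "x \<in> mm M"
 proof -
  have "x \<in> mm (M \<inter> line x)" using mm_Int[OF L sM] that line_self[OF x(1)] by simp
  then obtain e y where e: "e \<in> m" "y \<in> VO.line g" "x = e \<cdot> y" unfolding eqM mm_def by blast
  then obtain r where r: "r \<in> \<O>" "y = r \<cdot> g" unfolding VO.line_def by auto
  have "x = (r \<otimes> e) \<cdot> g"
   using e r m_carrier O_carrier gM by (simp add: smult_assoc1[symmetric] R.m_comm)
  then have "c = r \<otimes> e" using smult_cancel[of c g "r \<otimes> e"] c gM gz O_carrier[OF r(1)] m_carrier[OF e(1)] by auto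
  then show ?thesis using m_mult r e by simp
 qed
 ultimately show ?thesis using c cz gM by blast
qed

text \<open>The lattice of Langton's elementary modification of \<open>M\<close> along \<open>Y\<close>.\<close>

lemma modification:
 assumes M: "lattice M" and Y: "sub Y" and a: "a \<in> m" "a \<noteq> \<zero>"
 defines "L \<equiv> (M \<inter> Y) \<uplus> scale a M" and "W \<equiv> (M \<inter> Y) \<uplus> mm M"
 shows "lattice L" "scale a M \<inter> mm L = scale a W" "L \<inter> mm M = mm L \<uplus> scale a M" "L \<subseteq> W"
proof -
 have sM: "Osub M" using lattice_sub M by simp
 note smM = mm_sub[OF sM]
 have aK: "a \<in> carrier K" "a \<in> \<O>" using a m_carrier m_O by auto
 let ?A = "M \<inter> Y" and ?S = "scale a M"
 have cV: "mm M \<inter> carrier V = mm M" using VO.sub_subset smM(1) by auto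
 have A: "Osub ?A" using VO.sub_Int sM sub_Osub Y by auto
 note mA = mm_sub[OF A]
 have S: "Osub ?S" "?S \<subseteq> mm M" "?S \<subseteq> M" using scale_sub[OF sM aK(1)] scale_m[OF a(1)] scale_subset[OF sM aK(2)] by auto
 have mS: "Osub (scale a (mm M))" "scale a (mm M) \<subseteq> ?S" using scale_sub[OF smM(1) aK(1)] scale_mono[OF smM(2)] by auto
 \<comment> \<open>N equals L \<inter> mM. The quotient L/N is the reduction of Y, and N/mL is M/W
   multiplied by a; their lengths add up to dim V.\<close>
 define N where "N = mm ?A \<uplus> ?S"
 have N: "Osub N" "mm ?A \<subseteq> N" "?S \<subseteq> N"
  using VO.sub_sum[OF mA(1) S(1)] VO.sum_upper1[OF mA(1) S(1)] VO.sum_upper2[OF mA(1) S(1)] unfolding N_def by auto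
 have mL: "mm L = mm ?A \<uplus> scale a (mm M)"
  unfolding L_def using mm_sum[OF A S(1)] mm_scale[OF sM aK(1)] by simp
 have aY: "a \<cdot> y \<in> mm ?A" if "y \<in> ?A" for y using that a mmI by blast
 have AN: "?A \<inter> N = mm ?A"
 proof (intro equalityI subsetI)
  fix z assume "z \<in> ?A \<inter> N"
  then obtain u t where u: "z \<in> ?A" "u \<in> mm ?A" "t \<in> M" "z = u \<boxplus> a \<cdot> t"
   unfolding N_def by (auto simp: mem_sum scale_def)
  have tc: "t \<in> carrier V" using u VO.sub_carrier[OF sM] by blast
  have "a \<cdot> t \<in> Y" using sub_cancel[OF Y, of u "a \<cdot> t"] u mA(2) tc aK by auto
  then have "t \<in> Y" using sub_cancel_smult[OF Y] tc aK a by blast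
  then show "z \<in> mm ?A" using u aY VO.sub_add[OF mA(1)] by blast
 qed (use mA N in auto)
 have AL: "?A \<uplus> N = L"
  unfolding N_def L_def using VO.sum_assoc[OF A mA(1) S(1)] VO.sum_absorb1[OF A mA(1,2)] by simp
 have finA: "VO.fin (?A \<inter> N) ?A" "VO.rk (?A \<inter> N) ?A = dimK Y"
  unfolding AN using lattice_finI[OF M Y] lattice_rank[OF M Y] mm_Int[OF Y sM] by auto
 have 1: "VO.fin N L" "VO.rk N L = dimK Y"
  using VO.second_iso[OF A N(1)] finA AL by auto
 have sL: "Osub L" unfolding L_def using VO.sub_sum[OF A S(1)] .
 note smL = mm_sub[OF sL]
 have SL: "?S \<uplus> mm L = N"
  unfolding mL N_def using VO.sum_comm[OF S(1) VO.sub_sum[OF mA(1) mS(1)]]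
   VO.sum_assoc[OF mA(1) mS(1) S(1)] VO.sum_absorb2[OF mS(1) S(1) mS(2)] by simp
 have W: "Osub W" "mm M \<subseteq> W" "W \<subseteq> M" "?A \<subseteq> W"
  unfolding W_def using VO.sub_sum[OF A smM(1)] VO.sum_upper2[OF A smM(1)] VO.sum_least[OF sM _ smM(2)]
   VO.sum_upper1[OF A smM(1)] by auto
 show SmL: "?S \<inter> mm L = scale a W"
 proof (intro equalityI subsetI)
  fix z assume "z \<in> ?S \<inter> mm L"
  then obtain t u w where t: "t \<in> M" "z = a \<cdot> t" "u \<in> mm ?A" "w \<in> mm M" "z = u \<boxplus> a \<cdot> w"
   unfolding mL by (auto simp: mem_sum scale_def)
  have c: "t \<in> carrier V" "w \<in> carrier V" "u \<in> carrier V" "u \<in> Y"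
   using t VO.sub_carrier[OF sM] VO.sub_carrier[OF smM(1)] VO.sub_carrier[OF mA(1)] mA(2) by auto
  have "a \<cdot> (t \<ominus>\<^bsub>V\<^esub> w) \<boxplus> a \<cdot> w = a \<cdot> t"
   using c aK smult_r_distr[of a "t \<ominus>\<^bsub>V\<^esub> w" w] minus_add_cancel(1)[of t w] by simp
  then have "a \<cdot> (t \<ominus>\<^bsub>V\<^esub> w) \<boxplus> a \<cdot> w = u \<boxplus> a \<cdot> w" using t by simp
  then have "a \<cdot> (t \<ominus>\<^bsub>V\<^esub> w) = u" using c aK by simp
  then have "t \<ominus>\<^bsub>V\<^esub> w \<in> Y" using sub_cancel_smult[OF Y, of a "t \<ominus>\<^bsub>V\<^esub> w"] c aK a by simp
  moreover have "t \<ominus>\<^bsub>V\<^esub> w \<in> M" using VO.sub_minus[OF sM] t smM(2) by blast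
  ultimately have "(t \<ominus>\<^bsub>V\<^esub> w) \<boxplus> w \<in> W" unfolding W_def using t by (intro sumI) auto
  then show "z \<in> scale a W" using t minus_add_cancel(1)[of t w] c scaleI by simp
 next
  fix z assume "z \<in> scale a W"
  then obtain y w where y: "y \<in> ?A" "w \<in> mm M" "z = a \<cdot> (y \<boxplus> w)"
   unfolding W_def by (auto simp: mem_sum scale_def)
  have c: "y \<in> carrier V" "w \<in> carrier V" using y VO.sub_carrier[OF A] VO.sub_carrier[OF smM(1)] by auto
  have z: "z = a \<cdot> y \<boxplus> a \<cdot> w" using y c aK by (simp add: smult_r_distr)
  have "z \<in> mm L" unfolding mL z using aY y scaleI by (intro sumI) auto
  moreover have "z \<in> ?S" using y VO.sub_add[OF sM] smM(2) scaleI by blast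
  ultimately show "z \<in> ?S \<inter> mm L" by simp
 qed
 have rd: "VO.rk (mm M) M = dimK (carrier V)" using VO.rk_eq M lattice_def by blast
 have rW: "VO.rk (mm M) W = dimK Y"
  using rank_reduction(2)[OF M Y sub_carrier_set sub_subset[OF Y]] cV unfolding W_def by simp
 note bW = VO.rk_between[OF lattice_fin[OF M] W(1-3)]
 have "VO.fin (?S \<inter> mm L) ?S" "VO.rk (?S \<inter> mm L) ?S = VO.rk W M"
  unfolding SmL using rk_scale[OF aK(1) a(2) bW(2)] by auto
 then have 2: "VO.fin (mm L) N" "VO.rk (mm L) N = VO.rk W M"
  using VO.second_iso[OF S(1) smL(1)] SL by auto
 have "VO.fin (mm L) L" "VO.rk (mm L) L = dimK (carrier V)"
  using VO.rk_trans[OF 2(1) 1(1)] 1 2 bW(3) rW rd by auto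
 then show "lattice L" by (simp add: lattice_def VO.dm_iff)
 have "L \<inter> mm M = (?S \<uplus> ?A) \<inter> mm M" unfolding L_def using VO.sum_comm[OF A S(1)] by simp
 also have "\<dots> = ?S \<uplus> (?A \<inter> mm M)" using VO.modular_law[OF S(1) A smM(1) S(2)] .
 also have "?A \<inter> mm M = mm ?A" using mm_Int[OF Y sM] smM(2) by auto
 also have "?S \<uplus> mm ?A = N" unfolding N_def using VO.sum_comm[OF S(1) mA(1)] .
 finally show "L \<inter> mm M = mm L \<uplus> ?S" using SL VO.sum_comm[OF S(1) smL(1)] by simp
 have "?S \<subseteq> W" using S(2) W(2) by blast
 then show "L \<subseteq> W" unfolding L_def using VO.sum_least[OF W(1) W(4)] by blast
qed

end

section \<open>Langton's modification\<close>

text \<open>The \<open>F i\<close> are the steps of all filtrations listed together, and \<alpha>,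
  \<beta> express a slope inequality as an integer degree. The last assumption lets the degree
  determine the dimension, so that nested submodules of equal degree coincide.\<close>

locale subspace_config = fd_valued_space K V \<O> for K (structure) and V and \<O> +
 fixes Idx :: "'i set" and F :: "'i \<Rightarrow> 'c set" and \<alpha> \<beta> :: int
 assumes finite_Idx: "finite Idx"
  and F_sub: "i \<in> Idx \<Longrightarrow> sub (F i)"
  and \<alpha>_pos: "0 < \<alpha>" and \<beta>_nonneg: "0 \<le> \<beta>"
  and determines_dim: "\<lbrakk>y \<le> dimK (carrier V); y' \<le> dimK (carrier V); \<alpha> * x - \<beta> * int y = \<alpha> * x' - \<beta> * int y'\<rbrakk>
   \<Longrightarrow> y = y'"
begin

section \<open>Degrees of subspaces and of reductions, and admissible lifts\<close>

definition degK where
 "degK Y = \<alpha> * (\<Sum>i\<in>Idx. int (dimK (Y \<inter> F i))) - \<beta> * int (dimK Y)"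

text \<open>For mM \<subseteq> X \<subseteq> M this is the degree of X/mM in M/mM with respect to
  the images of the M \<inter> \<open>F i\<close>: since X contains mM, the intersection of X/mM
  with such an image is the image of X \<inter> \<open>F i\<close>.\<close>

definition degO where
 "degO M X = \<alpha> * (\<Sum>i\<in>Idx. int (VO.rk (mm M \<inter> F i) (X \<inter> F i))) - \<beta> * int (VO.rk (mm M) X)"

definition between where "between M X \<longleftrightarrow> Osub X \<and> mm M \<subseteq> X \<and> X \<subseteq> M"

text \<open>\<open>adm M Y a\<close>: modulo \<open>a\<close>, the subspace \<open>Y\<close> meets each \<open>F i\<close> as largely as its reduction does.\<close>

definition adm where
 "adm M Y a \<longleftrightarrow> (\<forall>i\<in>Idx. ((M \<inter> Y) \<uplus> mm M) \<inter> F i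
  \<subseteq> (F i \<inter> ((M \<inter> Y) \<uplus> scale a M)) \<uplus> mm M)"

lemma between_fin:
 assumes "lattice M" "between M X"
 shows "VO.fin (mm M) X" "sub G \<Longrightarrow> VO.fin (mm M \<inter> G) (X \<inter> G)"
proof -
 show 1: "VO.fin (mm M) X"
  using VO.rk_between(1)[OF lattice_fin[OF assms(1)]] assms(2) unfolding between_def by blast
 show "VO.fin (mm M \<inter> G) (X \<inter> G)" if "sub G" using VO.rk_split(1)[OF 1 sub_Osub[OF that]] .
qed

lemma between_rk_le:
 assumes "lattice M" "between M X"
 shows "VO.rk (mm M) X \<le> dimK (carrier V)"
proof -
 have "VO.rk (mm M) X \<le> VO.rk (mm M) M"
  using VO.rk_mono[OF lattice_fin[OF assms(1)]] assms(2) unfolding between_def by blast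
 then show ?thesis using VO.rk_eq assms(1) lattice_def by metis
qed

lemma nested_eq:
 assumes M: "lattice M" and X: "between M X" "between M X'" "X \<subseteq> X'" and e: "degO M X = degO M X'"
 shows "X = X'"
proof -
 have "VO.rk (mm M) X = VO.rk (mm M) X'"
  using determines_dim[OF between_rk_le[OF M X(1)] between_rk_le[OF M X(2)]] e unfolding degO_def by blast
 then show ?thesis
  using VO.rk_eq_imp_eq[OF between_fin(1)[OF M X(2)]] X unfolding between_def by auto
qed

lemma reduction_between:
 assumes M: "lattice M" and Y: "sub Y"
 shows "between M ((M \<inter> Y) \<uplus> mm M)" "VO.rk (mm M) ((M \<inter> Y) \<uplus> mm M) = dimK Y"
proof -
 have sM: "Osub M" using lattice_sub M by simp
 note smM = mm_sub[OF sM]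
 have sY: "Osub (M \<inter> Y)" using VO.sub_Int sM sub_Osub Y by auto
 show "between M ((M \<inter> Y) \<uplus> mm M)"
  unfolding between_def
  using VO.sub_sum[OF sY smM(1)] VO.sum_upper2[OF sY smM(1)] VO.sum_least[OF sM _ smM(2)] by auto
 have "mm M \<inter> carrier V = mm M" using VO.sub_subset smM(1) by auto
 then show "VO.rk (mm M) ((M \<inter> Y) \<uplus> mm M) = dimK Y"
  using rank_reduction(2)[OF M Y sub_carrier_set sub_subset[OF Y]] by simp
qed

lemma adm_mono:
 assumes M: "lattice M" and a: "adm M Y (r \<otimes> a)" "r \<in> \<O>" "a \<in> carrier K"
 shows "adm M Y a"
proof -
 have "scale (r \<otimes> a) M \<subseteq> scale a M" using scale_dvd[OF lattice_sub[OF M] a(3,2)] .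
 then have "(F i \<inter> ((M \<inter> Y) \<uplus> scale (r \<otimes> a) M)) \<uplus> mm M \<subseteq> (F i \<inter> ((M \<inter> Y) \<uplus> scale a M)) \<uplus> mm M" for i
  using VO.sum_mono[OF subset_refl, of "scale (r \<otimes> a) M" "scale a M" "M \<inter> Y"]
  by (intro VO.sum_mono) auto
 then show ?thesis using a(1) unfolding adm_def by blast
qed

lemma reduction_Int:
 assumes M: "lattice M" and G: "sub G" and X: "Osub X" "X \<subseteq> W" "mm M \<subseteq> W" "Osub W"
  and le: "W \<inter> G \<subseteq> (G \<inter> X) \<uplus> mm M"
 shows "W \<inter> G = (X \<inter> G) \<uplus> (mm M \<inter> G)"
proof (intro equalityI subsetI)
 have smM: "Osub (mm M)" using mm_sub lattice_sub M by blast
 fix x assume x: "x \<in> W \<inter> G"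
 then obtain l n where l: "l \<in> G" "l \<in> X" "n \<in> mm M" "x = l \<boxplus> n"
  using le by (auto simp: mem_sum dest!: subsetD)
 have "n \<in> G" using sub_cancel[OF G, of l n] l x VO.sub_carrier[OF smM] by auto
 then show "x \<in> (X \<inter> G) \<uplus> (mm M \<inter> G)" unfolding l(4) using l by (intro sumI) auto
next
 fix x assume "x \<in> (X \<inter> G) \<uplus> (mm M \<inter> G)"
 moreover have "(X \<inter> G) \<uplus> (mm M \<inter> G) \<subseteq> W \<inter> G"
  by (rule VO.sum_least[OF VO.sub_Int[OF X(4) sub_Osub[OF G]]]) (use X(2,3) in auto)
 ultimately show "x \<in> W \<inter> G" by blast
qed

text \<open>L/mL is an extension of W/mM by M/W. Admissibility says that the part in
  \<open>F i\<close> still maps onto that of W/mM; the kernel of this map then has the right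
  dimension, because the parts of L/mL and M/mM in \<open>F i\<close> both have dimension dim
  \<open>F i\<close>. So the extension restricts to every \<open>F i\<close>.\<close>

lemma adm_kernel:
 assumes M: "lattice M" and Y: "sub Y" and a: "a \<in> m" "a \<noteq> \<zero>" and adm: "adm M Y a" and i: "i \<in> Idx"
 defines "L \<equiv> (M \<inter> Y) \<uplus> scale a M" and "W \<equiv> (M \<inter> Y) \<uplus> mm M"
 shows "W \<inter> F i = (L \<inter> F i) \<uplus> (mm M \<inter> F i)"
  and "L \<inter> mm M \<inter> F i = scale a (M \<inter> F i) \<uplus> (mm L \<inter> F i)"
proof -
 let ?F = "F i"
 note F = F_sub[OF i]
 have FO: "Osub ?F" using sub_Osub[OF F] .
 have sM: "Osub M" using lattice_sub M by simp
 note smM = mm_sub[OF sM]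
 have aK: "a \<in> carrier K" using a m_carrier by simp
 note mod = modification[OF M Y a, folded L_def W_def]
 have sL: "Osub L" using lattice_sub[OF mod(1)] .
 note smL = mm_sub[OF sL]
 have W: "Osub W" "mm M \<subseteq> W" "W \<subseteq> M"
  using reduction_between(1)[OF M Y] unfolding between_def W_def by auto
 show WF: "W \<inter> ?F = (L \<inter> ?F) \<uplus> (mm M \<inter> ?F)"
  by (rule reduction_Int[OF M F sL mod(4) W(2,1)]) (use adm i in \<open>auto simp: adm_def L_def W_def\<close>)
 let ?N = "L \<inter> mm M"
 have LM: "L \<subseteq> M" using mod(4) W by blast
 have mLM: "mm L \<subseteq> mm M" using mm_mono LM by blast
 have s: "Osub (?N \<inter> ?F)" "Osub (L \<inter> ?F)" "Osub (mm M \<inter> ?F)" "Osub (mm L \<inter> ?F)" "Osub (W \<inter> ?F)" "Osub (M \<inter> ?F)"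
  using VO.sub_Int sL smM(1) smL(1) FO W(1) sM by auto
 have e0: "(L \<inter> ?F) \<inter> (mm M \<inter> ?F) = ?N \<inter> ?F" by auto
 have "VO.fin (mm M \<inter> ?F) (W \<inter> ?F)" using between_fin(2)[OF M _ F] W between_def by blast
 then have e1: "VO.rk (?N \<inter> ?F) (L \<inter> ?F) = VO.rk (mm M \<inter> ?F) (W \<inter> ?F)"
  using VO.second_iso(3)[OF s(2,3)] unfolding e0 WF[symmetric] by blast
 have e2: "VO.rk (mm L \<inter> ?F) (L \<inter> ?F) = VO.rk (mm L \<inter> ?F) (?N \<inter> ?F) + VO.rk (?N \<inter> ?F) (L \<inter> ?F)"
  and fN: "VO.fin (mm L \<inter> ?F) (?N \<inter> ?F)"
  using VO.rk_between[OF lattice_finI[OF mod(1) F] s(1)] smL(2) mLM by auto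
 have e3: "VO.rk (mm M \<inter> ?F) (M \<inter> ?F) = VO.rk (mm M \<inter> ?F) (W \<inter> ?F) + VO.rk (W \<inter> ?F) (M \<inter> ?F)"
  and fW: "VO.fin (W \<inter> ?F) (M \<inter> ?F)"
  using VO.rk_between[OF lattice_finI[OF M F] s(5)] W by auto
 let ?S = "scale a (M \<inter> ?F)"
 have S: "Osub ?S" using scale_sub[OF s(6) aK] .
 have SF: "?S = scale a M \<inter> ?F" using scale_Int[OF sM F aK a(2)] .
 have "?S \<inter> (mm L \<inter> ?F) = scale a W \<inter> ?F" unfolding SF mod(2)[symmetric] by auto
 then have "?S \<inter> (mm L \<inter> ?F) = scale a (W \<inter> ?F)" using scale_Int[OF W(1) F aK a(2)] by simp
 then have e4: "VO.rk (mm L \<inter> ?F) (?S \<uplus> (mm L \<inter> ?F)) = VO.rk (W \<inter> ?F) (M \<inter> ?F)"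
  using VO.second_iso(3)[OF S s(4)] rk_scale[OF aK a(2) fW] by auto
 have SN: "?S \<uplus> (mm L \<inter> ?F) \<subseteq> ?N \<inter> ?F"
 proof (rule VO.sum_least[OF s(1)])
  have "scale a M \<subseteq> L \<inter> mm M" unfolding mod(3)
   using VO.sum_upper2[OF smL(1) scale_sub[OF sM aK]] .
  then show "?S \<subseteq> ?N \<inter> ?F" unfolding SF by blast
  show "mm L \<inter> ?F \<subseteq> ?N \<inter> ?F" using smL mLM by blast
 qed
 have "?S \<uplus> (mm L \<inter> ?F) = ?N \<inter> ?F"
 proof (rule VO.rk_eq_imp_eq[OF fN VO.sub_sum[OF S s(4)] VO.sum_upper2[OF S s(4)] SN])
  show "VO.rk (mm L \<inter> ?F) (?N \<inter> ?F) \<le> VO.rk (mm L \<inter> ?F) (?S \<uplus> (mm L \<inter> ?F))"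
   using e1 e2 e3 e4 lattice_rank[OF mod(1) F] lattice_rank[OF M F] by simp
 qed
 then show "?N \<inter> ?F = ?S \<uplus> (mm L \<inter> ?F)" by simp
qed

text \<open>U/mL is cut along the extension of W/mM by M/W: its image in M/mM, and P/W for its
  intersection with the kernel. W lies in P because aW lies in mL. The premise on the kernel holds
  for G = V as well as for each \<open>F i\<close>.\<close>

lemma modification_rank:
 assumes M: "lattice M" and Y: "sub Y" and a: "a \<in> m" "a \<noteq> \<zero>" and G: "sub G"
 defines "L \<equiv> (M \<inter> Y) \<uplus> scale a M" and "W \<equiv> (M \<inter> Y) \<uplus> mm M"
 assumes ker: "L \<inter> mm M \<inter> G = scale a (M \<inter> G) \<uplus> (mm L \<inter> G)"
  and U: "between L U"
 defines "P \<equiv> {x \<in> M. a \<cdot> x \<in> U}"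
 shows "Osub P" "W \<subseteq> P" "P \<subseteq> M"
  and "VO.rk (mm L \<inter> G) (U \<inter> G) = VO.rk (mm M \<inter> G) ((U \<inter> G) \<uplus> (mm M \<inter> G)) + VO.rk (W \<inter> G) (P \<inter> G)"
  and "VO.fin (mm M \<inter> G) ((U \<inter> G) \<uplus> (mm M \<inter> G))"
proof -
 have sM: "Osub M" using lattice_sub M by simp
 note smM = mm_sub[OF sM]
 have aK: "a \<in> carrier K" "a \<in> \<O>" using a m_carrier m_O by auto
 note mod = modification[OF M Y a, folded L_def W_def]
 have sL: "Osub L" using lattice_sub[OF mod(1)] .
 note smL = mm_sub[OF sL]
 have W: "Osub W" "mm M \<subseteq> W" "W \<subseteq> M"
  using reduction_between(1)[OF M Y] unfolding between_def W_def by auto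
 have U': "Osub U" "mm L \<subseteq> U" "U \<subseteq> L" using U unfolding between_def by auto
 show P: "Osub P"
 proof (rule OsubI)
  note c = VO.sub_carrier[OF sM]
  show "P \<subseteq> carrier V" unfolding P_def using c by blast
  show "0\<^sub>V \<in> P" unfolding P_def using VO.sub_zero[OF sM] VO.sub_zero[OF U'(1)] aK by simp
  show "x \<boxplus> y \<in> P" if "x \<in> P" "y \<in> P" for x y
   using that VO.sub_add[OF sM] VO.sub_add[OF U'(1)] c aK unfolding P_def by (simp add: smult_r_distr)
  show "r \<cdot> x \<in> P" if r: "r \<in> \<O>" and x: "x \<in> P" for r x
  proof -
   have "a \<cdot> (r \<cdot> x) = r \<cdot> (a \<cdot> x)"
    using x c aK O_carrier[OF r] unfolding P_def by (simp add: smult_assoc1[symmetric] R.m_comm)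
   then show ?thesis using Osub_smult[OF sM r] Osub_smult[OF U'(1) r] x unfolding P_def by simp
  qed
 qed
 show PM: "P \<subseteq> M" unfolding P_def by blast
 show WP: "W \<subseteq> P"
 proof
  fix x assume x: "x \<in> W"
  then have "a \<cdot> x \<in> mm L" using mod(2) scaleI[of x W a] by blast
  then show "x \<in> P" unfolding P_def using x W U' by blast
 qed
 have LM: "L \<subseteq> M" using mod(4) W by blast
 have mLM: "mm L \<subseteq> mm M" using mm_mono LM by blast
 note OG = sub_Osub[OF G]
 have s: "Osub (U \<inter> G)" "Osub (mm M \<inter> G)" "Osub (mm L \<inter> G)" "Osub (U \<inter> mm M \<inter> G)" "Osub (P \<inter> G)" "Osub (M \<inter> G)"
  using VO.sub_Int U'(1) smM(1) smL(1) OG P sM by auto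
 note fU = between_fin(2)[OF mod(1) U G]
 have e1: "VO.fin (U \<inter> mm M \<inter> G) (U \<inter> G)" "VO.fin (mm L \<inter> G) (U \<inter> mm M \<inter> G)"
  "VO.rk (mm L \<inter> G) (U \<inter> G) = VO.rk (mm L \<inter> G) (U \<inter> mm M \<inter> G) + VO.rk (U \<inter> mm M \<inter> G) (U \<inter> G)"
  using VO.rk_between[OF fU s(4)] U' mLM by auto
 have "(U \<inter> G) \<inter> (mm M \<inter> G) = U \<inter> mm M \<inter> G" by auto
 then have e2: "VO.rk (U \<inter> mm M \<inter> G) (U \<inter> G) = VO.rk (mm M \<inter> G) ((U \<inter> G) \<uplus> (mm M \<inter> G))"
  and f2: "VO.fin (mm M \<inter> G) ((U \<inter> G) \<uplus> (mm M \<inter> G))"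
  using VO.second_iso[OF s(1,2)] e1(1) by auto
 show "VO.fin (mm M \<inter> G) ((U \<inter> G) \<uplus> (mm M \<inter> G))" by (rule f2)
 let ?S = "scale a (M \<inter> G)" and ?SP = "scale a (P \<inter> G)"
 have S: "Osub ?S" "Osub ?SP" using scale_sub s aK by auto
 have SU: "?S \<inter> U = ?SP" unfolding P_def scale_def by auto
 have "U \<inter> mm M \<inter> G = ((mm L \<inter> G) \<uplus> ?S) \<inter> U"
  using ker U'(3) VO.sum_comm[OF S(1) s(3)] by auto
 also have "\<dots> = (mm L \<inter> G) \<uplus> ?SP"
  unfolding SU[symmetric] using VO.modular_law[OF s(3) S(1) U'(1)] U'(2) by blast
 finally have e3: "U \<inter> mm M \<inter> G = ?SP \<uplus> (mm L \<inter> G)" using VO.sum_comm[OF S(2) s(3)] by simp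
 have cc: "W \<subseteq> carrier V" "P \<inter> G \<subseteq> carrier V" using VO.sub_subset W(1) s(5) by auto
 have "?SP \<subseteq> scale a M" "?SP \<subseteq> G"
  using scale_mono[of "P \<inter> G" M a] PM sub_smult[OF G aK(1)] unfolding scale_def by auto
 then have "?SP \<inter> (mm L \<inter> G) = ?SP \<inter> (scale a M \<inter> mm L)" by blast
 also have "\<dots> = scale a ((P \<inter> G) \<inter> W)" unfolding mod(2) using scale_Int2[OF aK(1) a(2) cc(2,1)] by simp
 also have "(P \<inter> G) \<inter> W = W \<inter> G" using WP by blast
 finally have e4: "?SP \<inter> (mm L \<inter> G) = scale a (W \<inter> G)" .
 have fWP: "VO.fin (W \<inter> G) (P \<inter> G)"
 proof -
  have "VO.fin W M" using VO.rk_between(2)[OF lattice_fin[OF M] W] .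
  then have "VO.fin W P" using VO.rk_between(1) P WP PM by blast
  then show ?thesis using VO.rk_split(1)[OF _ OG] by blast
 qed
 have "VO.rk (mm L \<inter> G) (U \<inter> mm M \<inter> G) = VO.rk (W \<inter> G) (P \<inter> G)"
  unfolding e3 using VO.second_iso(3)[OF S(2) s(3)] e4 rk_scale[OF aK(1) a(2) fWP] by auto
 then show "VO.rk (mm L \<inter> G) (U \<inter> G) = VO.rk (mm M \<inter> G) ((U \<inter> G) \<uplus> (mm M \<inter> G)) + VO.rk (W \<inter> G) (P \<inter> G)"
  using e1(3) e2 by simp
qed

text \<open>Admissibility has to be tested only on finitely many lifted generators of the W \<inter>
  \<open>F i\<close>. Their orders, together with b, have a common divisor that is one of them; b is
  included so that the order found divides it.\<close>

lemma adm_from_generators: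
 assumes M: "lattice M" and Y: "sub Y" and a: "a \<in> carrier K"
  and U: "\<And>i. i \<in> Idx \<Longrightarrow> Osub (U i) \<and> U i \<subseteq> ((M \<inter> Y) \<uplus> mm M) \<inter> F i
   \<and> ((M \<inter> Y) \<uplus> mm M) \<inter> F i \<subseteq> (mm M \<inter> F i) \<uplus> U i"
  and c: "\<And>i x. \<lbrakk>i \<in> Idx; x \<in> U i\<rbrakk> \<Longrightarrow> \<exists>c\<in>J. x \<in> (M \<inter> Y) \<uplus> scale (a \<otimes> c) M"
  and J: "J \<subseteq> carrier K" "b \<in> J"
 shows "\<exists>c\<in>J. adm M Y (a \<otimes> c) \<and> (\<exists>r\<in>\<O>. b = r \<otimes> c)"
proof -
 have sM: "Osub M" using lattice_sub M by simp
 note smM = mm_sub[OF sM]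
 let ?W = "(M \<inter> Y) \<uplus> mm M"
 have "\<exists>xs. set xs \<subseteq> U i \<and> VO.ext (mm M \<inter> F i) xs = ?W \<inter> F i" if i: "i \<in> Idx" for i
  using VO.dm_gens_in[OF VO.dm_rk[OF between_fin(2)[OF M reduction_between(1)[OF M Y] F_sub[OF i]]]] U[OF i]
  by blast
 then obtain xs where xs: "\<And>i. i \<in> Idx \<Longrightarrow> set (xs i) \<subseteq> U i \<and> VO.ext (mm M \<inter> F i) (xs i) = ?W \<inter> F i"
  by metis
 let ?T = "\<Union>i\<in>Idx. set (xs i)"
 have "\<forall>x\<in>?T. \<exists>c\<in>J. x \<in> (M \<inter> Y) \<uplus> scale (a \<otimes> c) M" using xs c by blast
 then obtain cf where cf: "\<And>x. x \<in> ?T \<Longrightarrow> cf x \<in> J \<and> x \<in> (M \<inter> Y) \<uplus> scale (a \<otimes> cf x) M" by metis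
 have "finite (insert b (cf ` ?T))" using finite_Idx by auto
 moreover have "insert b (cf ` ?T) \<subseteq> J" using cf J by auto
 ultimately obtain e where e: "e \<in> J" "\<forall>x\<in>insert b (cf ` ?T). \<exists>r\<in>\<O>. x = r \<otimes> e"
  using common_divisor[of "insert b (cf ` ?T)"] J(1) by blast
 have eK: "e \<in> carrier K" using e J by blast
 have sY: "Osub (M \<inter> Y)" using VO.sub_Int sM sub_Osub Y by auto
 have "adm M Y (a \<otimes> e)"
  unfolding adm_def
 proof
  fix i assume i: "i \<in> Idx"
  note FO = sub_Osub[OF F_sub[OF i]]
  let ?L = "(M \<inter> Y) \<uplus> scale (a \<otimes> e) M"
  have L: "Osub ?L" using VO.sub_sum[OF sY scale_sub[OF sM]] a eK by simp
  have FL: "Osub (F i \<inter> ?L)" using VO.sub_Int[OF FO L] .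
  let ?C = "(F i \<inter> ?L) \<uplus> mm M"
  have C: "Osub ?C" "F i \<inter> ?L \<subseteq> ?C" "mm M \<subseteq> ?C"
   using VO.sub_sum[OF FL smM(1)] VO.sum_upper1[OF FL smM(1)] VO.sum_upper2[OF FL smM(1)] by auto
  have "set (xs i) \<subseteq> F i \<inter> ?L"
  proof
   fix x assume x: "x \<in> set (xs i)"
   then have xT: "x \<in> ?T" using i by blast
   then obtain r where r: "r \<in> \<O>" "cf x = r \<otimes> e" using e by blast
   have "a \<otimes> cf x = r \<otimes> (a \<otimes> e)" using r a eK O_carrier by (simp add: R.m_lcomm)
   then have "scale (a \<otimes> cf x) M \<subseteq> scale (a \<otimes> e) M" using scale_dvd[OF sM _ r(1), of "a \<otimes> e"] a eK by simp
   then have "x \<in> ?L" using cf[OF xT] VO.sum_mono[OF subset_refl] by blast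
   then show "x \<in> F i \<inter> ?L" using x xs[OF i] U[OF i] by blast
  qed
  then show "?W \<inter> F i \<subseteq> ?C"
   using VO.ext_least[OF C(1), of "mm M \<inter> F i" "xs i"] C xs[OF i] by blast
 qed
 then show ?thesis using e by blast
qed

lemma adm_exists:
 assumes M: "lattice M" and Y: "sub Y"
 shows "\<exists>c\<in>m. adm M Y c"
proof -
 have sM: "Osub M" using lattice_sub M by simp
 note smM = mm_sub[OF sM]
 let ?W = "(M \<inter> Y) \<uplus> mm M"
 have W: "Osub ?W" "mm M \<subseteq> ?W" using reduction_between(1)[OF M Y] unfolding between_def by auto
 have "\<exists>c\<in>m. adm M Y (\<one> \<otimes> c) \<and> (\<exists>r\<in>\<O>. \<zero> = r \<otimes> c)"
 proof (rule adm_from_generators[OF M Y, where U = "\<lambda>i. ?W \<inter> F i"])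
  fix i assume i: "i \<in> Idx"
  note FO = sub_Osub[OF F_sub[OF i]]
  show "Osub (?W \<inter> F i) \<and> ?W \<inter> F i \<subseteq> ?W \<inter> F i \<and> ?W \<inter> F i \<subseteq> (mm M \<inter> F i) \<uplus> (?W \<inter> F i)"
   using VO.sub_Int[OF W(1) FO] VO.sum_upper2[OF VO.sub_Int[OF smM(1) FO] VO.sub_Int[OF W(1) FO]] by blast
  fix x assume "x \<in> ?W \<inter> F i"
  then obtain y c w where x: "y \<in> M \<inter> Y" "c \<in> m" "w \<in> M" "x = y \<boxplus> c \<cdot> w"
   by (auto simp: mem_sum mm_def)
  then have "x \<in> (M \<inter> Y) \<uplus> scale (\<one> \<otimes> c) M" using sumI[OF x(1) scaleI[OF x(3)]] m_carrier by simp
  then show "\<exists>c\<in>m. x \<in> (M \<inter> Y) \<uplus> scale (\<one> \<otimes> c) M" using x by blast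
 qed (use m_carrier zero_m in auto)
 then obtain c where "c \<in> m" "adm M Y (\<one> \<otimes> c)" by blast
 then show ?thesis using m_carrier by (intro bexI[of _ c]) auto
qed

text \<open>Modulo 0 the generators of each W \<inter> \<open>F i\<close> come from Y \<inter>
  \<open>F i\<close> itself, so W has no larger degree than Y. For semistable V this excludes 0 from
  the moduli to which a W of positive degree lifts.\<close>

lemma adm_zero:
 assumes M: "lattice M" and Y: "sub Y" and adm: "adm M Y \<zero>"
 shows "degO M ((M \<inter> Y) \<uplus> mm M) \<le> degK Y"
proof -
 have sM: "Osub M" using lattice_sub M by simp
 note smM = mm_sub[OF sM]
 let ?W = "(M \<inter> Y) \<uplus> mm M"
 have sY: "Osub (M \<inter> Y)" using VO.sub_Int sM sub_Osub Y by auto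
 have W: "Osub ?W" "mm M \<subseteq> ?W" "M \<inter> Y \<subseteq> ?W"
  using reduction_between(1)[OF M Y] VO.sum_upper1[OF sY smM(1)] unfolding between_def by auto
 have "scale \<zero> M = {0\<^sub>V}"
  using VO.sub_zero[OF sM] VO.sub_carrier[OF sM] unfolding scale_def by force
 then have L: "(M \<inter> Y) \<uplus> scale \<zero> M = M \<inter> Y"
  using VO.sum_absorb1[OF sY VO.sub_zero_set] VO.sub_zero[OF sY] by simp
 have "VO.rk (mm M \<inter> F i) (?W \<inter> F i) = dimK (Y \<inter> F i)" if i: "i \<in> Idx" for i
 proof -
  note F = F_sub[OF i]
  have "?W \<inter> F i \<subseteq> (F i \<inter> (M \<inter> Y)) \<uplus> mm M" using adm i unfolding adm_def L by blast
  then have "?W \<inter> F i = (M \<inter> Y \<inter> F i) \<uplus> (mm M \<inter> F i)"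
   using reduction_Int[OF M F sY W(3,2,1)] by blast
  then show ?thesis using rank_reduction(2)[OF M sub_Int[OF Y F] F] by (simp add: Int_assoc)
 qed
 then show ?thesis unfolding degO_def degK_def using reduction_between(2)[OF M Y] by simp
qed

text \<open>If no lattice has a smaller maximal degree, then the maximiser \<open>U\<close> on the modified lattice
 is a lift of \<open>W\<close>, which improves the admissibility of \<open>Y\<close>.\<close>

lemma langton:
 assumes M: "lattice M" and Y: "sub Y"
 defines "W \<equiv> (M \<inter> Y) \<uplus> mm M"
 assumes max: "\<And>X. between M X \<Longrightarrow> degO M X \<le> degO M W"
  and min: "\<And>L. lattice L \<Longrightarrow> \<exists>X. between L X \<and> degO M W \<le> degO L X"
  and a: "a \<in> m" "a \<noteq> \<zero>" and adm: "adm M Y a"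
 shows "\<exists>Y' c. sub Y' \<and> (M \<inter> Y') \<uplus> mm M = W \<and> c \<in> m \<and> c \<noteq> \<zero> \<and> adm M Y' (a \<otimes> c)
  \<and> (M \<inter> Y') \<uplus> scale a M = (M \<inter> Y) \<uplus> scale a M"
proof -
 have sM: "Osub M" using lattice_sub M by simp
 note smM = mm_sub[OF sM]
 have aK: "a \<in> carrier K" "a \<in> \<O>" using a m_carrier m_O by auto
 have cM: "mm M \<inter> carrier V = mm M" "M \<inter> carrier V = M" using VO.sub_subset smM(1) sM by auto
 define L where "L = (M \<inter> Y) \<uplus> scale a M"
 note mod = modification[OF M Y a, folded L_def W_def]
 have sL: "Osub L" using lattice_sub[OF mod(1)] .
 note smL = mm_sub[OF sL]
 have cL: "mm L \<inter> carrier V = mm L" "L \<inter> mm M \<inter> carrier V = L \<inter> mm M"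
  using VO.sub_subset smM(1) smL(1) by auto
 have bW: "between M W" using reduction_between(1)[OF M Y] W_def by simp
 have W: "Osub W" "mm M \<subseteq> W" "W \<subseteq> M" using bW unfolding between_def by auto
 obtain U where U: "between L U" "degO M W \<le> degO L U" using min[OF mod(1)] by blast
 have U': "Osub U" "mm L \<subseteq> U" "U \<subseteq> L" using U unfolding between_def by auto
 have cU: "U \<inter> carrier V = U" using VO.sub_subset U' by auto
 \<comment> \<open>aP is the part of U inside aM. Thus U is made of its image X in M/mM, which lies
   in W, and of P, which contains W.\<close>
 define P where "P = {x \<in> M. a \<cdot> x \<in> U}"
 have kerV: "L \<inter> mm M \<inter> carrier V = scale a (M \<inter> carrier V) \<uplus> (mm L \<inter> carrier V)"
  using mod(3) cL cM VO.sum_comm[OF smL(1) scale_sub[OF sM aK(1)]] by simp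
 note rV = modification_rank[OF M Y a sub_carrier_set, folded L_def W_def, OF kerV U(1), folded P_def]
 have rF: "VO.rk (mm L \<inter> F i) (U \<inter> F i) = VO.rk (mm M \<inter> F i) ((U \<inter> F i) \<uplus> (mm M \<inter> F i)) + VO.rk (W \<inter> F i) (P \<inter> F i)"
  if i: "i \<in> Idx" for i
  using modification_rank(4)[OF M Y a F_sub[OF i], folded L_def W_def, OF _ U(1), folded P_def]
   adm_kernel(2)[OF M Y a adm i, folded L_def W_def] by blast
 define X where "X = U \<uplus> mm M"
 have UW: "U \<subseteq> W" using U' mod(4) by blast
 have X: "Osub X" "mm M \<subseteq> X" "X \<subseteq> W" "U \<subseteq> X"
  unfolding X_def using VO.sub_sum[OF U'(1) smM(1)] VO.sum_upper2[OF U'(1) smM(1)] VO.sum_upper1[OF U'(1) smM(1)]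
   VO.sum_least[OF W(1) UW W(2)] by auto
 have bX: "between M X" and bP: "between M P" using X W rV(1-3) unfolding between_def by auto
 let ?u = "\<lambda>i. VO.rk (mm M \<inter> F i) ((U \<inter> F i) \<uplus> (mm M \<inter> F i))"
 have UF: "Osub ((U \<inter> F i) \<uplus> (mm M \<inter> F i))" "mm M \<inter> F i \<subseteq> (U \<inter> F i) \<uplus> (mm M \<inter> F i)"
   "(U \<inter> F i) \<uplus> (mm M \<inter> F i) \<subseteq> X \<inter> F i" if i: "i \<in> Idx" for i
 proof -
  note FO = sub_Osub[OF F_sub[OF i]]
  note s = VO.sub_Int[OF U'(1) FO] VO.sub_Int[OF smM(1) FO]
  show "Osub ((U \<inter> F i) \<uplus> (mm M \<inter> F i))" "mm M \<inter> F i \<subseteq> (U \<inter> F i) \<uplus> (mm M \<inter> F i)"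
   using VO.sub_sum[OF s] VO.sum_upper2[OF s] by auto
  show "(U \<inter> F i) \<uplus> (mm M \<inter> F i) \<subseteq> X \<inter> F i"
   by (rule VO.sum_least[OF VO.sub_Int[OF X(1) FO]]) (use X(2,4) in auto)
 qed
 have le: "?u i \<le> VO.rk (mm M \<inter> F i) (X \<inter> F i)" if i: "i \<in> Idx" for i
  using VO.rk_mono[OF between_fin(2)[OF M bX F_sub[OF i]] UF[OF i]] .
 have rPF: "VO.rk (mm M \<inter> F i) (P \<inter> F i) = VO.rk (mm M \<inter> F i) (W \<inter> F i) + VO.rk (W \<inter> F i) (P \<inter> F i)"
  if i: "i \<in> Idx" for i
  using VO.rk_between(3)[OF between_fin(2)[OF M bP F_sub[OF i]] VO.sub_Int[OF W(1) sub_Osub[OF F_sub[OF i]]]]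
   W rV(2) by blast
 have rP: "VO.rk (mm M) P = VO.rk (mm M) W + VO.rk W P"
  using VO.rk_between(3)[OF between_fin(1)[OF M bP] W(1,2) rV(2)] .
 have cWP: "W \<inter> carrier V = W" "P \<inter> carrier V = P" using VO.sub_subset W(1) rV(1) by auto
 have rU: "VO.rk (mm L) U = VO.rk (mm M) X + VO.rk W P"
  using rV(4) unfolding cU cM cL cWP X_def .
 let ?S = "\<lambda>g. (\<Sum>i\<in>Idx. int (g i))"
 let ?rX = "\<lambda>i. VO.rk (mm M \<inter> F i) (X \<inter> F i)"
 have "?S (\<lambda>i. VO.rk (mm L \<inter> F i) (U \<inter> F i)) = ?S ?u + (?S (\<lambda>i. VO.rk (mm M \<inter> F i) (P \<inter> F i)) - ?S (\<lambda>i. VO.rk (mm M \<inter> F i) (W \<inter> F i)))"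
  unfolding sum.distrib[symmetric] sum_subtractf[symmetric] by (rule sum.cong) (use rF rPF in auto)
 \<comment> \<open>The last term is what U loses in the \<open>F i\<close> against its image. X and
   P have degree at most that of W, and U at least that, so all three degrees agree and nothing is
   lost.\<close>
 then have dU: "degO L U = degO M X + degO M P - degO M W - \<alpha> * (?S ?rX - ?S ?u)"
  unfolding degO_def rU rP by (simp only:) (simp add: algebra_simps)
 have Sle: "?S ?u \<le> ?S ?rX" by (rule ordered_comm_monoid_add_class.sum_mono) (use le in auto)
 then have "0 \<le> \<alpha> * (?S ?rX - ?S ?u)" using \<alpha>_pos by simp
 then have eqs: "degO M X = degO M W" "degO M P = degO M W" "\<alpha> * (?S ?rX - ?S ?u) = 0"
  using dU U(2) max[OF bX] max[OF bP] by linarith+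
 have XW: "X = W" using nested_eq[OF M bX bW X(3) eqs(1)] .
 have PW: "P = W" using nested_eq[OF M bW bP rV(2)] eqs(2) by simp
 have Seq: "?S ?rX = ?S ?u" using eqs(3) \<alpha>_pos by simp
 have "?u i = ?rX i" if i: "i \<in> Idx" for i
 proof (rule ccontr)
  assume "?u i \<noteq> ?rX i"
  then have "?u i < ?rX i" using le[OF i] by simp
  then have "?S ?u < ?S ?rX" using le finite_Idx i by (intro sum_strict_mono_ex1) auto
  then show False using Seq by simp
 qed
 then have UFW: "(U \<inter> F i) \<uplus> (mm M \<inter> F i) = W \<inter> F i" if i: "i \<in> Idx" for i
  using VO.rk_eq_imp_eq[OF between_fin(2)[OF M bX F_sub[OF i]] UF[OF i]] i XW by simp
 have "L \<inter> {0\<^sub>V} \<subseteq> U" using VO.sub_zero[OF U'(1)] by auto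
 \<comment> \<open>U is lifted through the lattice L. That X and P both equal W says that U/mL maps
   isomorphically to W/mM, so Y' also has the right dimension to lift W through M.\<close>
 then obtain Y' where Y': "sub Y'" "(L \<inter> Y') \<uplus> mm L = U" "dimK Y' = VO.rk (mm L) U"
  using lift_subspace_carrier[OF mod(1) sub_zero_set U'(1) _ U'(2,3)] by blast
 have LM: "L \<subseteq> M" using mod(4) W by blast
 have mLM: "mm L \<subseteq> mm M" using mm_mono LM by blast
 have sLY: "Osub (L \<inter> Y')" "Osub (M \<inter> Y')" using VO.sub_Int sL sM sub_Osub Y' by auto
 have LYW: "(L \<inter> Y') \<uplus> mm M = W"
  using XW VO.sum_assoc[OF sLY(1) smL(1) smM(1)] VO.sum_absorb2[OF smL(1) smM(1) mLM] Y'(2) unfolding X_def by simp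
 have "VO.rk W W = 0" using VO.rk_self(2)[OF W(1)] .
 then have dY': "dimK Y' = VO.rk (mm M) W" using Y'(3) rU XW PW by simp
 note bY' = reduction_between[OF M Y'(1)]
 have MYW: "(M \<inter> Y') \<uplus> mm M = W"
 proof -
  have "W \<subseteq> (M \<inter> Y') \<uplus> mm M" unfolding LYW[symmetric] by (rule VO.sum_mono) (use LM in auto)
  then show ?thesis
   using VO.rk_eq_imp_eq[OF between_fin(1)[OF M bY'(1)] W(1,2)] bY'(2) dY' by simp
 qed
 have LYM: "L \<inter> Y' = M \<inter> Y'"
 proof (rule nakayama[OF M Y'(1) sLY(1)])
  show "L \<inter> Y' \<subseteq> M \<inter> Y'" using LM by blast
  show "M \<inter> Y' \<subseteq> (L \<inter> Y') \<uplus> mm M"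
   unfolding LYW using VO.sum_upper1[OF sLY(2) smM(1)] MYW by simp
 qed
 have S: "Osub (scale a M)" using scale_sub[OF sM aK(1)] .
 have sY: "Osub (M \<inter> Y)" using VO.sub_Int sM sub_Osub Y by auto
 have SL: "scale a M \<subseteq> L" "M \<inter> Y \<subseteq> L"
  unfolding L_def using VO.sum_upper2[OF sY S] VO.sum_upper1[OF sY S] by auto
 define N where "N = (M \<inter> Y') \<uplus> scale a M"
 have N: "Osub N" "M \<inter> Y' \<subseteq> N" "scale a M \<subseteq> N"
  unfolding N_def using VO.sub_sum[OF sLY(2) S] VO.sum_upper1[OF sLY(2) S] VO.sum_upper2[OF sLY(2) S] by auto
 \<comment> \<open>Y' and Y define the same modified lattice, so they agree modulo a.\<close>
 have NL: "N = L"
 proof (rule nakayama_carrier[OF mod(1) N(1)])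
  show "N \<subseteq> L" unfolding N_def using VO.sum_least[OF sL _ SL(1)] LYM by blast
  have NmL: "Osub (N \<uplus> mm L)" "N \<subseteq> N \<uplus> mm L" "mm L \<subseteq> N \<uplus> mm L"
   using VO.sub_sum[OF N(1) smL(1)] VO.sum_upper1[OF N(1) smL(1)] VO.sum_upper2[OF N(1) smL(1)] by auto
  have "M \<inter> Y \<subseteq> N \<uplus> mm L"
  proof
   fix y assume y: "y \<in> M \<inter> Y"
   then have "y \<in> (M \<inter> Y') \<uplus> mm M" using MYW W_def VO.sum_upper1[OF sY smM(1)] by blast
   then obtain u w where u: "u \<in> M \<inter> Y'" "w \<in> mm M" "y = u \<boxplus> w" by (auto simp: mem_sum)
   have "w \<in> L" using VO.sub_cancel[OF sL, of u w] u y LYM SL VO.sub_carrier[OF smM(1)] by blast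
   then have "w \<in> mm L \<uplus> scale a M" using mod(3) u by blast
   moreover have "mm L \<uplus> scale a M \<subseteq> N \<uplus> mm L"
    by (rule VO.sum_least[OF NmL(1,3)]) (use N NmL in blast)
   ultimately show "y \<in> N \<uplus> mm L" using u N NmL VO.sub_add[OF NmL(1)] by blast
  qed
  then show "L \<subseteq> N \<uplus> mm L" 
   using VO.sum_least[OF NmL(1), of "M \<inter> Y" "scale a M"] N NmL unfolding L_def by blast
 qed
 have "\<exists>c\<in>m. adm M Y' (a \<otimes> c) \<and> (\<exists>r\<in>\<O>. a = r \<otimes> c)"
 proof (rule adm_from_generators[OF M Y'(1) aK(1), where U = "\<lambda>i. U \<inter> F i"])
  fix i assume i: "i \<in> Idx"
  note FO = sub_Osub[OF F_sub[OF i]]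
  note s = VO.sub_Int[OF U'(1) FO] VO.sub_Int[OF smM(1) FO]
  show "Osub (U \<inter> F i) \<and> U \<inter> F i \<subseteq> ((M \<inter> Y') \<uplus> mm M) \<inter> F i
   \<and> ((M \<inter> Y') \<uplus> mm M) \<inter> F i \<subseteq> (mm M \<inter> F i) \<uplus> (U \<inter> F i)"
   unfolding MYW UFW[OF i, symmetric] using s VO.sum_comm[OF s] VO.sum_upper1[OF s] by simp
  fix x assume "x \<in> U \<inter> F i"
  \<comment> \<open>The gain in order: x is congruent to Y' modulo c L, and L is congruent to Y'
    modulo aM, so x is congruent to Y' modulo ac M.\<close>
  then have "x \<in> (L \<inter> Y') \<uplus> mm L" using Y'(2) by simp
  then obtain y c l where x: "y \<in> M \<inter> Y'" "c \<in> m" "l \<in> L" "x = y \<boxplus> c \<cdot> l"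
   using LYM by (auto simp: mem_sum mm_def)
  obtain z t where z: "z \<in> M \<inter> Y'" "t \<in> M" "l = z \<boxplus> a \<cdot> t"
   using x(3) unfolding NL[symmetric] N_def by (auto simp: mem_sum scale_def)
  have cK: "c \<in> carrier K" "c \<in> \<O>" using x m_carrier m_O by auto
  have car: "y \<in> carrier V" "z \<in> carrier V" "t \<in> carrier V" using x z VO.sub_carrier[OF sM] by auto
  have "x = (y \<boxplus> c \<cdot> z) \<boxplus> (a \<otimes> c) \<cdot> t"
   unfolding x(4) z(3) using car cK aK by (simp add: smult_r_distr M.a_assoc smult_assoc1[symmetric] R.m_comm)
  moreover have "y \<boxplus> c \<cdot> z \<in> M \<inter> Y'" using VO.sub_add[OF sLY(2) x(1) Osub_smult[OF sLY(2) cK(2) z(1)]] .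
  ultimately have "x \<in> (M \<inter> Y') \<uplus> scale (a \<otimes> c) M" using sumI scaleI z by metis
  then show "\<exists>c\<in>m. x \<in> (M \<inter> Y') \<uplus> scale (a \<otimes> c) M" using x by blast
 qed (use a m_carrier in auto)
 then obtain c r where c: "c \<in> m" "adm M Y' (a \<otimes> c)" "r \<in> \<O>" "a = r \<otimes> c" by blast
 \<comment> \<open>This is the purpose of passing a as the element that the order must
   divide.\<close>
 have "c \<noteq> \<zero>" using c a O_carrier by auto
 then show ?thesis using Y' MYW c NL unfolding N_def L_def by blast
qed

end

section \<open>Doubling the order of admissibility\<close>

text \<open>The product is taken over the whole index type, so that tuples of vectors over a finite
  set and families indexed by S are instances of one module. Multiplication and unit are
  placeholders of the record.\<close>

definition pw :: "('a, 'b, 'k) module_scheme \<Rightarrow> ('a, 'j \<Rightarrow> 'b) module" where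
 "pw M = \<lparr>carrier = {f. \<forall>j. f j \<in> carrier M}, mult = undefined, one = undefined,
   zero = (\<lambda>_. \<zero>\<^bsub>M\<^esub>), add = (\<lambda>f g j. f j \<oplus>\<^bsub>M\<^esub> g j), smult = (\<lambda>r f j. r \<odot>\<^bsub>M\<^esub> f j)\<rparr>"

lemma pw_simps [simp]:
 "f \<in> carrier (pw M) \<longleftrightarrow> (\<forall>j. f j \<in> carrier M)"
 "\<zero>\<^bsub>pw M\<^esub> = (\<lambda>_. \<zero>\<^bsub>M\<^esub>)"
 "f \<oplus>\<^bsub>pw M\<^esub> g = (\<lambda>j. f j \<oplus>\<^bsub>M\<^esub> g j)"
 "r \<odot>\<^bsub>pw M\<^esub> f = (\<lambda>j. r \<odot>\<^bsub>M\<^esub> f j)"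
 by (simp_all add: pw_def)

lemma (in module) pw_module: "module R (pw M)"
proof (rule moduleI[OF R.cring_axioms abelian_groupI])
 fix f assume f: "f \<in> carrier (pw M)"
 show "\<exists>g\<in>carrier (pw M). g \<oplus>\<^bsub>pw M\<^esub> f = \<zero>\<^bsub>pw M\<^esub>"
  using f by (intro bexI[of _ "\<lambda>j. \<ominus>\<^bsub>M\<^esub> f j"]) (auto simp: M.l_neg)
qed (auto simp: M.a_ac smult_l_distr smult_r_distr smult_assoc1)

lemma (in local_module) pw_local_module: "local_module R (pw M) I"
 using pw_module I_carrier unit_outside by (simp add: local_module_def local_module_axioms_def)

section \<open>Best approximation by finitely generated submodules\<close>

context fd_valued_space
begin

text \<open>If instead b = r c with c nonzero, then x = r l; as x lies outside mM, r is a unit and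
  can be moved to the other side.\<close>

lemma primitive_dvd:
 assumes M: "lattice M" and x: "x \<in> M" "x \<notin> mm M" and c: "c \<in> carrier K" "b \<in> carrier K"
  and l: "l \<in> M" and e: "c \<cdot> x = b \<cdot> l"
 shows "\<exists>r\<in>\<O>. c = r \<otimes> b"
proof -
 have sM: "Osub M" using lattice_sub M by simp
 have xl: "x \<in> carrier V" "l \<in> carrier V" using x l VO.sub_carrier[OF sM] by auto
 obtain r where r: "r \<in> \<O>" "c = r \<otimes> b \<or> b = r \<otimes> c" using divide_total c by blast
 from r(2) show ?thesis
 proof
  assume b: "b = r \<otimes> c"
  show ?thesis
  proof (cases "c = \<zero>")
   case True
   then show ?thesis using O_closed(1) c by (intro bexI[of _ "\<zero>"]) auto
  next
   case False
   have rK: "r \<in> carrier K" using r O_carrier by simp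
   have "c \<cdot> x = c \<cdot> (r \<cdot> l)"
    unfolding e b using c rK xl by (simp add: smult_assoc1[symmetric] R.m_comm)
   then have "x = r \<cdot> l" using smult_inv(1)[OF c(1) False] xl rK by (metis smult_closed)
   then have "r \<notin> m" using x(2) mmI l by blast
   then have u: "r \<noteq> \<zero>" "inv r \<in> \<O>" using O_unit r by auto
   have "c = inv r \<otimes> b" unfolding b using inv_K[OF rK u(1)] c rK by (simp add: R.m_assoc[symmetric])
   then show ?thesis using u by blast
  qed
 qed (use r in blast)
qed

text \<open>A finitely generated submodule of a power of \<open>M\<close> is closed: a vector has a best approximation.
 The pivot is the entry of the generators with the coarsest divisor.\<close>

lemma best_approximation:
 fixes gs :: "('j \<Rightarrow> 'c) list" and v :: "'j \<Rightarrow> 'c"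
 assumes M: "lattice M" and J: "finite J"
  and gs: "\<And>g j. g \<in> set gs \<Longrightarrow> g j \<in> carrier V" "\<And>g j. \<lbrakk>g \<in> set gs; j \<in> J\<rbrakk> \<Longrightarrow> g j \<in> M"
  and v: "\<And>j. v j \<in> carrier V" "\<And>j. j \<in> J \<Longrightarrow> v j \<in> M"
 defines "E \<equiv> local_module.ext (K\<lparr>carrier := \<O>\<rparr>) (pw V :: ('a, 'j \<Rightarrow> 'c) module) {\<lambda>_. 0\<^sub>V}"
 defines "near \<equiv> \<lambda>gs v b. \<exists>n\<in>E gs. \<forall>j\<in>J. \<exists>l\<in>M. v j = n j \<boxplus> b \<cdot> l"
 shows "\<exists>b\<in>\<O>. near gs v b \<and> (\<forall>b'\<in>\<O>. near gs v b' \<longrightarrow> (\<exists>r\<in>\<O>. b = r \<otimes> b'))"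
proof -
 interpret PW: local_module "K\<lparr>carrier := \<O>\<rparr>" "pw V :: ('a, 'j \<Rightarrow> 'c) module" m by (rule VO.pw_local_module)
 have sM: "Osub M" using lattice_sub M by simp
 note smM = mm_sub[OF sM]
 note Mc = VO.sub_carrier[OF sM]
 have zero_sub: "PW.sub {\<lambda>_. 0\<^sub>V}" using PW.sub_zero_set by simp
 show ?thesis using gs v
 proof (induction "length gs" arbitrary: gs v rule: less_induct)
  case less
  note gs = less.prems(1,2) and v = less.prems(3,4)
  have gsc: "set gs \<subseteq> carrier (pw V)" using gs by auto
  have Esub: "PW.sub (E gs)" unfolding E_def by (rule PW.ext_sub[OF zero_sub gsc])
  have Ec: "n j \<in> carrier V" if "n \<in> E gs" for n j using PW.sub_carrier[OF Esub that] by simp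
  show ?case
  proof (cases "\<forall>g\<in>set gs. \<forall>j\<in>J. g j = 0\<^sub>V")
   case True
   have z: "n j = 0\<^sub>V" if "n \<in> E gs" "j \<in> J" for n j
   proof -
    have "PW.sub {f \<in> carrier (pw V). f j = 0\<^sub>V}"
     by (rule PW.subI) (auto simp: O_carrier)
    then have "E gs \<subseteq> {f \<in> carrier (pw V). f j = 0\<^sub>V}"
     unfolding E_def by (rule PW.ext_least) (use True gs that in auto)
    then show ?thesis using that by blast
   qed
   have "\<exists>c x. c \<in> \<O> \<and> x \<in> M \<and> v j = c \<cdot> x \<and> (c \<noteq> \<zero> \<longrightarrow> x \<notin> mm M)" if "j \<in> J" for j
   proof (cases "v j = 0\<^sub>V")
    case True
    then show ?thesis using O_closed(1) VO.sub_zero[OF sM]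
     by (intro exI[of _ "\<zero>"] exI[of _ "0\<^sub>V"]) auto
   next
    case False
    then show ?thesis using primitive_part[OF M v(1) False] v(2)[OF that] by blast
   qed
   then obtain c x where cx: "\<And>j. j \<in> J \<Longrightarrow> c j \<in> \<O> \<and> x j \<in> M \<and> v j = c j \<cdot> x j \<and> (c j \<noteq> \<zero> \<longrightarrow> x j \<notin> mm M)"
    by metis
   have "finite (insert \<zero> (c ` J))" "insert \<zero> (c ` J) \<subseteq> carrier K" using J cx O_carrier by auto
   \<comment> \<open>All generators vanish on J, so the best modulus is the common divisor of the
     contents of the entries of v. Adding 0 covers the case that v vanishes too.\<close>
   then obtain b where b: "b \<in> insert \<zero> (c ` J)" "\<forall>y\<in>insert \<zero> (c ` J). \<exists>r\<in>\<O>. y = r \<otimes> b"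
    using common_divisor[of "insert \<zero> (c ` J)"] by blast
   have bO: "b \<in> \<O>" using b cx O_closed by auto
   have "near gs v b"
    unfolding near_def
   proof (intro bexI[of _ "\<lambda>_. 0\<^sub>V"] ballI)
    show "(\<lambda>_. 0\<^sub>V) \<in> E gs" using PW.sub_zero[OF Esub] by simp
    fix j assume j: "j \<in> J"
    obtain r where r: "r \<in> \<O>" "c j = r \<otimes> b" using b j by blast
    have "v j = b \<cdot> (r \<cdot> x j)"
     using cx[OF j] r bO O_carrier Mc by (simp add: smult_assoc1[symmetric] R.m_comm)
    moreover have "r \<cdot> x j \<in> M" using Osub_smult[OF sM r(1)] cx[OF j] by blast
    ultimately show "\<exists>l\<in>M. v j = 0\<^sub>V \<boxplus> b \<cdot> l" using Mc O_carrier bO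
     by (intro bexI[of _ "r \<cdot> x j"]) auto
   qed
   moreover have "\<exists>r\<in>\<O>. b = r \<otimes> b'" if b': "b' \<in> \<O>" "near gs v b'" for b'
   proof (cases "b = \<zero>")
    case True
    then show ?thesis using O_closed(1) O_carrier[OF b'(1)] by (intro bexI[of _ "\<zero>"]) auto
   next
    case False
    then obtain j where j: "j \<in> J" "b = c j" using b by auto
    obtain n l where nl: "n \<in> E gs" "l \<in> M" "v j = n j \<boxplus> b' \<cdot> l"
     using b'(2) j(1) unfolding near_def by blast
    then have "c j \<cdot> x j = b' \<cdot> l"
     using z[OF nl(1) j(1)] cx[OF j(1)] Mc O_carrier[OF b'(1)] by simp
    then show ?thesis unfolding j(2)
     using primitive_dvd[OF M _ _ _ O_carrier[OF b'(1)] nl(2)] cx[OF j(1)] O_carrier False j(2) by blast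
   qed
   ultimately show ?thesis using bO by blast
  next
   case nz: False
   define P where "P = {(g, j). g \<in> set gs \<and> j \<in> J \<and> g j \<noteq> 0\<^sub>V}"
   define Q where "Q g j p \<longleftrightarrow> fst p \<in> \<O> \<and> snd p \<in> M \<and> g j = fst p \<cdot> snd p \<and> snd p \<notin> mm M \<and> fst p \<noteq> \<zero>" for g :: "'j \<Rightarrow> 'c" and j p
   define c where "c g j = fst (SOME p. Q g j p)" for g :: "'j \<Rightarrow> 'c" and j
   define x where "x g j = snd (SOME p. Q g j p)" for g :: "'j \<Rightarrow> 'c" and j
   have cx: "c g j \<in> \<O> \<and> x g j \<in> M \<and> g j = c g j \<cdot> x g j \<and> x g j \<notin> mm M \<and> c g j \<noteq> \<zero>" if p: "(g, j) \<in> P" for g j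
   proof -
    have gj: "g \<in> set gs" "j \<in> J" "g j \<noteq> 0\<^sub>V" using p unfolding P_def by auto
    then obtain c' x' where "c' \<in> \<O>" "x' \<in> M" "g j = c' \<cdot> x'" "x' \<notin> mm M" "c' \<noteq> \<zero>"
     using primitive_part[OF M gs(1)[OF gj(1)] gj(3)] gs(2)[OF gj(1,2)] by blast
    then have "Q g j (c', x')" unfolding Q_def by simp
    then have "Q g j (SOME p. Q g j p)" by (rule someI)
    then show ?thesis unfolding Q_def c_def x_def .
   qed
   have finP: "finite P"
    by (rule finite_subset[of _ "set gs \<times> J"]) (use J in \<open>auto simp: P_def\<close>)
   have "P \<noteq> {}" using nz unfolding P_def by auto
   moreover have "(\<lambda>(g, j). c g j) ` P \<subseteq> carrier K" using cx O_carrier by auto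
   \<comment> \<open>d divides every entry of every generator and is the content of the pivot entry:
     row \<open>g0\<close>, column \<open>j0\<close>.\<close>
   ultimately obtain d where d: "d \<in> (\<lambda>(g, j). c g j) ` P" "\<forall>y\<in>(\<lambda>(g, j). c g j) ` P. \<exists>r\<in>\<O>. y = r \<otimes> d"
    using common_divisor[of "(\<lambda>(g, j). c g j) ` P"] finP by blast
   then obtain g0 j0 where p: "(g0, j0) \<in> P" "d = c g0 j0" by auto
   have g0: "g0 \<in> set gs" "j0 \<in> J" using p unfolding P_def by auto
   define x0 where "x0 = x g0 j0"
   have x0: "x0 \<in> M" "x0 \<notin> mm M" "g0 j0 = d \<cdot> x0" "d \<in> \<O>" "d \<noteq> \<zero>"
    using cx[OF p(1)] p(2) x0_def by auto
   have dK: "d \<in> carrier K" using x0 O_carrier by simp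
   note di = inv_K[OF dK x0(5)]
   have div: "\<exists>y\<in>M. g j = d \<cdot> y" if gj: "g \<in> set gs" "j \<in> J" for g j
   proof (cases "g j = 0\<^sub>V")
    case True
    then show ?thesis using VO.sub_zero[OF sM] dK by (intro bexI[of _ "0\<^sub>V"]) auto
   next
    case False
    then have q: "(g, j) \<in> P" using gj unfolding P_def by simp
    then obtain r where r: "r \<in> \<O>" "c g j = r \<otimes> d" using d(2) by blast
    have "g j = d \<cdot> (r \<cdot> x g j)"
     using cx[OF q] r dK O_carrier Mc by (simp add: smult_assoc1[symmetric] R.m_comm)
    then show ?thesis using Osub_smult[OF sM r(1)] cx[OF q] by blast
   qed
   have "(M \<inter> {0\<^sub>V}) \<uplus> mm M = mm M"
    using VO.sum_absorb2[OF VO.sub_Int[OF sM VO.sub_zero_set] smM(1)] VO.sub_zero[OF smM(1)] by auto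
   \<comment> \<open>\<theta> reads off a coordinate in which the primitive part \<open>x0\<close>
     of the pivot entry is 1.\<close>
   then obtain \<theta> where \<theta>: "linfun \<theta>" "\<theta> x0 = \<one>" "\<And>z. z \<in> M \<Longrightarrow> \<theta> z \<in> \<O>"
    using lattice_functional[OF M sub_zero_set x0(1)] x0(2) by auto
   note \<theta>D = linfunD[OF \<theta>(1)]
   define n' where "n' j = inv d \<cdot> g0 j" for j
   have n'c: "n' j \<in> carrier V" for j using gs(1)[OF g0(1)] di unfolding n'_def by simp
   have g0n: "g0 j = d \<cdot> n' j" for j
    unfolding n'_def using smult_inv(2)[OF dK x0(5)] gs(1)[OF g0(1)] by simp
   have n'0: "n' j0 = x0" unfolding n'_def x0(3) using smult_inv(1)[OF dK x0(5)] Mc[OF x0(1)] by simp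
   have n'M: "n' j \<in> M" if "j \<in> J" for j
    using div[OF g0(1) that] smult_inv(1)[OF dK x0(5)] Mc unfolding n'_def by force
   \<comment> \<open>Elimination: subtracting s g times the pivot row kills the \<theta>-coordinate
     of column \<open>j0\<close>. The multiplier is integral because d divides the whole
     column.\<close>
   define s where "s g = inv d \<otimes> \<theta> (g j0)" for g
   have s: "s g \<in> \<O>" "d \<otimes> s g = \<theta> (g j0)" if g: "g \<in> set gs" for g
   proof -
    obtain y where y: "y \<in> M" "g j0 = d \<cdot> y" using div[OF g g0(2)] by blast
    have \<theta>y: "\<theta> y \<in> \<O>" "\<theta> y \<in> carrier K" using \<theta>(3)[OF y(1)] O_carrier by auto
    have "s g = (inv d \<otimes> d) \<otimes> \<theta> y"
     unfolding s_def y(2) using \<theta>D(3)[OF dK Mc[OF y(1)]] di(1) dK \<theta>y by (simp add: R.m_assoc)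
    then have e: "s g = \<theta> y" using di \<theta>y by simp
    then show "s g \<in> \<O>" "d \<otimes> s g = \<theta> (g j0)" using \<theta>y y \<theta>D(3)[OF dK Mc[OF y(1)]] by auto
   qed
   define red where "red g = (\<lambda>j. g j \<ominus>\<^bsub>V\<^esub> s g \<cdot> g0 j)" for g
   have red: "g j = red g j \<boxplus> s g \<cdot> g0 j" "red g j \<in> carrier V" if g: "g \<in> set gs" for g j
    using gs(1)[OF g] gs(1)[OF g0(1)] s(1)[OF g] O_carrier minus_add_cancel(1)[of "g j" "s g \<cdot> g0 j"]
    unfolding red_def by auto
   define gs' where "gs' = map red (remove1 g0 gs)"
   have sub': "set (remove1 g0 gs) \<subseteq> set gs" by (rule set_remove1_subset)
   have len: "length gs' < length gs"
    using g0(1) length_pos_if_in_set[OF g0(1)] unfolding gs'_def by (simp add: length_remove1)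
   have gs'c: "h j \<in> carrier V" if "h \<in> set gs'" for h j using that red(2) sub' unfolding gs'_def by auto
   have gs'M: "h j \<in> M" if "h \<in> set gs'" "j \<in> J" for h j
   proof -
    obtain g where g: "g \<in> set gs" "h = red g" using \<open>h \<in> set gs'\<close> sub' unfolding gs'_def by auto
    show ?thesis unfolding g(2) red_def
     using VO.sub_minus[OF sM gs(2)[OF g(1) that(2)] Osub_smult[OF sM s(1)[OF g(1)] gs(2)[OF g0(1) that(2)]]] .
   qed
   have gs'p: "set gs' \<subseteq> carrier (pw V)" using gs'c by auto
   have E'sub: "PW.sub (E gs')" unfolding E_def by (rule PW.ext_sub[OF zero_sub gs'p])
   have E'c: "n j \<in> carrier V" if "n \<in> E gs'" for n j using PW.sub_carrier[OF E'sub that] by simp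
   have g0c: "g0 \<in> carrier (pw V)" using gsc g0 by blast
   have E'mem: "set gs' \<subseteq> E gs'" unfolding E_def by (rule PW.ext_mem[OF zero_sub gs'p])
   have Emem: "set gs \<subseteq> E gs" unfolding E_def by (rule PW.ext_mem[OF zero_sub gsc])
   have E1: "E gs \<subseteq> E gs' <+>\<^bsub>pw V\<^esub> PW.line g0"
   proof -
    have S: "PW.sub (E gs' <+>\<^bsub>pw V\<^esub> PW.line g0)" using PW.sub_adjoin[OF E'sub g0c] .
    have "set gs \<subseteq> E gs' <+>\<^bsub>pw V\<^esub> PW.line g0"
    proof
     fix g assume g: "g \<in> set gs"
     show "g \<in> E gs' <+>\<^bsub>pw V\<^esub> PW.line g0"
     proof (cases "g = g0")
      case True
      then show ?thesis using PW.adjoin_self[OF E'sub g0c] by simp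
     next
      case False
      then have "red g \<in> set gs'" using g unfolding gs'_def by (simp add: in_set_remove1)
      then have "red g \<in> E gs'" using E'mem by blast
      moreover have "g = red g \<oplus>\<^bsub>pw V\<^esub> s g \<odot>\<^bsub>pw V\<^esub> g0" using red(1)[OF g] by auto
      ultimately show ?thesis unfolding PW.mem_sum_line using s(1)[OF g] by (intro bexI[of _ "red g"] bexI[of _ "s g"]) auto
     qed
    qed
    moreover have "{\<lambda>_. 0\<^sub>V} \<subseteq> E gs' <+>\<^bsub>pw V\<^esub> PW.line g0" using PW.sub_zero[OF S] by simp
    ultimately show ?thesis using PW.ext_least[OF S] unfolding E_def by blast
   qed
   have E2: "E gs' \<subseteq> E gs"
   proof -
    have "set gs' \<subseteq> E gs"
    proof
     fix h assume "h \<in> set gs'"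
     then obtain g where g: "g \<in> set gs" "h = red g" using sub' unfolding gs'_def by auto
     have "(\<ominus>\<^bsub>K\<^esub> s g) \<odot>\<^bsub>pw V\<^esub> g0 \<in> E gs"
      using PW.sub_smult[OF Esub, of "\<ominus> s g" g0] Emem g0 O_closed(5)[OF s(1)[OF g(1)]] by auto
     then have "g \<oplus>\<^bsub>pw V\<^esub> (\<ominus>\<^bsub>K\<^esub> s g) \<odot>\<^bsub>pw V\<^esub> g0 \<in> E gs" using PW.sub_add[OF Esub] Emem g by blast
     moreover have "h = g \<oplus>\<^bsub>pw V\<^esub> (\<ominus>\<^bsub>K\<^esub> s g) \<odot>\<^bsub>pw V\<^esub> g0"
      unfolding g(2) red_def using s(1)[OF g(1)] O_carrier gs(1)[OF g0(1)] by (simp add: M.minus_eq smult_l_minus)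
     ultimately show "h \<in> E gs" by simp
    qed
    moreover have "{\<lambda>_. 0\<^sub>V} \<subseteq> E gs" using PW.sub_zero[OF Esub] by simp
    ultimately show ?thesis using PW.ext_least[OF Esub] unfolding E_def by blast
   qed
   have \<theta>z: "\<theta> 0\<^sub>V = \<zero>" using \<theta>D(3)[of "\<zero>" "0\<^sub>V"] \<theta>D(1)[of "0\<^sub>V"] by simp
   have \<theta>E': "\<theta> (n j0) = \<zero>" if "n \<in> E gs'" for n
   proof -
    have S: "PW.sub {f \<in> carrier (pw V). \<theta> (f j0) = \<zero>}"
     by (rule PW.subI) (auto simp: O_carrier \<theta>z \<theta>D)
    have "\<theta> (red g j0) = \<zero>" if g: "g \<in> set gs" for g
    proof -
     have sK: "s g \<in> carrier K" using s(1)[OF g] O_carrier by simp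
     have "\<theta> (g j0) = \<theta> (red g j0) \<oplus> s g \<otimes> (d \<otimes> \<theta> x0)"
      using red[OF g, of j0] \<theta>D sK x0(3) gs(1)[OF g0(1)] dK Mc[OF x0(1)] by (metis smult_closed)
     then have "\<theta> (g j0) = \<theta> (red g j0) \<oplus> \<theta> (g j0)"
      using s(2)[OF g] \<theta>(2) sK dK by (simp add: R.m_comm)
     then show ?thesis using \<theta>D(1)[OF gs(1)[OF g]] \<theta>D(1)[OF red(2)[OF g]] by simp
    qed
    then have "set gs' \<subseteq> {f \<in> carrier (pw V). \<theta> (f j0) = \<zero>}"
     using gs'c sub' unfolding gs'_def by auto
    then have "E gs' \<subseteq> {f \<in> carrier (pw V). \<theta> (f j0) = \<zero>}"
     unfolding E_def by (intro PW.ext_least[OF S]) (auto simp: \<theta>z)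
    then show ?thesis using that by blast
   qed
   \<comment> \<open>v is cleared in the same way, but by a multiple of the pivot row divided by d.
     This may leave the span, which is why the two cases below differ.\<close>
   define t where "t = \<theta> (v j0)"
   have t: "t \<in> \<O>" "t \<in> carrier K" using \<theta>(3)[OF v(2)[OF g0(2)]] O_carrier unfolding t_def by auto
   define v0 where "v0 j = v j \<ominus>\<^bsub>V\<^esub> t \<cdot> n' j" for j
   have v0: "v j = v0 j \<boxplus> t \<cdot> n' j" "v0 j \<in> carrier V" for j
    using minus_add_cancel(1)[of "v j" "t \<cdot> n' j"] v(1) t n'c unfolding v0_def by auto
   have v0M: "v0 j \<in> M" if "j \<in> J" for j
    unfolding v0_def using VO.sub_minus[OF sM v(2)[OF that] Osub_smult[OF sM t(1) n'M[OF that]]] .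
   obtain b0 where b0: "b0 \<in> \<O>" "near gs' v0 b0" "\<And>b'. b' \<in> \<O> \<Longrightarrow> near gs' v0 b' \<Longrightarrow> \<exists>r\<in>\<O>. b0 = r \<otimes> b'"
   proof -
    have "\<exists>b\<in>\<O>. near gs' v0 b \<and> (\<forall>b'\<in>\<O>. near gs' v0 b' \<longrightarrow> (\<exists>r\<in>\<O>. b = r \<otimes> b'))"
     by (rule less.hyps[OF len], erule gs'c, erule (1) gs'M, rule v0(2), erule v0M)
    then show ?thesis using that by blast
   qed
   \<comment> \<open>Comparing \<theta>-coordinates in column \<open>j0\<close> gives t = r d + b'
     l; subtracting the pivot part leaves an approximation of \<open>v0\<close> by the reduced
     rows.\<close>
   have fwd: "near gs' v0 b' \<and> (\<exists>r\<in>\<O>. \<exists>l\<in>\<O>. t = r \<otimes> d \<oplus> b' \<otimes> l)" if b': "b' \<in> \<O>" "near gs v b'" for b'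
   proof -
    have b'K: "b' \<in> carrier K" using b' O_carrier by simp
    obtain n where n: "n \<in> E gs" "\<And>j. j \<in> J \<Longrightarrow> \<exists>l\<in>M. v j = n j \<boxplus> b' \<cdot> l"
     using b'(2) unfolding near_def by blast
    then have "n \<in> E gs' <+>\<^bsub>pw V\<^esub> PW.line g0" using E1 by blast
    then obtain n0 r where nr: "n0 \<in> E gs'" "r \<in> \<O>" "n = n0 \<oplus>\<^bsub>pw V\<^esub> r \<odot>\<^bsub>pw V\<^esub> g0"
     unfolding PW.mem_sum_line by auto
    have rK: "r \<in> carrier K" using nr O_carrier by simp
    have nj: "n j = n0 j \<boxplus> (r \<otimes> d) \<cdot> n' j" for j
     unfolding nr(3) using g0n[of j] rK dK n'c[of j] by (simp add: smult_assoc1)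
    obtain l0 where l0: "l0 \<in> M" "v j0 = n j0 \<boxplus> b' \<cdot> l0" using n(2)[OF g0(2)] by blast
    define q where "q = \<theta> l0"
    have q: "q \<in> \<O>" "q \<in> carrier K" using \<theta>(3)[OF l0(1)] O_carrier unfolding q_def by auto
    have "t = (\<theta> (n0 j0) \<oplus> (r \<otimes> d) \<otimes> \<theta> (n' j0)) \<oplus> b' \<otimes> q"
     unfolding t_def q_def l0(2) nj using \<theta>D E'c[OF nr(1), of j0] rK dK n'c[of j0] b'K Mc[OF l0(1)] by simp
    then have tq: "t = r \<otimes> d \<oplus> b' \<otimes> q" unfolding \<theta>E'[OF nr(1)] n'0 \<theta>(2) using rK dK q b'K by simp
    have "near gs' v0 b'"
     unfolding near_def
    proof (intro bexI[OF _ nr(1)] ballI)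
     fix j assume j: "j \<in> J"
     obtain l where l: "l \<in> M" "v j = n j \<boxplus> b' \<cdot> l" using n(2)[OF j] by blast
     define l' where "l' = l \<ominus>\<^bsub>V\<^esub> q \<cdot> n' j"
     have l'M: "l' \<in> M" unfolding l'_def using VO.sub_minus[OF sM l(1) Osub_smult[OF sM q(1) n'M[OF j]]] .
     have l': "l = l' \<boxplus> q \<cdot> n' j"
      using minus_add_cancel(1)[of l "q \<cdot> n' j"] Mc[OF l(1)] q n'c unfolding l'_def by simp
     have "v0 j \<boxplus> t \<cdot> n' j = v j" using v0 by simp
     also have "\<dots> = (n0 j \<boxplus> b' \<cdot> l') \<boxplus> t \<cdot> n' j"
      unfolding l(2) nj l' tq
      using E'c[OF nr(1), of j] n'c[of j] Mc[OF l'M] rK dK q(2) b'K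
      by (simp add: smult_l_distr smult_r_distr smult_assoc1 M.a_ac)
     finally have "v0 j = n0 j \<boxplus> b' \<cdot> l'"
      using v0(2) t n'c E'c[OF nr(1)] b'K Mc[OF l'M] by simp
     then show "\<exists>l\<in>M. v0 j = n0 j \<boxplus> b' \<cdot> l" using l'M by blast
    qed
    then show ?thesis using tq nr(2) q(1) by blast
   qed
   obtain n0 where n0: "n0 \<in> E gs'" "\<And>j. j \<in> J \<Longrightarrow> \<exists>l\<in>M. v0 j = n0 j \<boxplus> b0 \<cdot> l"
    using b0(2) unfolding near_def by blast
   note b0K = O_carrier[OF b0(1)]
   show ?thesis
   proof (cases "\<exists>q\<in>\<O>. t = q \<otimes> d")
    case True
    then obtain q where q: "q \<in> \<O>" "t = q \<otimes> d" by blast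
    \<comment> \<open>As d divides t, the part removed from v lies in the span, and the best modulus
      for \<open>v0\<close> serves for v.\<close>
    have "near gs v b0"
     unfolding near_def
    proof (rule bexI[of _ "n0 \<oplus>\<^bsub>pw V\<^esub> q \<odot>\<^bsub>pw V\<^esub> g0"], intro ballI)
     have "q \<odot>\<^bsub>pw V\<^esub> g0 \<in> E gs" using PW.sub_smult[OF Esub, of q g0] q(1) Emem g0 by auto
     then show "n0 \<oplus>\<^bsub>pw V\<^esub> q \<odot>\<^bsub>pw V\<^esub> g0 \<in> E gs" using PW.sub_add[OF Esub] n0(1) E2 by blast
     fix j assume j: "j \<in> J"
     obtain l where l: "l \<in> M" "v0 j = n0 j \<boxplus> b0 \<cdot> l" using n0(2)[OF j] by blast
     have "v j = (n0 j \<boxplus> q \<cdot> g0 j) \<boxplus> b0 \<cdot> l"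
      unfolding v0(1)[of j] l(2) q(2) g0n[of j]
      using E'c[OF n0(1), of j] n'c[of j] Mc[OF l(1)] O_carrier[OF q(1)] dK b0K
      by (simp add: smult_assoc1 M.a_ac)
     then show "\<exists>l\<in>M. v j = (n0 \<oplus>\<^bsub>pw V\<^esub> q \<odot>\<^bsub>pw V\<^esub> g0) j \<boxplus> b0 \<cdot> l" using l(1) by auto
    qed
    then show ?thesis using b0 fwd by blast
   next
    case False
    \<comment> \<open>Now the removed part has to be counted as error, so the candidate is the
      common divisor of \<open>b0\<close> and t.\<close>
    obtain b where b: "b \<in> {b0, t}" "\<forall>y\<in>{b0, t}. \<exists>r\<in>\<O>. y = r \<otimes> b"
     using common_divisor[of "{b0, t}"] b0K t(2) by auto
    have bO: "b \<in> \<O>" using b b0 t by auto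
    note bK = O_carrier[OF bO]
    obtain r1 r2 where r: "r1 \<in> \<O>" "b0 = r1 \<otimes> b" "r2 \<in> \<O>" "t = r2 \<otimes> b" using b by auto
    note rK = O_carrier[OF r(1)] O_carrier[OF r(3)]
    have "near gs v b"
     unfolding near_def
    proof (rule bexI[of _ n0], intro ballI)
     show "n0 \<in> E gs" using n0 E2 by blast
     fix j assume j: "j \<in> J"
     obtain l where l: "l \<in> M" "v0 j = n0 j \<boxplus> b0 \<cdot> l" using n0(2)[OF j] by blast
     have "v j = n0 j \<boxplus> b \<cdot> (r1 \<cdot> l \<boxplus> r2 \<cdot> n' j)"
      unfolding v0(1)[of j] l(2) r(2,4)
      using E'c[OF n0(1), of j] n'c[of j] Mc[OF l(1)] rK bK
      by (simp add: smult_r_distr smult_assoc1[symmetric] R.m_comm M.a_ac)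
     moreover have "r1 \<cdot> l \<boxplus> r2 \<cdot> n' j \<in> M"
      using VO.sub_add[OF sM Osub_smult[OF sM r(1) l(1)] Osub_smult[OF sM r(3) n'M[OF j]]] .
     ultimately show "\<exists>l\<in>M. v j = n0 j \<boxplus> b \<cdot> l" by blast
    qed
    moreover have "\<exists>r\<in>\<O>. b = r \<otimes> b'" if b': "b' \<in> \<O>" "near gs v b'" for b'
    proof -
     note b'K = O_carrier[OF b'(1)]
     obtain r l where rl: "r \<in> \<O>" "l \<in> \<O>" "t = r \<otimes> d \<oplus> b' \<otimes> l" and nb: "near gs' v0 b'"
      using fwd[OF b'] by blast
     note rlK = O_carrier[OF rl(1)] O_carrier[OF rl(2)]
     \<comment> \<open>t lies in the ideal generated by d and b'. If neither divided t, both would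
       be m-multiples of t, and dividing by t would put 1 into m.\<close>
     have "\<exists>s\<in>\<O>. t = s \<otimes> b'"
     proof (rule ccontr)
      assume nt: "\<not> (\<exists>s\<in>\<O>. t = s \<otimes> b')"
      obtain s where s: "s \<in> \<O>" "b' = s \<otimes> t" using divide_total[OF t(2) b'K] nt by blast
      obtain s' where s': "s' \<in> \<O>" "d = s' \<otimes> t" using divide_total[OF t(2) dK] False by blast
      note sK = O_carrier[OF s(1)] O_carrier[OF s'(1)]
      have tz: "t \<noteq> \<zero>" using s' x0(5) sK by auto
      have unit: "w \<in> m" if w: "w \<in> \<O>" "y = w \<otimes> t" "\<not> (\<exists>q\<in>\<O>. t = q \<otimes> y)" for w y
      proof (rule ccontr)
       assume "w \<notin> m"
       then have u: "w \<noteq> \<zero>" "inv w \<in> \<O>" using O_unit w by auto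
       have "t = inv w \<otimes> y" unfolding w(2) using inv_K[OF O_carrier[OF w(1)] u(1)] t O_carrier[OF w(1)]
        by (simp add: R.m_assoc[symmetric])
       then show False using w u by blast
      qed
      have sm: "s \<in> m" "s' \<in> m" using unit[OF s nt] unit[OF s' False] by auto
      have e1: "t = r \<otimes> (s' \<otimes> t) \<oplus> (s \<otimes> t) \<otimes> l" using rl(3) unfolding s(2) s'(2) .
      have e2: "(r \<otimes> s' \<oplus> l \<otimes> s) \<otimes> t = r \<otimes> (s' \<otimes> t) \<oplus> (s \<otimes> t) \<otimes> l"
       using sK rlK t(2) by (simp add: R.l_distr R.r_distr R.m_ac)
      have "\<one> \<otimes> t = (r \<otimes> s' \<oplus> l \<otimes> s) \<otimes> t"
       using trans[OF trans[OF R.l_one[OF t(2)] e1] e2[symmetric]] .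
      then have "\<one> = r \<otimes> s' \<oplus> l \<otimes> s"
       using m_rcancel[OF tz t(2), of "\<one>" "r \<otimes> s' \<oplus> l \<otimes> s"] sK rlK by simp
      moreover have "r \<otimes> s' \<oplus> l \<otimes> s \<in> m" using m_add m_mult sm rl by simp
      ultimately show False using one_nm by simp
     qed
     moreover have "\<exists>s\<in>\<O>. b0 = s \<otimes> b'" using b0(3)[OF b'(1) nb] .
     ultimately show ?thesis using b(1) by blast
    qed
    ultimately show ?thesis using bO by blast
   qed
  qed
 qed
qed

text \<open>Induction on the codimension of a subspace Z on which \<phi> vanishes. With an integral
  functional \<theta> that vanishes on Z and is 1 at some x of M, the map \<phi> is the elementary
  map \<theta>(y) \<phi>(x) plus an endomorphism vanishing on Z + Kx. Elementary maps are generated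
  by those with a basis vector of M in place of \<phi>(x).\<close>

lemma endo_generators:
 fixes u :: "'j \<Rightarrow> 'c"
 assumes M: "lattice M" and u: "\<And>j. u j \<in> M"
 shows "\<exists>gs. (\<forall>g\<in>set gs. \<exists>\<phi>. linmap \<phi> \<and> (\<forall>x\<in>M. \<phi> x \<in> M) \<and> (\<forall>j. g j = \<phi> (u j))) \<and>
  (\<forall>\<phi>. linmap \<phi> \<and> (\<forall>x\<in>M. \<phi> x \<in> M) \<longrightarrow>
   (\<lambda>j. \<phi> (u j)) \<in> local_module.ext (K\<lparr>carrier := \<O>\<rparr>) (pw V :: ('a, 'j \<Rightarrow> 'c) module) {\<lambda>_. 0\<^sub>V} gs)"
proof -
 interpret PW: local_module "K\<lparr>carrier := \<O>\<rparr>" "pw V :: ('a, 'j \<Rightarrow> 'c) module" m by (rule VO.pw_local_module)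
 have sM: "Osub M" using lattice_sub M by simp
 note smM = mm_sub[OF sM]
 note Mc = VO.sub_carrier[OF sM]
 have zero_sub: "PW.sub {\<lambda>_. 0\<^sub>V}" using PW.sub_zero_set by simp
 obtain es where es: "set es \<subseteq> M" "M = Ospan es" using lattice_basis_carrier[OF M] by blast
 define endo where "endo \<phi> \<longleftrightarrow> linmap \<phi> \<and> (\<forall>x\<in>M. \<phi> x \<in> M)" for \<phi>
 define vec where "vec g \<longleftrightarrow> (\<exists>\<phi>. endo \<phi> \<and> (\<forall>j. g j = \<phi> (u j)))" for g
 define gen where "gen Z gs \<longleftrightarrow> (\<forall>\<phi>. endo \<phi> \<longrightarrow> (\<forall>z\<in>Z. \<phi> z = 0\<^sub>V) \<longrightarrow> (\<lambda>j. \<phi> (u j)) \<in> PW.ext {\<lambda>_. 0\<^sub>V} gs)" for Z gs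
 have ex: "\<exists>gs. (\<forall>g\<in>set gs. vec g) \<and> gen Z gs" if "sub Z" "dimK (carrier V) - dimK Z = k" for Z k
  using that
 proof (induction k arbitrary: Z)
  case 0
  have "Z = carrier V" using dimK_eq[OF 0(1) sub_carrier_set sub_subset[OF 0(1)]] 0(2) by simp
  then have "(\<lambda>j. \<phi> (u j)) = (\<lambda>_. 0\<^sub>V)" if "\<forall>z\<in>Z. \<phi> z = 0\<^sub>V" for \<phi> using that u Mc by auto
  then have "gen Z []" unfolding gen_def by simp
  then show ?case by (intro exI[of _ "[]"]) auto
 next
  case (Suc k)
  note Z = Suc.prems(1)
  let ?W = "(M \<inter> Z) \<uplus> mm M"
  have "mm M \<inter> carrier V = mm M" using VO.sub_subset smM(1) by auto
  then have "VO.rk (mm M) ?W = dimK Z"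
   using rank_reduction(2)[OF M Z sub_carrier_set sub_subset[OF Z]] by simp
  moreover have "VO.rk (mm M) M = dimK (carrier V)" using VO.rk_eq M lattice_def by blast
  ultimately have "?W \<noteq> M" using Suc.prems(2) by auto
  moreover have "?W \<subseteq> M" using VO.sum_least[OF sM _ smM(2)] by blast
  ultimately obtain x where x: "x \<in> M" "x \<notin> ?W" by blast
  obtain \<theta> where \<theta>: "linfun \<theta>" "\<And>z. z \<in> Z \<Longrightarrow> \<theta> z = \<zero>" "\<theta> x = \<one>" "\<And>z. z \<in> M \<Longrightarrow> \<theta> z \<in> \<O>"
   using lattice_functional[OF M Z x] by blast
  note \<theta>D = linfunD[OF \<theta>(1)]
  have xc: "x \<in> carrier V" using x Mc by simp
  have xZ: "x \<notin> Z" using \<theta>(2)[of x] \<theta>(3) one_not_zero by auto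
  let ?Z = "Z \<uplus> line x"
  have "dimK (carrier V) - dimK ?Z = k" using dimK_adjoin[OF Z xc xZ] Suc.prems(2) by simp
  then obtain gs where gs: "\<forall>g\<in>set gs. vec g" "gen ?Z gs"
   using Suc.IH[OF sub_adjoin[OF Z xc]] by blast
  define el where "el e = (\<lambda>j. \<theta> (u j) \<cdot> e)" for e
  define hs where "hs = gs @ map el es"
  have elmap: "linmap (\<lambda>y. \<theta> y \<cdot> e)" "\<forall>y\<in>M. \<theta> y \<cdot> e \<in> M" if e: "e \<in> M" for e
  proof -
   show "linmap (\<lambda>y. \<theta> y \<cdot> e)"
    unfolding linmap_def using \<theta>D Mc[OF e] by (auto simp: smult_l_distr smult_assoc1)
   show "\<forall>y\<in>M. \<theta> y \<cdot> e \<in> M" using Osub_smult[OF sM \<theta>(4) e] by blast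
  qed
  have hs1: "vec g" if g: "g \<in> set hs" for g
  proof -
   consider "g \<in> set gs" | e where "e \<in> set es" "g = el e" using g unfolding hs_def by auto
   then show ?thesis
   proof cases
    case 2
    then have "e \<in> M" using es by blast
    then have "endo (\<lambda>y. \<theta> y \<cdot> e)" using elmap unfolding endo_def by blast
    then show ?thesis using 2(2) unfolding el_def vec_def by blast
   qed (use gs in blast)
  qed
  have hsc: "set hs \<subseteq> carrier (pw V)"
  proof
   fix g assume "g \<in> set hs"
   then obtain \<phi> where "linmap \<phi>" "\<forall>j. g j = \<phi> (u j)" using hs1 unfolding vec_def endo_def by blast
   then show "g \<in> carrier (pw V)" using linmapD(1) u Mc by simp
  qed
  let ?E = "PW.ext {\<lambda>_. 0\<^sub>V}"
  have Es: "PW.sub (?E hs)" "set hs \<subseteq> ?E hs" using PW.ext_sub[OF zero_sub hsc] PW.ext_mem[OF zero_sub hsc] by auto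
  have "(\<lambda>_. 0\<^sub>V) \<in> ?E hs" using PW.sub_zero[OF Es(1)] by simp
  then have gE: "?E gs \<subseteq> ?E hs" using PW.ext_least[OF Es(1), of "{\<lambda>_. 0\<^sub>V}" gs] Es(2) unfolding hs_def by auto
  have elE: "el e \<in> ?E hs" if e: "e \<in> M" for e
  proof -
   have S: "Osub {e \<in> carrier V. el e \<in> ?E hs}"
   proof (rule OsubI)
    have uK: "\<theta> (u j) \<in> carrier K" for j using \<theta>D(1) u Mc by simp
    show "0\<^sub>V \<in> {e \<in> carrier V. el e \<in> ?E hs}" using PW.sub_zero[OF Es(1)] uK by (simp add: el_def)
    show "y \<boxplus> z \<in> {e \<in> carrier V. el e \<in> ?E hs}"
     if "y \<in> {e \<in> carrier V. el e \<in> ?E hs}" "z \<in> {e \<in> carrier V. el e \<in> ?E hs}" for y z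
     using PW.sub_add[OF Es(1), of "el y" "el z"] that uK by (simp add: el_def smult_r_distr)
    show "r \<cdot> y \<in> {e \<in> carrier V. el e \<in> ?E hs}"
     if r: "r \<in> \<O>" and y: "y \<in> {e \<in> carrier V. el e \<in> ?E hs}" for r y
    proof -
     have "r \<odot>\<^bsub>pw V\<^esub> el y = el (r \<cdot> y)"
      using y O_carrier[OF r] uK by (auto simp: el_def smult_assoc1[symmetric] R.m_comm)
     then show ?thesis using PW.sub_smult[OF Es(1), of r "el y"] r y O_carrier[OF r] by simp
    qed
   qed auto
   have "set es \<subseteq> {e \<in> carrier V. el e \<in> ?E hs}" using Es(2) es Mc unfolding hs_def by auto
   then have "Ospan es \<subseteq> {e \<in> carrier V. el e \<in> ?E hs}"
    by (intro VO.ext_least[OF S]) (use VO.sub_zero[OF S] in auto)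
   then show ?thesis using e es(2) by blast
  qed
  have "(\<lambda>j. \<phi> (u j)) \<in> ?E hs"
   if \<phi>: "linmap \<phi>" "\<forall>x\<in>M. \<phi> x \<in> M" "\<forall>z\<in>Z. \<phi> z = 0\<^sub>V" for \<phi>
  proof -
   note \<phi>D = linmapD[OF \<phi>(1)]
   have \<phi>x: "\<phi> x \<in> M" "\<phi> x \<in> carrier V" using \<phi>(2) x Mc by auto
   define \<psi> where "\<psi> y = \<phi> y \<ominus>\<^bsub>V\<^esub> \<theta> y \<cdot> \<phi> x" for y
   have \<psi>: "\<phi> y = \<psi> y \<boxplus> \<theta> y \<cdot> \<phi> x" "\<psi> y \<in> carrier V" if "y \<in> carrier V" for y
    using minus_add_cancel(1)[of "\<phi> y" "\<theta> y \<cdot> \<phi> x"] \<phi>D(1) \<theta>D(1) \<phi>x that unfolding \<psi>_def by auto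
   have "linmap \<psi>"
    unfolding linmap_def
   proof (intro conjI ballI)
    fix y z assume yz: "y \<in> carrier V" "z \<in> carrier V"
    have "\<psi> (y \<boxplus> z) \<boxplus> \<theta> (y \<boxplus> z) \<cdot> \<phi> x = \<phi> y \<boxplus> \<phi> z"
     using \<psi>(1)[of "y \<boxplus> z"] \<phi>D(2) yz by simp
    also have "\<dots> = (\<psi> y \<boxplus> \<psi> z) \<boxplus> \<theta> (y \<boxplus> z) \<cdot> \<phi> x"
     using \<psi>(1)[OF yz(1)] \<psi>(1)[OF yz(2)] \<psi>(2) yz \<theta>D \<phi>x by (simp add: smult_l_distr M.a_ac)
    finally show "\<psi> (y \<boxplus> z) = \<psi> y \<boxplus> \<psi> z"
     using \<psi>(2) yz \<theta>D(1)[of "y \<boxplus> z"] \<phi>x by simp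
   next
    fix r y assume r: "r \<in> carrier K" and y: "y \<in> carrier V"
    have "\<psi> (r \<cdot> y) \<boxplus> \<theta> (r \<cdot> y) \<cdot> \<phi> x = r \<cdot> \<phi> y"
     using \<psi>(1)[of "r \<cdot> y"] \<phi>D(3) r y by simp
    also have "\<dots> = r \<cdot> \<psi> y \<boxplus> \<theta> (r \<cdot> y) \<cdot> \<phi> x"
     using \<psi>(1)[OF y] \<psi>(2)[OF y] \<theta>D(1,3) r y \<phi>x by (simp add: smult_r_distr smult_assoc1)
    finally show "\<psi> (r \<cdot> y) = r \<cdot> \<psi> y"
     using \<psi>(2) r y \<theta>D(1)[of "r \<cdot> y"] \<phi>x by simp
   qed (use \<psi> in auto)
   moreover have "\<forall>y\<in>M. \<psi> y \<in> M"
    unfolding \<psi>_def using VO.sub_minus[OF sM] \<phi>(2) Osub_smult[OF sM \<theta>(4) \<phi>x(1)] by blast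
   moreover have "\<forall>z\<in>?Z. \<psi> z = 0\<^sub>V"
   proof
    fix z assume "z \<in> ?Z"
    then obtain y r where yr: "y \<in> Z" "r \<in> carrier K" "z = y \<boxplus> r \<cdot> x" by (auto simp: mem_sum_line)
    have yc: "y \<in> carrier V" using yr sub_carrier[OF Z] by blast
    have "\<phi> z = r \<cdot> \<phi> x" "\<theta> z = r"
     unfolding yr(3) using \<phi>D \<theta>D \<phi>(3) \<theta>(2,3) yr yc xc \<phi>x by auto
    then show "\<psi> z = 0\<^sub>V" unfolding \<psi>_def using yr \<phi>x by simp
   qed
   ultimately have "(\<lambda>j. \<psi> (u j)) \<in> ?E hs" using gs(2) gE unfolding gen_def endo_def by blast
   then have "(\<lambda>j. \<psi> (u j)) \<oplus>\<^bsub>pw V\<^esub> el (\<phi> x) \<in> ?E hs" using PW.sub_add[OF Es(1)] elE[OF \<phi>x(1)] by blast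
   moreover have "(\<lambda>j. \<psi> (u j)) \<oplus>\<^bsub>pw V\<^esub> el (\<phi> x) = (\<lambda>j. \<phi> (u j))"
    using \<psi>(1)[OF Mc[OF u]] by (auto simp: el_def)
   ultimately show ?thesis by simp
  qed
  then have "gen Z hs" unfolding gen_def endo_def by blast
  then show ?case using hs1 by blast
 qed
 obtain gs where gs: "\<forall>g\<in>set gs. vec g" "gen {0\<^sub>V} gs" using ex[OF sub_zero_set refl] by blast
 have "\<phi> 0\<^sub>V = 0\<^sub>V" if "linmap \<phi>" for \<phi>
  using linmapD(3)[OF that, of "\<zero>" "0\<^sub>V"] linmapD(1)[OF that, of "0\<^sub>V"] by simp
 then have "\<forall>\<phi>. endo \<phi> \<longrightarrow> (\<lambda>j. \<phi> (u j)) \<in> PW.ext {\<lambda>_. 0\<^sub>V} gs"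
  using gs(2) unfolding gen_def endo_def by simp
 then show ?thesis using gs(1) unfolding vec_def endo_def conj_assoc by (intro exI[of _ gs] conjI)
qed

end

section \<open>Endomorphisms of a lattice\<close>

context fd_valued_space
begin

lemma linmap_zero: "linmap (\<lambda>_. 0\<^sub>V)"
 by (simp add: linmap_def)

lemma linmap_add:
 assumes "linmap \<phi>" "linmap \<psi>"
 shows "linmap (\<lambda>x. \<phi> x \<boxplus> \<psi> x)"
 unfolding linmap_def using linmapD[OF assms(1)] linmapD[OF assms(2)]
 by (simp add: M.a_ac smult_r_distr)

lemma linmap_smult:
 assumes "linmap \<phi>" "c \<in> carrier K"
 shows "linmap (\<lambda>x. c \<cdot> \<phi> x)"
 unfolding linmap_def using linmapD[OF assms(1)] assms(2)
 by (simp add: smult_r_distr smult_assoc1[symmetric] R.m_comm)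

lemma linmap_id: "linmap (\<lambda>x. x)"
 by (simp add: linmap_def)

lemma linmap_comp:
 assumes "linmap \<phi>" "linmap \<psi>"
 shows "linmap (\<lambda>x. \<phi> (\<psi> x))"
 unfolding linmap_def using linmapD[OF assms(1)] linmapD[OF assms(2)] by simp

lemma linmap_image:
 assumes T: "linmap T" and Y: "sub Y"
 shows "sub (T ` Y)"
proof (rule subI)
 note TD = linmapD[OF T] and Yc = sub_carrier[OF Y]
 show "T ` Y \<subseteq> carrier V" using TD(1) Yc by blast
 have "T (\<zero> \<cdot> 0\<^sub>V) = 0\<^sub>V" using TD(3)[of "\<zero>" "0\<^sub>V"] TD(1)[of "0\<^sub>V"] by simp
 then show "0\<^sub>V \<in> T ` Y" using sub_zero[OF Y] by force
 show "x \<boxplus> y \<in> T ` Y" if xy: "x \<in> T ` Y" "y \<in> T ` Y" for x y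
 proof -
  obtain x' y' where "x' \<in> Y" "y' \<in> Y" "x = T x'" "y = T y'" using xy by blast
  then show ?thesis using TD(2)[of x' y'] sub_add[OF Y, of x' y'] Yc by (metis imageI)
 qed
 show "r \<cdot> x \<in> T ` Y" if rx: "r \<in> carrier K" "x \<in> T ` Y" for r x
 proof -
  obtain x' where "x' \<in> Y" "x = T x'" using rx by blast
  then show ?thesis using TD(3)[OF rx(1), of x'] sub_smult[OF Y rx(1), of x'] Yc by (metis imageI)
 qed
qed

definition endo where "endo M \<phi> \<longleftrightarrow> linmap \<phi> \<and> (\<forall>x\<in>M. \<phi> x \<in> M)"

text \<open>The tuples \<phi>(u) and the corrections from the H j together form a finitely generated
  module: evaluated generators of the endomorphisms, and generators of each H j placed in the single
  coordinate j. Hence a best \<phi> exists.\<close>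

lemma best_endo:
 fixes u v :: "'j \<Rightarrow> 'c"
 assumes M: "lattice M" and J: "finite J" and u: "\<And>j. u j \<in> M" and v: "\<And>j. v j \<in> M"
  and H: "\<And>j. j \<in> J \<Longrightarrow> set (hs j) \<subseteq> M" "\<And>j. j \<in> J \<Longrightarrow> H j = Ospan (hs j)"
 defines "near \<equiv> \<lambda>b. \<exists>\<phi>. endo M \<phi> \<and> (\<forall>j\<in>J. \<exists>h\<in>H j. \<exists>l\<in>M. v j = (\<phi> (u j) \<boxplus> h) \<boxplus> b \<cdot> l)"
 shows "\<exists>b\<in>\<O>. near b \<and> (\<forall>b'\<in>\<O>. near b' \<longrightarrow> (\<exists>r\<in>\<O>. b = r \<otimes> b'))"
proof -
 interpret PW: local_module "K\<lparr>carrier := \<O>\<rparr>" "pw V :: ('a, 'j \<Rightarrow> 'c) module" m by (rule VO.pw_local_module)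
 have sM: "Osub M" using lattice_sub M by simp
 note Mc = VO.sub_carrier[OF sM]
 have zero_sub: "PW.sub {\<lambda>_. 0\<^sub>V}" using PW.sub_zero_set by simp
 have Hsub: "Osub (H j)" "H j \<subseteq> M" if j: "j \<in> J" for j
 proof -
  have "set (hs j) \<subseteq> carrier V" using H(1)[OF j] Mc by blast
  then show "Osub (H j)" unfolding H(2)[OF j] by (rule Ospan_sub)
  show "H j \<subseteq> M" unfolding H(2)[OF j]
   by (rule VO.ext_least[OF sM]) (use VO.sub_zero[OF sM] H(1)[OF j] in auto)
 qed
 obtain gs1 where gs1: "\<And>g. g \<in> set gs1 \<Longrightarrow> \<exists>\<phi>. endo M \<phi> \<and> (\<forall>j. g j = \<phi> (u j))"
  "\<And>\<phi>. endo M \<phi> \<Longrightarrow> (\<lambda>j. \<phi> (u j)) \<in> PW.ext {\<lambda>_. 0\<^sub>V} gs1"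
 proof -
  obtain gs where "\<forall>g\<in>set gs. \<exists>\<phi>. linmap \<phi> \<and> (\<forall>x\<in>M. \<phi> x \<in> M) \<and> (\<forall>j. g j = \<phi> (u j))"
   "\<forall>\<phi>. linmap \<phi> \<and> (\<forall>x\<in>M. \<phi> x \<in> M) \<longrightarrow> (\<lambda>j. \<phi> (u j)) \<in> PW.ext {\<lambda>_. 0\<^sub>V} gs"
   using endo_generators[OF M, of u, OF u] by (elim exE conjE)
  then show ?thesis by (intro that[of gs]) (auto simp: endo_def)
 qed
 define \<delta> where "\<delta> j h = (\<lambda>j'. if j' = j then h else 0\<^sub>V)" for j :: 'j and h
 have "finite (\<Union>j\<in>J. \<delta> j ` set (hs j))" using J by auto
 from finite_list[OF this] obtain gs2 where gs2: "set gs2 = (\<Union>j\<in>J. \<delta> j ` set (hs j))" by (elim exE)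
 define gs where "gs = gs1 @ gs2"
 define E where "E = PW.ext {\<lambda>_. 0\<^sub>V} gs"
 have gsM: "g j \<in> M" if g: "g \<in> set gs" for g j
 proof -
  have "g \<in> set gs1 \<or> g \<in> set gs2" using g unfolding gs_def by auto
  then show ?thesis
  proof
   assume "g \<in> set gs1"
   then show ?thesis using gs1(1) u unfolding endo_def by metis
  next
   assume "g \<in> set gs2"
   then obtain j' h where "j' \<in> J" "h \<in> set (hs j')" "g = \<delta> j' h" unfolding gs2 by blast
   then show ?thesis using H(1) VO.sub_zero[OF sM] unfolding \<delta>_def by auto
  qed
 qed
 have gsc: "set gs \<subseteq> carrier (pw V)" using gsM Mc by auto
 have Es: "PW.sub E" "set gs \<subseteq> E" unfolding E_def using PW.ext_sub[OF zero_sub gsc] PW.ext_mem[OF zero_sub gsc] by auto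
 have G1: "\<exists>\<phi>. endo M \<phi> \<and> (\<forall>j\<in>J. \<exists>h\<in>H j. n j = \<phi> (u j) \<boxplus> h)" if n: "n \<in> E" for n
 proof -
  define good where "good n \<phi> \<longleftrightarrow> endo M \<phi> \<and> (\<forall>j\<in>J. \<exists>h\<in>H j. n j = \<phi> (u j) \<boxplus> h)" for n \<phi>
  define S where "S = {n \<in> carrier (pw V). \<exists>\<phi>. good n \<phi>}"
  have Sub: "PW.sub S"
  proof (rule PW.subI)
   show "S \<subseteq> carrier (pw V)" unfolding S_def by blast
   have "good (\<lambda>_. 0\<^sub>V) (\<lambda>_. 0\<^sub>V)"
    unfolding good_def endo_def using linmap_zero VO.sub_zero[OF sM] VO.sub_zero[OF Hsub(1)] by force
   then show "\<zero>\<^bsub>pw V\<^esub> \<in> S" unfolding S_def by auto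
  next
   fix n n' assume "n \<in> S" "n' \<in> S"
   then obtain \<phi> \<phi>' where *: "n \<in> carrier (pw V)" "n' \<in> carrier (pw V)" "good n \<phi>" "good n' \<phi>'" unfolding S_def by auto
   have "good (n \<oplus>\<^bsub>pw V\<^esub> n') (\<lambda>x. \<phi> x \<boxplus> \<phi>' x)"
    unfolding good_def
   proof (intro conjI ballI)
    show "endo M (\<lambda>x. \<phi> x \<boxplus> \<phi>' x)"
     using *(3,4) linmap_add VO.sub_add[OF sM] unfolding good_def endo_def by blast
    fix j assume j: "j \<in> J"
    obtain h h' where h: "h \<in> H j" "h' \<in> H j" "n j = \<phi> (u j) \<boxplus> h" "n' j = \<phi>' (u j) \<boxplus> h'"
     using *(3,4) j unfolding good_def by blast
    have "\<phi> (u j) \<in> carrier V" "\<phi>' (u j) \<in> carrier V" "h \<in> carrier V" "h' \<in> carrier V"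
     using *(3,4) u Mc VO.sub_carrier[OF Hsub(1)[OF j]] h unfolding good_def endo_def by auto
    then have "(n \<oplus>\<^bsub>pw V\<^esub> n') j = (\<phi> (u j) \<boxplus> \<phi>' (u j)) \<boxplus> (h \<boxplus> h')" using h by (simp add: M.a_ac)
    then show "\<exists>h\<in>H j. (n \<oplus>\<^bsub>pw V\<^esub> n') j = (\<phi> (u j) \<boxplus> \<phi>' (u j)) \<boxplus> h"
     using VO.sub_add[OF Hsub(1)[OF j] h(1,2)] by blast
   qed
   then show "n \<oplus>\<^bsub>pw V\<^esub> n' \<in> S" unfolding S_def using * by auto
  next
   fix r n assume "r \<in> carrier R" "n \<in> S"
   then obtain \<phi> where *: "r \<in> \<O>" "n \<in> carrier (pw V)" "good n \<phi>" unfolding S_def by auto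
   note rK = O_carrier[OF *(1)]
   have "good (r \<odot>\<^bsub>pw V\<^esub> n) (\<lambda>x. r \<cdot> \<phi> x)"
    unfolding good_def
   proof (intro conjI ballI)
    show "endo M (\<lambda>x. r \<cdot> \<phi> x)"
     using *(3) linmap_smult rK Osub_smult[OF sM *(1)] unfolding good_def endo_def by blast
    fix j assume j: "j \<in> J"
    obtain h where h: "h \<in> H j" "n j = \<phi> (u j) \<boxplus> h" using *(3) j unfolding good_def by blast
    have "\<phi> (u j) \<in> carrier V" "h \<in> carrier V"
     using *(3) u Mc VO.sub_carrier[OF Hsub(1)[OF j]] h unfolding good_def endo_def by auto
    then have "(r \<odot>\<^bsub>pw V\<^esub> n) j = r \<cdot> \<phi> (u j) \<boxplus> r \<cdot> h" using h rK by (simp add: smult_r_distr)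
    then show "\<exists>h\<in>H j. (r \<odot>\<^bsub>pw V\<^esub> n) j = r \<cdot> \<phi> (u j) \<boxplus> h"
     using Osub_smult[OF Hsub(1)[OF j] *(1) h(1)] by blast
   qed
   then show "r \<odot>\<^bsub>pw V\<^esub> n \<in> S" unfolding S_def using * rK by auto
  qed
  have "set gs \<subseteq> S"
  proof
   fix g assume g: "g \<in> set gs"
   have gc: "g \<in> carrier (pw V)" using gsc g by blast
   have "g \<in> set gs1 \<or> g \<in> set gs2" using g unfolding gs_def by auto
   then show "g \<in> S"
   proof
    assume "g \<in> set gs1"
    then obtain \<phi> where \<phi>: "endo M \<phi>" "\<forall>j. g j = \<phi> (u j)" using gs1(1) by blast
    have "good g \<phi>"
     unfolding good_def
    proof (intro conjI ballI \<phi>(1))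
     fix j assume j: "j \<in> J"
     have "\<phi> (u j) \<in> carrier V" using \<phi>(1) u Mc unfolding endo_def by blast
     then show "\<exists>h\<in>H j. g j = \<phi> (u j) \<boxplus> h"
      using \<phi>(2) VO.sub_zero[OF Hsub(1)[OF j]] by (intro bexI[of _ "0\<^sub>V"]) auto
    qed
    then show ?thesis unfolding S_def using gc by blast
   next
    assume "g \<in> set gs2"
    then obtain j' h where jh: "j' \<in> J" "h \<in> set (hs j')" "g = \<delta> j' h" unfolding gs2 by blast
    have "h \<in> H j'" unfolding H(2)[OF jh(1)]
     using VO.ext_mem[OF VO.sub_zero_set, of "hs j'"] H(1)[OF jh(1)] Mc jh(2) by blast
    then have "g j \<in> H j" if "j \<in> J" for j
     unfolding jh(3) \<delta>_def using VO.sub_zero[OF Hsub(1)[OF that]] by auto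
    moreover have "g j = 0\<^sub>V \<boxplus> g j" for j using gc by simp
    ultimately have "good g (\<lambda>_. 0\<^sub>V)"
     unfolding good_def endo_def using linmap_zero VO.sub_zero[OF sM] by blast
    then show ?thesis unfolding S_def using gc by blast
   qed
  qed
  then have "E \<subseteq> S" unfolding E_def
   using PW.ext_least[OF Sub, of "{\<lambda>_. 0\<^sub>V}" gs] PW.sub_zero[OF Sub] by simp
  then show ?thesis using n unfolding S_def good_def by blast
 qed
 have G2: "\<exists>n\<in>E. \<forall>j\<in>J. n j = \<phi> (u j) \<boxplus> f j" if \<phi>: "endo M \<phi>" and f: "\<And>j. j \<in> J \<Longrightarrow> f j \<in> H j" for \<phi> f
 proof -
  have \<delta>E: "\<delta> j h \<in> E" if j: "j \<in> J" and h: "h \<in> H j" for j h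
  proof -
   have S: "Osub {h \<in> carrier V. \<delta> j h \<in> E}"
   proof (rule OsubI)
    show "0\<^sub>V \<in> {h \<in> carrier V. \<delta> j h \<in> E}" using PW.sub_zero[OF Es(1)] by (simp add: \<delta>_def)
    show "x \<boxplus> y \<in> {h \<in> carrier V. \<delta> j h \<in> E}"
     if xy: "x \<in> {h \<in> carrier V. \<delta> j h \<in> E}" "y \<in> {h \<in> carrier V. \<delta> j h \<in> E}" for x y
    proof -
     have "\<delta> j x \<oplus>\<^bsub>pw V\<^esub> \<delta> j y = \<delta> j (x \<boxplus> y)" using xy by (auto simp: \<delta>_def)
     then show ?thesis using PW.sub_add[OF Es(1), of "\<delta> j x" "\<delta> j y"] xy by simp
    qed
    show "r \<cdot> y \<in> {h \<in> carrier V. \<delta> j h \<in> E}"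
     if r: "r \<in> \<O>" and y: "y \<in> {h \<in> carrier V. \<delta> j h \<in> E}" for r y
    proof -
     have "r \<odot>\<^bsub>pw V\<^esub> \<delta> j y = \<delta> j (r \<cdot> y)" using O_carrier[OF r] by (auto simp: \<delta>_def)
     then show ?thesis using PW.sub_smult[OF Es(1), of r "\<delta> j y"] r y O_carrier[OF r] by simp
    qed
   qed auto
   have "set (hs j) \<subseteq> {h \<in> carrier V. \<delta> j h \<in> E}"
   proof
    fix h assume hh: "h \<in> set (hs j)"
    then have "\<delta> j h \<in> set gs" using j unfolding gs_def set_append gs2 by blast
    then show "h \<in> {h \<in> carrier V. \<delta> j h \<in> E}" using Es(2) H(1)[OF j] Mc hh by blast
   qed
   then have "H j \<subseteq> {h \<in> carrier V. \<delta> j h \<in> E}" unfolding H(2)[OF j]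
    using VO.ext_least[OF S, of "{0\<^sub>V}" "hs j"] VO.sub_zero[OF S] by simp
   then show ?thesis using h by blast
  qed
  have fc: "f j \<in> carrier V" if "j \<in> J" for j using f[OF that] VO.sub_carrier[OF Hsub(1)[OF that]] by blast
  have "(\<lambda>j. if j \<in> J' then f j else 0\<^sub>V) \<in> E" if "J' \<subseteq> J" for J'
   using finite_subset[OF that J] that
  proof (induction J' rule: finite_induct)
   case empty
   then show ?case using PW.sub_zero[OF Es(1)] by simp
  next
   case (insert j J')
   have "(\<lambda>i. if i \<in> J' then f i else 0\<^sub>V) \<oplus>\<^bsub>pw V\<^esub> \<delta> j (f j) = (\<lambda>i. if i \<in> insert j J' then f i else 0\<^sub>V)"
    using insert fc by (auto simp: \<delta>_def subset_iff fun_eq_iff)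
   then show ?case
    using PW.sub_add[OF Es(1), of "\<lambda>i. if i \<in> J' then f i else 0\<^sub>V" "\<delta> j (f j)"] insert \<delta>E f by simp
  qed
  then have f': "(\<lambda>j. if j \<in> J then f j else 0\<^sub>V) \<in> E" by simp
  have "set gs1 \<subseteq> E" using Es(2) unfolding gs_def by auto
  then have "PW.ext {\<lambda>_. 0\<^sub>V} gs1 \<subseteq> E"
   using PW.ext_least[OF Es(1), of "{\<lambda>_. 0\<^sub>V}" gs1] PW.sub_zero[OF Es(1)] by simp
  then have "(\<lambda>j. \<phi> (u j)) \<in> E" using gs1(2)[OF \<phi>] by blast
  then have "(\<lambda>j. \<phi> (u j)) \<oplus>\<^bsub>pw V\<^esub> (\<lambda>j. if j \<in> J then f j else 0\<^sub>V) \<in> E" using PW.sub_add[OF Es(1)] f' by blast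
  then show ?thesis by (rule bexI[rotated]) simp
 qed
 let ?near = "\<lambda>b. \<exists>n\<in>E. \<forall>j\<in>J. \<exists>l\<in>M. v j = n j \<boxplus> b \<cdot> l"
 have eq: "?near b \<longleftrightarrow> near b" for b
 proof
  assume "?near b"
  then obtain n where n: "n \<in> E" "\<forall>j\<in>J. \<exists>l\<in>M. v j = n j \<boxplus> b \<cdot> l" by blast
  obtain \<phi> where \<phi>: "endo M \<phi>" "\<forall>j\<in>J. \<exists>h\<in>H j. n j = \<phi> (u j) \<boxplus> h" using G1[OF n(1)] by blast
  show "near b" unfolding near_def
  proof (intro exI[of _ \<phi>] conjI ballI \<phi>(1))
   fix j assume "j \<in> J"
   then show "\<exists>h\<in>H j. \<exists>l\<in>M. v j = (\<phi> (u j) \<boxplus> h) \<boxplus> b \<cdot> l" using n(2) \<phi>(2) by metis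
  qed
 next
  assume "near b"
  then obtain \<phi> where \<phi>: "endo M \<phi>" "\<forall>j\<in>J. \<exists>h\<in>H j. \<exists>l\<in>M. v j = (\<phi> (u j) \<boxplus> h) \<boxplus> b \<cdot> l" unfolding near_def by blast
  then obtain f where f: "\<And>j. j \<in> J \<Longrightarrow> f j \<in> H j \<and> (\<exists>l\<in>M. v j = (\<phi> (u j) \<boxplus> f j) \<boxplus> b \<cdot> l)" by metis
  obtain n where n: "n \<in> E" "\<forall>j\<in>J. n j = \<phi> (u j) \<boxplus> f j" using G2[OF \<phi>(1), of f] f by blast
  show "?near b"
  proof (rule bexI[OF _ n(1)], intro ballI)
   fix j assume "j \<in> J"
   then show "\<exists>l\<in>M. v j = n j \<boxplus> b \<cdot> l" using n(2) f by simp
  qed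
 qed
 have "\<exists>b\<in>\<O>. ?near b \<and> (\<forall>b'\<in>\<O>. ?near b' \<longrightarrow> (\<exists>r\<in>\<O>. b = r \<otimes> b'))"
  unfolding E_def by (rule best_approximation[OF M J]) (use gsM v Mc in auto)
 then show ?thesis unfolding eq .
qed

end

section \<open>Lifts that agree modulo a, as graphs\<close>

context subspace_config
begin

text \<open>The map T = 1 + a\<phi> is the identity modulo m, so it sends vectors of M outside mM to
  such vectors, and T y in M forces y in M. Hence M \<inter> T(Y) = T(M \<inter> Y), which differs
  from M \<inter> Y only modulo aM.\<close>

lemma graph_modification:
 assumes M: "lattice M" and Y: "sub Y" and a: "a \<in> m" and \<phi>: "endo M \<phi>"
 defines "Y' \<equiv> (\<lambda>y. y \<boxplus> a \<cdot> \<phi> y) ` Y"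
 shows "sub Y'" "M \<inter> Y' = (\<lambda>y. y \<boxplus> a \<cdot> \<phi> y) ` (M \<inter> Y)"
  "(M \<inter> Y') \<uplus> mm M = (M \<inter> Y) \<uplus> mm M"
  "(M \<inter> Y') \<uplus> scale a M = (M \<inter> Y) \<uplus> scale a M"
proof -
 have sM: "Osub M" using lattice_sub M by simp
 note smM = mm_sub[OF sM]
 note Mc = VO.sub_carrier[OF sM]
 have aK: "a \<in> carrier K" "a \<in> \<O>" using a m_carrier m_O by auto
 have lin: "linmap \<phi>" and \<phi>M: "\<And>x. x \<in> M \<Longrightarrow> \<phi> x \<in> M" using \<phi> unfolding endo_def by auto
 note \<phi>D = linmapD[OF lin]
 define T where "T = (\<lambda>y. y \<boxplus> a \<cdot> \<phi> y)"
 have T: "linmap T" unfolding T_def by (intro linmap_add linmap_id linmap_smult lin aK)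
 note TD = linmapD[OF T]
 show sY': "sub Y'" unfolding Y'_def using linmap_image[OF T Y] unfolding T_def .
 have am: "a \<cdot> \<phi> y \<in> scale a M" "a \<cdot> \<phi> y \<in> mm M" "a \<cdot> \<phi> y \<in> M" if "y \<in> M" for y
  using scaleI[OF \<phi>M[OF that]] mmI[OF a \<phi>M[OF that]] smM(2) by auto
 have TM: "T y \<in> M" if "y \<in> M" for y unfolding T_def using VO.sub_add[OF sM that am(3)[OF that]] .
 have TMiff: "y \<in> M" if y: "y \<in> Y" "T y \<in> M" for y
 proof (cases "y = 0\<^sub>V")
  case True
  then show ?thesis using VO.sub_zero[OF sM] by simp
 next
  case False
  obtain c g where cg: "c \<in> carrier K" "g \<in> M" "g \<notin> mm M" "y = c \<cdot> g"
   using primitive_part[OF M sub_carrier[OF Y y(1)] False] by blast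
  have gc: "g \<in> carrier V" using cg Mc by simp
  have "T g \<notin> mm M"
  proof
   assume "T g \<in> mm M"
   then have "g \<in> mm M" unfolding T_def using VO.sub_cancel'[OF smM(1) _ am(2)[OF cg(2)] gc] by simp
   then show False using cg by simp
  qed
  moreover have "c \<cdot> T g = \<one> \<cdot> T y" unfolding cg(4) using TD cg(1) gc by simp
  ultimately obtain r where "r \<in> \<O>" "c = r \<otimes> \<one>"
   using primitive_dvd[OF M TM[OF cg(2)] _ cg(1) R.one_closed y(2)] by blast
  then have "c \<in> \<O>" using O_carrier by simp
  then show ?thesis unfolding cg(4) using Osub_smult[OF sM _ cg(2)] by simp
 qed
 have MY': "M \<inter> Y' = T ` (M \<inter> Y)" unfolding Y'_def T_def[symmetric] using TM TMiff by blast
 then show "M \<inter> Y' = (\<lambda>y. y \<boxplus> a \<cdot> \<phi> y) ` (M \<inter> Y)" unfolding T_def .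
 have s: "Osub (M \<inter> Y)" "Osub (M \<inter> Y')" using VO.sub_Int sM sub_Osub Y sY' by auto
 have gen: "(M \<inter> Y') \<uplus> N = (M \<inter> Y) \<uplus> N"
  if N: "Osub N" and aN: "\<And>y. y \<in> M \<Longrightarrow> a \<cdot> \<phi> y \<in> N" for N
 proof (intro equalityI)
  have C: "Osub ((M \<inter> Y) \<uplus> N)" "M \<inter> Y \<subseteq> (M \<inter> Y) \<uplus> N" "N \<subseteq> (M \<inter> Y) \<uplus> N"
   using VO.sub_sum[OF s(1) N] VO.sum_upper1[OF s(1) N] VO.sum_upper2[OF s(1) N] by auto
  have C': "Osub ((M \<inter> Y') \<uplus> N)" "M \<inter> Y' \<subseteq> (M \<inter> Y') \<uplus> N" "N \<subseteq> (M \<inter> Y') \<uplus> N"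
   using VO.sub_sum[OF s(2) N] VO.sum_upper1[OF s(2) N] VO.sum_upper2[OF s(2) N] by auto
  have "M \<inter> Y' \<subseteq> (M \<inter> Y) \<uplus> N"
  proof
   fix z assume "z \<in> M \<inter> Y'"
   then obtain y where "y \<in> M \<inter> Y" "z = T y" unfolding MY' by blast
   then show "z \<in> (M \<inter> Y) \<uplus> N" unfolding T_def using sumI aN by auto
  qed
  then show "(M \<inter> Y') \<uplus> N \<subseteq> (M \<inter> Y) \<uplus> N" using VO.sum_least[OF C(1) _ C(3)] by simp
  have "M \<inter> Y \<subseteq> (M \<inter> Y') \<uplus> N"
  proof
   fix y assume y: "y \<in> M \<inter> Y"
   then have "T y \<in> (M \<inter> Y') \<uplus> N" using C' MY' by blast
   moreover have "a \<cdot> \<phi> y \<in> (M \<inter> Y') \<uplus> N" using aN C' y by blast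
   ultimately show "y \<in> (M \<inter> Y') \<uplus> N" unfolding T_def using VO.sub_cancel'[OF C'(1)] y Mc by blast
  qed
  then show "(M \<inter> Y) \<uplus> N \<subseteq> (M \<inter> Y') \<uplus> N" using VO.sum_least[OF C'(1) _ C'(3)] by simp
 qed
 show "(M \<inter> Y') \<uplus> mm M = (M \<inter> Y) \<uplus> mm M" by (rule gen[OF smM(1) am(2)])
 show "(M \<inter> Y') \<uplus> scale a M = (M \<inter> Y) \<uplus> scale a M" by (rule gen[OF scale_sub[OF sM aK(1)] am(1)])
qed

text \<open>A converse of \<open>graph_modification\<close>. A complement Q of Y that is compatible
  with M is also one of Y', since both have the same reduction. On Y the projection to Y' along Q
  differs from the identity by a multiple of a, because Y and Y' agree modulo aM; a\<phi> is this
  difference composed with the projection to Y.\<close>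

lemma modification_graph:
 assumes M: "lattice M" and Y: "sub Y" "sub Y'" and a: "a \<in> m" "a \<noteq> \<zero>"
  and W: "(M \<inter> Y') \<uplus> mm M = (M \<inter> Y) \<uplus> mm M"
  and L: "(M \<inter> Y') \<uplus> scale a M = (M \<inter> Y) \<uplus> scale a M"
 shows "\<exists>\<phi>. endo M \<phi> \<and> (\<forall>y'\<in>M \<inter> Y'. \<exists>y\<in>M \<inter> Y. y' = y \<boxplus> a \<cdot> \<phi> y)"
proof -
 have sM: "Osub M" using lattice_sub M by simp
 note smM = mm_sub[OF sM]
 note Mc = VO.sub_carrier[OF sM]
 have aK: "a \<in> carrier K" "a \<in> \<O>" using a m_carrier m_O by auto
 obtain Q where Q: "sub Q" "dimK Y + dimK Q \<le> dimK (carrier V)"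
  "M \<subseteq> ((M \<inter> Y) \<uplus> (M \<inter> Q)) \<uplus> mm M" using lattice_complement[OF M Y(1)] by blast
 have s: "Osub (M \<inter> Y)" "Osub (M \<inter> Y')" "Osub (M \<inter> Q)" using VO.sub_Int sM sub_Osub Y Q by auto
 note d1 = lattice_decomposition[OF M Y(1) Q]
 have "dimK Y' = dimK Y" using reduction_between(2)[OF M Y(1)] reduction_between(2)[OF M Y(2)] W by simp
 then have dim': "dimK Y' + dimK Q \<le> dimK (carrier V)" using Q by simp
 have swap: "(A \<uplus> (M \<inter> Q)) \<uplus> mm M = (A \<uplus> mm M) \<uplus> (M \<inter> Q)" if "Osub A" for A
  using VO.sum_assoc[OF that s(3) smM(1)] VO.sum_assoc[OF that smM(1) s(3)] VO.sum_comm[OF s(3) smM(1)] by simp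
 have "M \<subseteq> ((M \<inter> Y') \<uplus> (M \<inter> Q)) \<uplus> mm M"
  using Q(3) unfolding swap[OF s(1)] swap[OF s(2)] W .
 note d2 = lattice_decomposition[OF M Y(2) Q(1) dim' this]
 obtain \<pi> where \<pi>: "linmap \<pi>" "\<And>y q. y \<in> Y \<Longrightarrow> q \<in> Q \<Longrightarrow> \<pi> (y \<boxplus> q) = y"
  using projection[OF Y(1) Q(1) d1(2,3)] by blast
 obtain \<rho> where \<rho>: "linmap \<rho>" "\<And>y q. y \<in> Y' \<Longrightarrow> q \<in> Q \<Longrightarrow> \<rho> (y \<boxplus> q) = y"
  using projection[OF Y(2) Q(1) d2(2,3)] by blast
 define \<phi> where "\<phi> x = inv a \<cdot> (\<rho> (\<pi> x) \<boxplus> (\<ominus> \<one>) \<cdot> \<pi> x)" for x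
 have lin: "linmap \<phi>"
  unfolding \<phi>_def by (intro linmap_smult linmap_add linmap_comp[OF \<rho>(1)] \<pi>(1) inv_K(1)[OF aK(1) a(2)]) simp
 have \<pi>Y: "\<pi> y = y" if "y \<in> Y" for y
  using \<pi>(2)[OF that sub_zero[OF Q(1)]] sub_carrier[OF Y(1) that] by simp
 have key: "\<phi> y \<in> M \<and> \<rho> y = y \<boxplus> a \<cdot> \<phi> y" if y: "y \<in> M \<inter> Y" for y
 proof -
  have yc: "y \<in> carrier V" using y Mc by blast
  have "y \<in> (M \<inter> Y') \<uplus> scale a M"
   unfolding L using y VO.sum_upper1[OF s(1) scale_sub[OF sM aK(1)]] by blast
  then obtain y1 t where yt: "y1 \<in> M \<inter> Y'" "t \<in> M" "y = y1 \<boxplus> a \<cdot> t" by (auto simp: mem_sum scale_def)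
  have "t \<in> (M \<inter> Y') \<uplus> (M \<inter> Q)" using yt d2(1) by simp
  then obtain y2 q where q: "y2 \<in> M \<inter> Y'" "q \<in> M \<inter> Q" "t = y2 \<boxplus> q" unfolding mem_sum by blast
  have c: "y1 \<in> carrier V" "y2 \<in> carrier V" "q \<in> carrier V" using yt q Mc by auto
  have y1: "y = (y1 \<boxplus> a \<cdot> y2) \<boxplus> a \<cdot> q"
   unfolding yt(3) q(3) using c aK by (simp add: smult_r_distr M.a_assoc)
  have "\<rho> y = y1 \<boxplus> a \<cdot> y2"
   unfolding y1 by (rule \<rho>(2)) (use yt q sub_add[OF Y(2)] sub_smult[OF Y(2)] sub_smult[OF Q(1)] aK in auto)
  then have \<rho>y: "y = \<rho> y \<boxplus> a \<cdot> q" "\<rho> y \<in> carrier V" using y1 c aK by auto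
  have "\<rho> y \<boxplus> (\<ominus> \<one>) \<cdot> y = \<rho> y \<boxplus> \<ominus>\<^bsub>V\<^esub> y" using yc by (simp add: smult_l_minus)
  also have "\<dots> = \<rho> y \<boxplus> \<ominus>\<^bsub>V\<^esub> (\<rho> y \<boxplus> a \<cdot> q)" using \<rho>y(1) by simp
  also have "\<dots> = a \<cdot> (\<ominus>\<^bsub>V\<^esub> q)"
   using \<rho>y(2) c aK by (simp add: M.minus_add M.r_neg1 M.r_neg M.a_assoc[symmetric] smult_r_minus)
  finally have "\<phi> y = inv a \<cdot> (a \<cdot> (\<ominus>\<^bsub>V\<^esub> q))" unfolding \<phi>_def using \<pi>Y y by simp
  then have \<phi>y: "\<phi> y = \<ominus>\<^bsub>V\<^esub> q" using smult_inv(1)[OF aK(1) a(2)] c by simp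
  then have "\<phi> y \<in> M" using VO.sub_neg[OF sM] q by simp
  moreover have "y \<boxplus> a \<cdot> \<phi> y = (\<rho> y \<boxplus> a \<cdot> q) \<boxplus> a \<cdot> (\<ominus>\<^bsub>V\<^esub> q)" using \<rho>y(1) \<phi>y by simp
  moreover have "\<dots> = \<rho> y" using \<rho>y(2) c aK by (simp add: M.a_assoc smult_r_minus M.r_neg)
  ultimately show ?thesis by simp
 qed
 have "endo M \<phi>"
  unfolding endo_def
 proof (intro conjI lin ballI)
  fix x assume "x \<in> M"
  then have "x \<in> (M \<inter> Y) \<uplus> (M \<inter> Q)" using d1(1) by simp
  then obtain y q where yq: "y \<in> M \<inter> Y" "q \<in> M \<inter> Q" "x = y \<boxplus> q" unfolding mem_sum by blast
  then have "\<phi> x = \<phi> y" unfolding \<phi>_def using \<pi>(2)[of y q] \<pi>Y[of y] by simp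
  then show "\<phi> x \<in> M" using key[OF yq(1)] by simp
 qed
 moreover have "\<exists>y\<in>M \<inter> Y. y' = y \<boxplus> a \<cdot> \<phi> y" if y': "y' \<in> M \<inter> Y'" for y'
 proof -
  have "y' \<in> (M \<inter> Y) \<uplus> (M \<inter> Q)" using y' d1(1) by simp
  then obtain y q where yq: "y \<in> M \<inter> Y" "q \<in> M \<inter> Q" "y' = y \<boxplus> q" unfolding mem_sum by blast
  have c: "y \<in> carrier V" "q \<in> carrier V" "y' \<in> carrier V" using yq y' Mc by auto
  have "y = y' \<boxplus> \<ominus>\<^bsub>V\<^esub> q" unfolding yq(3) using c by (simp add: M.a_assoc M.r_neg)
  then have "\<rho> y = y'" using \<rho>(2)[of y' "\<ominus>\<^bsub>V\<^esub> q"] y' yq sub_neg[OF Q(1)] by simp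
  then show ?thesis using key[OF yq(1)] yq(1) by metis
 qed
 ultimately show ?thesis by blast
qed

end

section \<open>Squaring the modulus\<close>

context subspace_config
begin

text \<open>Nakayama inside L: by \<open>adm_kernel\<close> the part of L/mL in \<open>F i\<close>
  is generated by lifts of generators of W \<inter> \<open>F i\<close> and by a(M \<inter>
  \<open>F i\<close>).\<close>

lemma lattice_Int_eq_sum:
 assumes M: "lattice M" and Y: "sub Y" and a: "a \<in> m" "a \<noteq> \<zero>" and adm: "adm M Y a" and i: "i \<in> Idx"
 defines "L \<equiv> (M \<inter> Y) \<uplus> scale a M" and "W \<equiv> (M \<inter> Y) \<uplus> mm M"
 assumes xs: "set xs \<subseteq> F i \<inter> L" "VO.ext (mm M \<inter> F i) xs = W \<inter> F i"
 shows "F i \<inter> L \<subseteq> Ospan xs \<uplus> scale a (M \<inter> F i)"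
proof -
 note FK = F_sub[OF i]
 have FO: "Osub (F i)" using sub_Osub[OF FK] .
 have sM: "Osub M" using lattice_sub M by simp
 note smM = mm_sub[OF sM]
 have aK: "a \<in> carrier K" using a m_carrier by simp
 note mod = modification[OF M Y a, folded L_def W_def]
 note ker = adm_kernel[OF M Y a adm i, folded L_def W_def]
 have sL: "Osub L" using lattice_sub[OF mod(1)] .
 note smL = mm_sub[OF sL]
 have xc: "set xs \<subseteq> carrier V" using xs(1) VO.sub_carrier[OF sL] by blast
 have S: "Osub (Ospan xs)" using Ospan_sub[OF xc] .
 have SL: "Ospan xs \<subseteq> L \<inter> F i"
  by (rule VO.ext_least[OF VO.sub_Int[OF sL FO]]) (use xs VO.sub_zero[OF VO.sub_Int[OF sL FO]] in auto)
 have B: "Osub (mm M \<inter> F i)" using VO.sub_Int[OF smM(1) FO] .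
 have WF: "W \<inter> F i = Ospan xs \<uplus> (mm M \<inter> F i)"
  using VO.ext_sum[OF VO.sub_zero_set B xc] VO.sum_absorb2[OF VO.sub_zero_set B] VO.sub_zero[OF B] xs(2) by simp
 have A: "Osub (scale a (M \<inter> F i))" using scale_sub[OF VO.sub_Int[OF sM FO] aK] .
 let ?N = "Ospan xs \<uplus> scale a (M \<inter> F i)"
 have N: "Osub ?N" "Ospan xs \<subseteq> ?N" "scale a (M \<inter> F i) \<subseteq> ?N"
  using VO.sub_sum[OF S A] VO.sum_upper1[OF S A] VO.sum_upper2[OF S A] by auto
 have AL: "scale a (M \<inter> F i) \<subseteq> L \<inter> F i"
  using VO.sum_upper1[OF A VO.sub_Int[OF smL(1) FO]] ker(2) by blast
 have "?N = L \<inter> F i"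
 proof (rule nakayama[OF mod(1) FK N(1)])
  show "?N \<subseteq> L \<inter> F i" using VO.sum_least[OF VO.sub_Int[OF sL FO] SL AL] .
  show "L \<inter> F i \<subseteq> ?N \<uplus> mm L"
  proof
   fix x assume x: "x \<in> L \<inter> F i"
   then have "x \<in> Ospan xs \<uplus> (mm M \<inter> F i)" using mod(4) WF by blast
   then obtain s n where sn: "s \<in> Ospan xs" "n \<in> mm M \<inter> F i" "x = s \<boxplus> n" unfolding mem_sum by blast
   have "n \<in> L" using VO.sub_cancel[OF sL, of s n] x sn SL VO.sub_carrier[OF B] by blast
   then have "n \<in> scale a (M \<inter> F i) \<uplus> (mm L \<inter> F i)" using sn ker(2) by blast
   then obtain p q where pq: "p \<in> scale a (M \<inter> F i)" "q \<in> mm L" "n = p \<boxplus> q" unfolding mem_sum by blast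
   have "x = (s \<boxplus> p) \<boxplus> q"
    unfolding sn(3) pq(3) using VO.sub_carrier[OF S sn(1)] VO.sub_carrier[OF A pq(1)] VO.sub_carrier[OF smL(1) pq(2)]
    by (simp add: M.a_assoc)
   then show "x \<in> ?N \<uplus> mm L" using sumI[OF sumI[OF sn(1) pq(1)] pq(2)] by simp
  qed
 qed
 then show ?thesis by auto
qed

text \<open>Lifted generators of the W \<inter> \<open>F i\<close> are written as x = u + a v with u
  in Y. Deforming Y to (1 + a\<phi>)Y raises the order from a to ab for a divisor b of a, provided
  \<phi>(u) approximates v modulo b and harmless terms. For the best such b, suppose a does not
  divide b. Then b divides a properly, and Langton's step at order ab gains another factor from m;
  its result is again a graph over Y modulo a, so it is a strictly better approximation, a
  contradiction.\<close>

lemma doubling: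
 assumes M: "lattice M" and Y: "sub Y"
 defines "W \<equiv> (M \<inter> Y) \<uplus> mm M"
 assumes max: "\<And>X. between M X \<Longrightarrow> degO M X \<le> degO M W"
  and min: "\<And>L. lattice L \<Longrightarrow> \<exists>X. between L X \<and> degO M W \<le> degO L X"
  and a: "a \<in> m" "a \<noteq> \<zero>" and adm: "adm M Y a"
 shows "\<exists>Y'. sub Y' \<and> (M \<inter> Y') \<uplus> mm M = W \<and> adm M Y' (a \<otimes> a)"
proof -
 have sM: "Osub M" using lattice_sub M by simp
 note smM = mm_sub[OF sM]
 note Mc = VO.sub_carrier[OF sM]
 have aK: "a \<in> carrier K" "a \<in> \<O>" using a m_carrier m_O by auto
 have bW: "between M W" using reduction_between(1)[OF M Y] W_def by simp
 have W: "Osub W" "mm M \<subseteq> W" "W \<subseteq> M" using bW unfolding between_def by auto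
 define L where "L = (M \<inter> Y) \<uplus> scale a M"
 note mod = modification[OF M Y a, folded L_def W_def]
 have sL: "Osub L" using lattice_sub[OF mod(1)] .
 have sY: "Osub (M \<inter> Y)" using VO.sub_Int sM sub_Osub Y by auto
 note ker = adm_kernel[OF M Y a adm, folded L_def W_def]
 have "\<exists>xs. set xs \<subseteq> F i \<inter> L \<and> VO.ext (mm M \<inter> F i) xs = W \<inter> F i" if i: "i \<in> Idx" for i
 proof -
  note FO = sub_Osub[OF F_sub[OF i]]
  have N: "Osub (F i \<inter> L)" "F i \<inter> L \<subseteq> W \<inter> F i" using VO.sub_Int[OF FO sL] mod(4) by auto
  have "W \<inter> F i \<subseteq> (mm M \<inter> F i) \<uplus> (F i \<inter> L)"
   using ker(1)[OF i] VO.sum_comm[OF N(1) VO.sub_Int[OF smM(1) FO]] by (simp add: Int_commute)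
  then show ?thesis using VO.dm_gens_in[OF VO.dm_rk[OF between_fin(2)[OF M bW F_sub[OF i]]] N] by blast
 qed
 then obtain xs where xs: "\<And>i. i \<in> Idx \<Longrightarrow> set (xs i) \<subseteq> F i \<inter> L \<and> VO.ext (mm M \<inter> F i) (xs i) = W \<inter> F i" by metis
 define J where "J = (SIGMA i:Idx. set (xs i))"
 have J: "finite J" unfolding J_def using finite_Idx by auto
 have Jx: "i \<in> Idx" "x \<in> F i" "x \<in> L" if "(i, x) \<in> J" for i x using that xs unfolding J_def by auto
 have "\<forall>x\<in>L. \<exists>p. fst p \<in> M \<inter> Y \<and> snd p \<in> M \<and> x = fst p \<boxplus> a \<cdot> snd p"
 proof
  fix x assume "x \<in> L"
  then obtain u t where "u \<in> M \<inter> Y" "t \<in> M" "x = u \<boxplus> a \<cdot> t" unfolding L_def by (auto simp: mem_sum scale_def)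
  then show "\<exists>p. fst p \<in> M \<inter> Y \<and> snd p \<in> M \<and> x = fst p \<boxplus> a \<cdot> snd p" by (intro exI[of _ "(u, t)"]) simp
 qed
 from bchoice[OF this] obtain p where p: "\<forall>x\<in>L. fst (p x) \<in> M \<inter> Y \<and> snd (p x) \<in> M \<and> x = fst (p x) \<boxplus> a \<cdot> snd (p x)"
  by (elim exE)
 \<comment> \<open>The value 0 outside L keeps u and v in M at every index of the type.\<close>
 define u where "u j = (if snd j \<in> L then fst (p (snd j)) else 0\<^sub>V)" for j :: "'i \<times> 'c"
 define v where "v j = (if snd j \<in> L then snd (p (snd j)) else 0\<^sub>V)" for j :: "'i \<times> 'c"
 have uM: "u j \<in> M \<inter> Y" and vM: "v j \<in> M" for j
  using p VO.sub_zero[OF sY] VO.sub_zero[OF sM] unfolding u_def v_def by auto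
 have x: "x = u (i, x) \<boxplus> a \<cdot> v (i, x)" if "(i, x) \<in> J" for i x
  using p Jx[OF that] unfolding u_def v_def by simp
 \<comment> \<open>Harmless terms: changing v by M \<inter> \<open>F i\<close> moves x by a vector
   of \<open>F i\<close> in aM, and changing it by M \<inter> Y moves u inside M \<inter> Y.\<close>
 define H where "H j = (M \<inter> F (fst j)) \<uplus> (M \<inter> Y)" for j :: "'i \<times> 'c"
 obtain ey where ey: "set ey \<subseteq> M \<inter> Y" "M \<inter> Y = Ospan ey" using lattice_basis[OF M Y] by blast
 have "\<exists>ef. set ef \<subseteq> M \<inter> F i \<and> M \<inter> F i = Ospan ef" if "i \<in> Idx" for i
  using lattice_basis[OF M F_sub[OF that]] by blast
 then obtain ef where ef: "\<And>i. i \<in> Idx \<Longrightarrow> set (ef i) \<subseteq> M \<inter> F i \<and> M \<inter> F i = Ospan (ef i)" by metis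
 define hs where "hs j = ey @ ef (fst j)" for j :: "'i \<times> 'c"
 have append: "VO.ext (VO.ext B ys) xs = VO.ext B (xs @ ys)" for B xs ys by (induction xs) auto
 have H: "set (hs j) \<subseteq> M" "H j = Ospan (hs j)" if j: "j \<in> J" for j
 proof -
  have i: "fst j \<in> Idx" using j unfolding J_def by auto
  show "set (hs j) \<subseteq> M" using ey(1) ef[OF i] unfolding hs_def by auto
  have eyc: "set ey \<subseteq> carrier V" using ey Mc by blast
  have s: "Osub (M \<inter> F (fst j))" using VO.sub_Int[OF sM sub_Osub[OF F_sub[OF i]]] .
  have "Ospan (hs j) = VO.ext (M \<inter> F (fst j)) ey" unfolding hs_def append[symmetric] using ef[OF i] by simp
  also have "\<dots> = Ospan ey \<uplus> (M \<inter> F (fst j))"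
   using VO.ext_sum[OF VO.sub_zero_set s eyc] VO.sum_absorb2[OF VO.sub_zero_set s] VO.sub_zero[OF s] by simp
  finally show "H j = Ospan (hs j)" unfolding H_def using ey(2) VO.sum_comm[OF s sY] by simp
 qed
 define near where "near b \<longleftrightarrow> (\<exists>\<phi>. endo M \<phi> \<and> (\<forall>j\<in>J. \<exists>h\<in>H j. \<exists>l\<in>M. v j = (\<phi> (u j) \<boxplus> h) \<boxplus> b \<cdot> l))" for b
 obtain b where b: "b \<in> \<O>" "near b" "\<And>b'. b' \<in> \<O> \<Longrightarrow> near b' \<Longrightarrow> \<exists>r\<in>\<O>. b = r \<otimes> b'"
  using best_endo[OF M J, of u v hs H] uM vM H unfolding near_def by blast
 note bK = O_carrier[OF b(1)]
 \<comment> \<open>An approximation modulo a divisor \<open>b1\<close> of a yields a deformation of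
   order a \<open>b1\<close>. Divisibility is used to absorb the second-order term a a \<phi>(y),
   which arises because the correction y also passes through \<phi>.\<close>
 have improve: "\<exists>Y'. sub Y' \<and> (M \<inter> Y') \<uplus> mm M = W \<and> adm M Y' (a \<otimes> b1) \<and> (M \<inter> Y') \<uplus> scale a M = L"
  if b1: "b1 \<in> \<O>" "near b1" and r: "r \<in> \<O>" "a = r \<otimes> b1" for b1 r
 proof -
  note b1K = O_carrier[OF b1(1)] and rK = O_carrier[OF r(1)]
  obtain \<phi> where \<phi>: "endo M \<phi>" "\<And>j. j \<in> J \<Longrightarrow> \<exists>h\<in>H j. \<exists>l\<in>M. v j = (\<phi> (u j) \<boxplus> h) \<boxplus> b1 \<cdot> l"
   using b1(2) unfolding near_def by blast
  have lin: "linmap \<phi>" and \<phi>M: "\<And>x. x \<in> M \<Longrightarrow> \<phi> x \<in> M" using \<phi>(1) unfolding endo_def by auto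
  note \<phi>D = linmapD[OF lin]
  define Y' where "Y' = (\<lambda>y. y \<boxplus> a \<cdot> \<phi> y) ` Y"
  note g = graph_modification[OF M Y a(1) \<phi>(1), folded Y'_def W_def L_def]
  have sY': "Osub (M \<inter> Y')" using VO.sub_Int sM sub_Osub g(1) by auto
  have abK: "a \<otimes> b1 \<in> carrier K" using aK b1K by simp
  have "adm M Y' (a \<otimes> b1)"
   unfolding adm_def g(3)
  proof
   fix i assume i: "i \<in> Idx"
   note FO = sub_Osub[OF F_sub[OF i]]
   let ?A = "(M \<inter> Y') \<uplus> scale (a \<otimes> b1) M"
   have A: "Osub ?A" using VO.sub_sum[OF sY' scale_sub[OF sM abK]] .
   have FA: "Osub (F i \<inter> ?A)" using VO.sub_Int[OF FO A] .
   let ?C = "(F i \<inter> ?A) \<uplus> mm M"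
   have C: "Osub ?C" "mm M \<subseteq> ?C" using VO.sub_sum[OF FA smM(1)] VO.sum_upper2[OF FA smM(1)] by auto
   have "set (xs i) \<subseteq> ?C"
   proof
    fix x assume "x \<in> set (xs i)"
    then have j: "(i, x) \<in> J" unfolding J_def using i by simp
    note xJ = Jx[OF j]
    define u' where "u' = u (i, x)"
    have u': "u' \<in> M \<inter> Y" "u' \<in> carrier V" using uM[of "(i, x)"] Mc unfolding u'_def by auto
    obtain h l where hl: "h \<in> H (i, x)" "l \<in> M" "v (i, x) = (\<phi> u' \<boxplus> h) \<boxplus> b1 \<cdot> l"
     using \<phi>(2)[OF j] unfolding u'_def by blast
    obtain z y where zy: "z \<in> M \<inter> F i" "y \<in> M \<inter> Y" "h = z \<boxplus> y" using hl(1) unfolding H_def mem_sum by auto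
    define w where "w = u' \<boxplus> a \<cdot> y"
    \<comment> \<open>The component y of the correction in Y is transferred to the base point, so
      that x = (w + a \<phi>(w)) + a \<open>b1\<close> l' + a z.\<close>
    have w: "w \<in> M \<inter> Y" unfolding w_def using VO.sub_add[OF sY u'(1) Osub_smult[OF sY aK(2) zy(2)]] .
    define l' where "l' = l \<ominus>\<^bsub>V\<^esub> r \<cdot> \<phi> y"
    have \<phi>y: "\<phi> y \<in> M" "\<phi> u' \<in> M" using \<phi>M zy u' by auto
    have l'M: "l' \<in> M" unfolding l'_def using VO.sub_minus[OF sM hl(2) Osub_smult[OF sM r(1) \<phi>y(1)]] .
    have car: "l \<in> carrier V" "l' \<in> carrier V" "z \<in> carrier V" "y \<in> carrier V" "\<phi> y \<in> carrier V" "\<phi> u' \<in> carrier V"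
     using hl(2) l'M zy \<phi>y Mc by auto
    have l: "l = l' \<boxplus> r \<cdot> \<phi> y" unfolding l'_def using minus_add_cancel(1)[of l "r \<cdot> \<phi> y"] car rK by simp
    have b1r: "b1 \<otimes> r = a" using r(2) R.m_comm[OF b1K rK] by simp
    have "a \<cdot> (b1 \<cdot> l) = (a \<otimes> b1) \<cdot> l' \<boxplus> a \<cdot> ((b1 \<otimes> r) \<cdot> \<phi> y)"
     unfolding l using car aK(1) b1K rK by (simp add: smult_assoc1 smult_r_distr)
    then have bl: "a \<cdot> (b1 \<cdot> l) = (a \<otimes> b1) \<cdot> l' \<boxplus> a \<cdot> (a \<cdot> \<phi> y)"
     unfolding b1r .
    have \<phi>w: "\<phi> w = \<phi> u' \<boxplus> a \<cdot> \<phi> y" unfolding w_def using \<phi>D u' car aK by simp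
    define s where "s = (w \<boxplus> a \<cdot> \<phi> w) \<boxplus> (a \<otimes> b1) \<cdot> l'"
    have sA: "s \<in> ?A" unfolding s_def using w l'M by (intro sumI scaleI) (auto simp: g(2))
    have "x = u' \<boxplus> a \<cdot> ((\<phi> u' \<boxplus> (z \<boxplus> y)) \<boxplus> b1 \<cdot> l)"
     using x[OF j] hl(3) zy(3) unfolding u'_def by simp
    also have "\<dots> = (u' \<boxplus> ((a \<cdot> \<phi> u' \<boxplus> (a \<cdot> z \<boxplus> a \<cdot> y)) \<boxplus> a \<cdot> (b1 \<cdot> l)))"
     using car u'(2) aK(1) b1K by (simp add: smult_r_distr)
    also have "\<dots> = s \<boxplus> a \<cdot> z"
     unfolding bl s_def \<phi>w unfolding w_def using car u'(2) aK(1) abK by (simp add: smult_r_distr M.a_ac)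
    finally have xs': "x = s \<boxplus> a \<cdot> z" .
    have sc: "s \<in> carrier V" using sA VO.sub_carrier[OF A] by blast
    have "s \<in> F i" using sub_cancel'[OF F_sub[OF i], of s "a \<cdot> z"] xJ(2) xs' sc sub_smult[OF F_sub[OF i] aK(1)] zy(1) by auto
    then show "x \<in> ?C" unfolding xs' using sA mmI[OF a(1)] zy(1) by (intro sumI) auto
   qed
   then have "VO.ext (mm M \<inter> F i) (xs i) \<subseteq> ?C" using C by (intro VO.ext_least) auto
   then show "W \<inter> F i \<subseteq> ?C" using xs[OF i] by simp
  qed
  then show ?thesis using g by blast
 qed
 show ?thesis
 proof (cases "\<exists>r\<in>\<O>. b = r \<otimes> a")
  case True
  then obtain r where r: "r \<in> \<O>" "b = r \<otimes> a" by blast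
  obtain \<phi> where \<phi>: "endo M \<phi>" "\<forall>j\<in>J. \<exists>h\<in>H j. \<exists>l\<in>M. v j = (\<phi> (u j) \<boxplus> h) \<boxplus> b \<cdot> l"
   using b(2) unfolding near_def by blast
  have ba: "b \<cdot> l = a \<cdot> (r \<cdot> l)" "r \<cdot> l \<in> M" if "l \<in> M" for l
   using that Mc r aK O_carrier Osub_smult[OF sM r(1)] by (auto simp: smult_assoc1[symmetric] R.m_comm)
  have "near a" unfolding near_def
  proof (intro exI[of _ \<phi>] conjI \<phi>(1) ballI)
   fix j assume "j \<in> J"
   then obtain h l where "h \<in> H j" "l \<in> M" "v j = (\<phi> (u j) \<boxplus> h) \<boxplus> b \<cdot> l" using \<phi>(2) by blast
   then show "\<exists>h\<in>H j. \<exists>l\<in>M. v j = (\<phi> (u j) \<boxplus> h) \<boxplus> a \<cdot> l" using ba by metis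
  qed
  moreover have "a = \<one> \<otimes> a" using aK by simp
  ultimately show ?thesis using improve[OF aK(2) _ O_closed(2)] by blast
 next
  case False
  then obtain r where r: "r \<in> \<O>" "a = r \<otimes> b" using divide_total[OF aK(1) bK] by blast
  \<comment> \<open>a does not divide b, so a = r b with r in m; this room is needed to enlarge
    b.\<close>
  have rm: "r \<in> m"
  proof (rule ccontr)
   assume "r \<notin> m"
   then have i: "r \<noteq> \<zero>" "inv r \<in> \<O>" using O_unit r by auto
   have "b = inv r \<otimes> a" unfolding r(2) using inv_K[OF O_carrier[OF r(1)] i(1)] bK O_carrier[OF r(1)]
    by (simp add: R.m_assoc[symmetric])
   then show False using False i by blast
  qed
  have bz: "b \<noteq> \<zero>" using False O_closed(1) aK by (metis R.l_null)
  obtain Y1 where Y1: "sub Y1" "(M \<inter> Y1) \<uplus> mm M = W" "adm M Y1 (a \<otimes> b)" "(M \<inter> Y1) \<uplus> scale a M = L"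
   using improve[OF b(1,2) r] by blast
  have ab: "a \<otimes> b \<in> m" "a \<otimes> b \<noteq> \<zero>" "a \<otimes> b \<in> carrier K" using m_mult[OF b(1) a(1)] aK bK a bz by (auto simp: R.m_comm integral_iff)
  obtain Y2 c where Y2: "sub Y2" "(M \<inter> Y2) \<uplus> mm M = W" "c \<in> m" "c \<noteq> \<zero>" "adm M Y2 ((a \<otimes> b) \<otimes> c)"
   "(M \<inter> Y2) \<uplus> scale (a \<otimes> b) M = (M \<inter> Y1) \<uplus> scale (a \<otimes> b) M"
   using langton[OF M Y1(1) _ _ ab(1,2) Y1(3)] max min unfolding Y1(2) by blast
  have sY12: "Osub (M \<inter> Y1)" "Osub (M \<inter> Y2)" using VO.sub_Int sM sub_Osub Y1(1) Y2(1) by auto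
  have Sab: "Osub (scale (a \<otimes> b) M)" "Osub (scale a M)" using scale_sub[OF sM] ab aK by auto
  have "scale (a \<otimes> b) M \<subseteq> scale a M" using scale_dvd[OF sM aK(1) b(1)] aK bK by (simp add: R.m_comm)
  then have absorb: "scale (a \<otimes> b) M \<uplus> scale a M = scale a M" using VO.sum_absorb2[OF Sab] by simp
  have Y2L: "(M \<inter> Y2) \<uplus> scale a M = L"
   using VO.sum_assoc[OF sY12(2) Sab] VO.sum_assoc[OF sY12(1) Sab] absorb Y2(6) Y1(4) by simp
  obtain \<phi> where \<phi>: "endo M \<phi>" "\<And>y'. y' \<in> M \<inter> Y2 \<Longrightarrow> \<exists>y\<in>M \<inter> Y. y' = y \<boxplus> a \<cdot> \<phi> y"
   using modification_graph[OF M Y Y2(1) a] Y2(2) Y2L unfolding W_def L_def by blast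
  have lin: "linmap \<phi>" and \<phi>M: "\<And>x. x \<in> M \<Longrightarrow> \<phi> x \<in> M" using \<phi>(1) unfolding endo_def by auto
  note \<phi>D = linmapD[OF lin]
  \<comment> \<open>The gain c is cut down to d so that b d still divides a.\<close>
  obtain d where d: "d \<in> {c, r}" "\<forall>y\<in>{c, r}. \<exists>s\<in>\<O>. y = s \<otimes> d"
   using common_divisor[of "{c, r}"] Y2(3) rm m_carrier by auto
  have dm: "d \<in> m" "d \<in> carrier K" "d \<in> \<O>" using d Y2(3) rm m_carrier m_O by auto
  obtain s1 s2 where s: "s1 \<in> \<O>" "c = s1 \<otimes> d" "s2 \<in> \<O>" "r = s2 \<otimes> d" using d by auto
  note sK = O_carrier[OF s(1)] O_carrier[OF s(3)]
  define e where "e = (a \<otimes> b) \<otimes> d"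
  have eK: "e \<in> carrier K" unfolding e_def using ab dm by simp
  have "(a \<otimes> b) \<otimes> c = s1 \<otimes> e" unfolding e_def s(2) using ab dm sK by (simp add: R.m_ac)
  then have adm2: "adm M Y2 e" using adm_mono[OF M _ s(1) eK] Y2(5) by simp
  define b2 where "b2 = b \<otimes> d"
  have b2: "b2 \<in> \<O>" "b2 \<in> carrier K" "e = a \<otimes> b2" "a = s2 \<otimes> b2"
   unfolding b2_def e_def using b(1) dm bK aK sK r(2) s(4) O_closed(4) by (auto simp: R.m_ac)
  have eM: "scale e M \<subseteq> scale a M" using scale_dvd[OF sM aK(1) b2(1)] unfolding b2(3) using aK b2(2) by (simp add: R.m_comm)
  define N where "N = (M \<inter> Y2) \<uplus> scale e M"
  have N: "Osub N" "N \<subseteq> L" "N \<subseteq> W"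
  proof -
   show "Osub N" unfolding N_def using VO.sub_sum[OF sY12(2) scale_sub[OF sM eK]] .
   show "N \<subseteq> L" unfolding N_def Y2L[symmetric] by (rule VO.sum_mono[OF subset_refl eM])
   then show "N \<subseteq> W" using mod(4) by blast
  qed
  have "near b2"
   unfolding near_def
  proof (intro exI[of _ \<phi>] conjI \<phi>(1) ballI)
   fix j assume j: "j \<in> J"
   obtain i x where ix: "j = (i, x)" by (cases j)
   note xJ = Jx[OF j[unfolded ix]]
   note i = xJ(1)
   note FO = sub_Osub[OF F_sub[OF i]]
   have "W \<inter> F i \<subseteq> (F i \<inter> N) \<uplus> mm M" using adm2 i unfolding adm_def Y2(2) N_def by blast
   then have WF: "W \<inter> F i = (N \<inter> F i) \<uplus> (mm M \<inter> F i)"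
    using reduction_Int[OF M F_sub[OF i] N(1,3) W(2,1)] by blast
   have FN: "Osub (F i \<inter> N)" "F i \<inter> N \<subseteq> W \<inter> F i" using VO.sub_Int[OF FO N(1)] N(3) by auto
   have "W \<inter> F i \<subseteq> (mm M \<inter> F i) \<uplus> (F i \<inter> N)"
    unfolding WF using VO.sum_comm[OF FN(1) VO.sub_Int[OF smM(1) FO]] by (simp add: Int_commute)
   then obtain ys where ys: "set ys \<subseteq> F i \<inter> N" "VO.ext (mm M \<inter> F i) ys = W \<inter> F i"
    using VO.dm_gens_in[OF VO.dm_rk[OF between_fin(2)[OF M bW F_sub[OF i]]] FN] by blast
   have "set ys \<subseteq> F i \<inter> L" using ys N by blast
   then have "F i \<inter> L \<subseteq> Ospan ys \<uplus> scale a (M \<inter> F i)"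
    using lattice_Int_eq_sum[OF M Y a adm i, of ys] ys(2) unfolding L_def W_def by blast
   then obtain s z where sz: "s \<in> Ospan ys" "z \<in> M \<inter> F i" "x = s \<boxplus> a \<cdot> z"
    using xJ by (auto simp: mem_sum scale_def dest!: subsetD)
   have "{0\<^sub>V} \<subseteq> F i \<inter> N" using VO.sub_zero[OF FN(1)] by simp
   then have "s \<in> N" using VO.ext_least[OF FN(1) _ ys(1)] sz(1) by blast
   then obtain y' t where yt: "y' \<in> M \<inter> Y2" "t \<in> M" "s = y' \<boxplus> e \<cdot> t" unfolding N_def by (auto simp: mem_sum scale_def)
   obtain y where y: "y \<in> M \<inter> Y" "y' = y \<boxplus> a \<cdot> \<phi> y" using \<phi>(2)[OF yt(1)] by blast
   define u' where "u' = u j"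
   have u': "u' \<in> M \<inter> Y" using uM unfolding u'_def .
   define P where "P = (\<phi> y \<boxplus> b2 \<cdot> t) \<boxplus> z"
   have PM: "P \<in> M" unfolding P_def using VO.sub_add[OF sM VO.sub_add[OF sM \<phi>M Osub_smult[OF sM b2(1) yt(2)]]] y sz by blast
   define w where "w = y \<ominus>\<^bsub>V\<^esub> u'"
   define y0 where "y0 = v j \<ominus>\<^bsub>V\<^esub> P"
   have y0M: "y0 \<in> M" unfolding y0_def using VO.sub_minus[OF sM vM PM] .
   have wY: "w \<in> Y" unfolding w_def using sub_minus[OF Y] y u' by blast
   have car: "y \<in> carrier V" "u' \<in> carrier V" "w \<in> carrier V" "y0 \<in> carrier V" "P \<in> carrier V" "t \<in> carrier V"
    "z \<in> carrier V" "\<phi> y \<in> carrier V" "\<phi> u' \<in> carrier V"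
    using y u' sub_carrier[OF Y wY] y0M PM yt sz Mc \<phi>M by auto
   \<comment> \<open>Two expressions of x, one from the original lift and one from the improved
     lift, are compared: the difference w of their base points is a multiple a \<open>y0\<close>,
     and \<open>y0\<close> lies in M \<inter> Y, hence is a harmless term.\<close>
   have yw: "y = w \<boxplus> u'" unfolding w_def using minus_add_cancel(1) car by simp
   have vP: "v j = y0 \<boxplus> P" unfolding y0_def using minus_add_cancel(1)[OF Mc[OF vM] car(5)] by simp
   have "u' \<boxplus> a \<cdot> (y0 \<boxplus> P) = x" using x[OF j[unfolded ix]] vP unfolding u'_def ix by simp
   also have "\<dots> = ((w \<boxplus> u') \<boxplus> a \<cdot> \<phi> y) \<boxplus> (a \<otimes> b2) \<cdot> t \<boxplus> a \<cdot> z"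
    using sz(3) yt(3) y(2) yw b2(3) by simp
   also have "\<dots> = w \<boxplus> (u' \<boxplus> a \<cdot> P)"
    unfolding P_def using car aK(1) b2(2) by (simp add: smult_r_distr smult_assoc1 M.a_ac)
   finally have "a \<cdot> y0 \<boxplus> (u' \<boxplus> a \<cdot> P) = w \<boxplus> (u' \<boxplus> a \<cdot> P)"
    using car aK(1) by (simp add: smult_r_distr M.a_ac)
   then have wy0: "a \<cdot> y0 = w" using car aK(1) by simp
   then have y0Y: "y0 \<in> Y" using sub_cancel_smult[OF Y, of a y0] wY car aK a by blast
   have \<phi>y0: "\<phi> y0 \<in> M" "\<phi> y0 \<in> carrier V" using \<phi>M[OF y0M] Mc by auto
   have \<phi>y: "\<phi> y = b2 \<cdot> (s2 \<cdot> \<phi> y0) \<boxplus> \<phi> u'"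
   proof -
    have "\<phi> y = a \<cdot> \<phi> y0 \<boxplus> \<phi> u'" unfolding yw wy0[symmetric] using \<phi>D car aK(1) by simp
    moreover have "a \<cdot> \<phi> y0 = b2 \<cdot> (s2 \<cdot> \<phi> y0)"
     using \<phi>y0 sK b2(2) by (subst b2(4)) (simp add: smult_assoc1[symmetric] R.m_comm)
    ultimately show ?thesis by simp
   qed
   have "v j = (\<phi> (u j) \<boxplus> (z \<boxplus> y0)) \<boxplus> b2 \<cdot> (t \<boxplus> s2 \<cdot> \<phi> y0)"
    unfolding vP P_def \<phi>y u'_def[symmetric] using car \<phi>y0 sK b2(2) by (simp add: smult_r_distr M.a_ac)
   moreover have "z \<boxplus> y0 \<in> H j" unfolding H_def ix using sz y0M y0Y by (intro sumI) auto
   moreover have "t \<boxplus> s2 \<cdot> \<phi> y0 \<in> M" using VO.sub_add[OF sM yt(2) Osub_smult[OF sM s(3) \<phi>y0(1)]] .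
   ultimately show "\<exists>h\<in>H j. \<exists>l\<in>M. v j = (\<phi> (u j) \<boxplus> h) \<boxplus> b2 \<cdot> l" by blast
  qed
  then obtain q where q: "q \<in> \<O>" "b = q \<otimes> b2" using b(3)[OF b2(1)] by blast
  note qK = O_carrier[OF q(1)]
  \<comment> \<open>The best b is a multiple of b d with d in m; cancelling b makes d a
    unit.\<close>
  have "\<one> \<otimes> b = (q \<otimes> d) \<otimes> b"
  proof -
   have "(q \<otimes> d) \<otimes> b = q \<otimes> b2" unfolding b2_def using qK dm bK by (simp add: R.m_ac)
   then show ?thesis using trans[OF R.l_one[OF bK] q(2)] by simp
  qed
  then have "\<one> = q \<otimes> d" using m_rcancel[OF bz bK, of "\<one>" "q \<otimes> d"] qK dm by simp
  then show ?thesis using m_mult[OF q(1) dm(1)] one_nm by simp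
 qed
qed

end

section \<open>Uniqueness of the maximiser and the moduli to which it lifts\<close>

context subspace_config
begin

lemma supermodular:
 assumes M: "lattice M" and A: "between M A" and B: "between M B"
 shows "between M (A \<uplus> B)" "between M (A \<inter> B)"
  "degO M A + degO M B \<le> degO M (A \<uplus> B) + degO M (A \<inter> B)"
proof -
 have s: "Osub A" "Osub B" "mm M \<subseteq> A" "mm M \<subseteq> B" "A \<subseteq> M" "B \<subseteq> M" using A B unfolding between_def by auto
 note up = VO.sum_upper1[OF s(1,2)] VO.sum_upper2[OF s(1,2)]
 show AB: "between M (A \<uplus> B)" "between M (A \<inter> B)"
  unfolding between_def using VO.sub_sum[OF s(1,2)] VO.sub_Int[OF s(1,2)] up s
   VO.sum_least[OF lattice_sub[OF M] s(5,6)] by auto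
 have key: "VO.fin N (X \<inter> X') \<and> VO.fin N (X \<uplus> X')
   \<and> VO.rk N X + VO.rk N X' = VO.rk N (X \<uplus> X') + VO.rk N (X \<inter> X')"
  if X: "VO.fin N X" "VO.fin N X'" for N X X'
 proof -
  have c: "Osub X" "Osub X'" "N \<subseteq> X" "N \<subseteq> X'" using VO.fin_subs X by auto
  have XX: "Osub (X \<inter> X')" "N \<subseteq> X \<inter> X'" using VO.sub_Int c by auto
  note b1 = VO.rk_between[OF X(1) XX Int_lower1]
  note b = VO.second_iso[OF c(1,2) disjI1[OF b1(2)]]
  note t = VO.rk_trans[OF X(2) b(2)]
  show ?thesis using b1 b t by simp
 qed
 have dim: "VO.rk (mm M) A + VO.rk (mm M) B = VO.rk (mm M) (A \<uplus> B) + VO.rk (mm M) (A \<inter> B)"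
  using key[OF between_fin(1)[OF M A] between_fin(1)[OF M B]] by simp
 have le: "VO.rk (mm M \<inter> F i) (A \<inter> F i) + VO.rk (mm M \<inter> F i) (B \<inter> F i)
   \<le> VO.rk (mm M \<inter> F i) ((A \<uplus> B) \<inter> F i) + VO.rk (mm M \<inter> F i) (A \<inter> B \<inter> F i)" if i: "i \<in> Idx" for i
 proof -
  note G = F_sub[OF i]
  note k = key[OF between_fin(2)[OF M A G] between_fin(2)[OF M B G]]
  have sG: "Osub ((A \<uplus> B) \<inter> F i)" using VO.sub_Int[OF VO.sub_sum[OF s(1,2)] sub_Osub[OF G]] .
  have "A \<inter> F i \<subseteq> (A \<uplus> B) \<inter> F i" "B \<inter> F i \<subseteq> (A \<uplus> B) \<inter> F i" using up by auto
  then have "(A \<inter> F i) \<uplus> (B \<inter> F i) \<subseteq> (A \<uplus> B) \<inter> F i" by (rule VO.sum_least[OF sG])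
  moreover have "Osub ((A \<inter> F i) \<uplus> (B \<inter> F i))" "mm M \<inter> F i \<subseteq> (A \<inter> F i) \<uplus> (B \<inter> F i)"
   using k VO.fin_subs by auto
  ultimately have "VO.rk (mm M \<inter> F i) ((A \<inter> F i) \<uplus> (B \<inter> F i)) \<le> VO.rk (mm M \<inter> F i) ((A \<uplus> B) \<inter> F i)"
   using VO.rk_mono[OF between_fin(2)[OF M AB(1) G]] by blast
  moreover have "(A \<inter> F i) \<inter> (B \<inter> F i) = A \<inter> B \<inter> F i" by auto
  ultimately show ?thesis using k by simp
 qed
 let ?s = "\<lambda>X. \<Sum>i\<in>Idx. int (VO.rk (mm M \<inter> F i) (X \<inter> F i))"
 have "?s A + ?s B \<le> ?s (A \<uplus> B) + ?s (A \<inter> B)"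
  unfolding sum.distrib[symmetric] of_nat_add[symmetric]
  by (rule ordered_comm_monoid_add_class.sum_mono) (simp only: of_nat_le_iff le)
 then have "\<alpha> * (?s A + ?s B) \<le> \<alpha> * (?s (A \<uplus> B) + ?s (A \<inter> B))" using \<alpha>_pos by simp
 moreover have "\<beta> * (int (VO.rk (mm M) A) + int (VO.rk (mm M) B))
   = \<beta> * (int (VO.rk (mm M) (A \<uplus> B)) + int (VO.rk (mm M) (A \<inter> B)))"
  using arg_cong[OF dim, of int] by simp
 ultimately show "degO M A + degO M B \<le> degO M (A \<uplus> B) + degO M (A \<inter> B)"
  unfolding degO_def by (simp add: distrib_left)
qed

text \<open>By supermodularity the sum of two maximisers is again one, and nested maximisers
  coincide.\<close>

lemma maximiser_unique:
 assumes M: "lattice M" and A: "between M A" and B: "between M B"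
  and max: "\<And>X. between M X \<Longrightarrow> degO M X \<le> D" "degO M A = D" "degO M B = D"
 shows "A = B"
proof -
 note s = supermodular[OF M A B]
 have e: "degO M (A \<uplus> B) = D" using max(1)[OF s(1)] max(1)[OF s(2)] s(3) max(2,3) by simp
 have "Osub A" "Osub B" using A B unfolding between_def by auto
 then have "A \<subseteq> A \<uplus> B" "B \<subseteq> A \<uplus> B" using VO.sum_upper1 VO.sum_upper2 by auto
 then show ?thesis using nested_eq[OF M A s(1)] nested_eq[OF M B s(1)] e max(2,3) by simp
qed

text \<open>The elements modulo which the maximal destabilizing reduction lifts form the complement of a
 prime ideal.\<close>

definition liftable where
 "liftable M W = {a \<in> \<O>. \<exists>Y. sub Y \<and> (M \<inter> Y) \<uplus> mm M = W \<and> adm M Y a}"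

text \<open>The substance is closure under squares, from \<open>doubling\<close> for a in m; a unit
  a is handled by divisibility. That 0 is excluded combines the positive degree of W with
  \<open>adm_zero\<close>.\<close>

lemma liftable_multiplicative:
 assumes M: "lattice M" and W: "between M W"
  and max: "\<And>X. between M X \<Longrightarrow> degO M X \<le> degO M W"
  and min: "\<And>L. lattice L \<Longrightarrow> \<exists>X. between L X \<and> degO M W \<le> degO L X"
  and ss: "\<And>Y. sub Y \<Longrightarrow> degK Y \<le> 0" and pos: "0 < degO M W"
 defines "S \<equiv> liftable M W"
 shows "\<zero> \<notin> S" "\<lbrakk>r \<in> \<O>; a \<in> \<O>; r \<otimes> a \<in> S\<rbrakk> \<Longrightarrow> a \<in> S" "\<lbrakk>a \<in> S; b \<in> S\<rbrakk> \<Longrightarrow> a \<otimes> b \<in> S" "S \<inter> m \<noteq> {}"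
proof -
 have zero: "\<not> adm M Y \<zero>" if Y: "sub Y" "(M \<inter> Y) \<uplus> mm M = W" for Y
 proof
  assume "adm M Y \<zero>"
  then have "degO M W \<le> degK Y" using adm_zero[OF M Y(1)] Y(2) by simp
  then show False using ss[OF Y(1)] pos by simp
 qed
 then show S0: "\<zero> \<notin> S" unfolding S_def liftable_def by blast
 show dvd: "a \<in> S" if "r \<in> \<O>" "a \<in> \<O>" "r \<otimes> a \<in> S" for r a
  using adm_mono[OF M _ that(1) O_carrier[OF that(2)]] that unfolding S_def liftable_def by blast
 have SO: "S \<subseteq> \<O>" unfolding S_def liftable_def by blast
 have sq: "a \<otimes> a \<in> S" if a: "a \<in> S" for a
 proof (cases "a \<in> m")
  case True
  obtain Y where Y: "sub Y" "(M \<inter> Y) \<uplus> mm M = W" "adm M Y a" using a unfolding S_def liftable_def by blast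
  have az: "a \<noteq> \<zero>" using a S0 by blast
  have aa: "a \<otimes> a \<in> \<O>" using O_closed(4) a SO by blast
  have "\<exists>Y'. sub Y' \<and> (M \<inter> Y') \<uplus> mm M = W \<and> adm M Y' (a \<otimes> a)"
   using doubling[OF M Y(1) _ _ True az Y(3)] max min unfolding Y(2) by blast
  then show ?thesis using aa unfolding S_def liftable_def by blast
 next
  case False
  then have u: "a \<noteq> \<zero>" "inv a \<in> \<O>" using O_unit a SO by auto
  have aK: "a \<in> carrier K" using a SO O_carrier by blast
  have "inv a \<otimes> (a \<otimes> a) = a" using inv_K[OF aK u(1)] aK by (simp add: R.m_assoc[symmetric])
  then show ?thesis using dvd[OF u(2), of "a \<otimes> a"] O_closed(4)[of a a] a SO by auto
 qed
 show "a \<otimes> b \<in> S" if ab: "a \<in> S" "b \<in> S" for a b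
 proof -
  have abO: "a \<in> \<O>" "b \<in> \<O>" "a \<otimes> b \<in> \<O>" using ab SO O_closed(4) by auto
  note abK = O_carrier[OF abO(1)] O_carrier[OF abO(2)]
  \<comment> \<open>Of a and b one divides the other, so ab divides one of the two squares.\<close>
  obtain r where r: "r \<in> \<O>" "a = r \<otimes> b \<or> b = r \<otimes> a" using divide_total[OF abK] by blast
  note rK = O_carrier[OF r(1)]
  from r(2) have "a \<otimes> a = r \<otimes> (a \<otimes> b) \<or> b \<otimes> b = r \<otimes> (a \<otimes> b)" 
   using abK rK by (metis R.m_assoc R.m_comm)
  then show ?thesis using dvd[OF r(1) abO(3)] sq[OF ab(1)] sq[OF ab(2)] by auto
 qed
 have "Osub W" "mm M \<subseteq> W" "W \<subseteq> M" using W unfolding between_def by auto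
 moreover have "M \<inter> {0\<^sub>V} \<subseteq> W" using VO.sub_zero \<open>Osub W\<close> by auto
 ultimately obtain Y where Y: "sub Y" "(M \<inter> Y) \<uplus> mm M = W"
  using lift_subspace_carrier[OF M sub_zero_set] by blast
 obtain c where "c \<in> m" "adm M Y c" using adm_exists[OF M Y(1)] by blast
 then have "c \<in> S" using Y m_O unfolding S_def liftable_def by blast
 then show "S \<inter> m \<noteq> {}" using \<open>c \<in> m\<close> by blast
qed

end

section \<open>Localisation\<close>

text \<open>S is the complement of a prime ideal P of \<O>: multiplicative, closed under divisors
  and without 0. That it meets m says that P is strictly smaller than m.\<close>

locale localization = fd_valued_space K V \<O> for K (structure) and V and \<O> +
 fixes S
 assumes S_O: "S \<subseteq> \<O>" and zero_nS: "\<zero> \<notin> S"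
  and S_dvd: "\<lbrakk>r \<in> \<O>; a \<in> \<O>; r \<otimes> a \<in> S\<rbrakk> \<Longrightarrow> a \<in> S"
  and S_mult: "\<lbrakk>a \<in> S; b \<in> S\<rbrakk> \<Longrightarrow> a \<otimes> b \<in> S"
  and S_m: "S \<inter> m \<noteq> {}"
begin

definition OS where "OS = {z \<in> carrier K. \<exists>s\<in>S. s \<otimes> z \<in> \<O>}"

lemma S_carrier: "s \<in> S \<Longrightarrow> s \<in> carrier K"
 using S_O O_carrier by blast

lemma S_inv:
 assumes "s \<in> S"
 shows "s \<noteq> \<zero>" "inv s \<in> carrier K" "inv s \<otimes> s = \<one>" "s \<otimes> inv s = \<one>"
 using inv_K[OF S_carrier[OF assms]] assms zero_nS by auto

lemma one_S: "\<one> \<in> S"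
proof -
 obtain a where a: "a \<in> S" using S_m by blast
 then have "a \<otimes> \<one> \<in> S" using S_carrier by simp
 then show ?thesis using S_dvd[OF _ O_closed(2)] a S_O by blast
qed

lemma O_OS: "\<O> \<subseteq> OS"
proof
 fix x assume x: "x \<in> \<O>"
 then have "\<one> \<otimes> x \<in> \<O>" using O_carrier by simp
 then show "x \<in> OS" unfolding OS_def using x O_carrier one_S by blast
qed

lemma inv_S_OS: "s \<in> S \<Longrightarrow> inv s \<in> OS"
 unfolding OS_def using S_inv O_closed(2) by force

lemma OS_subring: "subring OS K"
proof (rule subringI)
 show "OS \<subseteq> carrier K" unfolding OS_def by blast
 show "\<one> \<in> OS" using O_OS O_closed by blast
 fix x y assume "x \<in> OS" "y \<in> OS"
 then obtain s t where st: "x \<in> carrier K" "y \<in> carrier K" "s \<in> S" "t \<in> S" "s \<otimes> x \<in> \<O>" "t \<otimes> y \<in> \<O>"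
  unfolding OS_def by blast
 note k = S_carrier[OF st(3)] S_carrier[OF st(4)]
 have O: "s \<in> \<O>" "t \<in> \<O>" using st S_O by auto
 have "s \<otimes> \<ominus> x = \<ominus> (s \<otimes> x)" using st k by (simp add: R.r_minus)
 then have "s \<otimes> \<ominus> x \<in> \<O>" using O_closed(5) st by simp
 then show "\<ominus> x \<in> OS" unfolding OS_def using st by blast
 have "(s \<otimes> t) \<otimes> (x \<otimes> y) = (s \<otimes> x) \<otimes> (t \<otimes> y)" using st k by (simp add: R.m_ac)
 then have "(s \<otimes> t) \<otimes> (x \<otimes> y) \<in> \<O>" using O_closed(4) st by simp
 then show "x \<otimes> y \<in> OS" unfolding OS_def using st S_mult[OF st(3,4)] by blast
 have "(s \<otimes> t) \<otimes> (x \<oplus> y) = t \<otimes> (s \<otimes> x) \<oplus> s \<otimes> (t \<otimes> y)" using st k by (simp add: R.m_ac R.r_distr)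
 then have "(s \<otimes> t) \<otimes> (x \<oplus> y) \<in> \<O>" using O_closed(3,4) st O by simp
 then show "x \<oplus> y \<in> OS" unfolding OS_def using st S_mult[OF st(3,4)] by blast
qed

end

sublocale localization \<subseteq> loc: fd_valued_space K V OS
proof (intro fd_valued_space.intro valued_space.intro valued_space_axioms.intro fd_valued_space_axioms.intro)
 show "vectorspace K V" by (rule vectorspace_axioms)
 show "subring OS K" by (rule OS_subring)
 show "inv x \<in> OS" if "x \<in> carrier K" "x \<noteq> \<zero>" "x \<notin> OS" for x
  using O_total[OF that(1,2)] that(3) O_OS by blast
 show "VK.fin {0\<^sub>V} (carrier V)" by (rule fd)
qed

context localization
begin

text \<open>In a valuation ring the maximal ideal of the localisation at P is P itself, already
  contained in \<O>.\<close>

lemma loc_m: "loc.m = \<O> - S"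
proof (intro equalityI subsetI)
 fix x assume "x \<in> loc.m"
 then have x: "x \<in> OS" "x = \<zero> \<or> inv x \<notin> OS" unfolding loc.m_def by auto
 have xK: "x \<in> carrier K" using loc.O_carrier x by blast
 show "x \<in> \<O> - S"
 proof (cases "x = \<zero>")
  case True
  then show ?thesis using O_closed(1) zero_nS by simp
 next
  case False
  then have "inv x \<notin> OS" using x by simp
  then have "x \<in> \<O>" using O_total[OF xK False] O_OS by blast
  moreover have "x \<notin> S" using inv_S_OS \<open>inv x \<notin> OS\<close> by blast
  ultimately show ?thesis by simp
 qed
next
 fix x assume x: "x \<in> \<O> - S"
 then have xK: "x \<in> carrier K" using O_carrier by blast
 have "inv x \<notin> OS" if nz: "x \<noteq> \<zero>"
 proof
  assume "inv x \<in> OS"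
  then obtain s where s: "s \<in> S" "s \<otimes> inv x \<in> \<O>" unfolding OS_def by blast
  have "(s \<otimes> inv x) \<otimes> x = s" using S_carrier[OF s(1)] inv_K[OF xK nz] xK by (simp add: R.m_assoc)
  then have "x \<in> S" using S_dvd[OF s(2)] x s(1) by auto
  then show False using x by simp
 qed
 then show "x \<in> loc.m" unfolding loc.m_def using x O_OS by blast
qed

text \<open>P = sP for every s outside P: s divides x because otherwise x would divide s and lie in
  S, and the quotient stays in P by multiplicativity.\<close>

lemma S_divides:
 assumes "x \<in> \<O>" "x \<notin> S" "s \<in> S"
 shows "\<exists>y\<in>\<O> - S. x = s \<otimes> y"
proof -
 have k: "x \<in> carrier K" "s \<in> carrier K" "s \<in> \<O>" using assms O_carrier S_carrier S_O by auto
 obtain r where r: "r \<in> \<O>" "x = r \<otimes> s \<or> s = r \<otimes> x" using divide_total[OF k(1,2)] by blast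
 note rK = O_carrier[OF r(1)]
 have "x \<in> S" if "s = r \<otimes> x" using S_dvd[OF r(1) assms(1)] assms(3) that by simp
 then have x: "x = s \<otimes> r" using r(2) assms(2) R.m_comm[OF rK k(2)] by auto
 moreover have "r \<notin> S" using S_mult[OF assms(3)] x assms(2) by blast
 ultimately show ?thesis using r by blast
qed

definition Mloc where "Mloc M = {z \<in> carrier V. \<exists>s\<in>S. s \<cdot> z \<in> M}"

lemma Mloc_upper: "Osub M \<Longrightarrow> M \<subseteq> Mloc M"
 unfolding Mloc_def using one_S VO.sub_carrier by force

lemma Mloc_sub:
 assumes M: "Osub M"
 shows "loc.Osub (Mloc M)"
proof (rule loc.OsubI)
 show "Mloc M \<subseteq> carrier V" unfolding Mloc_def by blast
 show "0\<^sub>V \<in> Mloc M" using Mloc_upper[OF M] VO.sub_zero[OF M] by blast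
 have SO: "s \<in> \<O>" if "s \<in> S" for s using that S_O by blast
 show "x \<boxplus> y \<in> Mloc M" if xy: "x \<in> Mloc M" "y \<in> Mloc M" for x y
 proof -
  obtain s t where st: "x \<in> carrier V" "y \<in> carrier V" "s \<in> S" "t \<in> S" "s \<cdot> x \<in> M" "t \<cdot> y \<in> M"
   using xy unfolding Mloc_def by blast
  note k = S_carrier[OF st(3)] S_carrier[OF st(4)]
  have "(s \<otimes> t) \<cdot> (x \<boxplus> y) = t \<cdot> (s \<cdot> x) \<boxplus> s \<cdot> (t \<cdot> y)"
   using st k by (simp add: smult_r_distr smult_assoc1[symmetric] R.m_comm)
  then have "(s \<otimes> t) \<cdot> (x \<boxplus> y) \<in> M"
   using VO.sub_add[OF M Osub_smult[OF M SO[OF st(4)] st(5)] Osub_smult[OF M SO[OF st(3)] st(6)]] by simp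
  then show ?thesis unfolding Mloc_def using st S_mult by blast
 qed
 show "r \<cdot> x \<in> Mloc M" if r: "r \<in> OS" and x: "x \<in> Mloc M" for r x
 proof -
  obtain s t where st: "x \<in> carrier V" "s \<in> S" "s \<cdot> x \<in> M" "t \<in> S" "t \<otimes> r \<in> \<O>" "r \<in> carrier K"
   using r x unfolding Mloc_def OS_def by blast
  note k = S_carrier[OF st(2)] S_carrier[OF st(4)]
  have "(s \<otimes> t) \<cdot> (r \<cdot> x) = (t \<otimes> r) \<cdot> (s \<cdot> x)"
   using st k by (simp add: smult_assoc1[symmetric] R.m_ac)
  then have "(s \<otimes> t) \<cdot> (r \<cdot> x) \<in> M" using Osub_smult[OF M st(5,3)] by simp
  then show ?thesis unfolding Mloc_def using st S_mult by auto
 qed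
qed

lemma Mloc_least:
 assumes "loc.Osub N" "M \<subseteq> N"
 shows "Mloc M \<subseteq> N"
proof
 fix z assume "z \<in> Mloc M"
 then obtain s where s: "z \<in> carrier V" "s \<in> S" "s \<cdot> z \<in> M" unfolding Mloc_def by blast
 have "inv s \<cdot> (s \<cdot> z) \<in> N" using loc.Osub_smult[OF assms(1) inv_S_OS[OF s(2)]] s(3) assms(2) by blast
 then show "z \<in> N" using smult_inv(1)[OF S_carrier S_inv(1)] s by simp
qed

lemma Mloc_lattice:
 assumes M: "lattice M"
 shows "loc.lattice (Mloc M)"
proof -
 obtain es where es: "set es \<subseteq> M" "M = Ospan es" "carrier V = Kspan es" "VK.indep {0\<^sub>V} es"
  using lattice_basis_carrier[OF M] by blast
 note sM = lattice_sub[OF M]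
 have esc: "set es \<subseteq> carrier V" using es(1) VO.sub_subset[OF sM] by blast
 note S = loc.Ospan_sub[OF esc]
 have OS: "Osub (loc.Ospan es)"
  using VO.sub_carrier loc.VO.sub_add[OF S] loc.VO.sub_zero[OF S] loc.Osub_smult[OF S] O_OS loc.VO.sub_subset[OF S]
  by (intro OsubI) auto
 have "M \<subseteq> loc.Ospan es" unfolding es(2)
  using loc.VO.ext_mem[OF loc.VO.sub_zero_set esc] loc.VO.sub_zero[OF S] by (intro VO.ext_least[OF OS]) auto
 then have "Mloc M \<subseteq> loc.Ospan es" using Mloc_least[OF S] by blast
 moreover have "loc.Ospan es \<subseteq> Mloc M"
  using Mloc_sub[OF sM] es(1) Mloc_upper[OF sM] loc.VO.sub_zero[OF Mloc_sub[OF sM]]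
  by (intro loc.VO.ext_least) auto
 ultimately have "Mloc M = loc.Ospan es" by simp
 then show ?thesis using loc.lattice_Ospan[OF es(4) esc] es(3) by simp
qed

text \<open>The denominators of the localised lattice are absorbed by P = sP. In particular P times
  the localised lattice lies in M, which is how congruences modulo P return to M in
  \<open>descend\<close>.\<close>

lemma loc_mm:
 assumes M: "Osub M"
 shows "loc.mm (Mloc M) = {c \<cdot> x | c x. c \<in> \<O> - S \<and> x \<in> M}" "loc.mm (Mloc M) \<subseteq> mm M"
proof -
 show e: "loc.mm (Mloc M) = {c \<cdot> x | c x. c \<in> \<O> - S \<and> x \<in> M}"
 proof (intro equalityI subsetI)
  fix z assume "z \<in> loc.mm (Mloc M)"
  then obtain c x where cx: "c \<in> \<O> - S" "x \<in> Mloc M" "z = c \<cdot> x" unfolding loc.mm_def loc_m by blast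
  obtain s where s: "x \<in> carrier V" "s \<in> S" "s \<cdot> x \<in> M" using cx(2) unfolding Mloc_def by blast
  obtain d where d: "d \<in> \<O> - S" "c = s \<otimes> d" using S_divides[of c s] cx(1) s(2) by blast
  have "z = d \<cdot> (s \<cdot> x)"
   unfolding cx(3) d(2) using d(1) O_carrier S_carrier[OF s(2)] s(1) by (simp add: smult_assoc1[symmetric] R.m_comm)
  then show "z \<in> {c \<cdot> x | c x. c \<in> \<O> - S \<and> x \<in> M}" using d s by blast
 next
  fix z assume "z \<in> {c \<cdot> x | c x. c \<in> \<O> - S \<and> x \<in> M}"
  then show "z \<in> loc.mm (Mloc M)" using Mloc_upper[OF M] unfolding loc.mm_def loc_m by blast
 qed
 have "c \<in> m" if c: "c \<in> \<O>" "c \<notin> S" for c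
 proof -
  obtain s where s: "s \<in> S" "s \<in> m" using S_m by blast
  then obtain d where "d \<in> \<O>" "c = s \<otimes> d" using S_divides[of c s] c by blast
  then show ?thesis using m_mult[of d s] s(2) m_carrier O_carrier R.m_comm by simp
 qed
 then show "loc.mm (Mloc M) \<subseteq> mm M" unfolding e mm_def by blast
qed

end

section \<open>Families indexed by the complement of a prime\<close>

lemma (in local_module) indep_sublist:
 assumes "sub B" "set xs \<subseteq> carrier M"
 shows "\<exists>ys. set ys \<subseteq> set xs \<and> indep B ys \<and> ext B ys = ext B xs"
 using assms(2)
proof (induction xs)
 case (Cons x xs)
 then obtain ys where ys: "set ys \<subseteq> set xs" "indep B ys" "ext B ys = ext B xs" by auto
 show ?case
 proof (cases "x \<in> ext B xs")
  case True
  then have "ext B (x # xs) = ext B xs" using adjoin_absorb[OF ext_sub[OF assms(1)]] Cons.prems by simp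
  then show ?thesis using ys by (intro exI[of _ ys]) auto
 next
  case False
  then show ?thesis using ys by (intro exI[of _ "x # ys"]) auto
 qed
qed (intro exI[of _ "[]"], simp)

text \<open>The vectors \<open>xs\<close> span over K a space of dimension at most their number, so
  by counting they generate all of its reduction. Independence of the reductions therefore meets the
  hypothesis of \<open>lattice_functional\<close>.\<close>

lemma (in fd_valued_space) indep_not_mem:
 assumes M: "lattice M" and xs: "set (x # xs) \<subseteq> M" and ind: "VO.indep (mm M) (x # xs)"
 shows "x \<notin> (M \<inter> Kspan xs) \<uplus> mm M"
proof -
 note sM = lattice_sub[OF M]
 note smM = mm_sub[OF sM]
 have xc: "set xs \<subseteq> carrier V" using xs VO.sub_subset[OF sM] by auto
 note K = Kspan_sub[OF xc]
 let ?W = "(M \<inter> Kspan xs) \<uplus> mm M"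
 have mc: "mm M \<inter> carrier V = mm M" using VO.sub_subset smM(1) by auto
 have W: "VO.fin (mm M) ?W" "VO.rk (mm M) ?W = dimK (Kspan xs)"
  using rank_reduction[OF M K sub_carrier_set sub_subset[OF K]] unfolding mc by auto
 have "r \<cdot> y \<in> {0\<^sub>V}" if "y \<in> set xs" "r \<in> {\<zero>}" for y r using that xc by auto
 then have "dimK (Kspan xs) \<le> length xs" using VK.ext_dm[OF sub_zero_set xc] by blast
 moreover have "VO.dm (mm M) (length xs) (VO.ext (mm M) xs)"
  using VO.indep_dm[OF smM(1) xc] ind xs mmI by auto
 moreover have "VO.ext (mm M) xs \<subseteq> ?W"
 proof (rule VO.ext_least)
  have s: "Osub (M \<inter> Kspan xs)" using VO.sub_Int[OF sM sub_Osub[OF K]] .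
  show "Osub ?W" "mm M \<subseteq> ?W" using VO.fin_subs W by auto
  have "set xs \<subseteq> M \<inter> Kspan xs" using xs VK.ext_mem[OF sub_zero_set xc] by auto
  then show "set xs \<subseteq> ?W" using VO.sum_upper1[OF s smM(1)] by blast
 qed
 ultimately have "VO.ext (mm M) xs = ?W"
  using VO.rk_eq_imp_eq[OF W(1), of "VO.ext (mm M) xs"] VO.dm_subs W(2) VO.rk_eq by metis
 then show ?thesis using ind by simp
qed

context localization
begin

text \<open>K as a module over the localisation, so that families of scalars and of vectors are
  instances of one theory of length.\<close>

abbreviation KM where
 "KM \<equiv> \<lparr>carrier = carrier K, mult = undefined, one = undefined, zero = \<zero>, add = (\<oplus>), smult = (\<otimes>)\<rparr>"

lemma KM_module: "module (K\<lparr>carrier := OS\<rparr>) KM"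
proof (rule moduleI[OF loc.cring_R abelian_groupI])
 show "\<exists>y\<in>carrier KM. y \<oplus>\<^bsub>KM\<^esub> x = \<zero>\<^bsub>KM\<^esub>" if "x \<in> carrier KM" for x
  using that by (intro bexI[of _ "\<ominus> x"]) (auto simp: R.l_neg)
qed (auto simp: loc.O_carrier R.a_ac R.m_assoc R.l_distr R.r_distr)

end

sublocale localization \<subseteq> PV: local_module "K\<lparr>carrier := OS\<rparr>" "pw V :: ('a, 'a \<Rightarrow> 'c) module" loc.m
 by (rule loc.VO.pw_local_module)

sublocale localization \<subseteq> PK: local_module "K\<lparr>carrier := OS\<rparr>" "pw KM :: ('a, 'a \<Rightarrow> 'a) module" loc.m
proof (rule local_module.pw_local_module)
 show "local_module (K\<lparr>carrier := OS\<rparr>) KM loc.m"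
  using KM_module loc.VO.I_carrier loc.VO.unit_outside by (simp add: local_module_def local_module_axioms_def)
qed

section \<open>Families modulo null families\<close>

context localization
begin

text \<open>\<open>S\<close> is directed by divisibility. Families that are eventually divisible by every element of \<open>S\<close>
 are null; bounded families modulo null families form a ring that contains the residue field of the
 localisation.\<close>

definition ev where "ev P \<longleftrightarrow> (\<exists>b\<in>S. \<forall>a\<in>S. (\<exists>r\<in>\<O>. a = r \<otimes> b) \<longrightarrow> P a)"

lemma ev_mono: "\<lbrakk>ev P; \<And>a. \<lbrakk>a \<in> S; P a\<rbrakk> \<Longrightarrow> Q a\<rbrakk> \<Longrightarrow> ev Q"
 unfolding ev_def by blast

lemma ev_all: "(\<And>a. a \<in> S \<Longrightarrow> P a) \<Longrightarrow> ev P"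
 unfolding ev_def using one_S by blast

lemma ev_dvd: "h \<in> S \<Longrightarrow> ev (\<lambda>a. \<exists>r\<in>\<O>. a = r \<otimes> h)"
 unfolding ev_def by blast

lemma ev_conj:
 assumes "ev P" "ev Q"
 shows "ev (\<lambda>a. P a \<and> Q a)"
proof -
 obtain b c where bc: "b \<in> S" "\<forall>a\<in>S. (\<exists>r\<in>\<O>. a = r \<otimes> b) \<longrightarrow> P a" "c \<in> S" "\<forall>a\<in>S. (\<exists>r\<in>\<O>. a = r \<otimes> c) \<longrightarrow> Q a"
  using assms unfolding ev_def by blast
 have "P a \<and> Q a" if a: "a \<in> S" "r \<in> \<O>" "a = r \<otimes> (b \<otimes> c)" for a r
 proof -
  have "a = (r \<otimes> c) \<otimes> b" "a = (r \<otimes> b) \<otimes> c" using a O_carrier S_carrier bc by (simp_all add: R.m_ac)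
  moreover have "r \<otimes> c \<in> \<O>" "r \<otimes> b \<in> \<O>" using O_closed(4) a bc S_O by auto
  ultimately show ?thesis using bc a by blast
 qed
 then show ?thesis unfolding ev_def using S_mult[OF bc(1,3)] by blast
qed

lemma ev_False: "\<not> ev (\<lambda>_. False)"
 unfolding ev_def using O_closed(2) S_carrier R.l_one by metis

definition nullV where
 "nullV M = {f. (\<forall>a. f a \<in> carrier V) \<and> (\<forall>h\<in>S. ev (\<lambda>a. f a \<in> scale h M))}"

definition nullK where
 "nullK = {f. (\<forall>a. f a \<in> carrier K) \<and> (\<forall>h\<in>S. ev (\<lambda>a. \<exists>r\<in>\<O>. f a = h \<otimes> r))}"

lemma nullV_carrier: "f \<in> nullV M \<Longrightarrow> f a \<in> carrier V"
 unfolding nullV_def by blast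

lemma nullK_carrier: "f \<in> nullK \<Longrightarrow> f a \<in> carrier K"
 unfolding nullK_def by blast

lemma nullV_sub:
 assumes M: "Osub M"
 shows "PV.sub (nullV M)"
proof (rule PV.subI)
 note Mc = VO.sub_carrier[OF M]
 note sc = scale_sub[OF M S_carrier]
 show "nullV M \<subseteq> carrier (pw V)" unfolding nullV_def by auto
 have "ev (\<lambda>a. 0\<^sub>V \<in> scale h M)" if "h \<in> S" for h using VO.sub_zero[OF sc[OF that]] by (rule ev_all)
 then show "\<zero>\<^bsub>pw V\<^esub> \<in> nullV M" unfolding nullV_def by simp
 show "f \<oplus>\<^bsub>pw V\<^esub> g \<in> nullV M" if fg: "f \<in> nullV M" "g \<in> nullV M" for f g
 proof -
  have "ev (\<lambda>a. f a \<boxplus> g a \<in> scale h M)" if h: "h \<in> S" for h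
  proof (rule ev_mono[OF ev_conj])
   show "ev (\<lambda>a. f a \<in> scale h M)" "ev (\<lambda>a. g a \<in> scale h M)" using fg h unfolding nullV_def by auto
   show "f a \<boxplus> g a \<in> scale h M" if "f a \<in> scale h M \<and> g a \<in> scale h M" for a
    using VO.sub_add[OF sc[OF h]] that by blast
  qed
  then show ?thesis using fg unfolding nullV_def by simp
 qed
 show "r \<odot>\<^bsub>pw V\<^esub> f \<in> nullV M" if rf: "r \<in> carrier (K\<lparr>carrier := OS\<rparr>)" "f \<in> nullV M" for r f
 proof -
  obtain t where t: "t \<in> S" "t \<otimes> r \<in> \<O>" "r \<in> carrier K" using rf(1) unfolding OS_def by auto
  note tK = S_carrier[OF t(1)]
  have "ev (\<lambda>a. r \<cdot> f a \<in> scale h M)" if h: "h \<in> S" for h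
  proof (rule ev_mono)
   show "ev (\<lambda>a. f a \<in> scale (h \<otimes> t) M)" using rf(2) S_mult[OF h t(1)] unfolding nullV_def by blast
   fix a assume "f a \<in> scale (h \<otimes> t) M"
   then obtain y where y: "y \<in> M" "f a = (h \<otimes> t) \<cdot> y" unfolding scale_def by blast
   have "r \<cdot> f a = h \<cdot> ((t \<otimes> r) \<cdot> y)"
    unfolding y(2) using Mc[OF y(1)] t(3) tK S_carrier[OF h] by (simp add: smult_assoc1[symmetric] R.m_ac)
   then show "r \<cdot> f a \<in> scale h M" using scaleI[OF Osub_smult[OF M t(2) y(1)]] by simp
  qed
  then show ?thesis using rf(2) t(3) unfolding nullV_def by simp
 qed
qed

lemma nullK_sub: "PK.sub nullK"
proof (rule PK.subI)
 show "nullK \<subseteq> carrier (pw KM)" unfolding nullK_def by auto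
 have "\<exists>r\<in>\<O>. \<zero> = h \<otimes> r" if "h \<in> S" for h using that S_carrier O_closed(1) by (intro bexI[of _ "\<zero>"]) auto
 then have "ev (\<lambda>a. \<exists>r\<in>\<O>. \<zero> = h \<otimes> r)" if "h \<in> S" for h using that by (intro ev_all)
 then show "\<zero>\<^bsub>pw KM\<^esub> \<in> nullK" unfolding nullK_def by simp
 show "f \<oplus>\<^bsub>pw KM\<^esub> g \<in> nullK" if fg: "f \<in> nullK" "g \<in> nullK" for f g
 proof -
  have "ev (\<lambda>a. \<exists>r\<in>\<O>. f a \<oplus> g a = h \<otimes> r)" if h: "h \<in> S" for h
  proof (rule ev_mono[OF ev_conj])
   show "ev (\<lambda>a. \<exists>r\<in>\<O>. f a = h \<otimes> r)" "ev (\<lambda>a. \<exists>r\<in>\<O>. g a = h \<otimes> r)" using fg h unfolding nullK_def by auto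
   fix a assume "(\<exists>r\<in>\<O>. f a = h \<otimes> r) \<and> (\<exists>r\<in>\<O>. g a = h \<otimes> r)"
   then obtain r s where "r \<in> \<O>" "s \<in> \<O>" "f a = h \<otimes> r" "g a = h \<otimes> s" by blast
   then show "\<exists>r\<in>\<O>. f a \<oplus> g a = h \<otimes> r"
    using O_closed(3) O_carrier S_carrier[OF h] by (intro bexI[of _ "r \<oplus> s"]) (auto simp: R.r_distr)
  qed
  then show ?thesis using fg unfolding nullK_def by simp
 qed
 show "r \<odot>\<^bsub>pw KM\<^esub> f \<in> nullK" if rf: "r \<in> carrier (K\<lparr>carrier := OS\<rparr>)" "f \<in> nullK" for r f
 proof -
  obtain t where t: "t \<in> S" "t \<otimes> r \<in> \<O>" "r \<in> carrier K" using rf(1) unfolding OS_def by auto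
  note tK = S_carrier[OF t(1)]
  have "ev (\<lambda>a. \<exists>q\<in>\<O>. r \<otimes> f a = h \<otimes> q)" if h: "h \<in> S" for h
  proof (rule ev_mono)
   show "ev (\<lambda>a. \<exists>q\<in>\<O>. f a = (h \<otimes> t) \<otimes> q)" using rf(2) S_mult[OF h t(1)] unfolding nullK_def by blast
   fix a assume "\<exists>q\<in>\<O>. f a = (h \<otimes> t) \<otimes> q"
   then obtain y where y: "y \<in> \<O>" "f a = (h \<otimes> t) \<otimes> y" by blast
   have "r \<otimes> f a = h \<otimes> ((t \<otimes> r) \<otimes> y)"
    unfolding y(2) using O_carrier[OF y(1)] t(3) tK S_carrier[OF h] by (simp add: R.m_ac)
   then show "\<exists>q\<in>\<O>. r \<otimes> f a = h \<otimes> q" using O_closed(4)[OF t(2) y(1)] by blast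
  qed
  then show ?thesis using rf(2) t(3) unfolding nullK_def by simp
 qed
qed

lemma null_mult1:
 assumes M: "Osub M" and c: "c \<in> nullK" and f: "\<And>a. f a \<in> carrier V" "\<And>a. a \<in> S \<Longrightarrow> f a \<in> M"
 shows "(\<lambda>a. c a \<cdot> f a) \<in> nullV M"
proof -
 have "ev (\<lambda>a. c a \<cdot> f a \<in> scale h M)" if h: "h \<in> S" for h
 proof (rule ev_mono)
  show "ev (\<lambda>a. \<exists>r\<in>\<O>. c a = h \<otimes> r)" using c h unfolding nullK_def by blast
  fix a assume a: "a \<in> S" "\<exists>r\<in>\<O>. c a = h \<otimes> r"
  then obtain r where r: "r \<in> \<O>" "c a = h \<otimes> r" by blast
  have "c a \<cdot> f a = h \<cdot> (r \<cdot> f a)"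
   unfolding r(2) using f(1) O_carrier[OF r(1)] S_carrier[OF h] by (simp add: smult_assoc1)
  then show "c a \<cdot> f a \<in> scale h M" using scaleI[OF Osub_smult[OF M r(1) f(2)[OF a(1)]]] by simp
 qed
 then show ?thesis unfolding nullV_def using f(1) nullK_carrier[OF c] by simp
qed

lemma null_mult2:
 assumes M: "Osub M" and c: "\<And>a. c a \<in> \<O>" and f: "f \<in> nullV M"
 shows "(\<lambda>a. c a \<cdot> f a) \<in> nullV M"
proof -
 have "ev (\<lambda>a. c a \<cdot> f a \<in> scale h M)" if h: "h \<in> S" for h
 proof (rule ev_mono)
  show "ev (\<lambda>a. f a \<in> scale h M)" using f h unfolding nullV_def by blast
  show "c a \<cdot> f a \<in> scale h M" if "f a \<in> scale h M" for a
   using Osub_smult[OF scale_sub[OF M S_carrier[OF h]] c that] .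
 qed
 then show ?thesis unfolding nullV_def using nullV_carrier[OF f] c O_carrier by simp
qed

text \<open>An element of P is divisible by every h in S. So P annihilates bounded families modulo
  null ones, and the quotient is a vector space over the residue field at P.\<close>

lemma null_mult_prime:
 assumes r: "r \<in> loc.m"
 shows "\<lbrakk>Osub M; \<And>a. f a \<in> carrier V; \<And>a. a \<in> S \<Longrightarrow> f a \<in> M\<rbrakk> \<Longrightarrow> (\<lambda>a. r \<cdot> f a) \<in> nullV M"
  and "(\<And>a. c a \<in> \<O>) \<Longrightarrow> (\<lambda>a. r \<otimes> c a) \<in> nullK"
proof -
 have rO: "r \<in> \<O>" "r \<notin> S" using r loc_m by auto
 note rK = O_carrier[OF rO(1)]
 have d: "\<exists>y\<in>\<O>. r = h \<otimes> y" if "h \<in> S" for h using S_divides[OF rO that] by blast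
 then have "ev (\<lambda>_. \<exists>y\<in>\<O>. r = h \<otimes> y)" if "h \<in> S" for h using that by (intro ev_all)
 then have rn: "(\<lambda>_. r) \<in> nullK" unfolding nullK_def using rK by simp
 show "(\<lambda>a. r \<cdot> f a) \<in> nullV M" if "Osub M" "\<And>a. f a \<in> carrier V" "\<And>a. a \<in> S \<Longrightarrow> f a \<in> M"
  using null_mult1[OF that(1) rn that(2,3)] by simp
 have "\<exists>y\<in>\<O>. r \<otimes> c a = h \<otimes> y" if c: "\<And>a. c a \<in> \<O>" and h: "h \<in> S" for h a
 proof -
  obtain y where y: "y \<in> \<O>" "r = h \<otimes> y" using d[OF h] by blast
  have "r \<otimes> c a = h \<otimes> (y \<otimes> c a)" unfolding y(2) using y(1) h c O_carrier S_carrier by (simp add: R.m_assoc)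
  then show ?thesis using O_closed(4)[OF y(1) c] by blast
 qed
 then show "(\<lambda>a. r \<otimes> c a) \<in> nullK" if c: "\<And>a. c a \<in> \<O>"
  unfolding nullK_def using rK O_carrier[OF c] ev_all c by simp
qed

text \<open>As soon as a is a multiple of h, divisibility by a gives divisibility by h. Relations
  that hold only modulo a at index a thereby become exact.\<close>

lemma null_scale:
 assumes M: "Osub M" and f: "\<And>a. f a \<in> carrier V" "\<And>a. a \<in> S \<Longrightarrow> f a \<in> scale a M"
 shows "f \<in> nullV M"
proof -
 have "ev (\<lambda>a. f a \<in> scale h M)" if h: "h \<in> S" for h
 proof (rule ev_mono[OF ev_dvd[OF h]])
  fix a assume "a \<in> S" "\<exists>r\<in>\<O>. a = r \<otimes> h"
  then show "f a \<in> scale h M" using f(2) scale_dvd[OF M S_carrier[OF h]] by blast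
 qed
 then show ?thesis unfolding nullV_def using f(1) by blast
qed

lemma null_functional:
 assumes f: "f \<in> nullV M" and M: "Osub M" and g: "\<And>a. g a \<in> carrier K"
  and \<theta>: "\<And>a. a \<in> S \<Longrightarrow> \<exists>\<theta>. linfun \<theta> \<and> (\<forall>z\<in>M. \<theta> z \<in> \<O>) \<and> g a = \<theta> (f a)"
 shows "g \<in> nullK"
proof -
 have "ev (\<lambda>a. \<exists>r\<in>\<O>. g a = h \<otimes> r)" if h: "h \<in> S" for h
 proof (rule ev_mono)
  show "ev (\<lambda>a. f a \<in> scale h M)" using f h unfolding nullV_def by blast
  fix a assume a: "a \<in> S" "f a \<in> scale h M"
  then obtain y where y: "y \<in> M" "f a = h \<cdot> y" unfolding scale_def by blast
  obtain \<theta> where t: "linfun \<theta>" "\<forall>z\<in>M. \<theta> z \<in> \<O>" "g a = \<theta> (f a)" using \<theta>[OF a(1)] by blast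
  have "g a = h \<otimes> \<theta> y" unfolding t(3) y(2) using linfunD(3)[OF t(1) S_carrier[OF h] VO.sub_carrier[OF M y(1)]] .
  then show "\<exists>r\<in>\<O>. g a = h \<otimes> r" using t(2) y(1) by blast
 qed
 then show ?thesis unfolding nullK_def using g by blast
qed

text \<open>An element of S that lies in m does not divide 1; here it matters that P is smaller than
  m.\<close>

lemma one_not_null: "(\<lambda>_. \<one>) \<notin> nullK"
proof
 assume n: "(\<lambda>_. \<one>) \<in> nullK"
 obtain h where h: "h \<in> S" "h \<in> m" using S_m by blast
 have "\<not> (\<exists>r\<in>\<O>. \<one> = h \<otimes> r)"
 proof
  assume "\<exists>r\<in>\<O>. \<one> = h \<otimes> r"
  then obtain r where r: "r \<in> \<O>" "\<one> = h \<otimes> r" by blast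
  have "\<one> = r \<otimes> h" unfolding r(2) using R.m_comm[OF S_carrier[OF h(1)] O_carrier[OF r(1)]] .
  then show False using m_mult[OF r(1) h(2)] one_nm by simp
 qed
 moreover have "ev (\<lambda>_. \<exists>r\<in>\<O>. \<one> = h \<otimes> r)" using n h(1) unfolding nullK_def by blast
 ultimately show False using ev_False by simp
qed

text \<open>The image of \<open>E\<close> tensored with the list of families: combinations with
  coefficients in \<open>E\<close>, together with the null families.\<close>

primrec comb where
 "comb M E [] = nullV M"
| "comb M E (f # X) = comb M E X <+>\<^bsub>pw V\<^esub> (\<lambda>\<epsilon> a. \<epsilon> a \<cdot> f a) ` E"

definition bdd where "bdd M f \<longleftrightarrow> (\<forall>a. f a \<in> carrier V) \<and> (\<forall>a\<in>S. f a \<in> M)"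

lemma mult_sub:
 assumes E: "PK.sub E" and f: "\<And>a. f a \<in> carrier V"
 shows "PV.sub ((\<lambda>\<epsilon> a. \<epsilon> a \<cdot> f a) ` E)"
proof (rule PV.subI)
 have c: "\<epsilon> a \<in> carrier K" if "\<epsilon> \<in> E" for \<epsilon> a using PK.sub_carrier[OF E that] by simp
 show "(\<lambda>\<epsilon> a. \<epsilon> a \<cdot> f a) ` E \<subseteq> carrier (pw V)" using c f by auto
 show "\<zero>\<^bsub>pw V\<^esub> \<in> (\<lambda>\<epsilon> a. \<epsilon> a \<cdot> f a) ` E"
  using PK.sub_zero[OF E] f by (intro image_eqI[of _ _ "\<lambda>_. \<zero>"]) auto
 show "x \<oplus>\<^bsub>pw V\<^esub> y \<in> (\<lambda>\<epsilon> a. \<epsilon> a \<cdot> f a) ` E"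
  if xy: "x \<in> (\<lambda>\<epsilon> a. \<epsilon> a \<cdot> f a) ` E" "y \<in> (\<lambda>\<epsilon> a. \<epsilon> a \<cdot> f a) ` E" for x y
 proof -
  obtain \<epsilon> \<delta> where e: "\<epsilon> \<in> E" "\<delta> \<in> E" "x = (\<lambda>a. \<epsilon> a \<cdot> f a)" "y = (\<lambda>a. \<delta> a \<cdot> f a)" using xy by blast
  show ?thesis using PK.sub_add[OF E e(1,2)] e c f
   by (intro image_eqI[of _ _ "\<lambda>a. \<epsilon> a \<oplus> \<delta> a"]) (auto simp: smult_l_distr)
 qed
 show "r \<odot>\<^bsub>pw V\<^esub> x \<in> (\<lambda>\<epsilon> a. \<epsilon> a \<cdot> f a) ` E"
  if asm: "r \<in> carrier (K\<lparr>carrier := OS\<rparr>)" "x \<in> (\<lambda>\<epsilon> a. \<epsilon> a \<cdot> f a) ` E" for r x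
 proof -
  obtain \<epsilon> where e: "\<epsilon> \<in> E" "x = (\<lambda>a. \<epsilon> a \<cdot> f a)" using asm(2) by blast
  have "r \<in> carrier K" using asm(1) loc.O_carrier by simp
  then show ?thesis using PK.sub_smult[OF E asm(1) e(1)] e c f
   by (intro image_eqI[of _ _ "\<lambda>a. r \<otimes> \<epsilon> a"]) (auto simp: smult_assoc1)
 qed
qed

lemma comb_sub:
 assumes M: "Osub M" and E: "PK.sub E" and X: "\<forall>f\<in>set X. bdd M f"
 shows "PV.sub (comb M E X)" "nullV M \<subseteq> comb M E X"
  "\<lbrakk>f \<in> set X; \<epsilon> \<in> E\<rbrakk> \<Longrightarrow> (\<lambda>a. \<epsilon> a \<cdot> f a) \<in> comb M E X"
proof -
 have "PV.sub (comb M E X) \<and> nullV M \<subseteq> comb M E X \<and> (\<forall>f\<in>set X. \<forall>\<epsilon>\<in>E. (\<lambda>a. \<epsilon> a \<cdot> f a) \<in> comb M E X)"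
  using X
 proof (induction X)
  case Nil
  then show ?case using nullV_sub[OF M] by simp
 next
  case (Cons f X)
  then have IH: "PV.sub (comb M E X)" "nullV M \<subseteq> comb M E X" "\<forall>f\<in>set X. \<forall>\<epsilon>\<in>E. (\<lambda>a. \<epsilon> a \<cdot> f a) \<in> comb M E X"
   by auto
  have f: "PV.sub ((\<lambda>\<epsilon> a. \<epsilon> a \<cdot> f a) ` E)" using mult_sub[OF E] Cons.prems unfolding bdd_def by simp
  note up = PV.sum_upper1[OF IH(1) f] PV.sum_upper2[OF IH(1) f]
  show ?case using PV.sub_sum[OF IH(1) f] IH(2,3) up by auto
 qed
 then show "PV.sub (comb M E X)" "nullV M \<subseteq> comb M E X"
  "\<lbrakk>f \<in> set X; \<epsilon> \<in> E\<rbrakk> \<Longrightarrow> (\<lambda>a. \<epsilon> a \<cdot> f a) \<in> comb M E X" by auto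
qed

lemma comb_least:
 assumes M: "Osub M" and G: "PV.sub G" "nullV M \<subseteq> G" and gs: "set gs \<subseteq> carrier (pw KM)"
  and X: "\<forall>f\<in>set X. bdd M f"
  and gf: "\<And>g f. \<lbrakk>g \<in> set gs; f \<in> set X\<rbrakk> \<Longrightarrow> (\<lambda>a. g a \<cdot> f a) \<in> G"
 shows "comb M (PK.ext nullK gs) X \<subseteq> G"
proof -
 have key: "(\<lambda>\<epsilon> a. \<epsilon> a \<cdot> f a) ` PK.ext nullK gs \<subseteq> G" if f: "f \<in> set X" for f
 proof -
  have fc: "f a \<in> carrier V" for a using X f unfolding bdd_def by blast
  have fM: "a \<in> S \<Longrightarrow> f a \<in> M" for a using X f unfolding bdd_def by blast
  let ?T = "{\<epsilon>. (\<forall>a. \<epsilon> a \<in> carrier K) \<and> (\<lambda>a. \<epsilon> a \<cdot> f a) \<in> G}"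
  have "PK.sub ?T"
  proof (rule PK.subI)
   show "?T \<subseteq> carrier (pw KM)" by auto
   show "\<zero>\<^bsub>pw KM\<^esub> \<in> ?T" using PV.sub_zero[OF G(1)] fc by simp
   show "x \<oplus>\<^bsub>pw KM\<^esub> y \<in> ?T" if "x \<in> ?T" "y \<in> ?T" for x y
    using PV.sub_add[OF G(1), of "\<lambda>a. x a \<cdot> f a" "\<lambda>a. y a \<cdot> f a"] that fc by (simp add: smult_l_distr)
   show "r \<odot>\<^bsub>pw KM\<^esub> x \<in> ?T" if asm: "r \<in> carrier (K\<lparr>carrier := OS\<rparr>)" "x \<in> ?T" for r x
    using PV.sub_smult[OF G(1) asm(1), of "\<lambda>a. x a \<cdot> f a"] asm fc loc.O_carrier by (simp add: smult_assoc1)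
  qed
  then have "PK.ext nullK gs \<subseteq> ?T"
  proof (rule PK.ext_least)
   show "nullK \<subseteq> ?T" using null_mult1[OF M _ fc fM] G(2) nullK_carrier by auto
   show "set gs \<subseteq> ?T" using gs gf[OF _ f] by auto
  qed
  then show ?thesis by auto
 qed
 have "set X' \<subseteq> set X \<Longrightarrow> comb M (PK.ext nullK gs) X' \<subseteq> G" for X'
 proof (induction X')
  case (Cons f X')
  then show ?case using PV.sum_least[OF G(1) _ key[of f]] by simp
 qed (use G(2) in simp)
 then show ?thesis by simp
qed

lemma comb_functional:
 assumes M: "Osub M" and E: "PK.sub E" and X: "\<forall>f\<in>set X. bdd M f"
  and \<theta>: "\<And>a. a \<in> S \<Longrightarrow> linfun (\<theta> a) \<and> (\<forall>z\<in>M. \<theta> a z \<in> \<O>) \<and> (\<forall>f\<in>set X. \<theta> a (f a) = \<zero>)"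
 shows "\<lbrakk>n \<in> comb M E X; \<And>a. g a \<in> carrier K; \<And>a. a \<in> S \<Longrightarrow> g a = \<theta> a (n a)\<rbrakk> \<Longrightarrow> g \<in> nullK"
 using X \<theta>
proof (induction X arbitrary: n)
 case Nil
 show ?case
 proof (rule null_functional[OF _ M Nil(2)])
  show "n \<in> nullV M" using Nil(1) by simp
  show "\<exists>\<theta>'. linfun \<theta>' \<and> (\<forall>z\<in>M. \<theta>' z \<in> \<O>) \<and> g a = \<theta>' (n a)" if "a \<in> S" for a
   using Nil(3)[OF that] Nil(5)[OF that] by blast
 qed
next
 case (Cons f X)
 obtain n' \<epsilon> where n: "n' \<in> comb M E X" "\<epsilon> \<in> E" "n = (\<lambda>a. n' a \<boxplus> \<epsilon> a \<cdot> f a)"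
  using Cons.prems(1) by (auto simp: PV.mem_sum)
 have X: "\<forall>f\<in>set X. bdd M f" using Cons.prems(4) by simp
 have n'c: "n' a \<in> carrier V" for a using PV.sub_carrier[OF comb_sub(1)[OF M E X] n(1)] by simp
 have \<epsilon>c: "\<epsilon> a \<in> carrier K" for a using PK.sub_carrier[OF E n(2)] by simp
 have fc: "f a \<in> carrier V" for a using Cons.prems(4) unfolding bdd_def by simp
 have "g a = \<theta> a (n' a)" if a: "a \<in> S" for a
 proof -
  have l: "linfun (\<theta> a)" "\<theta> a (f a) = \<zero>" using Cons.prems(5)[OF a] by auto
  have "\<theta> a (n a) = \<theta> a (n' a)" unfolding n(3) using linfunD[OF l(1)] l(2) n'c \<epsilon>c fc by simp
  then show ?thesis using Cons.prems(3)[OF a] by simp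
 qed
 then show ?case using Cons.IH[OF n(1) Cons.prems(2) _ X] Cons.prems(5) by simp
qed

text \<open>Each family contributes at most dim \<open>E\<close>. It contributes exactly dim
  \<open>E\<close> if at every index the vectors are independent modulo mM, which is stronger than
  independence modulo P: integral functionals \<theta> then exist, index by index, that isolate a
  coefficient and bring it into the null families whenever the combination is null.\<close>

lemma comb_rk:
 assumes M: "lattice M" and E: "PK.fin nullK E"
 shows "\<forall>f\<in>set X. bdd M f \<Longrightarrow> PV.fin (nullV M) (comb M E X)
   \<and> PV.rk (nullV M) (comb M E X) \<le> length X * PK.rk nullK E
   \<and> ((\<forall>a\<in>S. VO.indep (mm M) (map (\<lambda>f. f a) X)) \<longrightarrow> PV.rk (nullV M) (comb M E X) = length X * PK.rk nullK E)"
proof (induction X)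
 case Nil
 then show ?case using PV.rk_self[OF nullV_sub[OF lattice_sub[OF M]]] by simp
next
 case (Cons f X)
 note sM = lattice_sub[OF M]
 have sE: "PK.sub E" "nullK \<subseteq> E" using PK.fin_subs[OF E] by auto
 have X: "\<forall>f\<in>set X. bdd M f" using Cons.prems by simp
 have f: "bdd M f" using Cons.prems by simp
 have fc: "f a \<in> carrier V" for a using f unfolding bdd_def by simp
 have fM: "f a \<in> M" if "a \<in> S" for a using f that unfolding bdd_def by simp
 let ?A = "comb M E X"
 note A = comb_sub[OF sM sE(1) X]
 have Ec: "\<epsilon> a \<in> carrier K" if "\<epsilon> \<in> E" for \<epsilon> a using PK.sub_carrier[OF sE(1) that] by simp
 define Z where "Z = {\<epsilon> \<in> E. (\<lambda>a. \<epsilon> a \<cdot> f a) \<in> ?A}"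
 have ZI: "\<epsilon> \<in> Z" if "\<epsilon> \<in> E" "(\<lambda>a. \<epsilon> a \<cdot> f a) \<in> ?A" for \<epsilon> using that unfolding Z_def by blast
 have Z: "PK.sub Z"
 proof (rule PK.subI)
  show "Z \<subseteq> carrier (pw KM)" using PK.sub_subset[OF sE(1)] unfolding Z_def by blast
  show "\<zero>\<^bsub>pw KM\<^esub> \<in> Z" using PV.sub_zero[OF A(1)] PK.sub_zero[OF sE(1)] fc by (intro ZI) auto
  show "x \<oplus>\<^bsub>pw KM\<^esub> y \<in> Z" if "x \<in> Z" "y \<in> Z" for x y
   using PV.sub_add[OF A(1), of "\<lambda>a. x a \<cdot> f a" "\<lambda>a. y a \<cdot> f a"] that fc Ec
    PK.sub_add[OF sE(1), of x y] unfolding Z_def by (simp add: smult_l_distr)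
  show "r \<odot>\<^bsub>pw KM\<^esub> x \<in> Z" if asm: "r \<in> carrier (K\<lparr>carrier := OS\<rparr>)" "x \<in> Z" for r x
   using PV.sub_smult[OF A(1) asm(1), of "\<lambda>a. x a \<cdot> f a"] PK.sub_smult[OF sE(1) asm(1), of x]
    asm fc loc.O_carrier Ec unfolding Z_def by (simp add: smult_assoc1)
 qed
 have "(\<lambda>a. \<epsilon> a \<cdot> f a) \<in> nullV M" if "\<epsilon> \<in> nullK" for \<epsilon> by (rule null_mult1[OF sM that fc]) (rule fM)
 then have nZ: "nullK \<subseteq> Z" using A(2) sE(2) unfolding Z_def by blast
 have ZE: "Z \<subseteq> E" unfolding Z_def by blast
 note b = PK.rk_between[OF E Z nZ ZE]
 have dm: "PV.dm ?A (PK.rk Z E) (?A <+>\<^bsub>pw V\<^esub> (\<lambda>\<epsilon> a. \<epsilon> a \<cdot> f a) ` E)"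
 proof (rule rk_map[where \<kappa> = id and Z = Z, OF PK.local_module_axioms PV.local_module_axioms])
  show "PK.dm Z (PK.rk Z E) E" using PK.dm_rk[OF b(2)] .
  show "PV.sub ?A" by (rule A(1))
  show "((\<lambda>a. \<epsilon> a \<cdot> f a) \<in> ?A) = (\<epsilon> \<in> Z)" if "\<epsilon> \<in> E" for \<epsilon> using that unfolding Z_def by blast
  show "(\<lambda>a. (r \<odot>\<^bsub>pw KM\<^esub> x) a \<cdot> f a) = id r \<odot>\<^bsub>pw V\<^esub> (\<lambda>a. x a \<cdot> f a)"
   if "r \<in> carrier (K\<lparr>carrier := OS\<rparr>)" "x \<in> E" for r x
   using that Ec fc loc.O_carrier by (simp add: smult_assoc1)
 qed (use Ec fc in \<open>auto simp: smult_l_distr\<close>)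
 have IH: "PV.fin (nullV M) ?A" "PV.rk (nullV M) ?A \<le> length X * PK.rk nullK E"
  "(\<forall>a\<in>S. VO.indep (mm M) (map (\<lambda>f. f a) X)) \<Longrightarrow> PV.rk (nullV M) ?A = length X * PK.rk nullK E"
  using Cons.IH[OF X] by auto
 note t = PV.rk_trans[OF IH(1) PV.dm_fin[OF dm]]
 have rk: "PV.rk (nullV M) (comb M E (f # X)) = PV.rk (nullV M) ?A + PK.rk Z E" using t(2) PV.rk_eq[OF dm] by simp
 \<comment> \<open>\<open>Z\<close> consists of the coefficients of f for which the product is
   already a combination of the other families.\<close>
 have Zn: "Z = nullK" if ind: "\<forall>a\<in>S. VO.indep (mm M) (map (\<lambda>f. f a) (f # X))"
 proof
  show "Z \<subseteq> nullK"
  proof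
   fix \<epsilon> assume e: "\<epsilon> \<in> Z"
   have "\<exists>\<theta>. linfun \<theta> \<and> (\<forall>z\<in>M. \<theta> z \<in> \<O>) \<and> (\<forall>f\<in>set X. \<theta> (f a) = \<zero>) \<and> \<theta> (f a) = \<one>" if a: "a \<in> S" for a
   proof -
    let ?xs = "map (\<lambda>f. f a) X"
    have xs: "set ?xs \<subseteq> M" using X a unfolding bdd_def by auto
    then have xc: "set ?xs \<subseteq> carrier V" using VO.sub_subset[OF sM] by blast
    have "f a \<notin> (M \<inter> Kspan ?xs) \<uplus> mm M"
     using indep_not_mem[OF M, of "f a" ?xs] ind a xs fM[OF a] by simp
    then obtain \<theta> where "linfun \<theta>" "\<forall>z\<in>Kspan ?xs. \<theta> z = \<zero>" "\<theta> (f a) = \<one>" "\<forall>z\<in>M. \<theta> z \<in> \<O>"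
     using lattice_functional[OF M Kspan_sub[OF xc] fM[OF a]] by blast
    moreover have "set ?xs \<subseteq> Kspan ?xs" using VK.ext_mem[OF sub_zero_set xc] .
    ultimately show ?thesis by (intro exI[of _ \<theta>]) auto
   qed
   then obtain \<theta> where \<theta>: "\<And>a. a \<in> S \<Longrightarrow> linfun (\<theta> a) \<and> (\<forall>z\<in>M. \<theta> a z \<in> \<O>) \<and> (\<forall>f\<in>set X. \<theta> a (f a) = \<zero>) \<and> \<theta> a (f a) = \<one>"
    by metis
   have eE: "\<epsilon> \<in> E" "(\<lambda>a. \<epsilon> a \<cdot> f a) \<in> ?A" using e unfolding Z_def by auto
   have "\<epsilon> a = \<theta> a (\<epsilon> a \<cdot> f a)" if a: "a \<in> S" for a
    using linfunD(3)[of "\<theta> a" "\<epsilon> a" "f a"] \<theta>[OF a] Ec[OF eE(1)] fc by simp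
   then show "\<epsilon> \<in> nullK"
    using comb_functional[OF sM sE(1) X, of \<theta> "\<lambda>a. \<epsilon> a \<cdot> f a" \<epsilon>] eE(2) \<theta> Ec[OF eE(1)] by blast
  qed
 qed (rule nZ)
 have ub: "PV.rk (nullV M) (comb M E (f # X)) \<le> length (f # X) * PK.rk nullK E" using rk IH(2) b(3) by simp
 have "PV.rk (nullV M) (comb M E (f # X)) = length (f # X) * PK.rk nullK E"
  if ind: "\<forall>a\<in>S. VO.indep (mm M) (map (\<lambda>f. f a) (f # X))"
 proof -
  have "\<forall>a\<in>S. VO.indep (mm M) (map (\<lambda>f. f a) X)" using ind by simp
  then show ?thesis using rk IH(3) Zn[OF ind] by simp
 qed
 moreover have "PV.fin (nullV M) (comb M E (f # X))" using t(1) by simp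
 ultimately show ?case using ub by blast
qed

end

context localization
begin

text \<open>\<open>expressible M cs X Y\<close>: modulo null families, the families in \<open>X\<close> are combinations of those in
 \<open>Y\<close> with coefficients in \<open>cs\<close>.\<close>

definition expressible where
 "expressible M cs X Y \<longleftrightarrow> (\<forall>G g. PV.sub G \<and> nullV M \<subseteq> G \<and> (\<forall>a. g a \<in> \<O>)
  \<and> (\<forall>c\<in>set cs. \<forall>f\<in>set Y. (\<lambda>a. (g a \<otimes> c a) \<cdot> f a) \<in> G) \<longrightarrow> (\<forall>f\<in>set X. (\<lambda>a. g a \<cdot> f a) \<in> G))"

lemma expressibleD:
 assumes "expressible M cs X Y" "set cs \<subseteq> set cs'" "PV.sub G" "nullV M \<subseteq> G" "\<And>a. g a \<in> \<O>"
  and "\<And>c f. \<lbrakk>c \<in> set cs'; f \<in> set Y\<rbrakk> \<Longrightarrow> (\<lambda>a. (g a \<otimes> c a) \<cdot> f a) \<in> G" "f \<in> set X"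
 shows "(\<lambda>a. g a \<cdot> f a) \<in> G"
 using assms unfolding expressible_def by blast

text \<open>At every a in S, x(a) is a combination of the vectors of Y up to an error in aM.
  Coefficients chosen independently at each index form families in \<O>, and the errors form a null
  family.\<close>

lemma expressible_single:
 assumes M: "Osub M" and Y: "\<forall>f\<in>set Y. bdd M f"
 shows "\<lbrakk>\<And>a. a \<in> S \<Longrightarrow> x a \<in> VO.ext (scale a M) (map (\<lambda>f. f a) Y); \<And>a. a \<notin> S \<Longrightarrow> x a = 0\<^sub>V\<rbrakk>
  \<Longrightarrow> \<exists>cs. (\<forall>c\<in>set cs. \<forall>a. c a \<in> \<O>) \<and> expressible M cs [x] Y"
 using Y
proof (induction Y arbitrary: x)
 case Nil
 have x: "x a \<in> scale a M" if "a \<in> S" for a using Nil(1)[OF that] by simp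
 have "x a \<in> carrier V" for a
  using x[of a] Nil(2)[of a] VO.sub_carrier[OF scale_sub[OF M S_carrier]] by (cases "a \<in> S") auto
 then have "x \<in> nullV M" using null_scale[OF M] x by blast
 then have "expressible M [] [x] []" unfolding expressible_def using null_mult2[OF M] by auto
 then show ?case by (intro exI[of _ "[]"]) simp
next
 case (Cons f Y)
 have Y: "\<forall>f\<in>set Y. bdd M f" using Cons.prems by simp
 have fc: "f a \<in> carrier V" for a using Cons.prems(3) unfolding bdd_def by simp
 have "\<exists>y c. y \<in> VO.ext (scale a M) (map (\<lambda>f. f a) Y) \<and> c \<in> \<O> \<and> x a = y \<boxplus> c \<cdot> f a" if a: "a \<in> S" for a
  using Cons.prems(1)[OF a] unfolding list.map VO.ext.simps VO.mem_sum_line by auto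
 then obtain y c where yc: "\<And>a. a \<in> S \<Longrightarrow> y a \<in> VO.ext (scale a M) (map (\<lambda>f. f a) Y) \<and> c a \<in> \<O> \<and> x a = y a \<boxplus> c a \<cdot> f a"
  by metis
 define y' where "y' a = (if a \<in> S then y a else 0\<^sub>V)" for a
 define c' where "c' a = (if a \<in> S then c a else \<zero>)" for a
 have c': "c' a \<in> \<O>" for a using yc O_closed(1) unfolding c'_def by simp
 note c'K = O_carrier[OF c']
 have y'c: "y' a \<in> carrier V" for a
 proof (cases "a \<in> S")
  case True
  have "set (map (\<lambda>f. f a) Y) \<subseteq> carrier V" using Y unfolding bdd_def by auto
  then have "Osub (VO.ext (scale a M) (map (\<lambda>f. f a) Y))"
   by (rule VO.ext_sub[OF scale_sub[OF M S_carrier[OF True]]])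
  then show ?thesis using VO.sub_carrier yc[OF True] True unfolding y'_def by auto
 qed (simp add: y'_def)
 have x: "x a = y' a \<boxplus> c' a \<cdot> f a" for a
  using yc[of a] Cons.prems(2)[of a] fc unfolding y'_def c'_def by (cases "a \<in> S") auto
 obtain cs where cs: "\<forall>c\<in>set cs. \<forall>a. c a \<in> \<O>" "expressible M cs [y'] Y"
  using Cons.IH[OF _ _ Y, of y'] yc unfolding y'_def by auto
 have "expressible M (c' # cs) [x] (f # Y)"
  unfolding expressible_def
 proof (intro allI impI ballI)
  fix G g f' assume a: "PV.sub G \<and> nullV M \<subseteq> G \<and> (\<forall>a. g a \<in> \<O>)
   \<and> (\<forall>c\<in>set (c' # cs). \<forall>f\<in>set (f # Y). (\<lambda>a. (g a \<otimes> c a) \<cdot> f a) \<in> G)" and f': "f' \<in> set [x]"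
  have gK: "g a \<in> carrier K" for a using a O_carrier by blast
  have "(\<lambda>a. g a \<cdot> y' a) \<in> G" using cs(2) a unfolding expressible_def by auto
  moreover have "(\<lambda>a. (g a \<otimes> c' a) \<cdot> f a) \<in> G" using a by simp
  ultimately have "(\<lambda>a. g a \<cdot> y' a \<boxplus> (g a \<otimes> c' a) \<cdot> f a) \<in> G" using PV.sub_add[of G] a by fastforce
  moreover have "g a \<cdot> x a = g a \<cdot> y' a \<boxplus> (g a \<otimes> c' a) \<cdot> f a" for a
   unfolding x using gK c'K y'c fc by (simp add: smult_r_distr smult_assoc1)
  ultimately show "(\<lambda>a. g a \<cdot> f' a) \<in> G" using f' by simp
 qed
 then show ?case using cs(1) c' by (intro exI[of _ "c' # cs"]) auto
qed

lemma expressible_list: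
 assumes M: "Osub M" and Y: "\<forall>f\<in>set Y. bdd M f"
 shows "\<lbrakk>\<And>a x. \<lbrakk>a \<in> S; x \<in> set X\<rbrakk> \<Longrightarrow> x a \<in> VO.ext (scale a M) (map (\<lambda>f. f a) Y);
   \<And>a x. \<lbrakk>a \<notin> S; x \<in> set X\<rbrakk> \<Longrightarrow> x a = 0\<^sub>V\<rbrakk>
  \<Longrightarrow> \<exists>cs. (\<forall>c\<in>set cs. \<forall>a. c a \<in> \<O>) \<and> expressible M cs X Y"
proof (induction X)
 case Nil
 then show ?case by (intro exI[of _ "[]"]) (auto simp: expressible_def)
next
 case (Cons x X)
 obtain cs where cs: "\<forall>c\<in>set cs. \<forall>a. c a \<in> \<O>" "expressible M cs X Y"
  using Cons.IH Cons.prems by auto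
 obtain ds where ds: "\<forall>c\<in>set ds. \<forall>a. c a \<in> \<O>" "expressible M ds [x] Y"
  using expressible_single[OF M Y, of x] Cons.prems by auto
 have "expressible M (cs @ ds) (x # X) Y"
  unfolding expressible_def
 proof (intro allI impI ballI)
  fix G g f assume a: "PV.sub G \<and> nullV M \<subseteq> G \<and> (\<forall>a. g a \<in> \<O>)
   \<and> (\<forall>c\<in>set (cs @ ds). \<forall>f\<in>set Y. (\<lambda>a. (g a \<otimes> c a) \<cdot> f a) \<in> G)" and f: "f \<in> set (x # X)"
  have "(\<forall>f\<in>set X. (\<lambda>a. g a \<cdot> f a) \<in> G)" using cs(2)[unfolded expressible_def, rule_format, of G g] a by simp
  moreover have "(\<forall>f\<in>set [x]. (\<lambda>a. g a \<cdot> f a) \<in> G)" using ds(2)[unfolded expressible_def, rule_format, of G g] a by simp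
  ultimately show "(\<lambda>a. g a \<cdot> f a) \<in> G" using f by auto
 qed
 then show ?case using cs(1) ds(1) by (intro exI[of _ "cs @ ds"]) auto
qed

text \<open>The monomials in the coefficients with every exponent at most N. Bounding each exponent
  separately makes their number (N + 1) to the power \<open>length cs\<close>, a polynomial in
  N.\<close>

fun box :: "('a \<Rightarrow> 'a) list \<Rightarrow> nat \<Rightarrow> ('a \<Rightarrow> 'a) list" where
 "box [] N = [\<lambda>_. \<one>]"
| "box (c # cs) N = concat (map (\<lambda>g. map (\<lambda>j a. (c a [^] j) \<otimes> g a) [0..<Suc N]) (box cs N))"

lemma length_box: "length (box cs N) = (N + 1) ^ length cs"
 by (induction cs) (simp_all add: length_concat o_def sum_list_triv del: upt_Suc)

lemma mem_box_Cons: "x \<in> set (box (c # cs) N) \<longleftrightarrow> (\<exists>g\<in>set (box cs N). \<exists>j\<le>N. x = (\<lambda>a. (c a [^] j) \<otimes> g a))"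
proof -
 have "set (box (c # cs) N) = (\<Union>g\<in>set (box cs N). (\<lambda>j a. (c a [^] j) \<otimes> g a) ` {..N})"
  by (simp add: atLeast0LessThan lessThan_Suc_atMost del: upt_Suc)
 then show ?thesis by blast
qed

declare box.simps(2) [simp del]

lemma box_O: "\<lbrakk>\<forall>c\<in>set cs. \<forall>a. c a \<in> \<O>; g \<in> set (box cs N)\<rbrakk> \<Longrightarrow> g a \<in> \<O>"
proof (induction cs arbitrary: g)
 case (Cons c cs)
 have "c a [^] j \<in> \<O>" for j :: nat
  using Cons.prems(1) O_closed by (induction j) auto
 then show ?case using Cons O_closed(4) by (auto simp: mem_box_Cons)
qed (simp add: O_closed)

lemma one_box: "\<forall>c\<in>set cs. \<forall>a. c a \<in> \<O> \<Longrightarrow> (\<lambda>_. \<one>) \<in> set (box cs N)"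
proof (induction cs)
 case (Cons c cs)
 have "(\<lambda>_. \<one>) = (\<lambda>a. (c a [^] (0::nat)) \<otimes> \<one>)" by simp
 then show ?case using Cons unfolding mem_box_Cons by (intro bexI[of _ "\<lambda>_. \<one>"] exI[of _ 0]) auto
qed simp

lemma box_mono: "N \<le> N' \<Longrightarrow> set (box cs N) \<subseteq> set (box cs N')"
proof (induction cs)
 case (Cons c cs)
 show ?case
 proof
  fix x assume "x \<in> set (box (c # cs) N)"
  then show "x \<in> set (box (c # cs) N')" using Cons unfolding mem_box_Cons by (meson le_trans subsetD)
 qed
qed simp

lemma box_mult:
 "\<lbrakk>\<forall>c\<in>set cs. \<forall>a. c a \<in> \<O>; g \<in> set (box cs N); c \<in> set cs\<rbrakk> \<Longrightarrow> (\<lambda>a. g a \<otimes> c a) \<in> set (box cs (Suc N))"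
proof (induction cs arbitrary: g)
 case (Cons d cs)
 obtain g' j where g: "g' \<in> set (box cs N)" "j \<le> N" "g = (\<lambda>a. (d a [^] j) \<otimes> g' a)"
  using Cons.prems(2) unfolding mem_box_Cons by blast
 have K: "d a \<in> carrier K" "g' a \<in> carrier K" "c a \<in> carrier K" for a
  using Cons.prems box_O[of cs g'] g O_carrier by auto
 show ?case
 proof (cases "c = d")
  case True
  have "(\<lambda>a. g a \<otimes> c a) = (\<lambda>a. (d a [^] Suc j) \<otimes> g' a)" unfolding g(3) True using K by (simp add: R.m_ac)
  moreover have "g' \<in> set (box cs (Suc N))" using box_mono[of N "Suc N" cs] g(1) by auto
  ultimately show ?thesis unfolding mem_box_Cons using g(2) by (intro bexI[of _ g'] exI[of _ "Suc j"]) auto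
 next
  case False
  then have "(\<lambda>a. g' a \<otimes> c a) \<in> set (box cs (Suc N))" using Cons g by simp
  moreover have "(\<lambda>a. g a \<otimes> c a) = (\<lambda>a. (d a [^] j) \<otimes> (g' a \<otimes> c a))" unfolding g(3) using K by (simp add: R.m_assoc)
  ultimately show ?thesis unfolding mem_box_Cons using g(2) by (intro bexI[of _ "\<lambda>a. g' a \<otimes> c a"] exI[of _ j]) auto
 qed
qed simp

lemma box_carrier: "\<forall>c\<in>set cs. \<forall>a. c a \<in> \<O> \<Longrightarrow> set (box cs N) \<subseteq> carrier (pw KM)"
 using box_O O_carrier by auto

definition E where "E cs N = PK.ext nullK (box cs N)"

lemma E_props:
 assumes cs: "\<forall>c\<in>set cs. \<forall>a. c a \<in> \<O>"
 shows "PK.fin nullK (E cs N)" "PK.rk nullK (E cs N) \<le> (N + 1) ^ length cs" "set (box cs N) \<subseteq> E cs N"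
  "N \<le> N' \<Longrightarrow> E cs N \<subseteq> E cs N'" "0 < PK.rk nullK (E cs N)"
  "N \<le> N' \<Longrightarrow> PK.rk nullK (E cs N) \<le> PK.rk nullK (E cs N')"
proof -
 note c = box_carrier[OF cs]
 have ann: "r \<odot>\<^bsub>pw KM\<^esub> x \<in> nullK" if "x \<in> set (box cs N)" "r \<in> loc.m" for x r N
  using null_mult_prime(2)[OF that(2), of x] box_O[OF cs that(1)] by simp
 have e: "PK.fin nullK (E cs N) \<and> PK.rk nullK (E cs N) \<le> length (box cs N)" for N
  unfolding E_def by (rule PK.ext_dm[OF nullK_sub c ann])
 then show f: "PK.fin nullK (E cs N)" for N by blast
 show "PK.rk nullK (E cs N) \<le> (N + 1) ^ length cs" using e length_box by metis
 show g: "set (box cs N) \<subseteq> E cs N" for N unfolding E_def using PK.ext_mem[OF nullK_sub c] .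
 have s: "PK.sub (E cs N)" "nullK \<subseteq> E cs N" for N using PK.fin_subs[OF f] by auto
 show m: "E cs N \<subseteq> E cs N'" if "N \<le> N'" for N'
  using PK.ext_least[OF s(1) s(2), of "box cs N" N'] box_mono[OF that, of cs] g[of N'] unfolding E_def by blast
 show "PK.rk nullK (E cs N) \<le> PK.rk nullK (E cs N')" if "N \<le> N'"
  using PK.rk_mono[OF f s m[OF that]] .
 have "E cs N \<noteq> nullK" using one_box[OF cs, of N] g[of N] one_not_null by blast
 then show "0 < PK.rk nullK (E cs N)" using PK.rk_zero_iff[OF f[of N]] by simp
qed

text \<open>One substitution multiplies the monomials by one coefficient, hence raises the bound on
  the exponents by one. The shifts of N in the growth argument come from here.\<close>

lemma comb_expressible:
 assumes M: "Osub M" and X: "\<forall>f\<in>set X. bdd M f" and Y: "\<forall>f\<in>set Y. bdd M f"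
  and cs: "\<forall>c\<in>set cs. \<forall>a. c a \<in> \<O>" and ex: "expressible M ds X Y" "set ds \<subseteq> set cs"
 shows "comb M (E cs N) X \<subseteq> comb M (E cs (Suc N)) Y"
 unfolding E_def[of cs N]
proof (rule comb_least[OF M _ _ box_carrier[OF cs] X])
 have s: "PK.sub (E cs (Suc N))" using PK.fin_subs[OF E_props(1)[OF cs]] by blast
 note G = comb_sub[OF M s Y]
 show "PV.sub (comb M (E cs (Suc N)) Y)" "nullV M \<subseteq> comb M (E cs (Suc N)) Y" using G by auto
 show "(\<lambda>a. g a \<cdot> f a) \<in> comb M (E cs (Suc N)) Y" if gf: "g \<in> set (box cs N)" "f \<in> set X" for g f
 proof (rule expressibleD[OF ex G(1,2) _ _ gf(2)])
  show "g a \<in> \<O>" for a using box_O[OF cs gf(1)] .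
  show "(\<lambda>a. (g a \<otimes> c a) \<cdot> f a) \<in> comb M (E cs (Suc N)) Y" if "c \<in> set cs" "f \<in> set Y" for c f
   using G(3)[OF that(2), of "\<lambda>a. g a \<otimes> c a"] box_mult[OF cs gf(1) that(1)] E_props(3)[OF cs, of "Suc N"] by blast
 qed
qed

text \<open>Constant vectors of A with coefficients in the given list, plus null families: A with
  its scalars extended to the span of the \<epsilon>s. Applied to the localised lattice and its
  intersections with the \<open>F i\<close>, it is the scalar extension of the reduction at P and of
  its filtrations.\<close>

primrec tens where
 "tens M A [] = nullV M"
| "tens M A (\<epsilon> # \<epsilon>s) = tens M A \<epsilon>s <+>\<^bsub>pw V\<^esub> (\<lambda>x a. \<epsilon> a \<cdot> x) ` A"

lemma family_sub:
 assumes A: "loc.Osub A" and \<epsilon>: "\<And>a. \<epsilon> a \<in> carrier K"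
 shows "PV.sub ((\<lambda>x a. \<epsilon> a \<cdot> x) ` A)"
proof (rule PV.subI)
 note c = loc.VO.sub_carrier[OF A]
 let ?h = "\<lambda>x a. \<epsilon> a \<cdot> x"
 show "?h ` A \<subseteq> carrier (pw V)" using c \<epsilon> by auto
 show "\<zero>\<^bsub>pw V\<^esub> \<in> ?h ` A" using loc.VO.sub_zero[OF A] \<epsilon> by (intro image_eqI[of _ _ "0\<^sub>V"]) auto
 show "x \<oplus>\<^bsub>pw V\<^esub> y \<in> ?h ` A" if xy: "x \<in> ?h ` A" "y \<in> ?h ` A" for x y
 proof -
  obtain x' y' where "x' \<in> A" "y' \<in> A" "x = ?h x'" "y = ?h y'" using xy by blast
  then show ?thesis using loc.VO.sub_add[OF A] c \<epsilon>
   by (intro image_eqI[of _ _ "x' \<boxplus> y'"]) (auto simp: smult_r_distr)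
 qed
 show "r \<odot>\<^bsub>pw V\<^esub> x \<in> ?h ` A" if rx: "r \<in> carrier (K\<lparr>carrier := OS\<rparr>)" "x \<in> ?h ` A" for r x
 proof -
  obtain x' where "x' \<in> A" "x = ?h x'" using rx by blast
  then show ?thesis using loc.VO.sub_smult[OF A rx(1)] c \<epsilon> rx(1) loc.O_carrier
   by (intro image_eqI[of _ _ "r \<cdot> x'"]) (auto simp: smult_assoc1[symmetric] R.m_comm)
 qed
qed

lemma tens_sub:
 assumes M: "Osub M" and A: "loc.Osub A" and \<epsilon>s: "\<forall>\<epsilon>\<in>set \<epsilon>s. \<forall>a. \<epsilon> a \<in> carrier K"
 shows "PV.sub (tens M A \<epsilon>s)" "nullV M \<subseteq> tens M A \<epsilon>s"
  "\<lbrakk>\<epsilon> \<in> set \<epsilon>s; x \<in> A\<rbrakk> \<Longrightarrow> (\<lambda>a. \<epsilon> a \<cdot> x) \<in> tens M A \<epsilon>s"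
proof -
 have "PV.sub (tens M A \<epsilon>s) \<and> nullV M \<subseteq> tens M A \<epsilon>s \<and> (\<forall>\<epsilon>\<in>set \<epsilon>s. \<forall>x\<in>A. (\<lambda>a. \<epsilon> a \<cdot> x) \<in> tens M A \<epsilon>s)"
  using \<epsilon>s
 proof (induction \<epsilon>s)
  case Nil
  then show ?case using nullV_sub[OF M] by simp
 next
  case (Cons \<epsilon> \<epsilon>s)
  then have IH: "PV.sub (tens M A \<epsilon>s)" "nullV M \<subseteq> tens M A \<epsilon>s" "\<forall>\<epsilon>\<in>set \<epsilon>s. \<forall>x\<in>A. (\<lambda>a. \<epsilon> a \<cdot> x) \<in> tens M A \<epsilon>s"
   by auto
  have f: "PV.sub ((\<lambda>x a. \<epsilon> a \<cdot> x) ` A)" using family_sub[OF A] Cons.prems by simp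
  note up = PV.sum_upper1[OF IH(1) f] PV.sum_upper2[OF IH(1) f]
  show ?case using PV.sub_sum[OF IH(1) f] IH(2,3) up by auto
 qed
 then show "PV.sub (tens M A \<epsilon>s)" "nullV M \<subseteq> tens M A \<epsilon>s"
  "\<lbrakk>\<epsilon> \<in> set \<epsilon>s; x \<in> A\<rbrakk> \<Longrightarrow> (\<lambda>a. \<epsilon> a \<cdot> x) \<in> tens M A \<epsilon>s" by auto
qed

lemma tens_mono: "A \<subseteq> B \<Longrightarrow> tens M A \<epsilon>s \<subseteq> tens M B \<epsilon>s"
 by (induction \<epsilon>s) (simp_all add: PV.sum_mono image_mono)

lemma tens_functional:
 assumes M: "Osub M" and \<theta>: "linfun \<theta>" "\<forall>z\<in>M. \<theta> z \<in> \<O>" and \<epsilon>s: "\<forall>\<epsilon>\<in>set \<epsilon>s. \<forall>a. \<epsilon> a \<in> carrier K"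
 shows "f \<in> tens M (Mloc M) \<epsilon>s \<Longrightarrow> (\<lambda>a. \<theta> (f a)) \<in> PK.ext nullK \<epsilon>s"
 using \<epsilon>s
proof (induction \<epsilon>s arbitrary: f)
 case Nil
 have f: "f \<in> nullV M" using Nil by simp
 have "(\<lambda>a. \<theta> (f a)) \<in> nullK"
  by (rule null_functional[OF f M]) (use linfunD(1)[OF \<theta>(1)] nullV_carrier[OF f] \<theta> in auto)
 then show ?case by simp
next
 case (Cons \<epsilon> \<epsilon>s)
 obtain p x where p: "p \<in> tens M (Mloc M) \<epsilon>s" "x \<in> Mloc M" "f = (\<lambda>a. p a \<boxplus> \<epsilon> a \<cdot> x)"
  using Cons.prems(1) by (auto simp: PV.mem_sum)
 have \<epsilon>s: "\<forall>\<epsilon>\<in>set \<epsilon>s. \<forall>a. \<epsilon> a \<in> carrier K" and \<epsilon>K: "\<epsilon> a \<in> carrier K" for a using Cons.prems by auto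
 have pc: "p a \<in> carrier V" for a using PV.sub_carrier[OF tens_sub(1)[OF M Mloc_sub[OF M] \<epsilon>s] p(1)] by simp
 obtain s where s: "x \<in> carrier V" "s \<in> S" "s \<cdot> x \<in> M" using p(2) unfolding Mloc_def by blast
 note \<theta>D = linfunD[OF \<theta>(1)]
 have "s \<otimes> \<theta> x \<in> \<O>" using \<theta>(2) s \<theta>D(3)[OF S_carrier[OF s(2)] s(1)] by metis
 then have \<theta>x: "\<theta> x \<in> OS" "\<theta> x \<in> carrier K" unfolding OS_def using s(2) \<theta>D(1)[OF s(1)] by blast+
 have "(\<lambda>a. \<theta> (f a)) = (\<lambda>a. \<theta> (p a)) \<oplus>\<^bsub>pw KM\<^esub> \<theta> x \<odot>\<^bsub>pw KM\<^esub> \<epsilon>"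
  unfolding p(3) using \<theta>D pc s(1) \<epsilon>K \<theta>x by (simp add: R.m_comm)
 moreover have "(\<lambda>a. \<theta> (p a)) \<in> PK.ext nullK \<epsilon>s" using Cons.IH[OF p(1) \<epsilon>s] .
 ultimately show ?case unfolding PK.ext.simps PK.mem_sum_line using \<theta>x(1) by auto
qed

text \<open>A vector x outside P times the localised lattice is a scalar multiple, over the
  localisation, of a vector g of M outside mM. A functional with value 1 at g and integral on M
  would turn the relation for \<epsilon> g into one expressing \<epsilon> by the
  \<epsilon>s.\<close>

lemma tens_kernel:
 assumes M: "lattice M" and \<epsilon>s: "\<forall>\<epsilon>\<in>set (\<epsilon> # \<epsilon>s). \<forall>a. \<epsilon> a \<in> carrier K" and ind: "\<epsilon> \<notin> PK.ext nullK \<epsilon>s"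
  and x: "x \<in> Mloc M" "(\<lambda>a. \<epsilon> a \<cdot> x) \<in> tens M (Mloc M) \<epsilon>s"
 shows "x \<in> loc.mm (Mloc M)"
proof (rule ccontr)
 assume nx: "x \<notin> loc.mm (Mloc M)"
 note sM = lattice_sub[OF M]
 note L = Mloc_sub[OF sM]
 have sml: "loc.Osub (loc.mm (Mloc M))" using loc.mm_sub[OF L] by simp
 have \<epsilon>s': "\<forall>\<epsilon>\<in>set \<epsilon>s. \<forall>a. \<epsilon> a \<in> carrier K" and \<epsilon>K: "\<epsilon> a \<in> carrier K" for a using \<epsilon>s by auto
 obtain s where s: "x \<in> carrier V" "s \<in> S" "s \<cdot> x \<in> M" using x(1) unfolding Mloc_def by blast
 note sK = S_carrier[OF s(2)] S_inv[OF s(2)]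
 have inv: "inv s \<cdot> (s \<cdot> x) = x" using smult_inv(1)[OF sK(1,2) s(1)] .
 have nsx: "s \<cdot> x \<notin> loc.mm (Mloc M)" using loc.Osub_smult[OF sml inv_S_OS[OF s(2)]] inv nx by metis
 then have "s \<cdot> x \<noteq> 0\<^sub>V" using loc.VO.sub_zero[OF sml] by metis
 then obtain c g where cg: "c \<in> carrier K" "g \<in> M" "c \<noteq> \<zero>" "g \<notin> mm M" "s \<cdot> x = c \<cdot> g" "c \<in> \<O>"
  using primitive_part[OF M VO.sub_carrier[OF sM s(3)]] s(3) by blast
 \<comment> \<open>Otherwise the content c would lie in P and s x in P times the localised
   lattice.\<close>
 have cS: "c \<in> S" using nsx cg unfolding loc_mm(1)[OF sM] by blast
 note cK = S_inv[OF cS]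
 have gc: "g \<in> carrier V" using cg VO.sub_carrier[OF sM] by blast
 have g: "g = (inv c \<otimes> s) \<cdot> x"
  using smult_inv(1)[OF cg(1,3) gc] cg(5) s(1) sK(1) cK(2) by (simp add: smult_assoc1)
 have q: "inv c \<otimes> s \<in> OS" using loc.O_closed(4)[OF inv_S_OS[OF cS]] s(2) S_O O_OS by blast
 have "(\<lambda>a. \<epsilon> a \<cdot> g) = (inv c \<otimes> s) \<odot>\<^bsub>pw V\<^esub> (\<lambda>a. \<epsilon> a \<cdot> x)"
  unfolding g using \<epsilon>K loc.O_carrier[OF q] s(1) by (simp add: smult_assoc1[symmetric] R.m_comm)
 then have "(\<lambda>a. \<epsilon> a \<cdot> g) \<in> tens M (Mloc M) \<epsilon>s"
  using PV.sub_smult[OF tens_sub(1)[OF sM L \<epsilon>s'] _ x(2), of "inv c \<otimes> s"] q by simp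
 moreover have "M \<inter> {0\<^sub>V} = {0\<^sub>V}" using VO.sub_zero[OF sM] by auto
 then have "g \<notin> (M \<inter> {0\<^sub>V}) \<uplus> mm M"
  using VO.sum_absorb2[OF VO.sub_zero_set, of "mm M"] mm_sub(1)[OF sM] VO.sub_zero[of "mm M"] cg(4) by simp
 then obtain \<theta> where \<theta>: "linfun \<theta>" "\<theta> g = \<one>" "\<forall>z\<in>M. \<theta> z \<in> \<O>"
  using lattice_functional[OF M sub_zero_set cg(2)] by blast
 ultimately have "(\<lambda>a. \<theta> (\<epsilon> a \<cdot> g)) \<in> PK.ext nullK \<epsilon>s" using tens_functional[OF sM _ _ \<epsilon>s'] by blast
 moreover have "(\<lambda>a. \<theta> (\<epsilon> a \<cdot> g)) = \<epsilon>" using linfunD(3)[OF \<theta>(1) \<epsilon>K gc] \<theta>(2) \<epsilon>K by simp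
 ultimately show False using ind by simp
qed

lemma comb_tens:
 assumes M: "Osub M" and A: "loc.Osub A" and \<epsilon>s: "set \<epsilon>s \<subseteq> carrier (pw KM)" and bs: "set bs \<subseteq> A" "set bs \<subseteq> M"
 shows "comb M (PK.ext nullK \<epsilon>s) (map (\<lambda>b _. b) bs) \<subseteq> tens M A \<epsilon>s"
proof (rule comb_least[OF M _ _ \<epsilon>s])
 have e: "\<forall>\<epsilon>\<in>set \<epsilon>s. \<forall>a. \<epsilon> a \<in> carrier K" using \<epsilon>s by auto
 note t = tens_sub[OF M A e]
 show "PV.sub (tens M A \<epsilon>s)" "nullV M \<subseteq> tens M A \<epsilon>s" by (rule t)+
 show "\<forall>f\<in>set (map (\<lambda>b _. b) bs). bdd M f" using bs(2) VO.sub_subset[OF M] by (auto simp: bdd_def)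
 show "(\<lambda>a. g a \<cdot> f a) \<in> tens M A \<epsilon>s" if "g \<in> set \<epsilon>s" "f \<in> set (map (\<lambda>b _. b) bs)" for g f
  using t(3)[OF that(1)] that(2) bs(1) by auto
qed

end

section \<open>Growth\<close>

text \<open>Iterating the step N times gives X^N e(0) \<le> (X - 1)^N e(2N). With c = (X - 1)/X < 1
  the polynomial bound yields 1 \<le> c^N (2N + 1)^g for all N, which fails for large N.\<close>

lemma polynomial_exponential_growth:
 fixes e :: "nat \<Rightarrow> nat" and X :: int
 assumes step: "\<And>N. X * int (e N) \<le> (X - 1) * int (e (Suc (Suc N)))"
  and X: "1 \<le> X" and e0: "0 < e 0" and poly: "\<And>N. e N \<le> (N + 1) ^ g"
 shows False
proof -
 have "X ^ N * int (e 0) \<le> (X - 1) ^ N * int (e (2 * N))" for N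
 proof (induction N)
  case (Suc N)
  have "X ^ Suc N * int (e 0) = X * (X ^ N * int (e 0))" by simp
  also have "\<dots> \<le> X * ((X - 1) ^ N * int (e (2 * N)))" using Suc X by (intro mult_left_mono) auto
  also have "\<dots> = (X - 1) ^ N * (X * int (e (2 * N)))" by simp
  also have "\<dots> \<le> (X - 1) ^ N * ((X - 1) * int (e (Suc (Suc (2 * N)))))" using step X by (intro mult_left_mono) auto
  finally show ?case by (simp add: mult.assoc mult.left_commute)
 qed simp
 moreover have "X ^ N * 1 \<le> X ^ N * int (e 0)" for N using e0 X by (intro mult_left_mono) auto
 moreover have "(X - 1) ^ N * int (e (2 * N)) \<le> (X - 1) ^ N * int ((2 * N + 1) ^ g)" for N
  using poly[of "2 * N"] X by (intro mult_left_mono of_nat_mono) auto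
 ultimately have le0: "X ^ N \<le> (X - 1) ^ N * int ((2 * N + 1) ^ g)" for N by (metis mult.right_neutral order_trans)
 have le: "real_of_int X ^ N \<le> real_of_int (X - 1) ^ N * real (2 * N + 1) ^ g" for N
 proof -
  have "real_of_int (X ^ N) \<le> real_of_int ((X - 1) ^ N * int ((2 * N + 1) ^ g))"
   using le0[of N] by (simp only: of_int_le_iff)
  then show ?thesis by simp
 qed
 define c where "c = real_of_int (X - 1) / real_of_int X"
 have c: "0 \<le> c" "c < 1" using X unfolding c_def by auto
 have one: "1 \<le> c ^ N * real (2 * N + 1) ^ g" for N
 proof -
  have p: "0 < real_of_int X ^ N" using X by simp
  have "c ^ N * real (2 * N + 1) ^ g = (real_of_int (X - 1) ^ N * real (2 * N + 1) ^ g) / real_of_int X ^ N"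
   unfolding c_def by (simp only: power_divide times_divide_eq_left)
  then show ?thesis using le[of N] p by (simp only: pos_le_divide_eq mult_1)
 qed
 \<comment> \<open>Taking a root of order g + 1 reduces the decay of c^N (2N + 1)^g to that of N
   y^N, with one power to spare.\<close>
 define y where "y = root (Suc g) c"
 have y: "0 \<le> y" "y < 1" "y ^ Suc g = c" unfolding y_def using c by (auto simp: real_root_pow_pos2 simp del: power_Suc)
 have "(\<lambda>n. real n * y ^ n) \<longlonglongrightarrow> 0" using powser_times_n_limit_0[of y] y by simp
 then have "eventually (\<lambda>n. real n * y ^ n < 1 / 3) sequentially" by (rule order_tendstoD) simp
 then obtain N0 where N0: "\<forall>n\<ge>N0. real n * y ^ n < 1 / 3" unfolding eventually_sequentially by blast
 define N where "N = max 1 N0"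
 have N: "1 \<le> N" "real N * y ^ N < 1 / 3" using N0 unfolding N_def by auto
 have "real (2 * N + 1) * y ^ N \<le> 3 * (real N * y ^ N)" using N(1) y(1)
  unfolding mult.assoc[symmetric] by (intro mult_right_mono) auto
 then have "real (2 * N + 1) * y ^ N < 1" using N(2) by simp
 moreover have "z ^ Suc g \<le> z" if "0 \<le> z" "z < 1" for z :: real
  using that power_le_one[of z g] mult_left_le[of "z ^ g" z] by simp
 ultimately have "(real (2 * N + 1) * y ^ N) ^ Suc g < 1" using y(1)
  by (meson le_less_trans mult_nonneg_nonneg of_nat_0_le_iff zero_le_power)
 moreover have "(y ^ N) ^ Suc g = c ^ N" using y(3) power_mult[of y N "Suc g"] power_mult[of y "Suc g" N]
  by (simp only: mult.commute)
 ultimately have lt: "real (2 * N + 1) ^ Suc g * c ^ N < 1" by (simp only: power_mult_distrib)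
 have "real (2 * N + 1) ^ g * 1 \<le> real (2 * N + 1) ^ g * real (2 * N + 1)" by (intro mult_left_mono) auto
 then have "c ^ N * real (2 * N + 1) ^ g \<le> c ^ N * real (2 * N + 1) ^ Suc g"
  using c(1) by (intro mult_left_mono) (simp_all only: power_Suc2 mult_1_right zero_le_power)
 also have "\<dots> < 1" using lt by (simp only: mult.commute)
 finally show False using one[of N] by linarith
qed

section \<open>Descent to the residue field of the localisation\<close>

locale localized_config =
 subspace_config K V \<O> Idx F \<alpha> \<beta> + localization K V \<O> S
 for K (structure) and V and \<O> and Idx :: "'i set" and F and \<alpha> \<beta> :: int and S

sublocale localized_config \<subseteq> loc: subspace_config K V OS Idx F \<alpha> \<beta>
proof (intro subspace_config.intro subspace_config_axioms.intro)
 show "fd_valued_space K V OS" by (rule loc.fd_valued_space_axioms)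
qed (use finite_Idx F_sub \<alpha>_pos \<beta>_nonneg determines_dim in auto)

context localized_config
begin

text \<open>A subspace defined over a ring extension of dimension \<open>length \<epsilon>s\<close> has, by filtering the
 extension, degree at most \<open>length \<epsilon>s\<close> times the maximum over the residue field.\<close>

lemma telescope:
 assumes M: "lattice M" and max: "\<And>X. loc.between (Mloc M) X \<Longrightarrow> loc.degO (Mloc M) X \<le> D"
 shows "\<lbrakk>\<forall>\<epsilon>\<in>set \<epsilon>s. \<forall>a. \<epsilon> a \<in> \<O>; PK.indep nullK \<epsilon>s; PV.sub G; nullV M \<subseteq> G; G \<subseteq> tens M (Mloc M) \<epsilon>s\<rbrakk> \<Longrightarrow>
  PV.fin (nullV M) G \<and> \<alpha> * (\<Sum>i\<in>Idx. int (PV.rk (nullV M) (G \<inter> tens M (Mloc M \<inter> F i) \<epsilon>s)))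
   - \<beta> * int (PV.rk (nullV M) G) \<le> D * int (length \<epsilon>s)"
proof (induction \<epsilon>s arbitrary: G)
 case Nil
 then have "G = nullV M" by simp
 then show ?case using PV.rk_self[OF nullV_sub[OF lattice_sub[OF M]]] by simp
next
 case (Cons \<epsilon> \<epsilon>s)
 note sM = lattice_sub[OF M]
 define A where "A = Mloc M"
 have L: "loc.Osub A" and lat: "loc.lattice A" using Mloc_sub[OF sM] Mloc_lattice[OF M] unfolding A_def by auto
 define mA where "mA = loc.mm A"
 have smA: "loc.Osub mA" "mA \<subseteq> A" using loc.mm_sub[OF L] unfolding mA_def by auto
 have eK: "\<forall>\<epsilon>\<in>set (\<epsilon> # \<epsilon>s). \<forall>a. \<epsilon> a \<in> carrier K" using Cons.prems(1) O_carrier by blast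
 have eK': "\<forall>\<epsilon>\<in>set \<epsilon>s. \<forall>a. \<epsilon> a \<in> carrier K" and \<epsilon>K: "\<epsilon> a \<in> carrier K" and \<epsilon>O: "\<epsilon> a \<in> \<O>" for a
  using eK Cons.prems(1) by auto
 have Ac: "x \<in> carrier V" if "x \<in> A" for x using loc.VO.sub_carrier[OF L that] .
 define h where "h x = (\<lambda>a. \<epsilon> a \<cdot> x)" for x
 have hc: "h x \<in> carrier (pw V)" if "x \<in> A" for x using Ac[OF that] \<epsilon>K unfolding h_def by simp
 have hadd: "h (x \<boxplus> y) = h x \<oplus>\<^bsub>pw V\<^esub> h y" if "x \<in> A" "y \<in> A" for x y
  using Ac that \<epsilon>K unfolding h_def by (simp add: smult_r_distr)
 have hsm: "h (r \<cdot> x) = r \<odot>\<^bsub>pw V\<^esub> h x" if "r \<in> carrier (K\<lparr>carrier := OS\<rparr>)" "x \<in> A" for r x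
  using Ac that \<epsilon>K loc.O_carrier unfolding h_def by (simp add: smult_assoc1[symmetric] R.m_comm)
 define P where "P = tens M A \<epsilon>s"
 have P: "PV.sub P" "nullV M \<subseteq> P" using tens_sub[OF sM L eK'] unfolding P_def by auto
 have hnull: "h x \<in> nullV M" if x: "x \<in> mA" for x
 proof -
  obtain c y where cy: "c \<in> \<O> - S" "y \<in> M" "x = c \<cdot> y" using x unfolding mA_def A_def loc_mm(1)[OF sM] by blast
  have "c \<in> loc.m" using cy(1) loc_m by simp
  then have "(\<lambda>a. c \<cdot> (\<epsilon> a \<cdot> y)) \<in> nullV M"
   using null_mult_prime(1)[OF _ sM, of c "\<lambda>a. \<epsilon> a \<cdot> y"] Osub_smult[OF sM \<epsilon>O cy(2)] VO.sub_carrier[OF sM] by blast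
  moreover have "h x = (\<lambda>a. c \<cdot> (\<epsilon> a \<cdot> y))"
   unfolding h_def cy(3) using \<epsilon>K O_carrier cy(1) VO.sub_carrier[OF sM cy(2)] by (simp add: smult_assoc1[symmetric] R.m_comm)
  ultimately show ?thesis by simp
 qed
 have hP: "h x \<in> P \<longleftrightarrow> x \<in> mA" if x: "x \<in> A" for x
  using tens_kernel[OF M eK, of x] Cons.prems(2) x hnull P(2) unfolding h_def P_def A_def mA_def by auto
 note G = Cons.prems(3,4)
 have GA: "G \<subseteq> P <+>\<^bsub>pw V\<^esub> h ` A" using Cons.prems(5) unfolding P_def A_def h_def by simp
 define GP where "GP = G <+>\<^bsub>pw V\<^esub> P"
 have GP: "PV.sub GP" "G \<subseteq> GP" "P \<subseteq> GP"
  using PV.sub_sum[OF G(1) P(1)] PV.sum_upper1[OF G(1) P(1)] PV.sum_upper2[OF G(1) P(1)] unfolding GP_def by auto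
 \<comment> \<open>X/mA is the space of coefficients of \<epsilon> that occur in G modulo the other
   \<epsilon>s. It is a subspace of the reduction at P, so \<open>max\<close> bounds its degree, and
   its dimension is that of G modulo G \<inter> \<open>P\<close>.\<close>
 define X where "X = {x \<in> A. h x \<in> GP}"
 have XA: "X \<subseteq> A" unfolding X_def by blast
 have mX: "mA \<subseteq> X" using hnull P(2) GP(3) smA(2) unfolding X_def by blast
 have sX: "loc.Osub X"
 proof (rule loc.OsubI)
  show "X \<subseteq> carrier V" using XA Ac by blast
  show "0\<^sub>V \<in> X" using mX loc.VO.sub_zero[OF smA(1)] by blast
  show "x \<boxplus> y \<in> X" if "x \<in> X" "y \<in> X" for x y
   using that hadd[of x y] loc.VO.sub_add[OF L, of x y] PV.sub_add[OF GP(1), of "h x" "h y"] unfolding X_def by auto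
  show "r \<cdot> x \<in> X" if "r \<in> OS" "x \<in> X" for r x
   using that hsm[of r x] loc.Osub_smult[OF L, of r x] PV.sub_smult[OF GP(1), of r "h x"] unfolding X_def by auto
 qed
 have bX: "loc.between A X" unfolding loc.between_def using sX mX XA unfolding mA_def by blast
 have mem_X: "x \<in> X" if g: "g \<in> G" "p \<in> P" "x \<in> A" "g = p \<oplus>\<^bsub>pw V\<^esub> h x" for g p x
 proof -
  have "h x \<in> GP"
  proof (rule PV.sub_cancel[OF GP(1)])
   show "p \<oplus>\<^bsub>pw V\<^esub> h x \<in> GP" "p \<in> GP" using g GP by auto
   show "h x \<in> carrier (pw V)" using hc[OF g(3)] .
  qed
  then show ?thesis using g(3) unfolding X_def by blast
 qed
 have dmP: "PV.dm P (loc.VO.rk (mA \<inter> Y) Y) (P <+>\<^bsub>pw V\<^esub> h ` Y)" if Y: "loc.VO.fin (mA \<inter> Y) Y" "Y \<subseteq> A" for Y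
 proof (rule rk_map[where \<kappa> = id and Z = "mA \<inter> Y", OF loc.VO.local_module_axioms PV.local_module_axioms])
  show "loc.VO.dm (mA \<inter> Y) (loc.VO.rk (mA \<inter> Y) Y) Y" using loc.VO.dm_rk[OF Y(1)] .
  show "PV.sub P" by (rule P(1))
  show "(h x \<in> P) = (x \<in> mA \<inter> Y)" if "x \<in> Y" for x using hP that Y(2) by blast
  show "h x \<in> carrier (pw V)" if "x \<in> Y" for x using hc that Y(2) by blast
  show "h (x \<boxplus> y) = h x \<oplus>\<^bsub>pw V\<^esub> h y" if "x \<in> Y" "y \<in> Y" for x y using hadd that Y(2) by blast
  show "h (r \<cdot> x) = id r \<odot>\<^bsub>pw V\<^esub> h x" if "r \<in> carrier (K\<lparr>carrier := OS\<rparr>)" "x \<in> Y" for r x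
   using hsm[OF that(1)] that(2) Y(2) by auto
 qed auto
 have imX: "PV.sub (h ` X)" using family_sub[OF sX, of \<epsilon>] \<epsilon>K unfolding h_def by simp
 have GPX: "GP = P <+>\<^bsub>pw V\<^esub> h ` X"
 proof
  have s: "PV.sub (P <+>\<^bsub>pw V\<^esub> h ` X)" using PV.sub_sum[OF P(1) imX] .
  have "G \<subseteq> P <+>\<^bsub>pw V\<^esub> h ` X"
  proof
   fix g assume g: "g \<in> G"
   then obtain p x where px: "p \<in> P" "x \<in> A" "g = p \<oplus>\<^bsub>pw V\<^esub> h x" using GA unfolding PV.mem_sum by (auto simp: subset_iff PV.mem_sum)
   then have "x \<in> X" using mem_X g by blast
   then show "g \<in> P <+>\<^bsub>pw V\<^esub> h ` X" unfolding px(3) using px(1) by (intro PV.sumI) auto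
  qed
  then show "GP \<subseteq> P <+>\<^bsub>pw V\<^esub> h ` X" unfolding GP_def by (rule PV.sum_least[OF s _ PV.sum_upper1[OF P(1) imX]])
  show "P <+>\<^bsub>pw V\<^esub> h ` X \<subseteq> GP" by (rule PV.sum_least[OF GP(1,3)]) (auto simp: X_def)
 qed
 have fX: "loc.VO.fin mA X" using loc.between_fin(1)[OF lat bX] unfolding mA_def .
 have mAX: "mA \<inter> X = mA" using mX by blast
 have dX: "PV.dm P (loc.VO.rk mA X) GP" using dmP[of X] fX XA unfolding mAX GPX by blast
 define G0 where "G0 = G \<inter> P"
 have G0: "PV.sub G0" "nullV M \<subseteq> G0" "G0 \<subseteq> P" using PV.sub_Int[OF G(1) P(1)] G P unfolding G0_def by auto
 have IH: "PV.fin (nullV M) G0"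
  "\<alpha> * (\<Sum>i\<in>Idx. int (PV.rk (nullV M) (G0 \<inter> tens M (A \<inter> F i) \<epsilon>s))) - \<beta> * int (PV.rk (nullV M) G0) \<le> D * int (length \<epsilon>s)"
  using Cons.IH[OF _ _ G0(1,2)] Cons.prems(1,2) G0(3) unfolding P_def A_def by auto
 note iso = PV.second_iso[OF G(1) P(1) disjI2[OF PV.dm_fin[OF dX[unfolded GP_def]]]]
 note tr = PV.rk_trans[OF IH(1) iso(1)[folded G0_def]]
 have finG: "PV.fin (nullV M) G" by (rule tr(1))
 have rkG: "PV.rk (nullV M) G = PV.rk (nullV M) G0 + loc.VO.rk mA X"
  using tr(2) iso(3) PV.rk_eq[OF dX] unfolding G0_def GP_def by simp
 \<comment> \<open>An upper bound is enough: a member of G with coefficients in \<open>F i\<close>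
   has its \<epsilon>-coefficient in X \<inter> \<open>F i\<close>, but not every vector of X
   \<inter> \<open>F i\<close> needs to arise in this way.\<close>
 have le: "PV.rk (nullV M) (G \<inter> tens M (A \<inter> F i) (\<epsilon> # \<epsilon>s))
   \<le> PV.rk (nullV M) (G0 \<inter> tens M (A \<inter> F i) \<epsilon>s) + loc.VO.rk (mA \<inter> F i) (X \<inter> F i)" if i: "i \<in> Idx" for i
 proof -
  note Fi = loc.sub_Osub[OF F_sub[OF i]]
  have AF: "loc.Osub (A \<inter> F i)" using loc.VO.sub_Int[OF L Fi] .
  define T where "T = tens M (A \<inter> F i) \<epsilon>s"
  have T: "PV.sub T" "nullV M \<subseteq> T" "T \<subseteq> P"
   using tens_sub[OF sM AF eK'] tens_mono[of "A \<inter> F i" A M \<epsilon>s] unfolding T_def P_def by auto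
  have imF: "PV.sub (h ` (A \<inter> F i))" using family_sub[OF AF, of \<epsilon>] \<epsilon>K unfolding h_def by simp
  have T': "tens M (A \<inter> F i) (\<epsilon> # \<epsilon>s) = T <+>\<^bsub>pw V\<^esub> h ` (A \<inter> F i)" unfolding T_def h_def by simp
  define Gi where "Gi = G \<inter> (T <+>\<^bsub>pw V\<^esub> h ` (A \<inter> F i))"
  have Gi: "PV.sub Gi" "nullV M \<subseteq> Gi" "Gi \<subseteq> G"
   using PV.sub_Int[OF G(1) PV.sub_sum[OF T(1) imF]] PV.sum_upper1[OF T(1) imF] T(2) G(2) unfolding Gi_def by auto
  have GiP: "Gi \<inter> P = G0 \<inter> T"
  proof (intro equalityI subsetI)
   fix g assume "g \<in> G0 \<inter> T"
   then show "g \<in> Gi \<inter> P" using PV.sum_upper1[OF T(1) imF] unfolding G0_def Gi_def by blast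
  next
   fix g assume g: "g \<in> Gi \<inter> P"
   then obtain t x where tx: "t \<in> T" "x \<in> A \<inter> F i" "g = t \<oplus>\<^bsub>pw V\<^esub> h x" unfolding Gi_def PV.mem_sum by (auto simp: PV.mem_sum)
   \<comment> \<open>If the \<epsilon>-term already lies in \<open>P\<close>, its coefficient is in
     mA and the term is null; so no \<open>F i\<close>-structure is lost on the smaller
     list.\<close>
   have "h x \<in> P"
   proof (rule PV.sub_cancel[OF P(1)])
    show "t \<oplus>\<^bsub>pw V\<^esub> h x \<in> P" "t \<in> P" using g tx T(3) by auto
    show "h x \<in> carrier (pw V)" using hc tx(2) by blast
   qed
   then have "h x \<in> T" using hP hnull T(2) tx(2) by blast
   then have "g \<in> T" unfolding tx(3) using PV.sub_add[OF T(1) tx(1)] by blast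
   then show "g \<in> G0 \<inter> T" using g unfolding G0_def Gi_def by blast
  qed
  have sGiP: "PV.sub (Gi \<inter> P)" using PV.sub_Int[OF Gi(1) P(1)] .
  note f = PV.rk_between[OF finG Gi]
  have nGiP: "nullV M \<subseteq> Gi \<inter> P" using Gi(2) P(2) by blast
  note b = PV.rk_between[OF f(1) sGiP nGiP Int_lower1]
  note iso = PV.second_iso[OF Gi(1) P(1) disjI1[OF b(2)]]
  have bXF: "mA \<inter> (X \<inter> F i) = mA \<inter> F i" using mX by blast
  have "loc.VO.fin (mA \<inter> F i) (X \<inter> F i)" using loc.between_fin(2)[OF lat bX F_sub[OF i]] unfolding mA_def .
  then have d: "PV.dm P (loc.VO.rk (mA \<inter> F i) (X \<inter> F i)) (P <+>\<^bsub>pw V\<^esub> h ` (X \<inter> F i))"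
   using dmP[of "X \<inter> F i"] XA unfolding bXF by blast
  have imXF: "PV.sub (h ` (X \<inter> F i))" using family_sub[OF loc.VO.sub_Int[OF sX Fi], of \<epsilon>] \<epsilon>K unfolding h_def by simp
  have "Gi \<subseteq> P <+>\<^bsub>pw V\<^esub> h ` (X \<inter> F i)"
  proof
   fix g assume g: "g \<in> Gi"
   then obtain t x where tx: "t \<in> T" "x \<in> A \<inter> F i" "g = t \<oplus>\<^bsub>pw V\<^esub> h x" unfolding Gi_def PV.mem_sum by (auto simp: PV.mem_sum)
   then have "x \<in> X" using mem_X[of g t x] g Gi(3) T(3) by blast
   then show "g \<in> P <+>\<^bsub>pw V\<^esub> h ` (X \<inter> F i)" unfolding tx(3) using tx T(3) by (intro PV.sumI) auto
  qed
  then have "Gi <+>\<^bsub>pw V\<^esub> P \<subseteq> P <+>\<^bsub>pw V\<^esub> h ` (X \<inter> F i)"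
   using PV.sum_least[OF PV.sub_sum[OF P(1) imXF] _ PV.sum_upper1[OF P(1) imXF]] by blast
  then have "PV.rk P (Gi <+>\<^bsub>pw V\<^esub> P) \<le> loc.VO.rk (mA \<inter> F i) (X \<inter> F i)"
   using PV.rk_mono[OF PV.dm_fin[OF d] PV.sub_sum[OF Gi(1) P(1)] PV.sum_upper2[OF Gi(1) P(1)]] PV.rk_eq[OF d] by simp
  then show ?thesis using b(3) iso(3) GiP unfolding T' Gi_def[symmetric] T_def[symmetric] by simp
 qed
 let ?s = "\<Sum>i\<in>Idx. int (PV.rk (nullV M) (G0 \<inter> tens M (A \<inter> F i) \<epsilon>s))"
 let ?t = "\<Sum>i\<in>Idx. int (loc.VO.rk (mA \<inter> F i) (X \<inter> F i))"
 have "(\<Sum>i\<in>Idx. int (PV.rk (nullV M) (G \<inter> tens M (A \<inter> F i) (\<epsilon> # \<epsilon>s)))) \<le> ?s + ?t"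
  unfolding sum.distrib[symmetric] of_nat_add[symmetric]
  by (rule ordered_comm_monoid_add_class.sum_mono) (simp only: of_nat_le_iff le)
 then have 1: "\<alpha> * (\<Sum>i\<in>Idx. int (PV.rk (nullV M) (G \<inter> tens M (A \<inter> F i) (\<epsilon> # \<epsilon>s)))) \<le> \<alpha> * ?s + \<alpha> * ?t"
  using \<alpha>_pos unfolding distrib_left[symmetric] by simp
 have "\<alpha> * ?t - \<beta> * int (loc.VO.rk mA X) \<le> D" using max[of X] bX unfolding loc.degO_def A_def mA_def by simp
 then show ?case using 1 IH(2) finG unfolding rkG A_def by (simp add: distrib_left)
qed

text \<open>Let \<open>E cs N\<close> be the span of the monomials of degree at most \<open>N\<close> in each of the finitely many
 coefficients \<open>cs\<close> of the lifts. If all degrees were less than \<open>D\<close>, then its dimension would grow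
 exponentially in \<open>N\<close>.\<close>

theorem growth:
 assumes M: "lattice M" and W: "between M W" and pos: "0 < degO M W"
  and S: "\<And>a. a \<in> S \<Longrightarrow> \<exists>Y. sub Y \<and> (M \<inter> Y) \<uplus> mm M = W \<and> adm M Y a"
 shows "\<exists>X. loc.between (Mloc M) X \<and> degO M W \<le> loc.degO (Mloc M) X"
proof (rule ccontr)
 assume neg: "\<not> (\<exists>X. loc.between (Mloc M) X \<and> degO M W \<le> loc.degO (Mloc M) X)"
 then have max: "loc.degO (Mloc M) X \<le> degO M W - 1" if "loc.between (Mloc M) X" for X using that by force
 note sM = lattice_sub[OF M]
 note smM = mm_sub[OF sM]
 have Ws: "Osub W" "mm M \<subseteq> W" "W \<subseteq> M" using W unfolding between_def by auto
 define s where "s = VO.rk (mm M) W"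
 define r where "r i = VO.rk (mm M \<inter> F i) (W \<inter> F i)" for i
 have D: "degO M W = \<alpha> * (\<Sum>i\<in>Idx. int (r i)) - \<beta> * int s" unfolding degO_def r_def s_def ..
 obtain a0 where a0: "a0 \<in> S" "a0 \<in> m" using S_m by blast
 have "\<exists>es xs. length es = s \<and> set es \<subseteq> M \<and> (\<forall>i\<in>Idx. length (xs i) = r i \<and> set (xs i) \<subseteq> M \<inter> F i
   \<and> VO.indep (mm M) (xs i) \<and> set (xs i) \<subseteq> VO.ext (scale a M) es)" if a: "a \<in> S" for a
 proof -
  \<comment> \<open>The factor \<open>a0\<close> from m keeps bM inside mM even when a is a unit,
    and a lift modulo b is also one modulo a.\<close>
  define b where "b = a \<otimes> a0"
  have b: "b \<in> S" "b \<in> m" using S_mult[OF a a0(1)] m_mult[OF _ a0(2), of a] a S_O unfolding b_def by auto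
  have aK: "a \<in> carrier K" "b \<in> carrier K" "a0 \<in> \<O>" using S_carrier a b a0 S_O by auto
  obtain Y where Y: "sub Y" "(M \<inter> Y) \<uplus> mm M = W" "adm M Y b" using S[OF b(1)] by blast
  have sY: "Osub (M \<inter> Y)" using VO.sub_Int[OF sM sub_Osub[OF Y(1)]] .
  obtain es where es: "length es = dimK Y" "set es \<subseteq> M \<inter> Y" "M \<inter> Y = Ospan es" using lattice_basis[OF M Y(1)] by blast
  have les: "length es = s" using reduction_between(2)[OF M Y(1)] es(1) unfolding Y(2) s_def by simp
  define N where "N = (M \<inter> Y) \<uplus> scale b M"
  have sb: "Osub (scale b M)" "Osub (scale a M)" using scale_sub[OF sM] aK by auto
  have N: "Osub N" unfolding N_def using VO.sub_sum[OF sY sb(1)] .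
  have "N \<subseteq> W" unfolding N_def Y(2)[symmetric] by (rule VO.sum_mono[OF subset_refl scale_m[OF b(2)]])
  have "scale b M \<subseteq> scale a M" using scale_dvd[OF sM aK(1,3)] R.m_comm[OF aK(1) S_carrier[OF a0(1)]] unfolding b_def by simp
  then have "N \<subseteq> (M \<inter> Y) \<uplus> scale a M" unfolding N_def by (intro VO.sum_mono) auto
  also have "\<dots> = VO.ext (scale a M) es"
  proof -
   have "set es \<subseteq> carrier V" using es(2) VO.sub_subset[OF sM] by blast
   then show ?thesis using VO.ext_sum[OF VO.sub_zero_set sb(2), of es] VO.sum_absorb2[OF VO.sub_zero_set sb(2)]
    VO.sub_zero[OF sb(2)] unfolding es(3) by simp
  qed
  finally have Nes: "N \<subseteq> VO.ext (scale a M) es" .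
  have "\<exists>xs. length xs = r i \<and> set xs \<subseteq> M \<inter> F i \<and> VO.indep (mm M) xs \<and> set xs \<subseteq> VO.ext (scale a M) es" if i: "i \<in> Idx" for i
  proof -
   note FO = sub_Osub[OF F_sub[OF i]]
   have "W \<inter> F i \<subseteq> (F i \<inter> N) \<uplus> mm M" using Y(3) i unfolding adm_def Y(2) N_def by blast
   then have WF: "W \<inter> F i = (N \<inter> F i) \<uplus> (mm M \<inter> F i)"
    using reduction_Int[OF M F_sub[OF i] N \<open>N \<subseteq> W\<close> Ws(2,1)] by blast
   have FN: "Osub (N \<inter> F i)" "N \<inter> F i \<subseteq> W \<inter> F i" using VO.sub_Int[OF N FO] \<open>N \<subseteq> W\<close> by auto
   have FM: "Osub (mm M \<inter> F i)" using VO.sub_Int[OF smM(1) FO] .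
   have "W \<inter> F i \<subseteq> (mm M \<inter> F i) \<uplus> (N \<inter> F i)" unfolding WF using VO.sum_comm[OF FN(1) FM] by simp
   then obtain xs where xs: "length xs = r i" "set xs \<subseteq> N \<inter> F i" "VO.indep (mm M \<inter> F i) xs"
    using VO.dm_gens_in[OF VO.dm_rk[OF between_fin(2)[OF M W F_sub[OF i]]] FN] unfolding r_def by blast
   then show ?thesis using VO.indep_Int[OF smM(1) FO _ xs(3)] Nes \<open>N \<subseteq> W\<close> Ws(3) by (intro exI[of _ xs]) auto
  qed
  then have "\<exists>xs. \<forall>i\<in>Idx. length (xs i) = r i \<and> set (xs i) \<subseteq> M \<inter> F i \<and> VO.indep (mm M) (xs i) \<and> set (xs i) \<subseteq> VO.ext (scale a M) es"
   by (intro bchoice) blast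
  then show ?thesis using les es(2) by blast
 qed
 then obtain es xs where esxs: "\<And>a. a \<in> S \<Longrightarrow> length (es a) = s \<and> set (es a) \<subseteq> M \<and> (\<forall>i\<in>Idx. length (xs a i) = r i \<and> set (xs a i) \<subseteq> M \<inter> F i
   \<and> VO.indep (mm M) (xs a i) \<and> set (xs a i) \<subseteq> VO.ext (scale a M) (es a))" by metis
 have es: "length (es a) = s" "set (es a) \<subseteq> M" if "a \<in> S" for a using esxs[OF that] by auto
 have xs: "length (xs a i) = r i" "set (xs a i) \<subseteq> M \<inter> F i" "VO.indep (mm M) (xs a i)" "set (xs a i) \<subseteq> VO.ext (scale a M) (es a)"
  if "a \<in> S" "i \<in> Idx" for a i using esxs[OF that(1)] that(2) by auto
 \<comment> \<open>The l-th entries of the lists chosen at the various a become one family. Its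
   value 0 outside S keeps it in V; integrality and nullity are tested on S only.\<close>
 define fam where "fam k ls = map (\<lambda>l a. if a \<in> S then ls a ! l else 0\<^sub>V) [0..<k]" for k and ls :: "'a \<Rightarrow> 'c list"
 have fam_at: "map (\<lambda>f. f a) (fam k ls) = ls a" if "a \<in> S" "length (ls a) = k" for a k ls
  using that map_nth[of "ls a"] unfolding fam_def by (simp add: o_def)
 have fam_out: "f a = 0\<^sub>V" if "f \<in> set (fam k ls)" "a \<notin> S" for f a k ls using that unfolding fam_def by auto
 have fam_in: "f a \<in> set (ls a)" if "f \<in> set (fam k ls)" "a \<in> S" "length (ls a) = k" for f a k ls using that unfolding fam_def by auto
 have fam_bdd: "\<forall>f\<in>set (fam k ls). bdd M f" if "\<And>a. a \<in> S \<Longrightarrow> length (ls a) = k \<and> set (ls a) \<subseteq> M" for k ls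
 proof
  fix f assume f: "f \<in> set (fam k ls)"
  have "f a \<in> M" if "a \<in> S" for a using fam_in[OF f that] \<open>a \<in> S \<Longrightarrow> length (ls a) = k \<and> set (ls a) \<subseteq> M\<close> that by blast
  moreover have "f a \<in> carrier V" for a using calculation[of a] fam_out[OF f, of a] VO.sub_carrier[OF sM] by (cases "a \<in> S") auto
  ultimately show "bdd M f" unfolding bdd_def by blast
 qed
 define ws where "ws = fam s es"
 define X where "X i = fam (r i) (\<lambda>a. xs a i)" for i
 have ws: "\<forall>f\<in>set ws. bdd M f" "length ws = s" using fam_bdd[of es s] es unfolding ws_def by (auto simp: fam_def)
 have X: "\<forall>f\<in>set (X i). bdd M f" "length (X i) = r i" if i: "i \<in> Idx" for i
  using fam_bdd[of "\<lambda>a. xs a i" "r i"] xs[OF _ i] unfolding X_def by (auto simp: fam_def)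
 obtain bs where bs: "set bs \<subseteq> M" "M = Ospan bs" using lattice_basis_carrier[OF M] by blast
 have "\<exists>ef. set ef \<subseteq> M \<inter> F i \<and> M \<inter> F i = Ospan ef" if "i \<in> Idx" for i
  using lattice_basis[OF M F_sub[OF that]] by blast
 then obtain bF where bF: "\<And>i. i \<in> Idx \<Longrightarrow> set (bF i) \<subseteq> M \<inter> F i \<and> M \<inter> F i = Ospan (bF i)" by metis
 have con: "\<forall>f\<in>set (map (\<lambda>b (_::'a). b) cs). bdd M f" if "set cs \<subseteq> M" for cs
  using that VO.sub_carrier[OF sM] unfolding bdd_def by auto
 have con_at: "map (\<lambda>f. f a) (map (\<lambda>b (_::'a). b) cs) = cs" for a and cs :: "'c list" by (simp add: o_def)
 have ext_le: "Ospan cs \<subseteq> VO.ext (scale a M) cs" if "a \<in> S" for a cs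
  using VO.ext_mono VO.sub_zero[OF scale_sub[OF sM S_carrier[OF that]]] by simp
 \<comment> \<open>Three sets of coefficients are collected: for the basis \<open>ws\<close> of the
   lifts over constant basis vectors of M, for the lifts in \<open>F i\<close> over
   \<open>ws\<close>, and for the latter over constant basis vectors of M \<inter>
   \<open>F i\<close>.\<close>
 obtain c0 where c0: "\<forall>c\<in>set c0. \<forall>a. c a \<in> \<O>" "expressible M c0 ws (map (\<lambda>b _. b) bs)"
 proof -
  have "x a \<in> VO.ext (scale a M) (map (\<lambda>f. f a) (map (\<lambda>b _. b) bs))" if "a \<in> S" "x \<in> set ws" for a x
   using fam_in[of x s es a] that es[OF that(1)] ext_le[OF that(1), of bs] bs(2) unfolding con_at ws_def by blast
  moreover have "x a = 0\<^sub>V" if "a \<notin> S" "x \<in> set ws" for a x using fam_out that unfolding ws_def by blast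
  ultimately show ?thesis using expressible_list[OF sM con[OF bs(1)], of ws] that by blast
 qed
 have "\<exists>cs. (\<forall>c\<in>set cs. \<forall>a. c a \<in> \<O>) \<and> expressible M cs (X i) ws" if i: "i \<in> Idx" for i
 proof -
  have "x a \<in> VO.ext (scale a M) (map (\<lambda>f. f a) ws)" if "a \<in> S" "x \<in> set (X i)" for a x
   using fam_in[of x "r i" "\<lambda>a. xs a i" a] that xs[OF that(1) i] fam_at[of a es s] es[OF that(1)] unfolding X_def ws_def by auto
  moreover have "x a = 0\<^sub>V" if "a \<notin> S" "x \<in> set (X i)" for a x using fam_out that unfolding X_def by blast
  ultimately show ?thesis using expressible_list[OF sM ws(1), of "X i"] by blast
 qed
 then obtain c1 where c1: "\<And>i. i \<in> Idx \<Longrightarrow> (\<forall>c\<in>set (c1 i). \<forall>a. c a \<in> \<O>) \<and> expressible M (c1 i) (X i) ws" by metis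
 have "\<exists>cs. (\<forall>c\<in>set cs. \<forall>a. c a \<in> \<O>) \<and> expressible M cs (X i) (map (\<lambda>b _. b) (bF i))" if i: "i \<in> Idx" for i
 proof -
  have c: "\<forall>f\<in>set (map (\<lambda>b (_::'a). b) (bF i)). bdd M f" by (rule con) (use bF[OF i] in blast)
  have "x a \<in> VO.ext (scale a M) (map (\<lambda>f. f a) (map (\<lambda>b _. b) (bF i)))" if "a \<in> S" "x \<in> set (X i)" for a x
   using fam_in[of x "r i" "\<lambda>a. xs a i" a] that xs(1,2)[OF that(1) i] bF[OF i] ext_le[OF that(1), of "bF i"]
   unfolding con_at X_def by blast
  moreover have "x a = 0\<^sub>V" if "a \<notin> S" "x \<in> set (X i)" for a x using fam_out that unfolding X_def by blast
  ultimately show ?thesis using expressible_list[OF sM c, of "X i"] by blast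
 qed
 then obtain c2 where c2: "\<And>i. i \<in> Idx \<Longrightarrow> (\<forall>c\<in>set (c2 i). \<forall>a. c a \<in> \<O>) \<and> expressible M (c2 i) (X i) (map (\<lambda>b _. b) (bF i))" by metis
 obtain js where js: "set js = Idx" using finite_list[OF finite_Idx] by blast
 define cs where "cs = c0 @ concat (map c1 js) @ concat (map c2 js)"
 have cs: "\<forall>c\<in>set cs. \<forall>a. c a \<in> \<O>" "set c0 \<subseteq> set cs" using c0(1) c1 c2 js unfolding cs_def by auto
 have cs12: "set (c1 i) \<subseteq> set cs" "set (c2 i) \<subseteq> set cs" if "i \<in> Idx" for i using that js unfolding cs_def by auto
 define e where "e N = PK.rk nullK (E cs N)" for N
 note Ep = E_props[OF cs(1)]
 define R where "R = \<alpha> * (\<Sum>i\<in>Idx. int (r i))"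
 \<comment> \<open>Let U be the combinations of \<open>ws\<close> with coefficients in
   \<open>E cs (Suc N)\<close>. Its dimension is at most s e(N + 1), it meets \<open>F i\<close> in
   dimension at least r i e(N), and it lives over \<open>E cs (Suc (Suc N))\<close>. If all degrees
   at P were at most deg W - 1, \<open>telescope\<close> would compare these three numbers.\<close>
 have step: "R * int (e N) \<le> (R - 1) * int (e (Suc (Suc N)))" for N
 proof -
  let ?N = "Suc (Suc N)"
  note bc = box_carrier[OF cs(1), of ?N]
  obtain \<epsilon>s where \<epsilon>s: "set \<epsilon>s \<subseteq> set (box cs ?N)" "PK.indep nullK \<epsilon>s" "PK.ext nullK \<epsilon>s = E cs ?N"
   using PK.indep_sublist[OF nullK_sub bc] unfolding E_def by blast
  have \<epsilon>O: "\<forall>\<epsilon>\<in>set \<epsilon>s. \<forall>a. \<epsilon> a \<in> \<O>" using \<epsilon>s(1) box_O[OF cs(1)] by blast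
  have \<epsilon>c: "set \<epsilon>s \<subseteq> carrier (pw KM)" using \<epsilon>s(1) bc by blast
  have "r' \<odot>\<^bsub>pw KM\<^esub> x \<in> nullK" if "x \<in> set \<epsilon>s" "r' \<in> loc.m" for x r'
   using null_mult_prime(2)[OF that(2), of x] \<epsilon>O that(1) by simp
  then have len: "length \<epsilon>s = e ?N" using PK.rk_eq[OF PK.indep_dm[OF nullK_sub \<epsilon>c \<epsilon>s(2)]] unfolding e_def \<epsilon>s(3) by simp
  define U where "U = comb M (E cs (Suc N)) ws"
  have sE: "PK.sub (E cs N)" for N using PK.fin_subs[OF Ep(1)] by blast
  note U = comb_sub[OF sM sE[of "Suc N"] ws(1), folded U_def]
  have "U \<subseteq> comb M (E cs ?N) (map (\<lambda>b _. b) bs)"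
   unfolding U_def by (rule comb_expressible[OF sM ws(1) con[OF bs(1)] cs(1) c0(2) cs(2)])
  also have "\<dots> \<subseteq> tens M (Mloc M) \<epsilon>s" unfolding \<epsilon>s(3)[symmetric]
   by (rule comb_tens[OF sM Mloc_sub[OF sM] \<epsilon>c _ bs(1)]) (use bs(1) Mloc_upper[OF sM] in blast)
  finally have UT: "U \<subseteq> tens M (Mloc M) \<epsilon>s" .
  note T = telescope[OF M max \<epsilon>O \<epsilon>s(2) U(1,2) UT]
  have low: "r i * e N \<le> PV.rk (nullV M) (U \<inter> tens M (Mloc M \<inter> F i) \<epsilon>s)" if i: "i \<in> Idx" for i
  proof -
   note Fi = loc.sub_Osub[OF F_sub[OF i]]
   define Vi where "Vi = comb M (E cs N) (X i)"
   have MF: "loc.Osub (Mloc M \<inter> F i)" using loc.VO.sub_Int[OF Mloc_sub[OF sM] Fi] .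
   \<comment> \<open>Independence of the lifts in \<open>F i\<close> modulo mM gives the exact
     dimension r i e(N) of their combinations, which is the lower bound.\<close>
   have "\<forall>a\<in>S. VO.indep (mm M) (map (\<lambda>f. f a) (X i))"
    using fam_at[of _ "\<lambda>a. xs a i" "r i"] xs[OF _ i] unfolding X_def by auto
   then have rkV: "PV.rk (nullV M) Vi = r i * e N"
    using comb_rk[OF M Ep(1) X(1)[OF i]] X(2)[OF i] unfolding e_def Vi_def by simp
   note sV = comb_sub[OF sM sE[of N] X(1)[OF i], folded Vi_def]
   have VU: "Vi \<subseteq> U" unfolding Vi_def U_def
    by (rule comb_expressible[OF sM X(1)[OF i] ws(1) cs(1) conjunct2[OF c1[OF i]] cs12(1)[OF i]])
   have bFM: "set (bF i) \<subseteq> M" using bF[OF i] by blast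
   have "Vi \<subseteq> comb M (E cs (Suc N)) (map (\<lambda>b _. b) (bF i))" unfolding Vi_def
    by (rule comb_expressible[OF sM X(1)[OF i] con[OF bFM] cs(1) conjunct2[OF c2[OF i]] cs12(2)[OF i]])
   also have "\<dots> \<subseteq> comb M (E cs ?N) (map (\<lambda>b _. b) (bF i))"
   proof -
    note G = comb_sub[OF sM sE[of ?N] con[OF bFM]]
    show ?thesis unfolding E_def[of cs "Suc N"]
    proof (rule comb_least[OF sM G(1,2) box_carrier[OF cs(1)] con[OF bFM]])
     fix g f assume gf: "g \<in> set (box cs (Suc N))" "f \<in> set (map (\<lambda>b (_::'a). b) (bF i))"
     have "g \<in> E cs ?N" using Ep(3)[of "Suc N"] Ep(4)[of "Suc N" ?N] gf(1) by auto
     then show "(\<lambda>a. g a \<cdot> f a) \<in> comb M (E cs ?N) (map (\<lambda>b _. b) (bF i))" using G(3)[OF gf(2)] by blast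
    qed
   qed
   also have "\<dots> \<subseteq> tens M (Mloc M \<inter> F i) \<epsilon>s" unfolding \<epsilon>s(3)[symmetric]
    by (rule comb_tens[OF sM MF \<epsilon>c _ bFM]) (use bF[OF i] Mloc_upper[OF sM] in blast)
   finally have VT: "Vi \<subseteq> U \<inter> tens M (Mloc M \<inter> F i) \<epsilon>s" using VU by blast
   have eK: "\<forall>\<epsilon>\<in>set \<epsilon>s. \<forall>a. \<epsilon> a \<in> carrier K" using \<epsilon>O O_carrier by blast
   note t = tens_sub[OF sM MF eK]
   have sUT: "PV.sub (U \<inter> tens M (Mloc M \<inter> F i) \<epsilon>s)" "nullV M \<subseteq> U \<inter> tens M (Mloc M \<inter> F i) \<epsilon>s"
    using PV.sub_Int[OF U(1) t(1)] U(2) t(2) by auto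
   have "PV.fin (nullV M) (U \<inter> tens M (Mloc M \<inter> F i) \<epsilon>s)" using PV.rk_between(1)[OF conjunct1[OF T] sUT] by blast
   then show ?thesis using PV.rk_mono[OF _ sV(1,2) VT] rkV by simp
  qed
  have up: "PV.rk (nullV M) U \<le> s * e (Suc N)" using comb_rk[OF M Ep(1) ws(1)] ws(2) unfolding e_def U_def by simp
  have "(\<Sum>i\<in>Idx. int (r i)) * int (e N) \<le> (\<Sum>i\<in>Idx. int (PV.rk (nullV M) (U \<inter> tens M (Mloc M \<inter> F i) \<epsilon>s)))"
   unfolding sum_distrib_right of_nat_mult[symmetric]
   by (rule ordered_comm_monoid_add_class.sum_mono) (simp only: of_nat_le_iff low)
  then have "\<alpha> * ((\<Sum>i\<in>Idx. int (r i)) * int (e N)) \<le> \<alpha> * (\<Sum>i\<in>Idx. int (PV.rk (nullV M) (U \<inter> tens M (Mloc M \<inter> F i) \<epsilon>s)))"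
   using \<alpha>_pos by simp
  then have "R * int (e N) \<le> \<beta> * int (PV.rk (nullV M) U) + (degO M W - 1) * int (e ?N)"
   using conjunct2[OF T] unfolding len R_def by (simp add: mult.assoc)
  moreover have "\<beta> * int (PV.rk (nullV M) U) \<le> \<beta> * (int s * int (e ?N))"
  proof (rule mult_left_mono[OF _ \<beta>_nonneg])
   have "s * e (Suc N) \<le> s * e ?N" unfolding e_def by (intro mult_left_mono Ep(6)) auto
   then show "int (PV.rk (nullV M) U) \<le> int s * int (e ?N)"
    using order_trans[OF up] unfolding of_nat_mult[symmetric] of_nat_le_iff by blast
  qed
  \<comment> \<open>R is deg W + \<beta> s, so \<beta> s + (deg W - 1) is R - 1.\<close>
  ultimately show ?thesis using D unfolding R_def by (simp add: algebra_simps)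
 qed
 have "1 \<le> R" using pos D \<beta>_nonneg unfolding R_def
  by (smt (verit) mult_nonneg_nonneg of_nat_0_le_iff)
 moreover have "0 < e 0" "e N \<le> (N + 1) ^ length cs" for N using Ep(2,5) unfolding e_def by auto
 ultimately show False using polynomial_exponential_growth[of R e "length cs"] step by blast
qed

text \<open>X and each X \<inter> \<open>F i\<close> are lifted to subspaces Y of V and
  \<open>Yi i\<close> of \<open>F i\<close>. Reducing further, modulo m, can only enlarge the
  intersections with the \<open>F i\<close>, so the degree does not drop. If it does not grow
  either, the \<open>Yi i\<close> account for all of W \<inter> \<open>F i\<close>; as they lie in Y
  modulo P, so does a full set of generators, and Y is admissible modulo an element of P.\<close>

lemma descend:
 assumes M: "lattice M" and X: "loc.between (Mloc M) X"
 shows "\<exists>Y. sub Y \<and> (degO M ((M \<inter> Y) \<uplus> mm M) \<le> loc.degO (Mloc M) X \<longrightarrow>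
   degO M ((M \<inter> Y) \<uplus> mm M) = loc.degO (Mloc M) X \<and> (\<exists>c\<in>loc.m. adm M Y c))"
proof -
 note sM = lattice_sub[OF M]
 note smM = mm_sub[OF sM]
 define A where "A = Mloc M"
 have L: "loc.Osub A" and lat: "loc.lattice A" using Mloc_sub[OF sM] Mloc_lattice[OF M] unfolding A_def by auto
 have MA: "M \<subseteq> A" using Mloc_upper[OF sM] unfolding A_def .
 have Xs: "loc.Osub X" "loc.mm A \<subseteq> X" "X \<subseteq> A" using X unfolding loc.between_def A_def by auto
 have z: "{0\<^sub>V} \<subseteq> X" using loc.VO.sub_zero[OF Xs(1)] by blast
 obtain Y where Y: "sub Y" "(A \<inter> Y) \<uplus> loc.mm A = X" "dimK Y = loc.VO.rk (loc.mm A) X"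
  using loc.lift_subspace_carrier[OF lat sub_zero_set Xs(1) _ Xs(2,3)] z by blast
 have "\<exists>Yi. sub Yi \<and> Yi \<subseteq> F i \<and> (A \<inter> Yi) \<uplus> (loc.mm A \<inter> F i) = X \<inter> F i
   \<and> dimK Yi = loc.VO.rk (loc.mm A \<inter> F i) (X \<inter> F i)" if i: "i \<in> Idx" for i
 proof -
  note F = F_sub[OF i]
  have XF: "loc.Osub (X \<inter> F i)" using loc.VO.sub_Int[OF Xs(1) loc.sub_Osub[OF F]] .
  have zF: "{0\<^sub>V} \<subseteq> F i" using sub_zero[OF F] by blast
  have 1: "A \<inter> {0\<^sub>V} \<subseteq> X \<inter> F i" "loc.mm A \<inter> F i \<subseteq> X \<inter> F i" "X \<inter> F i \<subseteq> A \<inter> F i" using z zF Xs by auto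
  show ?thesis using loc.lift_subspace[OF lat F sub_zero_set zF XF 1] by blast
 qed
 then obtain Yi where Yi: "\<And>i. i \<in> Idx \<Longrightarrow> sub (Yi i) \<and> Yi i \<subseteq> F i \<and> (A \<inter> Yi i) \<uplus> (loc.mm A \<inter> F i) = X \<inter> F i
   \<and> dimK (Yi i) = loc.VO.rk (loc.mm A \<inter> F i) (X \<inter> F i)" by metis
 define W where "W = (M \<inter> Y) \<uplus> mm M"
 note bW = reduction_between[OF M Y(1), folded W_def]
 have W: "Osub W" "mm M \<subseteq> W" "W \<subseteq> M" using bW(1) unfolding between_def by auto
 have mAM: "loc.mm A \<subseteq> M" using loc_mm(2)[OF sM] smM(2) unfolding A_def by blast
 \<comment> \<open>x is y + n with y in Y and n in P times the localised lattice. The latter lies in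
   M, so y does as well, and n is c l with c in P and l in M.\<close>
 have c: "\<exists>c\<in>loc.m. x \<in> (M \<inter> Y) \<uplus> scale (\<one> \<otimes> c) M" if i: "i \<in> Idx" and x: "x \<in> M \<inter> Yi i" for i x
 proof -
  have "x \<in> A \<inter> Yi i" using x MA by blast
  moreover have "A \<inter> Yi i \<subseteq> (A \<inter> Yi i) \<uplus> (loc.mm A \<inter> F i)"
   by (rule loc.VO.sum_upper1[OF loc.VO.sub_Int[OF L loc.sub_Osub[OF conjunct1[OF Yi[OF i]]]]
      loc.VO.sub_Int[OF loc.mm_sub(1)[OF L] loc.sub_Osub[OF F_sub[OF i]]]])
  ultimately have "x \<in> X" using Yi[OF i] by blast
  then obtain y n where yn: "y \<in> A \<inter> Y" "n \<in> loc.mm A" "x = y \<boxplus> n" unfolding Y(2)[symmetric] mem_sum by blast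
  have "y \<in> M" using VO.sub_cancel'[OF sM, of y n] yn x mAM loc.VO.sub_carrier[OF L] by auto
  moreover obtain c l where cl: "c \<in> loc.m" "l \<in> M" "n = c \<cdot> l"
   using yn(2) unfolding A_def loc_mm(1)[OF sM] loc_m by blast
  ultimately have "x \<in> (M \<inter> Y) \<uplus> scale c M" unfolding yn(3) using yn(1) by (intro sumI) (auto intro: scaleI)
  then show ?thesis using cl(1) loc.m_carrier by auto
 qed
 have sub_le: "(M \<inter> Yi i) \<uplus> (mm M \<inter> F i) \<subseteq> W \<inter> F i" if i: "i \<in> Idx" for i
 proof (rule VO.sum_least[OF VO.sub_Int[OF W(1) sub_Osub[OF F_sub[OF i]]]])
  show "M \<inter> Yi i \<subseteq> W \<inter> F i"
  proof
   fix x assume x: "x \<in> M \<inter> Yi i"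
   then obtain c where c: "c \<in> loc.m" "x \<in> (M \<inter> Y) \<uplus> scale (\<one> \<otimes> c) M" using c i by blast
   have "scale (\<one> \<otimes> c) M \<subseteq> mm M"
    using c(1) loc_mm(2)[OF sM] loc.m_carrier unfolding loc_mm(1)[OF sM] loc_m scale_def by auto
   then have "(M \<inter> Y) \<uplus> scale (\<one> \<otimes> c) M \<subseteq> W" unfolding W_def by (intro VO.sum_mono) auto
   then show "x \<in> W \<inter> F i" using c(2) x Yi[OF i] by blast
  qed
  show "mm M \<inter> F i \<subseteq> W \<inter> F i" using W by blast
 qed
 note rr = rank_reduction[OF M conjunct1[OF Yi] F_sub conjunct1[OF conjunct2[OF Yi]]]
 have le: "dimK (Yi i) \<le> VO.rk (mm M \<inter> F i) (W \<inter> F i)" if i: "i \<in> Idx" for i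
  using VO.rk_mono[OF between_fin(2)[OF M bW(1) F_sub[OF i]] _ _ sub_le[OF i]] rr[OF i i i] VO.fin_subs by metis
 have degX: "loc.degO A X = \<alpha> * (\<Sum>i\<in>Idx. int (dimK (Yi i))) - \<beta> * int (dimK Y)"
  unfolding loc.degO_def Y(3) using Yi by simp
 have degW: "degO M W = \<alpha> * (\<Sum>i\<in>Idx. int (VO.rk (mm M \<inter> F i) (W \<inter> F i))) - \<beta> * int (dimK Y)"
  unfolding degO_def bW(2) ..
 have sum_le: "(\<Sum>i\<in>Idx. int (dimK (Yi i))) \<le> (\<Sum>i\<in>Idx. int (VO.rk (mm M \<inter> F i) (W \<inter> F i)))"
  by (rule ordered_comm_monoid_add_class.sum_mono) (simp only: of_nat_le_iff le)
 have "degO M W = loc.degO A X \<and> (\<exists>c\<in>loc.m. adm M Y c)" if asm: "degO M W \<le> loc.degO A X"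
 proof -
  have "\<alpha> * (\<Sum>i\<in>Idx. int (VO.rk (mm M \<inter> F i) (W \<inter> F i))) \<le> \<alpha> * (\<Sum>i\<in>Idx. int (dimK (Yi i)))"
   using asm unfolding degX degW by simp
  then have "(\<Sum>i\<in>Idx. int (VO.rk (mm M \<inter> F i) (W \<inter> F i))) \<le> (\<Sum>i\<in>Idx. int (dimK (Yi i)))" using \<alpha>_pos by simp
  with sum_le have e: "(\<Sum>i\<in>Idx. int (dimK (Yi i))) = (\<Sum>i\<in>Idx. int (VO.rk (mm M \<inter> F i) (W \<inter> F i)))" by simp
  \<comment> \<open>Termwise inequality and equality of the sums force equality in each
    \<open>F i\<close>.\<close>
  have rk_e: "VO.rk (mm M \<inter> F i) (W \<inter> F i) = dimK (Yi i)" if i: "i \<in> Idx" for i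
  proof (rule ccontr)
   assume "VO.rk (mm M \<inter> F i) (W \<inter> F i) \<noteq> dimK (Yi i)"
   then have "dimK (Yi i) < VO.rk (mm M \<inter> F i) (W \<inter> F i)" using le[OF i] by simp
   then have "(\<Sum>i\<in>Idx. int (dimK (Yi i))) < (\<Sum>i\<in>Idx. int (VO.rk (mm M \<inter> F i) (W \<inter> F i)))"
    using le i by (intro sum_strict_mono_ex1[OF finite_Idx]) (auto intro!: bexI[of _ i])
   then show False using e by simp
  qed
  have U: "Osub (M \<inter> Yi i) \<and> M \<inter> Yi i \<subseteq> W \<inter> F i \<and> W \<inter> F i \<subseteq> (mm M \<inter> F i) \<uplus> (M \<inter> Yi i)" if i: "i \<in> Idx" for i
  proof -
   have s: "Osub (M \<inter> Yi i)" "Osub (mm M \<inter> F i)"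
    using VO.sub_Int sM smM(1) sub_Osub[OF F_sub[OF i]] sub_Osub[of "Yi i"] Yi[OF i] by auto
   have "(M \<inter> Yi i) \<uplus> (mm M \<inter> F i) = W \<inter> F i"
    using VO.rk_eq_imp_eq[OF between_fin(2)[OF M bW(1) F_sub[OF i]] VO.sub_sum[OF s] VO.sum_upper2[OF s] sub_le[OF i]]
     rr(2)[OF i i i] rk_e[OF i] by simp
   then show ?thesis using s VO.sum_upper1[OF s] VO.sum_comm[OF s] by simp
  qed
  have "loc.m \<subseteq> carrier K" using loc.m_carrier by blast
  from adm_from_generators[OF M Y(1) R.one_closed _ _ this loc.zero_m, of "\<lambda>i. M \<inter> Yi i"]
  have "\<exists>c\<in>loc.m. adm M Y (\<one> \<otimes> c)" using U c unfolding W_def by blast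
  then have "\<exists>c\<in>loc.m. adm M Y c" using loc.m_carrier by auto
  moreover have "degO M W = loc.degO A X" unfolding degW degX e ..
  ultimately show ?thesis by blast
 qed
 then show ?thesis using Y(1) unfolding W_def A_def by blast
qed

end

section \<open>The least maximal degree vanishes\<close>

context subspace_config
begin

lemma degO_bounded:
 assumes M: "lattice M" and X: "between M X"
 shows "degO M X \<le> \<alpha> * (\<Sum>i\<in>Idx. int (dimK (F i)))"
proof -
 have "VO.rk (mm M \<inter> F i) (X \<inter> F i) \<le> dimK (F i)" if i: "i \<in> Idx" for i
 proof -
  have "Osub (X \<inter> F i)" using VO.sub_Int[OF _ sub_Osub[OF F_sub[OF i]]] X unfolding between_def by blast
  then show ?thesis
   using VO.rk_mono[OF lattice_finI[OF M F_sub[OF i]], of "X \<inter> F i"] lattice_rank[OF M F_sub[OF i]] X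
   unfolding between_def by auto
 qed
 then have "(\<Sum>i\<in>Idx. int (VO.rk (mm M \<inter> F i) (X \<inter> F i))) \<le> (\<Sum>i\<in>Idx. int (dimK (F i)))"
  by (intro ordered_comm_monoid_add_class.sum_mono) simp
 then have "\<alpha> * (\<Sum>i\<in>Idx. int (VO.rk (mm M \<inter> F i) (X \<inter> F i))) \<le> \<alpha> * (\<Sum>i\<in>Idx. int (dimK (F i)))" using \<alpha>_pos by simp
 moreover have "0 \<le> \<beta> * int (VO.rk (mm M) X)" using \<beta>_nonneg by simp
 ultimately show ?thesis unfolding degO_def by linarith
qed

theorem semistable_lattice:
 assumes ss: "\<And>Y. sub Y \<Longrightarrow> degK Y \<le> 0"
 shows "\<exists>M. lattice M \<and> (\<forall>X. between M X \<longrightarrow> degO M X \<le> 0)"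
proof -
 define P where "P n \<longleftrightarrow> (\<exists>M. lattice M \<and> (\<forall>X. between M X \<longrightarrow> degO M X \<le> int n))" for n
 obtain M0 where M0: "lattice M0" using lattice_exists by blast
 define B where "B = nat (\<alpha> * (\<Sum>i\<in>Idx. int (dimK (F i))))"
 have "degO M0 X \<le> int B" if "between M0 X" for X
  using degO_bounded[OF M0 that] unfolding B_def by linarith
 then have PB: "P B" unfolding P_def using M0 by blast
 define D where "D = (LEAST n. P n)"
 have "P D" unfolding D_def using PB by (rule LeastI)
 then obtain M where M: "lattice M" "\<And>X. between M X \<Longrightarrow> degO M X \<le> int D" unfolding P_def by blast
 show ?thesis
 proof (cases "D = 0")
  case True
  then show ?thesis using M by auto
 next
  case False
  \<comment> \<open>Minimality of D > 0 says that every lattice has a submodule of degree at least D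
    in its reduction, which is the hypothesis of Langton's step.\<close>
  then have "\<not> P (D - 1)" unfolding D_def by (intro not_less_Least) simp
  then have min: "\<exists>X. between L X \<and> int D \<le> degO L X" if "lattice L" for L
   using that False unfolding P_def by (force simp: of_nat_diff)
  then obtain W where W: "between M W" "int D \<le> degO M W" using M(1) by blast
  then have DW: "degO M W = int D" using M(2) by force
  have max: "degO M X \<le> degO M W" if "between M X" for X using M(2)[OF that] DW by simp
  have min': "\<exists>X. between L X \<and> degO M W \<le> degO L X" if "lattice L" for L using min[OF that] DW by simp
  have pos: "0 < degO M W" using DW False by simp
  define S where "S = liftable M W"
  have S: "\<zero> \<notin> S" "S \<inter> m \<noteq> {}" "\<And>r a. \<lbrakk>r \<in> \<O>; a \<in> \<O>; r \<otimes> a \<in> S\<rbrakk> \<Longrightarrow> a \<in> S" "\<And>a b. \<lbrakk>a \<in> S; b \<in> S\<rbrakk> \<Longrightarrow> a \<otimes> b \<in> S"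
   unfolding S_def by (rule liftable_multiplicative[OF M(1) W(1) max min' ss pos]; assumption)+
  interpret localized_config K V \<O> Idx F \<alpha> \<beta> S
  proof (intro localized_config.intro localization.intro localization_axioms.intro)
   show "S \<subseteq> \<O>" unfolding S_def liftable_def by blast
  qed (fact subspace_config_axioms fd_valued_space_axioms S)+
  have SY: "\<exists>Y. sub Y \<and> (M \<inter> Y) \<uplus> mm M = W \<and> adm M Y a" if "a \<in> S" for a
   using that unfolding S_def liftable_def by blast
  obtain X where X: "loc.between (Mloc M) X" "degO M W \<le> loc.degO (Mloc M) X"
   using growth[OF M(1) W(1) pos SY] by blast
  obtain Y where Y: "sub Y" "degO M ((M \<inter> Y) \<uplus> mm M) \<le> loc.degO (Mloc M) X \<longrightarrow>
   degO M ((M \<inter> Y) \<uplus> mm M) = loc.degO (Mloc M) X \<and> (\<exists>c\<in>loc.m. adm M Y c)"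
   using descend[OF M(1) X(1)] by blast
  note bY = reduction_between(1)[OF M(1) Y(1)]
  have "degO M ((M \<inter> Y) \<uplus> mm M) \<le> loc.degO (Mloc M) X" using max[OF bY] X(2) by simp
  then obtain c where c: "c \<in> loc.m" "adm M Y c" and e: "degO M ((M \<inter> Y) \<uplus> mm M) = loc.degO (Mloc M) X"
   using Y(2) by blast
  have "degO M ((M \<inter> Y) \<uplus> mm M) = int D" using e max[OF bY] X(2) DW by simp
  \<comment> \<open>Y was found through the localisation, with no reference to W; uniqueness of the
    maximiser identifies its reduction with W, which puts c into S although c lies in P.\<close>
  then have "(M \<inter> Y) \<uplus> mm M = W" using maximiser_unique[OF M(1) bY W(1) M(2) _ DW] by blast
  moreover have cO: "c \<in> \<O>" "c \<notin> S" using c(1) loc_m by auto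
  ultimately have "c \<in> S" using c(2) Y(1) unfolding S_def liftable_def by blast
  then show ?thesis using cO(2) by blast
 qed
qed

end

section \<open>Dimensions, weights and slopes\<close>

lemma (in vectorspace) local_module_zero: "local_module K V {\<zero>\<^bsub>K\<^esub>}"
proof (intro local_module.intro local_module_axioms.intro)
 show "module K V" by (rule module_axioms)
 show "\<exists>s\<in>carrier K. s \<otimes>\<^bsub>K\<^esub> r = \<one>\<^bsub>K\<^esub>" if "r \<in> carrier K" "r \<notin> {\<zero>\<^bsub>K\<^esub>}" for r
 proof
  have "r \<in> Units K" using that field_Units by simp
  then show "inv\<^bsub>K\<^esub> r \<otimes>\<^bsub>K\<^esub> r = \<one>\<^bsub>K\<^esub>" "inv\<^bsub>K\<^esub> r \<in> carrier K" by auto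
 qed
qed simp

lemma (in vectorspace) ext_eq_span:
 assumes "set xs \<subseteq> carrier V"
 shows "local_module.ext K V {\<zero>\<^bsub>V\<^esub>} xs = span (set xs)"
proof -
 interpret L: local_module K V "{\<zero>\<^bsub>K\<^esub>}" by (rule local_module_zero)
 note s = span_is_submodule[OF assms]
 show ?thesis
  using L.ext_least[OF s _ in_own_span[OF assms]] sub_zero[OF s]
   span_is_subset[OF L.ext_mem[OF sub_zero_set assms] L.ext_sub[OF sub_zero_set assms]] by auto
qed

text \<open>\<open>dim\<close> is the least size of a generating set. A finite generating set bounds
  the length by its size (\<open>gen\<close>), and a chain of length n yields at most n generators
  (\<open>ex\<close>).\<close>

lemma (in vectorspace) fin_dim_iff_fin: "fin_dim \<longleftrightarrow> local_module.fin K V {\<zero>\<^bsub>K\<^esub>} {\<zero>\<^bsub>V\<^esub>} (carrier V)"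
 and dim_eq: "local_module.dm K V {\<zero>\<^bsub>K\<^esub>} {\<zero>\<^bsub>V\<^esub>} n (carrier V) \<Longrightarrow> dim = n"
proof -
 interpret L: local_module K V "{\<zero>\<^bsub>K\<^esub>}" by (rule local_module_zero)
 have ann: "r \<odot>\<^bsub>V\<^esub> x \<in> {\<zero>\<^bsub>V\<^esub>}" if "x \<in> set xs" "set xs \<subseteq> carrier V" "r \<in> {\<zero>\<^bsub>K\<^esub>}" for x r xs using that by auto
 have gen: "L.fin {\<zero>\<^bsub>V\<^esub>} (carrier V) \<and> L.rk {\<zero>\<^bsub>V\<^esub>} (carrier V) \<le> card A"
  if A: "finite A" "A \<subseteq> carrier V" "gen_set A" for A
 proof -
  obtain ys where ys: "set ys = A" "distinct ys" using finite_distinct_list[OF A(1)] by blast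
  have yc: "set ys \<subseteq> carrier V" using ys A by simp
  have "L.ext {\<zero>\<^bsub>V\<^esub>} ys = carrier V" using ext_eq_span[OF yc] ys(1) A(3) by simp
  then show ?thesis using L.ext_dm[OF sub_zero_set yc ann[OF _ yc]] ys distinct_card by fastforce
 qed
 have ex: "\<exists>A. finite A \<and> card A \<le> n \<and> A \<subseteq> carrier V \<and> gen_set A" if dm: "L.dm {\<zero>\<^bsub>V\<^esub>} n (carrier V)" for n
 proof -
  obtain xs where "length xs = n" "set xs \<subseteq> carrier V" "L.ext {\<zero>\<^bsub>V\<^esub>} xs = carrier V" using L.dm_list[OF dm] by blast
  then show ?thesis using ext_eq_span[of xs] card_length[of xs] by (intro exI[of _ "set xs"]) auto
 qed
 show "fin_dim \<longleftrightarrow> L.fin {\<zero>\<^bsub>V\<^esub>} (carrier V)"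
  using gen ex L.dm_rk unfolding fin_dim_def by metis
 assume dm: "L.dm {\<zero>\<^bsub>V\<^esub>} n (carrier V)"
 have le: "n \<le> card A" if "finite A" "A \<subseteq> carrier V" "gen_set A" for A using gen[OF that] L.rk_eq[OF dm] by simp
 obtain A where A: "finite A" "card A \<le> n" "A \<subseteq> carrier V" "gen_set A" using ex[OF dm] by blast
 then have "card A = n" using le[of A] by simp
 then show "dim = n" unfolding dim_def using A le by (intro Least_equality) auto
qed

text \<open>The bridge from lengths to the dimensions of the quotient and subspace records: such a
  space is given through a surjection h with known kernel, possibly semilinear.\<close>

lemma dim_eq_rk:
 assumes "local_module R M I" "vectorspace F Q"
  and "\<kappa> ` carrier R = carrier F" "\<kappa> ` I = {\<zero>\<^bsub>F\<^esub>}"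
  and h: "\<And>x y. \<lbrakk>x \<in> X; y \<in> X\<rbrakk> \<Longrightarrow> h (x \<oplus>\<^bsub>M\<^esub> y) = h x \<oplus>\<^bsub>Q\<^esub> h y"
   "\<And>r x. \<lbrakk>r \<in> carrier R; x \<in> X\<rbrakk> \<Longrightarrow> h (r \<odot>\<^bsub>M\<^esub> x) = \<kappa> r \<odot>\<^bsub>Q\<^esub> h x"
  and im: "h ` X = carrier Q" and Z: "\<And>x. x \<in> X \<Longrightarrow> h x = \<zero>\<^bsub>Q\<^esub> \<longleftrightarrow> x \<in> Z"
  and dm: "local_module.dm R M I Z n X"
 shows "vectorspace.fin_dim F Q" "vectorspace.dim F Q = n"
proof -
 interpret Q: vectorspace F Q by fact
 interpret L: local_module F Q "{\<zero>\<^bsub>F\<^esub>}" by (rule Q.local_module_zero)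
 have "L.dm {\<zero>\<^bsub>Q\<^esub>} n ({\<zero>\<^bsub>Q\<^esub>} <+>\<^bsub>Q\<^esub> h ` X)"
  by (rule rk_map[OF assms(1) L.local_module_axioms assms(3,4) _ h Q.sub_zero_set _ dm]) (use im Z in auto)
 moreover have "{\<zero>\<^bsub>Q\<^esub>} <+>\<^bsub>Q\<^esub> carrier Q = carrier Q"
  by (rule Q.sum_absorb2[OF Q.sub_zero_set Q.sub_carrier_set]) simp
 ultimately have d: "L.dm {\<zero>\<^bsub>Q\<^esub>} n (carrier Q)" unfolding im by simp
 then show "vectorspace.fin_dim F Q" "vectorspace.dim F Q = n" using Q.fin_dim_iff_fin Q.dim_eq L.dm_fin by auto
qed

text \<open>The module axioms of a quotient are read off from the projection, which avoids computing
  with cosets.\<close>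

lemma module_image:
 assumes "module R M" and c: "p ` carrier M = carrier Q"
  and a: "\<And>x y. \<lbrakk>x \<in> carrier M; y \<in> carrier M\<rbrakk> \<Longrightarrow> p x \<oplus>\<^bsub>Q\<^esub> p y = p (x \<oplus>\<^bsub>M\<^esub> y)"
  and s: "\<And>r x. \<lbrakk>r \<in> carrier R; x \<in> carrier M\<rbrakk> \<Longrightarrow> r \<odot>\<^bsub>Q\<^esub> p x = p (r \<odot>\<^bsub>M\<^esub> x)"
  and z: "\<zero>\<^bsub>Q\<^esub> = p \<zero>\<^bsub>M\<^esub>"
 shows "module R Q"
proof -
 interpret module R M by fact
 have ex: "\<exists>x\<in>carrier M. X = p x" if "X \<in> carrier Q" for X using that c by blast
 have pc: "p x \<in> carrier Q" if "x \<in> carrier M" for x using that c by blast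
 note simps = a s z pc
 show ?thesis
 proof (rule moduleI[OF R.cring_axioms abelian_groupI])
  fix X assume "X \<in> carrier Q"
  then obtain x where x: "x \<in> carrier M" "X = p x" using ex by blast
  then show "\<exists>Y\<in>carrier Q. Y \<oplus>\<^bsub>Q\<^esub> X = \<zero>\<^bsub>Q\<^esub>"
   by (intro bexI[of _ "p (\<ominus>\<^bsub>M\<^esub> x)"]) (simp_all add: simps M.l_neg)
 qed (auto dest!: ex simp: simps M.a_ac smult_l_distr smult_r_distr smult_assoc1)
qed

lemma (in vectorspace) quotient_dim:
 assumes B: "submodule K B V" and A: "submodule K A V" and BA: "B \<subseteq> A"
  and dm: "local_module.dm K V {\<zero>\<^bsub>K\<^esub>} B n A"
 shows "vectorspace.dim K (quotient_module (V\<lparr>carrier := A\<rparr>) B) = n"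
proof -
 interpret A: module K "V\<lparr>carrier := A\<rparr>" by (rule submodule_is_module[OF A])
 have BA': "submodule K B (V\<lparr>carrier := A\<rparr>)"
  using BA sub_zero[OF B] sub_add[OF B] sub_smult[OF B] by (intro A.subI) auto
 interpret G: abelian_subgroup B "V\<lparr>carrier := A\<rparr>" by (rule A.submodule_abelian_subgroup[OF BA'])
 note Ac = sub_carrier[OF A] and Bc = sub_carrier[OF B]
 let ?Q = "quotient_module (V\<lparr>carrier := A\<rparr>) B"
 define p where "p x = B +>\<^bsub>V\<lparr>carrier := A\<rparr>\<^esub> x" for x
 have mem: "y \<in> p x \<longleftrightarrow> (\<exists>b\<in>B. y = b \<oplus>\<^bsub>V\<^esub> x)" for x y unfolding p_def by (auto simp: a_r_coset_def')
 have pe: "p x = p y" if "x \<in> p y" "y \<in> A" for x y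
  using G.a_repr_independence'[of x y] that unfolding p_def by simp
 have car: "p ` A = carrier ?Q" unfolding quotient_module_def A_RCOSETS_def' p_def by auto
 have add: "p x \<oplus>\<^bsub>?Q\<^esub> p y = p (x \<oplus>\<^bsub>V\<^esub> y)" if "x \<in> A" "y \<in> A" for x y
  using G.a_rcos_sum[of x y] that unfolding quotient_module_def p_def by simp
 have sm: "r \<odot>\<^bsub>?Q\<^esub> p x = p (r \<odot>\<^bsub>V\<^esub> x)" if r: "r \<in> carrier K" and x: "x \<in> A" for r x
 proof -
  have eq: "p (r \<odot>\<^bsub>V\<^esub> y) = p (r \<odot>\<^bsub>V\<^esub> x)" if y: "y \<in> p x" for y
  proof (rule pe)
   obtain b where b: "b \<in> B" "y = b \<oplus>\<^bsub>V\<^esub> x" using y mem by blast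
   then show "r \<odot>\<^bsub>V\<^esub> y \<in> p (r \<odot>\<^bsub>V\<^esub> x)" unfolding mem using sub_smult[OF B r b(1)] Ac[OF x] Bc r
    by (intro bexI[of _ "r \<odot>\<^bsub>V\<^esub> b"]) (auto simp: smult_r_distr)
  qed (rule sub_smult[OF A r x])
  have "x \<in> p x" unfolding mem using sub_zero[OF B] Ac[OF x] by (intro bexI[of _ "\<zero>\<^bsub>V\<^esub>"]) auto
  then have "p x \<noteq> {}" by blast
  have "r \<odot>\<^bsub>?Q\<^esub> p x = (\<Union>y\<in>p x. p (r \<odot>\<^bsub>V\<^esub> y))" unfolding quotient_module_def p_def by simp
  also have "\<dots> = (\<Union>y\<in>p x. p (r \<odot>\<^bsub>V\<^esub> x))" by (rule SUP_cong[OF refl eq])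
  also have "\<dots> = p (r \<odot>\<^bsub>V\<^esub> x)" using \<open>p x \<noteq> {}\<close> by (rule cSUP_const)
  finally show ?thesis .
 qed
 have zero: "\<zero>\<^bsub>?Q\<^esub> = p \<zero>\<^bsub>V\<^esub>" unfolding quotient_module_def using mem[of _ "\<zero>\<^bsub>V\<^esub>"] Bc by auto
 have ker: "p x = \<zero>\<^bsub>?Q\<^esub> \<longleftrightarrow> x \<in> B" if x: "x \<in> A" for x
 proof
  have "x \<in> p x" unfolding mem using sub_zero[OF B] Ac[OF x] by (intro bexI[of _ "\<zero>\<^bsub>V\<^esub>"]) auto
  then show "p x = \<zero>\<^bsub>?Q\<^esub> \<Longrightarrow> x \<in> B" unfolding quotient_module_def by auto
  show "p x = \<zero>\<^bsub>?Q\<^esub>" if "x \<in> B" unfolding zero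
   by (rule pe) (use that sub_zero[OF A] Bc mem in \<open>auto intro!: bexI[of _ x]\<close>)
 qed
 have "vectorspace K ?Q"
  by (intro vectorspace.intro module_image[OF A.module_axioms, of p] field_axioms) (simp_all add: car add sm zero)
 then show ?thesis
  by (rule dim_eq_rk(2)[where \<kappa> = id and h = p and X = A and Z = B, OF local_module_zero])
   (use car add sm ker dm in auto)
qed

text \<open>With d j the dimension of the j-th step and q j that of its graded piece, this turns the
  weight into a sum of dimensions of subspaces.\<close>

lemma sum_by_parts:
 fixes d q :: "nat \<Rightarrow> nat"
 assumes "\<And>j. d j = q j + d (Suc j)"
 shows "(\<Sum>j<l. j * q j) + l * d l = (\<Sum>j\<in>{1..l}. d j)"
proof (induction l)
 case (Suc l)
 have "l * d l = l * q l + l * d (Suc l)" by (subst assms) (simp add: distrib_left)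
 then show ?case using Suc by simp
qed simp

lemma rat_divide_le_divide_iff: "\<lbrakk>0 < y; 0 < z\<rbrakk> \<Longrightarrow> x / y \<le> w / z \<longleftrightarrow> x * z \<le> w * y" for x y z w :: rat
 by (simp add: field_simps)

section \<open>Weights as sums of dimensions\<close>

context multi_filtered_space
begin

abbreviation dm0 where "dm0 \<equiv> local_module.dm F V {\<zero>\<^bsub>F\<^esub>}"
abbreviation rk0 where "rk0 \<equiv> local_module.rk F V {\<zero>\<^bsub>F\<^esub>} {\<zero>\<^bsub>V\<^esub>}"

text \<open>The weight of W after summation by parts. The term j = 0 disappears, and l has to bound
  the lengths of all filtrations for the boundary term to vanish; the F i j \<inter> W with 1 \<le>
  j \<le> l are the subspaces that enter the degree.\<close>

definition wt where "wt l W = (\<Sum>i\<in>{1..n}. \<Sum>j\<in>{1..l}. rk0 (Fil i j \<inter> W))"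

lemma Fil_sub: "i \<in> {1..n} \<Longrightarrow> sub (Fil i j)"
 using Fil_subspace by (simp add: subspace_def)

lemma Fil_bound: "\<exists>l. \<forall>i\<in>{1..n}. \<forall>j\<ge>l. Fil i j = {\<zero>\<^bsub>V\<^esub>}"
proof -
 obtain l where l: "\<And>i. i \<in> {1..n} \<Longrightarrow> Fil i (l i) = {\<zero>\<^bsub>V\<^esub>}" using Fil_separated by metis
 have "Fil i j = {\<zero>\<^bsub>V\<^esub>}" if i: "i \<in> {1..n}" "(\<Sum>i\<in>{1..n}. l i) \<le> j" for i j
 proof -
  have "l i \<le> (\<Sum>i\<in>{1..n}. l i)" using i(1) by (intro member_le_sum) auto
  then have "Fil i j \<subseteq> Fil i (l i)" using lift_Suc_antimono_le[of "Fil i" "l i" j] Fil_decreasing[OF i(1)] i(2) by auto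
  then show ?thesis using l[OF i(1)] sub_zero[OF Fil_sub[OF i(1)]] by blast
 qed
 then show ?thesis by blast
qed

lemma dim_sub:
 assumes "sub W"
 shows "dm0 {\<zero>\<^bsub>V\<^esub>} (rk0 W) W" "vectorspace.dim F (V\<lparr>carrier := W\<rparr>) = rk0 W"
proof -
 interpret L: local_module F V "{\<zero>\<^bsub>F\<^esub>}" by (rule local_module_zero)
 have "L.fin {\<zero>\<^bsub>V\<^esub>} (carrier V)" using fin_dim fin_dim_iff_fin by simp
 then have "L.fin {\<zero>\<^bsub>V\<^esub>} W" using L.rk_between(1) assms sub_zero[OF assms] sub_subset[OF assms] by blast
 then show dm: "dm0 {\<zero>\<^bsub>V\<^esub>} (rk0 W) W" using L.dm_rk by blast
 have "vectorspace F (V\<lparr>carrier := W\<rparr>)" using submodule_is_module[OF assms] field_axioms by (rule vectorspace.intro)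
 then show "vectorspace.dim F (V\<lparr>carrier := W\<rparr>) = rk0 W"
  by (rule dim_eq_rk(2)[where \<kappa> = id and h = id and X = W and Z = "{\<zero>\<^bsub>V\<^esub>}", OF local_module_zero]) (use dm in auto)
qed

lemma weight_eq:
 assumes W: "sub W" and l: "\<forall>i\<in>{1..n}. \<forall>j\<ge>l. Fil i j = {\<zero>\<^bsub>V\<^esub>}"
 shows "filtration_weight F (V\<lparr>carrier := W\<rparr>) n (\<lambda>i j. Fil i j \<inter> W) = wt l W"
proof -
 interpret L: local_module F V "{\<zero>\<^bsub>F\<^esub>}" by (rule local_module_zero)
 have "(\<Sum>j\<in>{j. Fil i j \<inter> W \<noteq> {\<zero>\<^bsub>V\<^esub>}}. j * vectorspace.dim F (quotient_module (V\<lparr>carrier := Fil i j \<inter> W\<rparr>) (Fil i (Suc j) \<inter> W)))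
   = (\<Sum>j\<in>{1..l}. rk0 (Fil i j \<inter> W))" if i: "i \<in> {1..n}" for i
 proof -
  define A where "A j = Fil i j \<inter> W" for j
  have A: "sub (A j)" for j unfolding A_def using sub_Int[OF Fil_sub[OF i] W] .
  have Al: "A j = {\<zero>\<^bsub>V\<^esub>}" if "l \<le> j" for j unfolding A_def using l i that sub_zero[OF W] by auto
  have dec: "A (Suc j) \<subseteq> A j" for j unfolding A_def using Fil_decreasing[OF i] by blast
  define q where "q j = L.rk (A (Suc j)) (A j)" for j
  have zA: "{\<zero>\<^bsub>V\<^esub>} \<subseteq> A j" for j using sub_zero[OF A] by blast
  note b = L.rk_between[OF L.dm_fin[OF dim_sub(1)[OF A]] A zA dec]
  have "vectorspace.dim F (quotient_module (V\<lparr>carrier := A j\<rparr>) (A (Suc j))) = q j" for j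
   unfolding q_def by (rule quotient_dim[OF A A dec L.dm_rk[OF b(2)]])
  moreover have "(\<Sum>j\<in>{j. A j \<noteq> {\<zero>\<^bsub>V\<^esub>}}. j * q j) = (\<Sum>j<l. j * q j)"
  proof (rule sum.mono_neutral_left)
   show "{j. A j \<noteq> {\<zero>\<^bsub>V\<^esub>}} \<subseteq> {..<l}" using Al by (auto simp: not_less[symmetric])
   have "q j = 0" if "A j = {\<zero>\<^bsub>V\<^esub>}" for j
   proof -
    have "A (Suc j) = {\<zero>\<^bsub>V\<^esub>}" using dec[of j] zA[of "Suc j"] that by blast
    then show ?thesis using L.rk_self(2)[OF sub_zero_set] that unfolding q_def by simp
   qed
   then show "\<forall>j\<in>{..<l} - {j. A j \<noteq> {\<zero>\<^bsub>V\<^esub>}}. j * q j = 0" by simp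
  qed simp
  moreover have "(\<Sum>j<l. j * q j) + l * rk0 (A l) = (\<Sum>j\<in>{1..l}. rk0 (A j))"
   by (rule sum_by_parts) (unfold q_def, rule trans[OF b(3) add.commute])
  moreover have "rk0 (A l) = 0" using Al[of l] L.rk_self(2)[OF sub_zero_set] by simp
  ultimately show ?thesis unfolding A_def by simp
 qed
 then show ?thesis unfolding filtration_weight_def wt_def by simp
qed

lemma semistable_iff:
 assumes l: "\<forall>i\<in>{1..n}. \<forall>j\<ge>l. Fil i j = {\<zero>\<^bsub>V\<^esub>}"
 shows "semistable F V n Fil \<longleftrightarrow> (\<forall>W. sub W \<longrightarrow> wt l W * rk0 (carrier V) \<le> wt l (carrier V) * rk0 W)"
proof -
 interpret L: local_module F V "{\<zero>\<^bsub>F\<^esub>}" by (rule local_module_zero)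
 note C = sub_carrier_set
 have Fc: "Fil i j \<inter> carrier V = Fil i j" if "i \<in> {1..n}" for i j using sub_subset[OF Fil_sub[OF that]] by blast
 have "filtration_weight F V n Fil = filtration_weight F (V\<lparr>carrier := carrier V\<rparr>) n (\<lambda>i j. Fil i j \<inter> carrier V)"
  unfolding filtration_weight_def by (intro sum.cong) (simp_all add: Fc)
 then have wV: "filtration_weight F V n Fil = wt l (carrier V)" using weight_eq[OF C l] by simp
 have dV: "vectorspace.dim F V = rk0 (carrier V)" using dim_sub(2)[OF C] by simp
 have key: "slope F (V\<lparr>carrier := W\<rparr>) n (\<lambda>i j. Fil i j \<inter> W) \<le> slope F V n Fil
   \<longleftrightarrow> wt l W * rk0 (carrier V) \<le> wt l (carrier V) * rk0 W" if W: "sub W" "W \<noteq> {\<zero>\<^bsub>V\<^esub>}" for W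
 proof -
  have z: "{\<zero>\<^bsub>V\<^esub>} \<subseteq> W" using sub_zero[OF W(1)] by blast
  have "rk0 W \<noteq> 0" using L.rk_zero_iff[OF L.dm_fin[OF dim_sub(1)[OF W(1)]]] W(2) by simp
  moreover have "rk0 W \<le> rk0 (carrier V)"
   using L.rk_mono[OF L.dm_fin[OF dim_sub(1)[OF C]] W(1) z sub_subset[OF W(1)]] .
  ultimately have "0 < rk0 W" "0 < rk0 (carrier V)" by auto
  then show ?thesis
   unfolding slope_def weight_eq[OF W(1) l] wV dV dim_sub(2)[OF W(1)]
   by (simp only: rat_divide_le_divide_iff of_nat_0_less_iff of_nat_mult[symmetric] of_nat_le_iff)
 qed
 \<comment> \<open>Semistability speaks of nonzero W only; for W = 0 both sides of the inequality
   vanish, so it can be stated for all W.\<close>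
 have w0: "wt l {\<zero>\<^bsub>V\<^esub>} = 0"
 proof -
  have "Fil i j \<inter> {\<zero>\<^bsub>V\<^esub>} = {\<zero>\<^bsub>V\<^esub>}" if "i \<in> {1..n}" for i j using sub_zero[OF Fil_sub[OF that]] by blast
  then show ?thesis unfolding wt_def using L.rk_self(2)[OF sub_zero_set] by simp
 qed
 have ss: "subspace F W V \<longleftrightarrow> sub W" for W using vectorspace_axioms by (simp add: subspace_def)
 show ?thesis
 proof
  assume s: "semistable F V n Fil"
  show "\<forall>W. sub W \<longrightarrow> wt l W * rk0 (carrier V) \<le> wt l (carrier V) * rk0 W"
  proof (intro allI impI)
   fix W assume W: "sub W"
   show "wt l W * rk0 (carrier V) \<le> wt l (carrier V) * rk0 W"
   proof (cases "W = {\<zero>\<^bsub>V\<^esub>}")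
    case False
    then show ?thesis using s key[OF W False] W unfolding semistable_def ss by blast
   qed (simp add: w0)
  qed
 next
  assume "\<forall>W. sub W \<longrightarrow> wt l W * rk0 (carrier V) \<le> wt l (carrier V) * rk0 W"
  then show "semistable F V n Fil" unfolding semistable_def ss using key by blast
 qed
qed

end

section \<open>The reduction over the residue field\<close>

context valued_space
begin

text \<open>The coefficient of the head has the largest index, so that extending a list leaves the
  coordinates of its tail unchanged and a list of length r uses exactly the indices of
  \<open>func_space {1..r}\<close>.\<close>

primrec lc where
 "lc [] c = 0\<^sub>V"
| "lc (x # xs) c = lc xs c \<boxplus> c (Suc (length xs)) \<cdot> x"

lemma lc_cong: "(\<And>i. i \<in> {1..length es} \<Longrightarrow> c i = d i) \<Longrightarrow> lc es c = lc es d"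
 by (induction es) auto

lemma lc_closed: "\<lbrakk>set es \<subseteq> carrier V; \<And>i. i \<in> {1..length es} \<Longrightarrow> c i \<in> carrier K\<rbrakk> \<Longrightarrow> lc es c \<in> carrier V"
 by (induction es) auto

lemma lc_linear:
 assumes "set es \<subseteq> carrier V" "\<And>i. i \<in> {1..length es} \<Longrightarrow> c i \<in> carrier K" "\<And>i. i \<in> {1..length es} \<Longrightarrow> d i \<in> carrier K"
 shows "lc es (\<lambda>i. c i \<oplus> d i) = lc es c \<boxplus> lc es d" "r \<in> carrier K \<Longrightarrow> lc es (\<lambda>i. r \<otimes> c i) = r \<cdot> lc es c"
proof -
 have "lc es (\<lambda>i. c i \<oplus> d i) = lc es c \<boxplus> lc es d \<and> (r \<in> carrier K \<longrightarrow> lc es (\<lambda>i. r \<otimes> c i) = r \<cdot> lc es c)"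
  using assms
 proof (induction es)
  case (Cons e es)
  have "lc es c \<in> carrier V" "lc es d \<in> carrier V" by (rule lc_closed; use Cons.prems in simp)+
  then show ?case using Cons by (simp add: smult_l_distr smult_r_distr smult_assoc1 M.a_ac)
 qed simp
 then show "lc es (\<lambda>i. c i \<oplus> d i) = lc es c \<boxplus> lc es d" "r \<in> carrier K \<Longrightarrow> lc es (\<lambda>i. r \<otimes> c i) = r \<cdot> lc es c" by auto
qed

lemma lc_range:
 assumes "set es \<subseteq> carrier V"
 shows "x \<in> VO.ext {0\<^sub>V} es \<longleftrightarrow> (\<exists>c\<in>{1..length es} \<rightarrow>\<^sub>E \<O>. x = lc es c)"
 using assms
proof (induction es arbitrary: x)
 case (Cons e es)
 show ?case
 proof
  assume "x \<in> VO.ext {0\<^sub>V} (e # es)"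
  then obtain y r where yr: "y \<in> VO.ext {0\<^sub>V} es" "r \<in> \<O>" "x = y \<boxplus> r \<cdot> e" by (auto simp: VO.mem_sum_line)
  obtain c where c: "c \<in> {1..length es} \<rightarrow>\<^sub>E \<O>" "y = lc es c" using Cons yr(1) by auto
  have "lc es (c(Suc (length es) := r)) = lc es c" by (rule lc_cong) auto
  then have "x = lc (e # es) (c(Suc (length es) := r))" using yr c by simp
  moreover have "c(Suc (length es) := r) \<in> {1..length (e # es)} \<rightarrow>\<^sub>E \<O>" using c(1) yr(2) by (auto simp: PiE_iff extensional_def)
  ultimately show "\<exists>c\<in>{1..length (e # es)} \<rightarrow>\<^sub>E \<O>. x = lc (e # es) c" by blast
 next
  assume "\<exists>c\<in>{1..length (e # es)} \<rightarrow>\<^sub>E \<O>. x = lc (e # es) c"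
  then obtain c where c: "c \<in> {1..length (e # es)} \<rightarrow>\<^sub>E \<O>" "x = lc (e # es) c" by blast
  have "lc es c = lc es (restrict c {1..length es})" by (rule lc_cong) simp
  moreover have "restrict c {1..length es} \<in> {1..length es} \<rightarrow>\<^sub>E \<O>" using c(1) by (auto simp: PiE_iff)
  ultimately have "\<exists>d\<in>{1..length es} \<rightarrow>\<^sub>E \<O>. lc es c = lc es d" by (rule bexI)
  moreover have "set es \<subseteq> carrier V" using Cons.prems by simp
  ultimately have "lc es c \<in> VO.ext {0\<^sub>V} es" using Cons.IH[of "lc es c"] by blast
  moreover have "c (Suc (length es)) \<in> \<O>" using c(1) by (auto simp: PiE_iff)
  ultimately show "x \<in> VO.ext {0\<^sub>V} (e # es)" using c(2) by (auto simp: VO.mem_sum_line)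
 qed
qed (auto intro!: bexI[of _ "\<lambda>_. undefined"])

lemma lc_kernel:
 assumes "set es \<subseteq> carrier V" "VK.indep {0\<^sub>V} es" "\<And>i. i \<in> {1..length es} \<Longrightarrow> c i \<in> carrier K" "lc es c = 0\<^sub>V"
 shows "i \<in> {1..length es} \<Longrightarrow> c i = \<zero>"
 using assms
proof (induction es)
 case (Cons e es)
 have ec: "e \<in> carrier V" "set es \<subseteq> carrier V" and cK: "c (Suc (length es)) \<in> carrier K" using Cons.prems by auto
 have sK: "sub (VK.ext {0\<^sub>V} es)" using VK.ext_sub[OF sub_zero_set ec(2)] .
 have lK: "set es' \<subseteq> carrier V \<Longrightarrow> (\<And>i. i \<in> {1..length es'} \<Longrightarrow> c i \<in> carrier K) \<Longrightarrow> lc es' c \<in> VK.ext {0\<^sub>V} es'" for es'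
 proof (induction es')
  case (Cons a es')
  then have "lc es' c \<in> VK.ext {0\<^sub>V} es'" by simp
  moreover have "c (Suc (length es')) \<in> carrier K" using Cons.prems(2) by simp
  ultimately show ?case unfolding lc.simps VK.ext.simps mem_sum_line by blast
 qed simp
 have l: "lc es c \<in> VK.ext {0\<^sub>V} es" using lK[OF ec(2)] Cons.prems(4) by simp
 have "c (Suc (length es)) = \<zero>"
 proof (rule ccontr)
  assume nz: "c (Suc (length es)) \<noteq> \<zero>"
  have "lc es c \<boxplus> c (Suc (length es)) \<cdot> e \<in> VK.ext {0\<^sub>V} es" using Cons.prems(5) sub_zero[OF sK] by simp
  then have "c (Suc (length es)) \<cdot> e \<in> VK.ext {0\<^sub>V} es" using sub_cancel[OF sK _ l] ec cK by simp
  then have "e \<in> VK.ext {0\<^sub>V} es" using sub_cancel_smult[OF sK _ cK nz ec(1)] by blast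
  then show False using Cons.prems(3) by simp
 qed
 moreover from this have "lc es c = 0\<^sub>V" using Cons.prems(5) ec lc_closed[OF ec(2), of c] Cons.prems(4) by simp
 moreover have "c i = \<zero>" if "i \<in> {1..length es}" using Cons.IH[OF that ec(2)] Cons.prems calculation(2) by simp
 ultimately show ?case using Cons.prems(1) by (cases "i = Suc (length es)") auto
qed simp

lemma free_finitely_presented:
 assumes es: "set es \<subseteq> carrier V" and ind: "VK.indep {0\<^sub>V} es"
 shows "finitely_presented (K\<lparr>carrier := \<O>\<rparr>) (V\<lparr>carrier := VO.ext {0\<^sub>V} es\<rparr>)"
proof -
 let ?r = "length es" and ?M = "VO.ext {0\<^sub>V} es"
 let ?P = "VO.R.func_space {1..?r}"
 interpret P: module "K\<lparr>carrier := \<O>\<rparr>" ?P by (rule VO.R.func_space_is_module)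
 have car: "carrier ?P = {1..?r} \<rightarrow>\<^sub>E \<O>" by (simp add: VO.R.func_space_def)
 have cK: "c i \<in> carrier K" if "c \<in> carrier ?P" "i \<in> {1..?r}" for c i
  using PiE_mem[of c "{1..?r}" "\<lambda>_. \<O>" i] that O_carrier unfolding car by blast
 have cM: "lc es c \<in> ?M" if "c \<in> carrier ?P" for c using lc_range[OF es] that unfolding car by blast
 have sM: "Osub ?M" using VO.ext_sub[OF VO.sub_zero_set es] .
 have hom: "lc es \<in> module_hom (K\<lparr>carrier := \<O>\<rparr>) ?P (V\<lparr>carrier := ?M\<rparr>)"
 proof -
  have "lc es (c \<oplus>\<^bsub>?P\<^esub> d) = lc es c \<boxplus> lc es d" if "c \<in> carrier ?P" "d \<in> carrier ?P" for c d
  proof -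
   have "lc es (c \<oplus>\<^bsub>?P\<^esub> d) = lc es (\<lambda>i. c i \<oplus> d i)" by (rule lc_cong) (simp add: VO.R.func_space_def)
   also have "\<dots> = lc es c \<boxplus> lc es d" by (rule lc_linear(1)[OF es]; (erule cK[OF that(1)] | erule cK[OF that(2)]))
   finally show ?thesis .
  qed
  moreover have "lc es (r \<odot>\<^bsub>?P\<^esub> c) = r \<cdot> lc es c" if "r \<in> \<O>" "c \<in> carrier ?P" for r c
  proof -
   have "lc es (r \<odot>\<^bsub>?P\<^esub> c) = lc es (\<lambda>i. r \<otimes> c i)" by (rule lc_cong) (simp add: VO.R.func_space_def)
   also have "\<dots> = r \<cdot> lc es c" by (rule lc_linear(2)[OF es _ _ O_carrier[OF that(1)]]; erule cK[OF that(2)])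
   finally show ?thesis .
  qed
  ultimately show ?thesis unfolding module_hom_def using cM by auto
 qed
 have "mod_hom (K\<lparr>carrier := \<O>\<rparr>) ?P (V\<lparr>carrier := ?M\<rparr>) (lc es)"
  by (intro mod_hom.intro mod_hom_axioms.intro P.module_axioms VO.submodule_is_module[OF sM] hom)
 moreover have "lc es ` carrier ?P = carrier (V\<lparr>carrier := ?M\<rparr>)" unfolding car using lc_range[OF es] by auto
 \<comment> \<open>A basis gives a presentation without relations: the empty set generates the zero
   kernel.\<close>
 moreover have "P.span {} = {c \<in> carrier ?P. lc es c = \<zero>\<^bsub>V\<lparr>carrier := ?M\<rparr>\<^esub>}"
 proof -
  have sp: "P.span {} = {\<zero>\<^bsub>?P\<^esub>}"
   using P.span_is_subset[OF _ P.sub_zero_set, of "{}"] P.sub_zero[OF P.span_is_submodule[of "{}"]] by auto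
  have inj: "c = \<zero>\<^bsub>?P\<^esub>" if c: "c \<in> carrier ?P" "lc es c = 0\<^sub>V" for c
  proof
   fix i
   show "c i = \<zero>\<^bsub>?P\<^esub> i"
    using lc_kernel[OF es ind cK[OF c(1)] c(2), of i] c(1) unfolding car
    by (cases "i \<in> {1..?r}") (auto simp: VO.R.func_space_def PiE_iff extensional_def)
  qed
  have l0: "lc es \<zero>\<^bsub>?P\<^esub> = 0\<^sub>V"
  proof -
   have "lc es \<zero>\<^bsub>?P\<^esub> = lc es (\<lambda>_. \<zero> \<otimes> \<zero>)" by (rule lc_cong) (simp add: VO.R.func_space_def)
   also have "\<dots> = \<zero> \<cdot> lc es (\<lambda>_. \<zero>)" by (rule lc_linear(2)[OF es]) auto
   finally show ?thesis using lc_closed[OF es, of "\<lambda>_. \<zero>"] by simp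
  qed
  have zM: "\<zero>\<^bsub>V\<lparr>carrier := ?M\<rparr>\<^esub> = 0\<^sub>V" by simp
  show ?thesis unfolding sp
  proof (intro equalityI subsetI)
   fix c assume "c \<in> {\<zero>\<^bsub>?P\<^esub>}"
   then have c: "c = \<zero>\<^bsub>?P\<^esub>" by (rule singletonD)
   show "c \<in> {c \<in> carrier ?P. lc es c = \<zero>\<^bsub>V\<lparr>carrier := ?M\<rparr>\<^esub>}"
    unfolding c mem_Collect_eq zM using P.M.zero_closed l0 by (rule conjI)
  next
   fix c assume "c \<in> {c \<in> carrier ?P. lc es c = \<zero>\<^bsub>V\<lparr>carrier := ?M\<rparr>\<^esub>}"
   then have "c \<in> carrier ?P" "lc es c = 0\<^sub>V" by simp_all
   then show "c \<in> {\<zero>\<^bsub>?P\<^esub>}" using inj singleton_iff by metis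
  qed
 qed
 ultimately show ?thesis unfolding finitely_presented_def
  by (intro exI[of _ ?r] exI[of _ "lc es"] exI[of _ "{}"] conjI finite.emptyI empty_subsetI)
qed

end

text \<open>All that is needed of the reduction: it is the image of M under p, with kernel mM.
  Residue dimensions of images p(Y) are then lengths of Y over mM \<inter> Y, and subspaces of the
  reduction correspond to submodules between mM and M.\<close>

lemma (in fd_valued_space) reduction_facts:
 assumes mx: "maximalideal m (K\<lparr>carrier := \<O>\<rparr>)" and M: "lattice M"
 defines "k \<equiv> (K\<lparr>carrier := \<O>\<rparr>) Quot m" and "T \<equiv> reduction (K\<lparr>carrier := \<O>\<rparr>) m (V\<lparr>carrier := M\<rparr>)"
  and "p \<equiv> reduction_map (K\<lparr>carrier := \<O>\<rparr>) m (V\<lparr>carrier := M\<rparr>)"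
 shows "vectorspace k T" "p ` M = carrier T" "p \<zero>\<^bsub>V\<^esub> = \<zero>\<^bsub>T\<^esub>" "x \<in> M \<Longrightarrow> p x = \<zero>\<^bsub>T\<^esub> \<longleftrightarrow> x \<in> mm M"
  "\<lbrakk>Osub Y; Y \<subseteq> M\<rbrakk> \<Longrightarrow> local_module.dm k T {\<zero>\<^bsub>k\<^esub>} {\<zero>\<^bsub>T\<^esub>} (VO.rk (mm M \<inter> Y) Y) (p ` Y)"
  "submodule k Z T \<Longrightarrow> Osub {x \<in> M. p x \<in> Z}"
proof -
 let ?R = "K\<lparr>carrier := \<O>\<rparr>" and ?M = "V\<lparr>carrier := M\<rparr>"
 note sM = lattice_sub[OF M]
 interpret mx: maximalideal m ?R by fact
 note idl = mx.ideal_axioms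
 interpret MM: module ?R ?M by (rule VO.submodule_is_module[OF sM])
 have "field k" unfolding k_def by (rule mx.quotient_is_field[OF cring_R])
 then show vs: "vectorspace k T" using MM.reduction_module[OF idl] unfolding T_def k_def by (intro vectorspace.intro)
 interpret T: vectorspace k T by (rule vs)
 interpret TL: local_module k T "{\<zero>\<^bsub>k\<^esub>}" by (rule T.local_module_zero)
 show car: "p ` M = carrier T" unfolding p_def T_def MM.reduction_carrier by simp
 show z: "p \<zero>\<^bsub>V\<^esub> = \<zero>\<^bsub>T\<^esub>" unfolding p_def T_def MM.reduction_zero[OF idl] by simp
 \<comment> \<open>The span in \<open>ideal_smult\<close> adds nothing to the set of products,
   because \<open>mm M\<close> is already a submodule.\<close>
 have mmM: "ideal_smult ?R m ?M = mm M"
 proof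
  have "submodule ?R (mm M) ?M"
   using mm_sub[OF sM] VO.sub_zero[OF mm_sub(1)[OF sM]] VO.sub_add[OF mm_sub(1)[OF sM]] VO.sub_smult[OF mm_sub(1)[OF sM]]
   by (intro MM.subI) auto
  then show "ideal_smult ?R m ?M \<subseteq> mm M" unfolding ideal_smult_def
   by (rule MM.span_is_subset[rotated]) (auto simp: mm_def)
  show "mm M \<subseteq> ideal_smult ?R m ?M" using MM.smult_in_ideal_smult[OF idl] unfolding mm_def by auto
 qed
 show ker: "p x = \<zero>\<^bsub>T\<^esub> \<longleftrightarrow> x \<in> mm M" if "x \<in> M" for x
 proof -
  have xc: "x \<in> carrier ?M" using that by simp
  have "x \<ominus>\<^bsub>?M\<^esub> \<zero>\<^bsub>?M\<^esub> = x"
   using trans[OF MM.M.r_zero[OF MM.M.minus_closed[OF xc MM.M.zero_closed], symmetric] MM.minus_add_cancel(1)[OF xc MM.M.zero_closed]] .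
  then show ?thesis
   using MM.reduction_map_eq_iff[OF idl xc MM.M.zero_closed] MM.reduction_zero[OF idl] unfolding mmM p_def T_def by simp
 qed
 have add: "p (x \<oplus>\<^bsub>V\<^esub> y) = p x \<oplus>\<^bsub>T\<^esub> p y" if "x \<in> M" "y \<in> M" for x y
  using MM.reduction_add[OF idl, of x y] that unfolding p_def T_def by simp
 have sm: "p (r \<odot>\<^bsub>V\<^esub> x) = (m +>\<^bsub>?R\<^esub> r) \<odot>\<^bsub>T\<^esub> p x" if "r \<in> \<O>" "x \<in> M" for r x
  using MM.reduction_smult[OF idl, of r x] that unfolding p_def T_def by simp
 have \<kappa>: "(+>\<^bsub>?R\<^esub>) m ` carrier ?R = carrier k" unfolding k_def by (auto simp: FactRing_def A_RCOSETS_def')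
 have "(+>\<^bsub>?R\<^esub>) m ` m = {m}" using mx.a_rcos_const zero_m by auto
 then have \<kappa>m: "(+>\<^bsub>?R\<^esub>) m ` m = {\<zero>\<^bsub>k\<^esub>}" unfolding k_def by (simp add: FactRing_def)
 show "TL.dm {\<zero>\<^bsub>T\<^esub>} (VO.rk (mm M \<inter> Y) Y) (p ` Y)" if Y: "Osub Y" "Y \<subseteq> M"
 proof -
  have "VO.fin (mm M \<inter> Y) (M \<inter> Y)" using VO.rk_split(1)[OF lattice_fin[OF M] Y(1)] .
  moreover have "M \<inter> Y = Y" using Y(2) by blast
  ultimately have f: "VO.fin (mm M \<inter> Y) Y" by simp
  have "TL.dm {\<zero>\<^bsub>T\<^esub>} (VO.rk (mm M \<inter> Y) Y) ({\<zero>\<^bsub>T\<^esub>} <+>\<^bsub>T\<^esub> p ` Y)"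
  proof (rule rk_map[OF VO.local_module_axioms TL.local_module_axioms \<kappa> \<kappa>m _ _ _ T.sub_zero_set _ VO.dm_rk[OF f]])
   note YM = subsetD[OF Y(2)]
   show "p x \<in> carrier T" if "x \<in> Y" for x using YM[OF that] car by blast
   show "p (x \<oplus>\<^bsub>V\<^esub> y) = p x \<oplus>\<^bsub>T\<^esub> p y" if "x \<in> Y" "y \<in> Y" for x y by (rule add[OF that[THEN YM]])
   show "p (r \<odot>\<^bsub>V\<^esub> x) = (m +>\<^bsub>?R\<^esub> r) \<odot>\<^bsub>T\<^esub> p x" if "r \<in> carrier ?R" "x \<in> Y" for r x
    using sm YM[OF that(2)] that(1) by simp
   show "p x \<in> {\<zero>\<^bsub>T\<^esub>} \<longleftrightarrow> x \<in> mm M \<inter> Y" if "x \<in> Y" for x using ker[OF YM[OF that]] that by simp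
  qed
  moreover have "{\<zero>\<^bsub>T\<^esub>} <+>\<^bsub>T\<^esub> p ` Y = p ` Y"
  proof -
   have "p ` Y \<subseteq> carrier T" using Y(2) car by blast
   then show ?thesis by (force simp: T.mem_sum subset_iff)
  qed
  ultimately show ?thesis by simp
 qed
 show "Osub {x \<in> M. p x \<in> Z}" if Z: "submodule k Z T"
 proof (rule OsubI)
  show "{x \<in> M. p x \<in> Z} \<subseteq> carrier V" using VO.sub_subset[OF sM] by blast
  show "\<zero>\<^bsub>V\<^esub> \<in> {x \<in> M. p x \<in> Z}" using VO.sub_zero[OF sM] z T.sub_zero[OF Z] by simp
  show "x \<oplus>\<^bsub>V\<^esub> y \<in> {x \<in> M. p x \<in> Z}" if "x \<in> {x \<in> M. p x \<in> Z}" "y \<in> {x \<in> M. p x \<in> Z}" for x y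
   using that VO.sub_add[OF sM] T.sub_add[OF Z] add by simp
  show "r \<odot>\<^bsub>V\<^esub> x \<in> {x \<in> M. p x \<in> Z}" if r: "r \<in> \<O>" and x: "x \<in> {x \<in> M. p x \<in> Z}" for r x
  proof -
   have "m +>\<^bsub>?R\<^esub> r \<in> carrier k" using \<kappa> r by auto
   then show ?thesis using x Osub_smult[OF sM r] T.sub_smult[OF Z] sm[OF r] by simp
  qed
 qed
qed

lemma (in valued_field) valued_vectorspace:
 assumes "vectorspace K V"
 shows "valued_space K V (carrier (valuation_ring K v))"
  "valued_space.m K (carrier (valuation_ring K v)) = valuation_ideal K v"
proof -
 let ?O = "carrier (valuation_ring K v)"
 have O: "?O = {x \<in> carrier K. x = \<zero> \<or> 0 \<le> v x}" by (simp add: valuation_ring_def)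
 have inv: "inv x \<in> carrier K" "inv x \<noteq> \<zero>" "v (inv x) = - v x" if x: "x \<in> carrier K" "x \<noteq> \<zero>" for x
 proof -
  have "x \<in> Units K" using x field_Units by simp
  then show i: "inv x \<in> carrier K" "inv x \<noteq> \<zero>" using field_Units by auto
  have "v (inv x) + v x = 0" using val_mult[OF i(1) x(1) i(2) x(2)] \<open>x \<in> Units K\<close> val_one by simp
  then show "v (inv x) = - v x" by (simp add: eq_neg_iff_add_eq_0)
 qed
 show vs: "valued_space K V ?O"
 proof (intro valued_space.intro valued_space_axioms.intro assms valuation_ring_subring)
  show "inv x \<in> ?O" if "x \<in> carrier K" "x \<noteq> \<zero>" "x \<notin> ?O" for x using inv[OF that(1,2)] that unfolding O by auto
 qed
 show "valued_space.m K ?O = valuation_ideal K v"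
 proof (rule Set.set_eqI)
  fix x
  have "inv x \<in> ?O \<longleftrightarrow> v x \<le> 0" if "x \<in> carrier K" "x \<noteq> \<zero>" using inv[OF that] unfolding O by simp
  then show "x \<in> valued_space.m K ?O \<longleftrightarrow> x \<in> valuation_ideal K v"
   unfolding valued_space.m_def[OF vs] valuation_ideal_def by (cases "x \<in> carrier K"; cases "x = \<zero>") (auto simp: O not_le)
 qed
qed

text \<open>The degree is chosen lexicographically: it is the numerical form of \<open>\<mu> \<le> \<mu>(V)\<close>, with ties broken
 in favour of small dimension.\<close>

lemma lexicographic_degree:
 fixes d d' w C s r s' r' :: int
 assumes C: "C = d + 1" and r: "0 \<le> r" "r \<le> d"
 shows "d' * s \<le> w * r \<Longrightarrow> (C * d') * s - (C * w + 1) * r \<le> 0"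
  and "(C * d') * s - (C * w + 1) * r \<le> 0 \<Longrightarrow> d' * s \<le> w * r"
  and "\<lbrakk>0 \<le> r'; r' \<le> d; (C * d') * s - (C * w + 1) * r = (C * d') * s' - (C * w + 1) * r'\<rbrakk> \<Longrightarrow> r = r'"
proof -
 have C0: "0 < C" using C r by simp
 have e: "(C * d') * s - (C * w + 1) * r = C * (d' * s - w * r) - r" for s r :: int by (simp add: algebra_simps)
 show "(C * d') * s - (C * w + 1) * r \<le> 0" if "d' * s \<le> w * r"
  unfolding e using that C0 r(1) mult_nonneg_nonpos[of C "d' * s - w * r"] by simp
 show "d' * s \<le> w * r" if "(C * d') * s - (C * w + 1) * r \<le> 0"
 proof (rule ccontr)
  assume "\<not> d' * s \<le> w * r"
  then have "C * 1 \<le> C * (d' * s - w * r)" using C0 by (intro mult_left_mono) auto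
  then have "C \<le> r" using that unfolding e by linarith
  then show False using r C by simp
 qed
 show "r = r'" if "0 \<le> r'" "r' \<le> d" "(C * d') * s - (C * w + 1) * r = (C * d') * s' - (C * w + 1) * r'"
 proof -
  have "C * (d' * s - w * r) - r = C * (d' * s' - w * r') - r'" using that(3) unfolding e .
  then have "r - r' = C * ((d' * s - w * r) - (d' * s' - w * r'))" by (simp only: right_diff_distrib)
  then have "C dvd r - r'" by simp
  moreover have "\<bar>r - r'\<bar> < C" using r that C by simp
  ultimately show "r = r'" using dvd_imp_le_int[of "r - r'" C] C0 by fastforce
 qed
qed

theorem theorem1p3:
 fixes K :: "('a, 'm) ring_scheme" and v :: "'a \<Rightarrow> 'g::linordered_ab_group_add"
  and V :: "('a, 'b, 'k) module_scheme" and n :: nat and Fil :: "nat \<Rightarrow> nat \<Rightarrow> 'b set"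
 assumes "valued_field K v"
  and "multi_filtered_space K V n Fil"
  and "semistable K V n Fil"
 shows "\<exists>M FilM. integral_model K v V Fil M FilM
  \<and> multi_filtered_space (residue_field K v) (model_reduction K v V M) n
    (reduced_filtration K v V M FilM)
  \<and> semistable (residue_field K v) (model_reduction K v V M) n
    (reduced_filtration K v V M FilM)"
proof -
 have vs: "vectorspace K V" using assms(2) by (rule multi_filtered_space.axioms(1))
 note vv = valued_field.valued_vectorspace[OF assms(1) vs]
 define \<O> where "\<O> = carrier (valuation_ring K v)"
 have vr: "valuation_ring K v = K\<lparr>carrier := \<O>\<rparr>" unfolding \<O>_def valuation_ring_def by simp
 interpret fd_valued_space K V \<O>
 proof (intro fd_valued_space.intro fd_valued_space_axioms.intro)
  show "valued_space K V \<O>" unfolding \<O>_def by (rule vv(1))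
  show "local_module.fin K V {\<zero>\<^bsub>K\<^esub>} {\<zero>\<^bsub>V\<^esub>} (carrier V)"       using multi_filtered_space.fin_dim[OF assms(2)] vectorspace.fin_dim_iff_fin[OF vs] by simp
 qed
 interpret MF: multi_filtered_space K V n Fil by fact
 have vm: "valuation_ideal K v = m" using vv(2) unfolding \<O>_def by simp
 have mx: "maximalideal m (K\<lparr>carrier := \<O>\<rparr>)"
  using valued_field.maximalideal_valuation_ideal[OF assms(1)] unfolding vm vr .
 obtain l where l: "\<forall>i\<in>{1..n}. \<forall>j\<ge>l. Fil i j = {\<zero>\<^bsub>V\<^esub>}" using MF.Fil_bound by blast
 define d where "d = dimK (carrier V)"
 define w where "w = MF.wt l (carrier V)"
 \<comment> \<open>For V = 0 the value 1 replaces the dimension, to keep \<alpha> positive.\<close>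
 define d' where "d' = max 1 d"
 define C where "C = int d + 1"
 define \<alpha> where "\<alpha> = C * int d'"
 define \<beta> where "\<beta> = C * int w + 1"
 \<comment> \<open>The steps start at 1: after summation by parts, Fil i 0 = V does not contribute
   to the weight, and beyond l all steps vanish.\<close>
 define Idx where "Idx = {1..n} \<times> {1..l}"
 define F where "F = (\<lambda>(i, j). Fil i j)"
 note lex = lexicographic_degree[where d' = "int d'" and w = "int w", OF C_def, folded \<alpha>_def \<beta>_def]
 have C0: "0 < C" unfolding C_def by simp
 interpret subspace_config K V \<O> Idx F \<alpha> \<beta>
 proof (intro subspace_config.intro subspace_config_axioms.intro)
  show "fd_valued_space K V \<O>" by (rule fd_valued_space_axioms)
  show "finite Idx" unfolding Idx_def by simp
  show "sub (F i)" if "i \<in> Idx" for i using that MF.Fil_sub unfolding Idx_def F_def by auto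
  show "0 < \<alpha>" "0 \<le> \<beta>" unfolding \<alpha>_def \<beta>_def d'_def using C0 by auto
  show "y = y'" if "y \<le> dimK (carrier V)" "y' \<le> dimK (carrier V)" "\<alpha> * x - \<beta> * int y = \<alpha> * x' - \<beta> * int y'" for y y' x x'
   using lex(3)[of "int y" "int y'" x x'] that unfolding d_def by simp
 qed
 have dim_le: "dimK Y \<le> d" if "sub Y" for Y unfolding d_def
  using VK.rk_mono[OF fd that sub_zero_subset[OF that] sub_subset[OF that]] .
 have sum_Idx: "(\<Sum>i\<in>Idx. int (f (F i))) = int (\<Sum>i\<in>{1..n}. \<Sum>j\<in>{1..l}. f (Fil i j))" for f :: "'b set \<Rightarrow> nat"
  unfolding Idx_def F_def sum.cartesian_product of_nat_sum by (simp add: case_prod_unfold)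
 have degK: "degK Y \<le> 0" if Y: "sub Y" for Y
 proof -
  have s: "(\<Sum>i\<in>Idx. int (dimK (Y \<inter> F i))) = int (MF.wt l Y)"
   unfolding sum_Idx[of "\<lambda>A. dimK (Y \<inter> A)"] MF.wt_def by (simp only: Int_commute)
  have "d' * MF.wt l Y \<le> w * dimK Y"
  proof (cases "d = 0")
   case True
   have "dimK (Fil i j \<inter> Y) = 0" if "i \<in> {1..n}" for i j using dim_le[OF sub_Int[OF MF.Fil_sub[OF that] Y]] True by simp
   then show ?thesis unfolding MF.wt_def by simp
  next
   case False
   then have "d' = d" unfolding d'_def by simp
   then show ?thesis
    using assms(3) Y unfolding MF.semistable_iff[OF l] w_def d_def by (simp add: mult.commute)
  qed
  then have "int d' * int (MF.wt l Y) \<le> int w * int (dimK Y)" unfolding of_nat_mult[symmetric] of_nat_le_iff .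
  then show ?thesis using lex(1)[of "int (dimK Y)"] dim_le[OF Y] unfolding degK_def s by simp
 qed
 obtain M where M: "lattice M" "\<And>X. between M X \<Longrightarrow> degO M X \<le> 0" using semistable_lattice[OF degK] by blast
 note sM = lattice_sub[OF M(1)]
 note smM = mm_sub[OF sM]
 define k where "k = (K\<lparr>carrier := \<O>\<rparr>) Quot m"
 define T where "T = reduction (K\<lparr>carrier := \<O>\<rparr>) m (V\<lparr>carrier := M\<rparr>)"
 define p where "p = reduction_map (K\<lparr>carrier := \<O>\<rparr>) m (V\<lparr>carrier := M\<rparr>)"
 note rf = reduction_facts[OF mx M(1), folded k_def T_def p_def]
 define FM where "FM i j = Fil i j \<inter> M" for i j
 have eqs: "residue_field K v = k" "model_reduction K v V M = T" "reduced_filtration K v V M FM = (\<lambda>i j. p ` FM i j)"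
  unfolding residue_field_def model_reduction_def reduced_filtration_def vr vm k_def T_def p_def by (rule refl)+
 interpret T: vectorspace k T by (rule rf(1))
 interpret TL: local_module k T "{\<zero>\<^bsub>k\<^esub>}" by (rule T.local_module_zero)
 have sF: "Osub (FM i j)" if "i \<in> {1..n}" for i j
  using VO.sub_Int[OF sub_Osub[OF MF.Fil_sub[OF that]] sM] unfolding FM_def .
 have dmT: "TL.dm {\<zero>\<^bsub>T\<^esub>} (VO.rk (mm M) M) (carrier T)" using rf(5)[OF sM subset_refl] rf(2) smM(2) by (simp add: Int_absorb2)
 interpret MR: multi_filtered_space k T n "\<lambda>i j. p ` FM i j"
 proof (intro multi_filtered_space.intro multi_filtered_space_axioms.intro rf(1))
  show "T.fin_dim" using T.fin_dim_iff_fin TL.dm_fin[OF dmT] by simp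
  fix i j assume i: "i \<in> {1..n}"
  show "subspace k (p ` FM i j) T"
   using TL.dm_subs[OF rf(5)[OF sF[OF i]]] rf(1) unfolding subspace_def FM_def by auto
  show "p ` FM i (Suc j) \<subseteq> p ` FM i j" using MF.Fil_decreasing[OF i, of j] unfolding FM_def by blast
  show "p ` FM i 0 = carrier T" using MF.Fil_exhaustive[OF i] rf(2) VO.sub_subset[OF sM] unfolding FM_def by (simp add: Int_absorb1)
  obtain l where "Fil i l = {\<zero>\<^bsub>V\<^esub>}" using MF.Fil_separated[OF i] by blast
  then show "\<exists>l. p ` FM i l = {\<zero>\<^bsub>T\<^esub>}" using VO.sub_zero[OF sM] rf(3) unfolding FM_def by (intro exI[of _ l]) auto
 qed
 have lT: "\<forall>i\<in>{1..n}. \<forall>j\<ge>l. p ` FM i j = {\<zero>\<^bsub>T\<^esub>}" using l VO.sub_zero[OF sM] rf(3) unfolding FM_def by auto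
 have "MR.wt l W * MR.rk0 (carrier T) \<le> MR.wt l (carrier T) * MR.rk0 W" if W: "submodule k W T" for W
 proof -
  \<comment> \<open>A subspace Z of the reduction is replaced by its preimage in M, where dimension
    and weight become the lengths that enter \<open>degO\<close>.\<close>
  have key: "between M {x \<in> M. p x \<in> Z} \<and> MR.rk0 Z = VO.rk (mm M) {x \<in> M. p x \<in> Z}
    \<and> int (MR.wt l Z) = (\<Sum>i\<in>Idx. int (VO.rk (mm M \<inter> F i) ({x \<in> M. p x \<in> Z} \<inter> F i)))" if Z: "submodule k Z T" for Z
  proof -
   define X where "X = {x \<in> M. p x \<in> Z}"
   have sX: "Osub X" "X \<subseteq> M" unfolding X_def using rf(6)[OF Z] by auto
   have mX: "mm M \<subseteq> X"
   proof
    fix x assume x: "x \<in> mm M"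
    then have "p x = \<zero>\<^bsub>T\<^esub>" using rf(4)[of x] smM(2) by blast
    then show "x \<in> X" unfolding X_def using x smM(2) T.sub_zero[OF Z] by auto
   qed
   have "Z \<subseteq> p ` M" unfolding rf(2) by (rule T.sub_subset[OF Z])
   then have pX: "p ` X = Z" unfolding X_def by blast
   have rk: "MR.rk0 (p ` A) = VO.rk (mm M \<inter> A) A" if "Osub A" "A \<subseteq> M" for A using TL.rk_eq[OF rf(5)[OF that]] .
   have "MR.rk0 Z = VO.rk (mm M) X" using rk[OF sX] mX unfolding pX by (simp add: Int_absorb2)
   moreover have "MR.rk0 (p ` FM i j \<inter> Z) = VO.rk (mm M \<inter> Fil i j) (X \<inter> Fil i j)" if i: "i \<in> {1..n}" for i j
   proof -
    have "p ` FM i j \<inter> Z = p ` (X \<inter> Fil i j)" unfolding FM_def X_def by blast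
    moreover have "mm M \<inter> (X \<inter> Fil i j) = mm M \<inter> Fil i j" using mX by blast
    moreover have "Osub (X \<inter> Fil i j)" using VO.sub_Int[OF sX(1) sub_Osub[OF MF.Fil_sub[OF i]]] .
    moreover have "X \<inter> Fil i j \<subseteq> M" using sX(2) by blast
    ultimately show ?thesis using rk[of "X \<inter> Fil i j"] by simp
   qed
   then have "int (MR.wt l Z) = (\<Sum>i\<in>Idx. int (VO.rk (mm M \<inter> F i) (X \<inter> F i)))"
    unfolding sum_Idx[of "\<lambda>A. VO.rk (mm M \<inter> A) (X \<inter> A)"] MR.wt_def by simp
   ultimately show ?thesis using sX mX unfolding between_def X_def by blast
  qed
  have full: "{x \<in> M. p x \<in> carrier T} = M" using rf(2) by auto
  note kT = key[OF T.sub_carrier_set, unfolded full]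
  have dT: "MR.rk0 (carrier T) = d" using kT VO.rk_eq M(1) unfolding d_def lattice_def by simp
  have "VO.rk (mm M \<inter> F i) (M \<inter> F i) = dimK (carrier V \<inter> F i)" if "i \<in> Idx" for i
   using lattice_rank[OF M(1) F_sub[OF that]] sub_subset[OF F_sub[OF that]] by (simp add: Int_absorb1)
  then have "int (MR.wt l (carrier T)) = (\<Sum>i\<in>Idx. int (dimK (carrier V \<inter> F i)))" using kT by simp
  also have "\<dots> = int w" unfolding w_def sum_Idx[of "\<lambda>A. dimK (carrier V \<inter> A)"] MF.wt_def by (simp only: Int_commute)
  finally have wT: "MR.wt l (carrier T) = w" by simp
  note kW = key[OF W]
  have r: "MR.rk0 W \<le> d" using between_rk_le[OF M(1), of "{x \<in> M. p x \<in> W}"] kW unfolding d_def by simp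
  have "\<alpha> * int (MR.wt l W) - \<beta> * int (MR.rk0 W) \<le> 0" using M(2)[of "{x \<in> M. p x \<in> W}"] kW unfolding degO_def by simp
  then have "int d' * int (MR.wt l W) \<le> int w * int (MR.rk0 W)" using lex(2)[of "int (MR.rk0 W)"] r by simp
  then have "d' * MR.wt l W \<le> w * MR.rk0 W" unfolding of_nat_mult[symmetric] of_nat_le_iff .
  moreover have "MR.wt l W * d \<le> d' * MR.wt l W" unfolding d'_def by simp
  ultimately show ?thesis unfolding dT wT by (rule order_trans[rotated])
 qed
 then have ss: "semistable k T n (\<lambda>i j. p ` FM i j)" unfolding MR.semistable_iff[OF lT] by blast
 obtain es where es: "set es \<subseteq> M" "M = Ospan es" "carrier V = Kspan es" "VK.indep {\<zero>\<^bsub>V\<^esub>} es"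
  using lattice_basis_carrier[OF M(1)] by blast
 have Mc: "M \<subseteq> carrier V" using VO.sub_subset[OF sM] .
 have "span M = carrier V"
 proof
  show "span M \<subseteq> carrier V" by (rule span_is_subset2[OF Mc])
  have "set es \<subseteq> span M" using in_own_span[OF Mc] es(1) by blast
  then show "carrier V \<subseteq> span M" unfolding es(3)
   using VK.ext_least[OF span_is_submodule[OF Mc]] sub_zero[OF span_is_submodule[OF Mc]] by simp
 qed
 moreover have "finitely_presented (K\<lparr>carrier := \<O>\<rparr>) (V\<lparr>carrier := M\<rparr>)"
  using free_finitely_presented[OF _ es(4)] es(1) Mc unfolding es(2) by blast
 ultimately have "integral_model K v V Fil M FM" unfolding integral_model_def is_lattice_def vr FM_def using sM by simp
 then show ?thesis using MR.multi_filtered_space_axioms ss unfolding eqs[symmetric] by blast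
qed

end
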